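(* Fix $\tilde\omega\in\widetilde\Omega$. Let $\{u_\varepsilon\}_{\varepsilon>0}$ be a bounded sequence in $BL^1(\mathbb{R}^3)$ which converges weakly in $BL^1(\mathbb{R}^3)$ to $u_\infty\in BL^1(\mathbb{R}^3)$. Then $u_\varepsilon$ stochastically $L^2_\theta$-two-scale converges to $u_\infty$, and there exists $\xi\in L^2(\mathbb{R}^3;L^2_{\mathrm{pot}}(\Omega))$ such that, up to a subsequence, $\nabla u_\varepsilon$ weakly stochastically two-scale converges to $\nabla u_\infty(x)+\xi(x,\omega)$ in $L^2(\mathbb{R}^3\times\Omega;\mathbb{R}^3)$.
   Context: **Stochastic setting.** $(\Omega,\Sigma,\mathbb{P})$ is a probability space, $\Omega$ is a compact metric space, $\Sigma$ is a complete $\sigma$-algebra containing the Borel sets and such that $C(\Omega)$ is dense in $L^2(\Omega)$. $\mathbb{E}[f]=\int_\Omega f\,d\mathbb{P}$. $(T_x)_{x\in\mathbb{R}^3}$ is a family of measurable bijections $T_x:\Omega\to\Omega$ with: $T_0=\mathrm{Id}$, $T_{x+y}=T_x\circ T_y$; $\mathbb{P}(T_x^{-1}(B))=\mathbb{P}(B)$ for all $x\in\mathbb{R}^3$, $B\in\Sigma$; $(x,\omega)\mapsto T_x\omega$ is measurable and continuous from $\mathbb{R}^3\times\Omega$ to $\Omega$; ergodicity: every $A\in\Sigma$ with $T_xA=A$ up to null sets for all $x$ satisfies $\mathbb{P}(A)\in\{0,1\}$. **Typical trajectories.** For $\rho\in L^1(\Omega)$, $\widetilde\Omega_{\rho\,d\mathbb{P}}$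 is the set of $\tilde\omega\in\Omega$ such that $\lim_{t\to\infty}\frac1{t^3|A|}\int_{tA}f(T_x\tilde\omega)\rho(T_x\tilde\omega)\,dx=\mathbb{E}[f\rho]$ for every bounded Borel set $A\subset\mathbb{R}^3$ with $|A|>0$ and every $f\in C(\Omega)$. Given fixed $a,\kappa,M_{\mathrm{sat}}\in L^\infty(\Omega)$ with $0<c_{\mathrm{ex}}\le a\le C_{\mathrm{ex}}$, $|\kappa|\le C_{\mathrm{DMI}}$, $0\le M_{\mathrm{sat}}\le C_{\mathrm{sat}}$ on $\Omega$, $\widetilde\Omega$ is the intersection of the sets $\widetilde\Omega_{\rho\,d\mathbb{P}}$ for $\rho=1,M_{\mathrm{sat}},M_{\mathrm{sat}}^2,a,\kappa,\kappa^2/a$. **Function spaces.** With $\theta(x)=(1+|x|^2)^{-1/2}$, $L^2_\theta(\mathbb{R}^3)=\{u\in\mathcal{D}'(\mathbb{R}^3):u\theta\in L^2(\mathbb{R}^3)\}$, and $BL^1(\mathbb{R}^3)=\{u\in L^2_\theta(\mathbb{R}^3):\nabla u\in L^2(\mathbb{R}^3;\mathbb{R}^3)\}$, a Hilbert space with inner product $(u,v)=\int_{\mathbb{R}^3}\nabla u\cdot\nabla v\,dx$. **Two-scale convergence (for fixed $\tilde\omega$).** A sequence $u_\varepsilon$ in $L^2_\theta(\mathbb{R}^3)$ stochastically $L^2_\theta$-two-scale converges to $u\in L^2_{\mathrm{loc}}(\mathbb{R}^3\times\Omega)$ (functions in $L^2(K\times\Omega)$ for every compact $K$) with $\mathbb{E}[u]\in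 L^2_\theta(\mathbb{R}^3)$ if $$\lim_{\varepsilon\to0}\int_{\mathbb{R}^3}u_\varepsilon(x)\phi(x)b(T_{x/\varepsilon}\tilde\omega)\,dx=\int_{\mathbb{R}^3}\int_\Omega u(x,\omega)\phi(x)b(\omega)\,d\mathbb{P}(\omega)\,dx\quad\forall\phi\in C_c^\infty(\mathbb{R}^3),\ b\in C(\Omega);$$ here a function of $x$ alone is viewed as constant in $\omega$. Sequences in $L^2(\mathbb{R}^3;\mathbb{R}^3)$ weakly stochastically two-scale converge to a limit in $L^2(\mathbb{R}^3\times\Omega;\mathbb{R}^3)$ if the same identity holds componentwise. **Spaces on $\Omega$.** $C^1(\Omega)$ is the set of $u\in C(\Omega)$ for which $D_iu(\omega)=\lim_{\delta\to0}(u(T_{\delta e_i}\omega)-u(\omega))/\delta$ exists for every $\omega$, $i=1,2,3$, and is continuous in $\omega$; $\nabla_\omega u=(D_1u,D_2u,D_3u)^\intercal$. $L^2_{\mathrm{pot}}(\Omega)$ is the closure of $\{\nabla_\omega u:u\in C^1(\Omega)\}$ in $L^2(\Omega;\mathbb{R}^3)$. *)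

theory Defs
  imports "HOL-Probability.Probability"
begin

(* Square-integrable functions are represented by genuine functions; no quotient by a.e. equality
   is formed. *)
definition L2 :: "'a measure \<Rightarrow> ('a \<Rightarrow> 'b::real_normed_vector) set" where
  "L2 M = {f \<in> borel_measurable M. integrable M (\<lambda>x. (norm (f x))\<^sup>2)}"

(* Measurability of the joint map refers to the completion of the product measure: since
   sets P is itself complete, measurability with respect to the uncompleted product would already
   fail for translations on a torus. *)
locale stochastic_setting = prob_space P + complete_measure P
  for P :: "'w::metric_space measure" +
  fixes T :: "real^3 \<Rightarrow> 'w \<Rightarrow> 'w"
  assumes compact_UNIV: "compact (UNIV :: 'w set)"
    and space_P: "space P = UNIV"
    and borel_subset: "sets borel \<subseteq> sets P"
    and continuous_dense: "\<And>f :: 'w \<Rightarrow> real. \<And>\<epsilon>. f \<in> L2 P \<Longrightarrow> 0 < \<epsilon> \<Longrightarrow>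
          \<exists>g. continuous_on UNIV g \<and> sqrt (\<integral>\<omega>. (f \<omega> - g \<omega>)\<^sup>2 \<partial>P) < \<epsilon>"
    and T_measurable: "\<And>x. T x \<in> measurable P P"
    and T_bij: "\<And>x. bij (T x)"
    and T_zero: "T 0 = id"
    and T_add: "\<And>x y. T (x + y) = T x \<circ> T y"
    and T_preserving: "\<And>x B. B \<in> sets P \<Longrightarrow> measure P (T x -` B) = measure P B"
    and T_joint_measurable: "(\<lambda>(x, \<omega>). T x \<omega>) \<in> measurable (completion (lborel \<Otimes>\<^sub>M P)) P"
    and T_joint_continuous: "continuous_on UNIV (\<lambda>(x, \<omega>). T x \<omega>)"
    and ergodic: "\<And>A. A \<in> sets P \<Longrightarrow>
          (\<And>x. (T x ` A - A) \<union> (A - T x ` A) \<in> null_sets P) \<Longrightarrow>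
          measure P A = 0 \<or> measure P A = 1"

(* The integrability clause makes the integral averages meaningful: the Bochner integral of a
   non-integrable function is 0 by convention. *)
definition typical :: "'w::metric_space measure \<Rightarrow> (real^3 \<Rightarrow> 'w \<Rightarrow> 'w) \<Rightarrow> ('w \<Rightarrow> real) \<Rightarrow> 'w set" where
  "typical P T \<rho> = {\<omega>0. \<forall>A f. A \<in> sets borel \<longrightarrow> bounded A \<longrightarrow> 0 < measure lebesgue A \<longrightarrow>
     continuous_on UNIV f \<longrightarrow>
       (\<forall>t>0. set_integrable lebesgue ((\<lambda>x. t *\<^sub>R x) ` A) (\<lambda>x. f (T x \<omega>0) * \<rho> (T x \<omega>0))) \<and>
       ((\<lambda>t. 1 / (t ^ 3 * measure lebesgue A) *
             (LINT x:(\<lambda>x. t *\<^sub>R x) ` A|lebesgue. f (T x \<omega>0) * \<rho> (T x \<omega>0)))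
          \<longlongrightarrow> (\<integral>\<omega>. f \<omega> * \<rho> \<omega> \<partial>P)) at_top}"

definition typical_set ::
  "'w::metric_space measure \<Rightarrow> (real^3 \<Rightarrow> 'w \<Rightarrow> 'w) \<Rightarrow> ('w \<Rightarrow> real) \<Rightarrow> ('w \<Rightarrow> real) \<Rightarrow> ('w \<Rightarrow> real) \<Rightarrow> 'w set"
where
  "typical_set P T a \<kappa> Msat =
     (\<Inter>\<rho> \<in> {\<lambda>_. 1, Msat, \<lambda>\<omega>. (Msat \<omega>)\<^sup>2, a, \<kappa>, \<lambda>\<omega>. (\<kappa> \<omega>)\<^sup>2 / a \<omega>}. typical P T \<rho>)"

definition partial_deriv :: "3 \<Rightarrow> (real^3 \<Rightarrow> real) \<Rightarrow> real^3 \<Rightarrow> real" where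
  "partial_deriv i f x = frechet_derivative f (at x) (axis i 1)"

fun Ck :: "nat \<Rightarrow> (real^3 \<Rightarrow> real) \<Rightarrow> bool" where
  "Ck 0 f \<longleftrightarrow> continuous_on UNIV f"
| "Ck (Suc k) f \<longleftrightarrow> (\<forall>x. f differentiable (at x)) \<and> (\<forall>i. Ck k (partial_deriv i f))"

definition Cc_infinity :: "(real^3 \<Rightarrow> real) set" where
  "Cc_infinity = {\<phi>. (\<forall>k. Ck k \<phi>) \<and> compact (closure {x. \<phi> x \<noteq> 0})}"

definition theta :: "real^3 \<Rightarrow> real" where
  "theta x = (1 + (norm x)\<^sup>2) powr (-1/2)"

(* A distribution whose product with theta lies in L2 is a locally square-integrable function,
   because theta is smooth and positive. *)
definition L2_theta :: "(real^3 \<Rightarrow> real) set" where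
  "L2_theta = {u. (\<lambda>x. u x * theta x) \<in> L2 lebesgue}"

definition is_weak_gradient :: "(real^3 \<Rightarrow> real) \<Rightarrow> (real^3 \<Rightarrow> real^3) \<Rightarrow> bool" where
  "is_weak_gradient u g \<longleftrightarrow> (\<forall>\<phi>\<in>Cc_infinity. \<forall>i.
     (\<integral>x. u x * partial_deriv i \<phi> x \<partial>lebesgue) = - (\<integral>x. g x $ i * \<phi> x \<partial>lebesgue))"

definition BL1 :: "(real^3 \<Rightarrow> real) set" where
  "BL1 = {u \<in> L2_theta. \<exists>g \<in> L2 lebesgue. is_weak_gradient u g}"

(* Used only on BL1, where it picks a representative of the a.e. unique weak gradient. *)
definition weak_gradient :: "(real^3 \<Rightarrow> real) \<Rightarrow> real^3 \<Rightarrow> real^3" where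
  "weak_gradient u = (SOME g. g \<in> L2 lebesgue \<and> is_weak_gradient u g)"

definition BL1_inner :: "(real^3 \<Rightarrow> real) \<Rightarrow> (real^3 \<Rightarrow> real) \<Rightarrow> real" where
  "BL1_inner u v = (\<integral>x. weak_gradient u x \<bullet> weak_gradient v x \<partial>lebesgue)"

definition BL1_norm :: "(real^3 \<Rightarrow> real) \<Rightarrow> real" where
  "BL1_norm u = sqrt (BL1_inner u u)"

definition BL1_weak_conv ::
  "('i \<Rightarrow> real^3 \<Rightarrow> real) \<Rightarrow> (real^3 \<Rightarrow> real) \<Rightarrow> 'i filter \<Rightarrow> bool" where
  "BL1_weak_conv u v F \<longleftrightarrow>
     (\<forall>w\<in>BL1. ((\<lambda>\<epsilon>. BL1_inner (u \<epsilon>) w) \<longlongrightarrow> BL1_inner v w) F)"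

definition L2_loc :: "'w measure \<Rightarrow> ((real^3) \<times> 'w \<Rightarrow> real) set" where
  "L2_loc P = {u. \<forall>K. compact K \<longrightarrow>
     (\<lambda>z. indicator (K \<times> UNIV) z * u z) \<in> L2 (lebesgue \<Otimes>\<^sub>M P)}"

(* The filter F on the parameter epsilon selects the mode of passing to the limit: at_right 0 for
   the whole family, filtermap e sequentially for the sequence of parameters e n. *)
definition two_scale_identity ::
  "'w::metric_space measure \<Rightarrow> (real^3 \<Rightarrow> 'w \<Rightarrow> 'w) \<Rightarrow> 'w \<Rightarrow> real filter \<Rightarrow>
   (real \<Rightarrow> real^3 \<Rightarrow> real) \<Rightarrow> ((real^3) \<times> 'w \<Rightarrow> real) \<Rightarrow> bool" where
  "two_scale_identity P T \<omega>0 F v V \<longleftrightarrow>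
     (\<forall>\<phi>\<in>Cc_infinity. \<forall>b. continuous_on UNIV b \<longrightarrow>
        ((\<lambda>\<epsilon>. \<integral>x. v \<epsilon> x * \<phi> x * b (T (x /\<^sub>R \<epsilon>) \<omega>0) \<partial>lebesgue)
           \<longlongrightarrow> (\<integral>x. (\<integral>\<omega>. V (x, \<omega>) * \<phi> x * b \<omega> \<partial>P) \<partial>lebesgue)) F)"

definition two_scale_L2_theta ::
  "'w::metric_space measure \<Rightarrow> (real^3 \<Rightarrow> 'w \<Rightarrow> 'w) \<Rightarrow> 'w \<Rightarrow> real filter \<Rightarrow>
   (real \<Rightarrow> real^3 \<Rightarrow> real) \<Rightarrow> ((real^3) \<times> 'w \<Rightarrow> real) \<Rightarrow> bool" where
  "two_scale_L2_theta P T \<omega>0 F u U \<longleftrightarrow>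
     (\<forall>\<epsilon>>0. u \<epsilon> \<in> L2_theta) \<and> U \<in> L2_loc P \<and> (\<lambda>x. \<integral>\<omega>. U (x, \<omega>) \<partial>P) \<in> L2_theta \<and>
     two_scale_identity P T \<omega>0 F u U"

definition two_scale_weak_L2 ::
  "'w::metric_space measure \<Rightarrow> (real^3 \<Rightarrow> 'w \<Rightarrow> 'w) \<Rightarrow> 'w \<Rightarrow> real filter \<Rightarrow>
   (real \<Rightarrow> real^3 \<Rightarrow> real^3) \<Rightarrow> ((real^3) \<times> 'w \<Rightarrow> real^3) \<Rightarrow> bool" where
  "two_scale_weak_L2 P T \<omega>0 F v V \<longleftrightarrow>
     (\<forall>\<epsilon>>0. v \<epsilon> \<in> L2 lebesgue) \<and> V \<in> L2 (lebesgue \<Otimes>\<^sub>M P) \<and>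
     (\<forall>i. two_scale_identity P T \<omega>0 F (\<lambda>\<epsilon> x. v \<epsilon> x $ i) (\<lambda>z. V z $ i))"

definition diff_quot ::
  "(real^3 \<Rightarrow> 'w \<Rightarrow> 'w) \<Rightarrow> 3 \<Rightarrow> ('w \<Rightarrow> real) \<Rightarrow> 'w \<Rightarrow> real \<Rightarrow> real" where
  "diff_quot T i u \<omega> \<delta> = (u (T (\<delta> *\<^sub>R axis i 1) \<omega>) - u \<omega>) / \<delta>"

definition D_omega :: "(real^3 \<Rightarrow> 'w \<Rightarrow> 'w) \<Rightarrow> 3 \<Rightarrow> ('w \<Rightarrow> real) \<Rightarrow> 'w \<Rightarrow> real" where
  "D_omega T i u \<omega> = Lim (at 0) (diff_quot T i u \<omega>)"

definition C1_omega :: "(real^3 \<Rightarrow> 'w::metric_space \<Rightarrow> 'w) \<Rightarrow> ('w \<Rightarrow> real) set" where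
  "C1_omega T = {u. continuous_on UNIV u \<and>
     (\<forall>i. (\<forall>\<omega>. \<exists>l. (diff_quot T i u \<omega> \<longlongrightarrow> l) (at 0)) \<and> continuous_on UNIV (D_omega T i u))}"

definition grad_omega :: "(real^3 \<Rightarrow> 'w \<Rightarrow> 'w) \<Rightarrow> ('w \<Rightarrow> real) \<Rightarrow> 'w \<Rightarrow> real^3" where
  "grad_omega T u \<omega> = (\<chi> i. D_omega T i u \<omega>)"

definition L2_pot ::
  "'w::metric_space measure \<Rightarrow> (real^3 \<Rightarrow> 'w \<Rightarrow> 'w) \<Rightarrow> ('w \<Rightarrow> real^3) set" where
  "L2_pot P T = {g \<in> L2 P. \<forall>\<epsilon>>0. \<exists>u\<in>C1_omega T.
     sqrt (\<integral>\<omega>. (norm (g \<omega> - grad_omega T u \<omega>))\<^sup>2 \<partial>P) < \<epsilon>}"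

(* The Bochner space L2(R^3; L2_pot), under the usual identification of L2(R^3; L2(Omega; R^3))
   with L2(R^3 x Omega; R^3). *)
definition L2_L2_pot ::
  "'w::metric_space measure \<Rightarrow> (real^3 \<Rightarrow> 'w \<Rightarrow> 'w) \<Rightarrow> ((real^3) \<times> 'w \<Rightarrow> real^3) set" where
  "L2_L2_pot P T = {\<xi> \<in> L2 (lebesgue \<Otimes>\<^sub>M P). AE x in lebesgue. (\<lambda>\<omega>. \<xi> (x, \<omega>)) \<in> L2_pot P T}"

end

theory Submission
  imports Defs "HOL-Complex_Analysis.Great_Picard"
begin

text \<open>The trajectory through a typical point turns ergodicity into the statement that, for integrable \<phi>
and continuous b, the oscillating integrals of \<phi>(x) b(T(x/\<epsilon>) \<omega>0) converge to the integral of \<phi>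
times the mean of b (oscillation_limit). It holds for indicators of bounded Borel sets by the very
definition of a typical point, after the change of variables x = \<epsilon> y, and extends by density in
L1. Everything below combines this with compactness.

\<^emph>\<open>The functions.\<close> A weakly convergent family in BL1 must be shown to converge when paired with test
functions \<phi>(x) b(T(x/\<epsilon>) \<omega>0) that stay bounded with bounded support but oscillate, so strong local
convergence is needed. Instead of an embedding theorem, a potential representation is used: testing
with the regularised Newton kernel of scale \<tau>, whose Laplacian is minus an approximate identity
(the Plummer kernel), expresses the smoothing of v at scale \<tau> by the gradient of v
(newton_representation). Differences of the kernel gradients at scales t and t/2 are integrable with
integral of order t, so smoothing at scale \<delta> costs an error of order \<delta> uniformly on bounded sets
of BL1 (mollification_error), while at a fixed scale the representation is a pairing of the gradient
with a fixed square-integrable field and therefore converges under weak convergence. Hence the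
pairing of v with uniformly bounded test functions tends to 0
(vanishing_flux_imp_vanishing_pairing), and the ergodic theorem computes the remaining limit.

\<^emph>\<open>The gradients.\<close> Bounded sequences in L2 have two-scale limits along a subsequence
(two_scale_compactness): the norm of \<psi>(x, T(x/\<epsilon>) \<omega>0) tends to the norm of \<psi> in L2 of the product
space, so a diagonal extraction over countably many test functions defines a bounded functional in
the limit, which is represented by the Riesz theorem. Let V be the limit of the gradients. Testing
with b = 1 shows that the mean of V(x,.) is the gradient of the weak limit. Testing the symmetry of
second derivatives with \<phi>(x) B(T(x/\<epsilon>) \<omega>0), where B is smooth along the orbits, and multiplying by
\<epsilon>, leaves only the derivatives of B and shows that V(x,.) is curl-free on \<Omega> for almost every x
(gradient_limit_curl_free).

\<^emph>\<open>Curl-free fields.\<close> It remains to see that a curl-free field W on \<Omega> with mean zero is a limit of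
gradients (curl_free_in_L2_pot). Integrating a smooth curl-free field G along the segments from \<omega> to
T y \<omega> gives a function with gradient G(T y \<omega>) - G(\<omega>) (line_potential). Averaging over finitely many y
gives S G - G, and by the mean ergodic theorem the averages S can be chosen such that S W is small
(mean_ergodic); thus -W is close to a gradient. Since W has to be smoothed first, the curl of the
approximation does not vanish exactly, and its size is controlled by curl_entry_bound.\<close>

section \<open>Square-integrable functions\<close>

definition nrm2 :: "'a measure \<Rightarrow> ('a \<Rightarrow> 'b::real_normed_vector) \<Rightarrow> real" where
  "nrm2 M f = sqrt (\<integral>x. (norm (f x))\<^sup>2 \<partial>M)"

lemma L2I: "f \<in> borel_measurable M \<Longrightarrow> integrable M (\<lambda>x. (norm (f x))\<^sup>2) \<Longrightarrow> f \<in> L2 M"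
  by (simp add: L2_def)

lemma L2_meas [measurable_dest]: "f \<in> L2 M \<Longrightarrow> f \<in> borel_measurable M"
  by (simp add: L2_def)

lemma L2_integrable: "f \<in> L2 M \<Longrightarrow> integrable M (\<lambda>x. (norm (f x))\<^sup>2)"
  by (simp add: L2_def)

lemma nrm2_nonneg [simp]: "0 \<le> nrm2 M f"
  by (simp add: nrm2_def)

lemma nrm2_sq: "(nrm2 M f)\<^sup>2 = (\<integral>x. (norm (f x))\<^sup>2 \<partial>M)"
  by (simp add: nrm2_def)

lemma nrm2_cong_norm: "(\<And>x. norm (f x) = norm (g x)) \<Longrightarrow> nrm2 M f = nrm2 M g"
  by (simp add: nrm2_def)

lemma nrm2_minus [simp]: "nrm2 M (\<lambda>x. - f x) = nrm2 M f"
  by (simp add: nrm2_def)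

lemma nrm2_scale: "nrm2 M (\<lambda>x. c *\<^sub>R f x) = \<bar>c\<bar> * nrm2 M f"
  by (simp add: nrm2_def power_mult_distrib real_sqrt_mult)

lemma L2_bound:
  fixes f :: "'a \<Rightarrow> 'b::euclidean_space" and g :: "'a \<Rightarrow> 'c::euclidean_space"
  assumes "f \<in> borel_measurable M" "g \<in> L2 M" "AE x in M. norm (f x) \<le> norm (g x)"
  shows "f \<in> L2 M"
proof (rule L2I)
  show "integrable M (\<lambda>x. (norm (f x))\<^sup>2)"
    by (rule Bochner_Integration.integrable_bound[OF L2_integrable[OF assms(2)]])
       (use assms in \<open>auto intro: power_mono\<close>)
qed (use assms in auto)

lemma nrm2_mono:
  fixes f :: "'a \<Rightarrow> 'b::euclidean_space" and g :: "'a \<Rightarrow> 'c::euclidean_space"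
  assumes "f \<in> borel_measurable M" "g \<in> L2 M" "AE x in M. norm (f x) \<le> norm (g x)"
  shows "nrm2 M f \<le> nrm2 M g"
  unfolding nrm2_def
  by (rule real_sqrt_le_mono, rule integral_mono_AE)
     (use L2_integrable[OF L2_bound[OF assms]] L2_integrable[OF assms(2)] assms(3) in
       \<open>auto intro: power_mono\<close>)

lemma nrm2_cong_AE:
  fixes f g :: "'a \<Rightarrow> 'b::euclidean_space"
  assumes "f \<in> borel_measurable M" "g \<in> borel_measurable M" "AE x in M. f x = g x"
  shows "nrm2 M f = nrm2 M g"
  unfolding nrm2_def
  by (rule arg_cong[where f=sqrt], rule integral_cong_AE) (use assms in auto)

lemma L2_prod_integrable:
  fixes f :: "'a \<Rightarrow> 'b::euclidean_space" and g :: "'a \<Rightarrow> 'c::euclidean_space"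
  assumes "f \<in> L2 M" "g \<in> L2 M"
  shows "integrable M (\<lambda>x. norm (f x) * norm (g x))"
proof (rule Bochner_Integration.integrable_bound)
  show "integrable M (\<lambda>x. (norm (f x))\<^sup>2 + (norm (g x))\<^sup>2)"
    using assms by (auto intro!: Bochner_Integration.integrable_add L2_integrable)
  show "AE x in M. norm (norm (f x) * norm (g x)) \<le> norm ((norm (f x))\<^sup>2 + (norm (g x))\<^sup>2)"
  proof (rule AE_I2)
    fix x
    have "2 * norm (f x) * norm (g x) \<le> (norm (f x))\<^sup>2 + (norm (g x))\<^sup>2"
      by (rule sum_squares_bound)
    moreover have "0 \<le> norm (f x) * norm (g x)" by simp
    ultimately have "norm (f x) * norm (g x) \<le> (norm (f x))\<^sup>2 + (norm (g x))\<^sup>2" by linarith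
    then show "norm (norm (f x) * norm (g x)) \<le> norm ((norm (f x))\<^sup>2 + (norm (g x))\<^sup>2)"
      by simp
  qed
  show "(\<lambda>x. norm (f x) * norm (g x)) \<in> borel_measurable M"
    using assms by measurable
qed

lemma L2_inner_integrable:
  fixes f g :: "'a \<Rightarrow> 'b::euclidean_space"
  assumes "f \<in> L2 M" "g \<in> L2 M"
  shows "integrable M (\<lambda>x. f x \<bullet> g x)"
  by (rule Bochner_Integration.integrable_bound[OF L2_prod_integrable[OF assms]])
     (use assms in \<open>auto simp: Cauchy_Schwarz_ineq2\<close>)

lemma L2_mult_integrable:
  fixes f g :: "'a \<Rightarrow> real"
  assumes "f \<in> L2 M" "g \<in> L2 M"
  shows "integrable M (\<lambda>x. f x * g x)"
  using L2_inner_integrable[OF assms] by simp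

lemma L2_scale: 
  fixes f :: "'a \<Rightarrow> 'b::euclidean_space"
  shows "f \<in> L2 M \<Longrightarrow> (\<lambda>x. c *\<^sub>R f x) \<in> L2 M"
  by (rule L2I) (auto simp: power_mult_distrib intro!: L2_integrable)

lemma L2_cmult: 
  fixes f :: "'a \<Rightarrow> real"
  shows "f \<in> L2 M \<Longrightarrow> (\<lambda>x. c * f x) \<in> L2 M"
  using L2_scale[of f M c] by simp

lemma L2_add:
  fixes f g :: "'a \<Rightarrow> 'b::euclidean_space"
  assumes "f \<in> L2 M" "g \<in> L2 M"
  shows "(\<lambda>x. f x + g x) \<in> L2 M"
proof (rule L2I)
  have *: "(norm (f x + g x))\<^sup>2 = (norm (f x))\<^sup>2 + 2 * (f x \<bullet> g x) + (norm (g x))\<^sup>2" for x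
    by (simp add: power2_norm_eq_inner inner_add_left inner_add_right inner_commute)
  show "integrable M (\<lambda>x. (norm (f x + g x))\<^sup>2)"
    unfolding * using assms
    by (intro Bochner_Integration.integrable_add L2_integrable integrable_mult_right L2_inner_integrable)
qed (use assms in measurable)

lemma L2_diff:
  fixes f g :: "'a \<Rightarrow> 'b::euclidean_space"
  assumes "f \<in> L2 M" "g \<in> L2 M"
  shows "(\<lambda>x. f x - g x) \<in> L2 M"
  using L2_add[OF assms(1) L2_scale[OF assms(2), of "-1"]] by simp

lemma vec_nth_measurable [measurable (raw)]:
  fixes f :: "'a \<Rightarrow> real^3"
  assumes [measurable]: "f \<in> borel_measurable M"
  shows "(\<lambda>x. f x $ i) \<in> borel_measurable M"
proof -
  have "(\<lambda>x. f x \<bullet> axis i 1) \<in> borel_measurable M" by measurable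
  then show ?thesis by (simp add: inner_axis)
qed

lemma L2_component:
  fixes f :: "'a \<Rightarrow> real^3"
  assumes "f \<in> L2 M" shows "(\<lambda>x. f x $ i) \<in> L2 M"
  by (rule L2_bound[of _ _ f])
     (use assms component_le_norm_cart in \<open>auto intro: vec_nth_measurable\<close>)

lemma nrm2_component_le:
  fixes f :: "'a \<Rightarrow> real^3"
  assumes "f \<in> L2 M" shows "nrm2 M (\<lambda>x. f x $ i) \<le> nrm2 M f"
  by (rule nrm2_mono)
     (use assms component_le_norm_cart in \<open>auto intro: vec_nth_measurable\<close>)

lemma L2_vec:
  fixes f :: "'a \<Rightarrow> real^3"
  assumes "\<And>i. (\<lambda>x. f x $ i) \<in> L2 M"
  shows "f \<in> L2 M"
proof (rule L2I)
  have m: "(\<lambda>x. f x $ i) \<in> borel_measurable M" for i using assms by (auto simp: L2_def)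
  have [measurable]: "f \<in> borel_measurable M"
  proof (subst borel_measurable_euclidean_space, intro ballI)
    fix b :: "real^3" assume "b \<in> Basis"
    then obtain i where "b = axis i 1" by (auto simp: Basis_vec_def)
    then show "(\<lambda>x. f x \<bullet> b) \<in> borel_measurable M"
      using m[of i] by (simp add: inner_axis)
  qed
  then show "f \<in> borel_measurable M" .
  have "(norm (f x))\<^sup>2 = (\<Sum>i\<in>UNIV. (norm (f x $ i))\<^sup>2)" for x
    by (simp add: norm_vec_def L2_set_def sum_nonneg)
  then show "integrable M (\<lambda>x. (norm (f x))\<^sup>2)"
    using assms L2_integrable by (auto intro!: Bochner_Integration.integrable_sum simp del: real_norm_def)
qed

text \<open>The constant 2 is a convenient bound for the square root of the dimension 3.\<close>

lemma nrm2_vec_le: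
  fixes f :: "'a \<Rightarrow> real^3"
  assumes "\<And>i. (\<lambda>x. f x $ i) \<in> L2 M" "\<And>i. nrm2 M (\<lambda>x. f x $ i) \<le> c"
  shows "nrm2 M f \<le> 2 * c"
proof -
  have "(norm (f x))\<^sup>2 = (\<Sum>i\<in>UNIV. (norm (f x $ i))\<^sup>2)" for x
    by (simp add: norm_vec_def L2_set_def sum_nonneg)
  then have "(nrm2 M f)\<^sup>2 = (\<Sum>i\<in>UNIV. (nrm2 M (\<lambda>x. f x $ i))\<^sup>2)"
    unfolding nrm2_sq using L2_integrable[OF assms(1)] by (simp add: Bochner_Integration.integral_sum)
  also have "\<dots> \<le> (\<Sum>i\<in>(UNIV::3 set). c\<^sup>2)"
    by (intro sum_mono power_mono assms) simp
  also have "\<dots> \<le> (2 * c)\<^sup>2" by (simp add: power2_eq_square)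
  finally show ?thesis
    using order_trans[OF nrm2_nonneg assms(2)] by (elim power2_le_imp_le) simp
qed

text \<open>Nonnegativity of the quadratic polynomial in t given by the integral of (t |f| - |g|)^2.\<close>

lemma L2_Cauchy_Schwarz_norm:
  fixes f :: "'a \<Rightarrow> 'b::euclidean_space" and g :: "'a \<Rightarrow> 'c::euclidean_space"
  assumes f: "f \<in> L2 M" and g: "g \<in> L2 M"
  shows "(\<integral>x. norm (f x) * norm (g x) \<partial>M) \<le> nrm2 M f * nrm2 M g"
proof -
  define A B C where "A = (nrm2 M f)\<^sup>2" "B = (\<integral>x. norm (f x) * norm (g x) \<partial>M)" "C = (nrm2 M g)\<^sup>2"
  note int = L2_integrable[OF f] L2_integrable[OF g] L2_prod_integrable[OF f g]
  have q: "0 \<le> A * t\<^sup>2 - 2 * t * B + C" for t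
  proof -
    have "0 \<le> (\<integral>x. (t * norm (f x) - norm (g x))\<^sup>2 \<partial>M)" by simp
    also have "\<dots> = (\<integral>x. t\<^sup>2 * (norm (f x))\<^sup>2 - (2 * t) * (norm (f x) * norm (g x)) + (norm (g x))\<^sup>2 \<partial>M)"
      by (rule Bochner_Integration.integral_cong) (auto simp: power2_diff algebra_simps power2_eq_square)
    also have "\<dots> = t\<^sup>2 * A - (2 * t) * B + C"
      unfolding A_B_C_def nrm2_sq using int by simp
    finally show ?thesis by (simp add: mult.commute)
  qed
  have "B \<ge> 0" unfolding A_B_C_def by simp
  have "B\<^sup>2 \<le> A * C"
  proof (cases "A = 0")
    case True
    have "B = 0"
    proof (rule ccontr)
      assume "B \<noteq> 0"
      with q[of "(C + 1) / (2 * B)"] True show False by (simp add: field_simps)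
    qed
    then show ?thesis using True by simp
  next
    case False
    then have "A > 0" unfolding A_B_C_def by simp
    with q[of "B / A"] have "0 \<le> B\<^sup>2 / A - 2 * B\<^sup>2 / A + C"
      by (simp add: power2_eq_square field_simps)
    then have "B\<^sup>2 / A \<le> C" by (simp add: field_simps)
    then show ?thesis using \<open>A > 0\<close> by (simp add: field_simps)
  qed
  then have "B\<^sup>2 \<le> (nrm2 M f * nrm2 M g)\<^sup>2" by (simp add: A_B_C_def power_mult_distrib)
  then show ?thesis
    unfolding A_B_C_def by (rule power2_le_imp_le) simp
qed

lemma L2_Cauchy_Schwarz:
  fixes f g :: "'a \<Rightarrow> 'b::euclidean_space"
  assumes f: "f \<in> L2 M" and g: "g \<in> L2 M"
  shows "\<bar>\<integral>x. f x \<bullet> g x \<partial>M\<bar> \<le> nrm2 M f * nrm2 M g"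
proof -
  have "\<bar>\<integral>x. f x \<bullet> g x \<partial>M\<bar> \<le> (\<integral>x. \<bar>f x \<bullet> g x\<bar> \<partial>M)" by (rule integral_abs_bound)
  also have "\<dots> \<le> (\<integral>x. norm (f x) * norm (g x) \<partial>M)"
    by (rule integral_mono) (auto simp: Cauchy_Schwarz_ineq2 intro!: L2_prod_integrable f g integrable_abs L2_inner_integrable)
  also have "\<dots> \<le> nrm2 M f * nrm2 M g" by (rule L2_Cauchy_Schwarz_norm[OF f g])
  finally show ?thesis .
qed

lemma L2_Cauchy_Schwarz_real:
  fixes f g :: "'a \<Rightarrow> real"
  assumes f: "f \<in> L2 M" and g: "g \<in> L2 M"
  shows "\<bar>\<integral>x. f x * g x \<partial>M\<bar> \<le> nrm2 M f * nrm2 M g"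
  using L2_Cauchy_Schwarz[OF assms] by simp

lemma nrm2_add_sq:
  fixes f g :: "'a \<Rightarrow> 'b::euclidean_space"
  assumes f: "f \<in> L2 M" and g: "g \<in> L2 M"
  shows "(nrm2 M (\<lambda>x. f x + g x))\<^sup>2 = (nrm2 M f)\<^sup>2 + 2 * (\<integral>x. f x \<bullet> g x \<partial>M) + (nrm2 M g)\<^sup>2"
proof -
  have *: "(norm (f x + g x))\<^sup>2 = (norm (f x))\<^sup>2 + 2 * (f x \<bullet> g x) + (norm (g x))\<^sup>2" for x
    by (simp add: power2_norm_eq_inner inner_add_left inner_add_right inner_commute)
  show ?thesis unfolding nrm2_sq *
    using L2_integrable[OF f] L2_integrable[OF g] L2_inner_integrable[OF f g] by simp
qed

lemma nrm2_triangle: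
  fixes f g :: "'a \<Rightarrow> 'b::euclidean_space"
  assumes f: "f \<in> L2 M" and g: "g \<in> L2 M"
  shows "nrm2 M (\<lambda>x. f x + g x) \<le> nrm2 M f + nrm2 M g"
proof (rule power2_le_imp_le)
  show "(nrm2 M (\<lambda>x. f x + g x))\<^sup>2 \<le> (nrm2 M f + nrm2 M g)\<^sup>2"
    using L2_Cauchy_Schwarz[OF f g] unfolding nrm2_add_sq[OF f g] power2_sum by linarith
qed simp

lemma nrm2_triangle_diff:
  fixes f g :: "'a \<Rightarrow> 'b::euclidean_space"
  assumes f: "f \<in> L2 M" and g: "g \<in> L2 M"
  shows "nrm2 M (\<lambda>x. f x - g x) \<le> nrm2 M f + nrm2 M g"
  using nrm2_triangle[OF f L2_scale[OF g, of "-1"]] by simp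

lemma nrm2_commute: "nrm2 M (\<lambda>x. f x - g x) = nrm2 M (\<lambda>x. g x - f x)"
  by (rule nrm2_cong_norm) (rule norm_minus_commute)

lemma nrm2_triangle3:
  fixes f g h :: "'a \<Rightarrow> 'b::euclidean_space"
  assumes f: "f \<in> L2 M" and g: "g \<in> L2 M" and h: "h \<in> L2 M"
  shows "nrm2 M (\<lambda>x. f x - h x) \<le> nrm2 M (\<lambda>x. f x - g x) + nrm2 M (\<lambda>x. g x - h x)"
  using nrm2_triangle[OF L2_diff[OF f g] L2_diff[OF g h]] by simp

text \<open>A subsequence with increments below (1/4)^n converges almost everywhere; Fatou's lemma identifies
the limit in norm and transfers the convergence to the whole sequence.\<close>

lemma L2_complete:
  fixes f :: "nat \<Rightarrow> 'a \<Rightarrow> 'b::euclidean_space"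
  assumes f: "\<And>n. f n \<in> L2 M"
    and Cauchy: "\<And>e. 0 < e \<Longrightarrow> \<exists>N. \<forall>m\<ge>N. \<forall>n\<ge>N. nrm2 M (\<lambda>x. f m x - f n x) < e"
  shows "\<exists>g\<in>L2 M. (\<lambda>n. nrm2 M (\<lambda>x. f n x - g x)) \<longlonglongrightarrow> 0"
proof -
  have [measurable]: "f n \<in> borel_measurable M" for n using f by (rule L2_meas)
  have sq: "(q^n)\<^sup>2 = (q\<^sup>2)^n" for q :: real and n by (simp only: power_mult[symmetric] mult.commute)
  have "\<exists>r. \<forall>n. (\<forall>i\<ge>r n. \<forall>j\<ge>r n. nrm2 M (\<lambda>x. f i x - f j x) < (1/4)^n) \<and> r n < r (Suc n)"
  proof (intro dependent_nat_choice)
    show "\<exists>k. \<forall>i\<ge>k. \<forall>j\<ge>k. nrm2 M (\<lambda>x. f i x - f j x) < (1 / 4) ^ 0"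
      using Cauchy[of 1] by simp
    fix k n :: nat
    obtain N where N: "\<And>i j. i \<ge> N \<Longrightarrow> j \<ge> N \<Longrightarrow> nrm2 M (\<lambda>x. f i x - f j x) < (1 / 4) ^ Suc n"
      using Cauchy[of "(1/4)^Suc n"] by auto
    show "\<exists>l. (\<forall>i\<ge>l. \<forall>j\<ge>l. nrm2 M (\<lambda>x. f i x - f j x) < (1 / 4) ^ Suc n) \<and> k < l"
      by (rule exI[of _ "max N (Suc k)"]) (use N in auto)
  qed
  then obtain r where r: "\<And>n i j. i \<ge> r n \<Longrightarrow> j \<ge> r n \<Longrightarrow> nrm2 M (\<lambda>x. f i x - f j x) < (1/4)^n"
    and rs: "\<And>n. r n < r (Suc n)" by blast
  have sm: "strict_mono r" by (rule strict_monoI_Suc) (rule rs)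
  define d where "d n x = f (r (Suc n)) x - f (r n) x" for n x
  have [measurable]: "d n \<in> borel_measurable M" for n unfolding d_def by measurable
  have d_int: "integrable M (\<lambda>x. (norm (d n x))\<^sup>2)" for n
    unfolding d_def by (intro L2_integrable L2_diff f)
  have dn: "(\<integral>x. (norm (d n x))\<^sup>2 \<partial>M) \<le> (1/16)^n" for n
  proof -
    have "nrm2 M (d n) < (1/4)^n"
      unfolding d_def using r[of n "r (Suc n)" "r n"] rs[of n] by simp
    then have "(nrm2 M (d n))\<^sup>2 \<le> ((1/4)^n)\<^sup>2" by (intro power_mono) auto
    also have "((1/4::real)^n)\<^sup>2 = (1/16)^n" using sq[of "1/4" n] by (simp add: power2_eq_square)
    finally show ?thesis by (simp add: nrm2_sq)
  qed
  \<comment> \<open>The weights 4^n force the increments to decay like 2^(-n) almost everywhere.\<close>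
  have "(\<integral>\<^sup>+x. (\<Sum>n. ennreal (4^n * (norm (d n x))\<^sup>2)) \<partial>M) = (\<Sum>n. \<integral>\<^sup>+x. ennreal (4^n * (norm (d n x))\<^sup>2) \<partial>M)"
    by (rule nn_integral_suminf) measurable
  also have "\<dots> \<le> (\<Sum>n. ennreal ((1/4)^n))"
  proof (rule suminf_le)
    fix n
    have "(\<integral>\<^sup>+x. ennreal (4^n * (norm (d n x))\<^sup>2) \<partial>M) = ennreal (\<integral>x. 4^n * (norm (d n x))\<^sup>2 \<partial>M)"
      by (rule nn_integral_eq_integral) (use d_int in auto)
    also have "\<dots> \<le> ennreal ((1/4)^n)"
    proof (rule ennreal_leI)
      have "(\<integral>x. 4^n * (norm (d n x))\<^sup>2 \<partial>M) = 4^n * (\<integral>x. (norm (d n x))\<^sup>2 \<partial>M)" by simp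
      also have "\<dots> \<le> 4^n * (1/16)^n" using dn by simp
      also have "\<dots> = (1/4::real)^n" by (simp flip: power_mult_distrib)
      finally show "(\<integral>x. 4^n * (norm (d n x))\<^sup>2 \<partial>M) \<le> (1/4)^n" .
    qed
    finally show "(\<integral>\<^sup>+x. ennreal (4^n * (norm (d n x))\<^sup>2) \<partial>M) \<le> ennreal ((1/4)^n)" .
  qed auto
  also have "\<dots> < \<infinity>"
    using summable_geometric[of "1/4::real"] by (simp add: suminf_ennreal2 less_top)
  finally have "AE x in M. (\<Sum>n. ennreal (4^n * (norm (d n x))\<^sup>2)) \<noteq> \<infinity>"
    by (intro nn_integral_noteq_infinite) auto
  then have conv: "AE x in M. convergent (\<lambda>n. f (r n) x)"
  proof eventually_elim
    case (elim x)
    then have s: "summable (\<lambda>n. 4^n * (norm (d n x))\<^sup>2)"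
      by (intro summable_suminf_not_top) (auto simp: top_unique)
    have "Bseq (\<lambda>n. 4^n * (norm (d n x))\<^sup>2)"
      using summable_LIMSEQ_zero[OF s] by (intro convergent_imp_Bseq convergentI)
    then obtain C where "\<And>n. norm (4^n * (norm (d n x))\<^sup>2) \<le> C"
      unfolding Bseq_def by blast
    then have C: "4^n * (norm (d n x))\<^sup>2 \<le> C" for n
      using abs_ge_self order_trans unfolding real_norm_def by blast
    have C0: "C \<ge> 0" using order_trans[OF zero_le_power2[of "norm (d 0 x)"], of C] C[of 0] by simp
    have "norm (d n x) \<le> sqrt C * (1/2)^n" for n
    proof (rule power2_le_imp_le)
      have "(norm (d n x))\<^sup>2 \<le> C * (1/4)^n" using C[of n] by (simp add: power_divide field_simps)
      also have "\<dots> = (sqrt C * (1/2)^n)\<^sup>2" using C0 sq[of "1/2" n] by (simp add: power_mult_distrib) (simp add: power2_eq_square)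
      finally show "(norm (d n x))\<^sup>2 \<le> (sqrt C * (1/2)^n)\<^sup>2" .
    qed (use C0 in simp)
    moreover have "summable (\<lambda>n. sqrt C * (1/2)^n)"
      by (rule summable_mult, rule summable_geometric) simp
    ultimately have "summable (\<lambda>n. d n x)" by (blast intro: summable_comparison_test')
    then have "convergent (\<lambda>n. \<Sum>i<n. d i x)" by (simp add: summable_iff_convergent)
    moreover have "(\<Sum>i<n. d i x) = f (r n) x - f (r 0) x" for n
      unfolding d_def by (rule sum_lessThan_telescope)
    ultimately have "convergent (\<lambda>n. f (r n) x - f (r 0) x)" by simp
    then have "convergent (\<lambda>n. (f (r n) x - f (r 0) x) + f (r 0) x)"
      by (intro convergent_add convergent_const)
    then show ?case by simp
  qed
  define g where "g x = lim (\<lambda>n. f (r n) x)" for x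
  have [measurable]: "g \<in> borel_measurable M"
    unfolding g_def by (rule borel_measurable_lim_metric) measurable
  have lim: "AE x in M. (\<lambda>n. f (r n) x) \<longlonglongrightarrow> g x"
    using conv by eventually_elim (simp add: g_def convergent_LIMSEQ_iff)
  have Fatou: "(\<integral>\<^sup>+x. ennreal ((norm (f m x - g x))\<^sup>2) \<partial>M) \<le> ennreal (((1/4)^n)\<^sup>2)" if "m \<ge> r n" for m n
  proof -
    have "(\<integral>\<^sup>+x. ennreal ((norm (f m x - g x))\<^sup>2) \<partial>M) = (\<integral>\<^sup>+x. liminf (\<lambda>k. ennreal ((norm (f m x - f (r k) x))\<^sup>2)) \<partial>M)"
    proof (rule nn_integral_cong_AE)
      show "AE x in M. ennreal ((norm (f m x - g x))\<^sup>2) = liminf (\<lambda>k. ennreal ((norm (f m x - f (r k) x))\<^sup>2))"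
        using lim
      proof eventually_elim
        case (elim x)
        have "(\<lambda>k. ennreal ((norm (f m x - f (r k) x))\<^sup>2)) \<longlonglongrightarrow> ennreal ((norm (f m x - g x))\<^sup>2)"
          by (intro tendsto_intros elim tendsto_ennrealI)
        then show ?case by (rule lim_imp_Liminf[OF trivial_limit_sequentially, symmetric])
      qed
    qed
    also have "\<dots> \<le> liminf (\<lambda>k. \<integral>\<^sup>+x. ennreal ((norm (f m x - f (r k) x))\<^sup>2) \<partial>M)"
      by (rule nn_integral_liminf) measurable
    also have "\<dots> \<le> ennreal (((1/4)^n)\<^sup>2)"
    proof (rule Liminf_le)
      show "\<forall>\<^sub>F k in sequentially. (\<integral>\<^sup>+x. ennreal ((norm (f m x - f (r k) x))\<^sup>2) \<partial>M) \<le> ennreal (((1/4)^n)\<^sup>2)"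
        using eventually_ge_at_top[of n]
      proof eventually_elim
        case (elim k)
        have "r k \<ge> r n" using sm elim by (simp add: strict_mono_less_eq)
        then have "nrm2 M (\<lambda>x. f m x - f (r k) x) < (1/4)^n" using that r by simp
        then have "(nrm2 M (\<lambda>x. f m x - f (r k) x))\<^sup>2 \<le> ((1/4)^n)\<^sup>2" by (intro power_mono) auto
        moreover have "(\<integral>\<^sup>+x. ennreal ((norm (f m x - f (r k) x))\<^sup>2) \<partial>M) = ennreal ((nrm2 M (\<lambda>x. f m x - f (r k) x))\<^sup>2)"
          unfolding nrm2_sq by (rule nn_integral_eq_integral) (auto intro!: L2_integrable L2_diff f)
        ultimately show ?case by (simp add: ennreal_leI)
      qed
    qed simp
    finally show ?thesis .
  qed
  have fg: "(\<lambda>x. f m x - g x) \<in> L2 M" if "m \<ge> r n" for m n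
  proof (rule L2I)
    show "integrable M (\<lambda>x. (norm (f m x - g x))\<^sup>2)"
      using le_less_trans[OF Fatou[OF that] ennreal_less_top] by (intro integrableI_bounded) auto
  qed measurable
  have "g \<in> L2 M"
    using L2_diff[OF f[of "r 0"] fg[of 0 "r 0"]] by simp
  moreover have "(\<lambda>n. nrm2 M (\<lambda>x. f n x - g x)) \<longlonglongrightarrow> 0"
  proof (rule LIMSEQ_I)
    fix e :: real assume "0 < e"
    then obtain n where n: "(1/4)^n < e" using real_arch_pow_inv[of e "1/4"] by auto
    have "nrm2 M (\<lambda>x. f m x - g x) \<le> (1/4)^n" if "m \<ge> r n" for m
    proof (rule power2_le_imp_le)
      have "ennreal ((nrm2 M (\<lambda>x. f m x - g x))\<^sup>2) \<le> ennreal (((1/4)^n)\<^sup>2)"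
        unfolding nrm2_sq using Fatou[OF that] L2_integrable[OF fg[OF that]]
        by (subst nn_integral_eq_integral[symmetric]) auto
      then show "(nrm2 M (\<lambda>x. f m x - g x))\<^sup>2 \<le> ((1/4)^n)\<^sup>2" by (simp add: ennreal_le_iff)
    qed simp
    then show "\<exists>no. \<forall>m\<ge>no. norm (nrm2 M (\<lambda>x. f m x - g x) - 0) < e"
      using n by (intro exI[of _ "r n"]) (auto intro: le_less_trans)
  qed
  ultimately show ?thesis by blast
qed

text \<open>The parallelogram identity for the functional nrm2 squared minus an affine part, on a set
closed under midpoints. With L = 0 this yields elements of nearly minimal norm, as in the mean ergodic
theorem; with L twice a bounded functional it yields the Riesz representation.\<close>

lemma L2_minimising_sequence:
  fixes D :: "('a \<Rightarrow> 'b::euclidean_space) set" and L :: "('a \<Rightarrow> 'b) \<Rightarrow> real"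
  assumes D: "D \<subseteq> L2 M" "D \<noteq> {}"
    and mid: "\<And>f g. f \<in> D \<Longrightarrow> g \<in> D \<Longrightarrow> (\<lambda>x. (1/2) *\<^sub>R (f x + g x)) \<in> D"
    and L: "\<And>f g. f \<in> D \<Longrightarrow> g \<in> D \<Longrightarrow> L (\<lambda>x. (1/2) *\<^sub>R (f x + g x)) = (L f + L g) / 2"
    and below: "\<And>f. f \<in> D \<Longrightarrow> c \<le> (nrm2 M f)\<^sup>2 - L f"
  obtains d g I where "\<And>n::nat. d n \<in> D" "g \<in> L2 M" "(\<lambda>n. nrm2 M (\<lambda>x. d n x - g x)) \<longlonglongrightarrow> 0"
    "\<And>f. f \<in> D \<Longrightarrow> I \<le> (nrm2 M f)\<^sup>2 - L f" "(\<lambda>n. (nrm2 M (d n))\<^sup>2 - L (d n)) \<longlonglongrightarrow> I"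
proof -
  define J where "J f = (nrm2 M f)\<^sup>2 - L f" for f
  define I where "I = Inf (J ` D)"
  have bdd: "bdd_below (J ` D)" using below by (auto simp: J_def bdd_below_def)
  have I: "I \<le> J f" if "f \<in> D" for f unfolding I_def using bdd that by (simp add: cInf_lower)
  have "\<exists>f\<in>D. J f < I + inverse (Suc n)" for n
    using cInf_lessD[of "J ` D" "I + inverse (Suc n)"] D(2) unfolding I_def by auto
  then obtain d where d: "\<And>n. d n \<in> D" "\<And>n. J (d n) < I + inverse (Suc n)" by metis
  have dL: "d n \<in> L2 M" for n using d D by blast
  have par: "(nrm2 M (\<lambda>x. d m x - d n x))\<^sup>2 \<le> 2 * (inverse (Suc m) + inverse (Suc n))" for m n
  proof -
    have 1: "(nrm2 M (\<lambda>x. d m x - d n x))\<^sup>2 = (nrm2 M (d m))\<^sup>2 - 2 * (\<integral>x. d m x \<bullet> d n x \<partial>M) + (nrm2 M (d n))\<^sup>2"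
      using nrm2_add_sq[OF dL[of m] L2_scale[OF dL[of n], of "-1"]] nrm2_scale[of M "-1" "d n"] by simp
    have 2: "(nrm2 M (\<lambda>x. d m x + d n x))\<^sup>2 = (nrm2 M (d m))\<^sup>2 + 2 * (\<integral>x. d m x \<bullet> d n x \<partial>M) + (nrm2 M (d n))\<^sup>2"
      by (rule nrm2_add_sq[OF dL dL])
    have "I \<le> J (\<lambda>x. (1/2) *\<^sub>R (d m x + d n x))" by (rule I[OF mid[OF d(1) d(1)]])
    also have "\<dots> = (nrm2 M (\<lambda>x. d m x + d n x))\<^sup>2 / 4 - (L (d m) + L (d n)) / 2"
      unfolding J_def L[OF d(1) d(1)] nrm2_scale[of M "1/2" "\<lambda>x. d m x + d n x"]
      by (simp add: power_divide)
    finally have 3: "I \<le> (nrm2 M (\<lambda>x. d m x + d n x))\<^sup>2 / 4 - (L (d m) + L (d n)) / 2" .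
    define p q where "p = inverse (real (Suc m))" "q = inverse (real (Suc n))"
    show ?thesis using d(2)[of m] d(2)[of n] 1 2 3 unfolding J_def p_q_def[symmetric] by argo
  qed
  have "\<exists>N. \<forall>m\<ge>N. \<forall>n\<ge>N. nrm2 M (\<lambda>x. d m x - d n x) < e" if "0 < e" for e
  proof -
    obtain N where N: "inverse (real (Suc N)) < e\<^sup>2 / 4"
      using reals_Archimedean[of "e\<^sup>2/4"] \<open>0 < e\<close> by (meson divide_pos_pos zero_less_numeral zero_less_power)
    have "nrm2 M (\<lambda>x. d m x - d n x) < e" if "m \<ge> N" "n \<ge> N" for m n
    proof (rule power2_less_imp_less)
      have "inverse (real (Suc m)) \<le> inverse (real (Suc N))" "inverse (real (Suc n)) \<le> inverse (real (Suc N))"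
        using that by (auto intro!: le_imp_inverse_le)
      then show "(nrm2 M (\<lambda>x. d m x - d n x))\<^sup>2 < e\<^sup>2" using par[of m n] N by argo
    qed (use \<open>0 < e\<close> in simp)
    then show ?thesis by blast
  qed
  from L2_complete[OF dL this] obtain g where "g \<in> L2 M" "(\<lambda>n. nrm2 M (\<lambda>x. d n x - g x)) \<longlonglongrightarrow> 0" by blast
  moreover have "(\<lambda>n. J (d n)) \<longlonglongrightarrow> I"
  proof (rule tendsto_sandwich[of "\<lambda>_. I" _ _ "\<lambda>n. I + inverse (real (Suc n))"])
    show "(\<lambda>n. I + inverse (real (Suc n))) \<longlonglongrightarrow> I"
      using tendsto_add[OF tendsto_const LIMSEQ_inverse_real_of_nat, of I] by simp
  qed (use I[OF d(1)] less_imp_le[OF d(2)] in \<open>auto simp del: of_nat_Suc\<close>)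
  ultimately show ?thesis
    using d(1) I unfolding J_def by (intro that[of d g I]) simp_all
qed

lemma L2_inner_tendsto:
  fixes d :: "nat \<Rightarrow> 'a \<Rightarrow> 'b::euclidean_space"
  assumes "\<And>n. d n \<in> L2 M" "g \<in> L2 M" "f \<in> L2 M" "(\<lambda>n. nrm2 M (\<lambda>x. d n x - g x)) \<longlonglongrightarrow> 0"
  shows "(\<lambda>n. \<integral>x. d n x \<bullet> f x \<partial>M) \<longlonglongrightarrow> (\<integral>x. g x \<bullet> f x \<partial>M)"
proof (rule LIM_zero_cancel, rule tendsto_0_le)
  show "(\<lambda>n. nrm2 M (\<lambda>x. d n x - g x) * nrm2 M f) \<longlonglongrightarrow> 0"
    using tendsto_mult_left_zero[OF assms(4)] by simp
  have "\<bar>(\<integral>x. d n x \<bullet> f x \<partial>M) - (\<integral>x. g x \<bullet> f x \<partial>M)\<bar> \<le> nrm2 M (\<lambda>x. d n x - g x) * nrm2 M f" for n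
    using L2_Cauchy_Schwarz[OF L2_diff[OF assms(1)[of n] assms(2)] assms(3)]
      Bochner_Integration.integral_diff[OF L2_inner_integrable[OF assms(1)[of n] assms(3)] L2_inner_integrable[OF assms(2,3)]]
    by (simp add: inner_diff_left)
  then show "\<forall>\<^sub>F n in sequentially. norm ((\<integral>x. d n x \<bullet> f x \<partial>M) - (\<integral>x. g x \<bullet> f x \<partial>M))
      \<le> norm (nrm2 M (\<lambda>x. d n x - g x) * nrm2 M f) * 1"
    by (auto simp: abs_mult)
qed

text \<open>The minimiser of nrm2 squared minus 2 L represents L. It is a limit of
elements of D in L2 and may itself lie outside D.\<close>

lemma L2_Riesz:
  fixes D :: "('a \<Rightarrow> real) set" and L :: "('a \<Rightarrow> real) \<Rightarrow> real"
  assumes D: "D \<subseteq> L2 M" "(\<lambda>x. 0) \<in> D"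
    and lin: "\<And>f g s t. f \<in> D \<Longrightarrow> g \<in> D \<Longrightarrow> (\<lambda>x. s * f x + t * g x) \<in> D \<and> L (\<lambda>x. s * f x + t * g x) = s * L f + t * L g"
    and bd: "\<And>f. f \<in> D \<Longrightarrow> \<bar>L f\<bar> \<le> C * nrm2 M f"
  shows "\<exists>V\<in>L2 M. \<forall>f\<in>D. L f = (\<integral>x. V x * f x \<partial>M)"
proof -
  have mid: "(\<lambda>x. (1/2) *\<^sub>R (f x + g x)) \<in> D \<and> 2 * L (\<lambda>x. (1/2) *\<^sub>R (f x + g x)) = (2 * L f + 2 * L g) / 2"
    if "f \<in> D" "g \<in> D" for f g
    using lin[OF that, of "1/2" "1/2"] by (simp add: distrib_left)
  obtain d V I where d: "\<And>n::nat. d n \<in> D" and V: "V \<in> L2 M" and lim: "(\<lambda>n. nrm2 M (\<lambda>x. d n x - V x)) \<longlonglongrightarrow> 0"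
    and I: "\<And>f. f \<in> D \<Longrightarrow> I \<le> (nrm2 M f)\<^sup>2 - 2 * L f" and J: "(\<lambda>n. (nrm2 M (d n))\<^sup>2 - 2 * L (d n)) \<longlonglongrightarrow> I"
  proof (rule L2_minimising_sequence[where D=D and M=M and L="\<lambda>f. 2 * L f" and c = "- C\<^sup>2"])
    show "D \<subseteq> L2 M" by (rule D)
    show "D \<noteq> {}" using D(2) by blast
    show "(\<lambda>x. (1/2) *\<^sub>R (f x + g x)) \<in> D" if "f \<in> D" "g \<in> D" for f g
      using mid[OF that] by (rule conjunct1)
    show "2 * L (\<lambda>x. (1/2) *\<^sub>R (f x + g x)) = (2 * L f + 2 * L g) / 2" if "f \<in> D" "g \<in> D" for f g
      using mid[OF that] by (rule conjunct2)
    fix f assume "f \<in> D"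
    have "0 \<le> (nrm2 M f - C)\<^sup>2" by simp
    then show "- C\<^sup>2 \<le> (nrm2 M f)\<^sup>2 - 2 * L f"
      using bd[OF \<open>f \<in> D\<close>] by (simp add: power2_diff mult.commute)
  qed (rule that)
  have "L f = (\<integral>x. V x * f x \<partial>M)" if f: "f \<in> D" for f
  proof -
    have fL: "f \<in> L2 M" and dL: "d n \<in> L2 M" for n using f d[of n] D(1) by (auto simp only: subset_iff)
    define q where "q = (\<integral>x. V x * f x \<partial>M) - L f"
    \<comment> \<open>Perturbing the minimising sequence by t f cannot lower the infimum; letting t tend to 0 from both
     sides forces q = 0.\<close>
  have "0 \<le> 2 * t * q + t\<^sup>2 * (nrm2 M f)\<^sup>2" for t
    proof -
      have ineq: "I \<le> ((nrm2 M (d n))\<^sup>2 - 2 * L (d n)) + 2 * t * ((\<integral>x. d n x \<bullet> f x \<partial>M) - L f) + t\<^sup>2 * (nrm2 M f)\<^sup>2" for n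
      proof -
        have "I \<le> (nrm2 M (\<lambda>x. d n x + t * f x))\<^sup>2 - 2 * (L (d n) + t * L f)"
          using I[of "\<lambda>x. d n x + t * f x"] lin[OF d f, of 1 n t] by simp
        moreover have "(nrm2 M (\<lambda>x. d n x + t * f x))\<^sup>2 = (nrm2 M (d n))\<^sup>2 + 2 * t * (\<integral>x. d n x \<bullet> f x \<partial>M) + t\<^sup>2 * (nrm2 M f)\<^sup>2"
          using nrm2_add_sq[OF dL[of n] L2_scale[OF fL, of t]] nrm2_scale[of M t f]
          by (simp add: power_mult_distrib mult.left_commute[of _ t])
        ultimately show ?thesis by (simp add: algebra_simps)
      qed
      have "(\<lambda>n. ((nrm2 M (d n))\<^sup>2 - 2 * L (d n)) + 2 * t * ((\<integral>x. d n x \<bullet> f x \<partial>M) - L f) + t\<^sup>2 * (nrm2 M f)\<^sup>2)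
         \<longlonglongrightarrow> I + 2 * t * ((\<integral>x. V x \<bullet> f x \<partial>M) - L f) + t\<^sup>2 * (nrm2 M f)\<^sup>2"
        by (intro tendsto_intros J L2_inner_tendsto dL V fL lim)
      then have "I \<le> I + 2 * t * ((\<integral>x. V x \<bullet> f x \<partial>M) - L f) + t\<^sup>2 * (nrm2 M f)\<^sup>2"
        by (rule tendsto_lowerbound) (use ineq in auto)
      then show ?thesis by (simp add: q_def)
    qed
    note nonneg = this
    define B where "B = (nrm2 M f)\<^sup>2 + 1"
    have "B > 0" unfolding B_def by (simp add: add_nonneg_pos)
    have "0 \<le> 2 * (-q/B) * q + (-q/B)\<^sup>2 * (nrm2 M f)\<^sup>2" by (rule nonneg)
    also have "\<dots> \<le> 2 * (-q/B) * q + (-q/B)\<^sup>2 * B" unfolding B_def by (intro add_left_mono mult_left_mono) auto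
    also have "\<dots> = - q\<^sup>2 / B" using \<open>B > 0\<close> by (simp add: power2_eq_square field_simps)
    finally have "q = 0" using \<open>B > 0\<close> by (simp add: field_simps)
    then show ?thesis by (simp add: q_def)
  qed
  then show ?thesis using V by blast
qed

section \<open>Smooth functions and bumps\<close>

definition smooth :: "(real^3 \<Rightarrow> real) \<Rightarrow> bool" where
  "smooth f \<longleftrightarrow> (\<forall>k. Ck k f)"

lemma partial_deriv_eq: "(f has_derivative D) (at x) \<Longrightarrow> partial_deriv i f x = D (axis i 1)"
  unfolding partial_deriv_def using frechet_derivative_at by metis

lemma Ck_SucI:
  assumes "\<And>x. (f has_derivative D x) (at x)" "\<And>i. Ck k (\<lambda>x. D x (axis i 1))"
  shows "Ck (Suc k) f"
proof -
  have "partial_deriv i f = (\<lambda>x. D x (axis i 1))" for i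
    using partial_deriv_eq[OF assms(1)] by blast
  then show ?thesis using assms by (auto simp: differentiable_def)
qed

lemma Ck_1_continuous: "Ck (Suc k) f \<Longrightarrow> continuous_on UNIV f"
  by (auto intro!: continuous_at_imp_continuous_on differentiable_imp_continuous_within)

lemma Ck_Suc_imp: "Ck (Suc k) f \<Longrightarrow> Ck k f"
proof (induction k arbitrary: f)
  case 0 then show ?case using Ck_1_continuous[of 0 f] by (simp only: Ck.simps(1))
next
  case (Suc k)
  then have "Ck k (partial_deriv i f)" for i by simp
  then show ?case using Suc by simp
qed

lemma Ck_continuous: "Ck k f \<Longrightarrow> continuous_on UNIV f"
  using Ck_1_continuous[of _ f] by (cases k) (simp, blast)

lemma Ck_const: "Ck k (\<lambda>x. c)"
proof (induction k arbitrary: c)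
  case (Suc k)
  show ?case by (rule Ck_SucI[where D="\<lambda>x h. 0"]) (use Suc in auto)
qed simp

lemma Ck_has_derivative:
  assumes "Ck (Suc k) f"
  shows "(f has_derivative (\<lambda>h. \<Sum>i\<in>UNIV. partial_deriv i f x * h $ i)) (at x)"
proof -
  have d: "(f has_derivative frechet_derivative f (at x)) (at x)"
    using assms frechet_derivative_works by auto
  then interpret bounded_linear "frechet_derivative f (at x)" by (rule has_derivative_bounded_linear)
  have "frechet_derivative f (at x) h = (\<Sum>i\<in>UNIV. partial_deriv i f x * h $ i)" for h
  proof -
    have "h = (\<Sum>i\<in>UNIV. (h $ i) *\<^sub>R axis i 1)"
      using basis_expansion[of h] by (simp add: scalar_mult_eq_scaleR)
    then have "frechet_derivative f (at x) h = (\<Sum>i\<in>UNIV. (h $ i) *\<^sub>R frechet_derivative f (at x) (axis i 1))"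
      using sum[of "\<lambda>i. (h $ i) *\<^sub>R axis i 1" UNIV] by (simp add: scaleR)
    then show ?thesis by (simp add: partial_deriv_def mult.commute)
  qed
  then have "frechet_derivative f (at x) = (\<lambda>h. \<Sum>i\<in>UNIV. partial_deriv i f x * h $ i)" by blast
  then show ?thesis using d by simp
qed

lemma sum_axis: "(\<Sum>i\<in>UNIV. (a i :: real) * axis j 1 $ i) = a j"
  by (simp add: axis_def if_distrib[of "(*) _"] cong: if_cong)

lemma Ck_add: "Ck k f \<Longrightarrow> Ck k g \<Longrightarrow> Ck k (\<lambda>x. f x + g x)"
proof (induction k arbitrary: f g)
  case 0 then show ?case by (auto intro: continuous_on_add)
next
  case (Suc k)
  show ?case
  proof (rule Ck_SucI)
    show "((\<lambda>x. f x + g x) has_derivative (\<lambda>h. (\<Sum>i\<in>UNIV. partial_deriv i f x * h $ i) + (\<Sum>i\<in>UNIV. partial_deriv i g x * h $ i))) (at x)" for x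
      by (intro has_derivative_add Ck_has_derivative[OF Suc.prems(1)] Ck_has_derivative[OF Suc.prems(2)])
    show "Ck k (\<lambda>x. (\<Sum>j\<in>UNIV. partial_deriv j f x * axis i 1 $ j) + (\<Sum>j\<in>UNIV. partial_deriv j g x * axis i 1 $ j))" for i
      unfolding sum_axis using Suc.prems by (intro Suc.IH) auto
  qed
qed

lemma Ck_mult: "Ck k f \<Longrightarrow> Ck k g \<Longrightarrow> Ck k (\<lambda>x. f x * g x)"
proof (induction k arbitrary: f g)
  case 0 then show ?case by (auto intro: continuous_on_mult)
next
  case (Suc k)
  show ?case
  proof (rule Ck_SucI)
    show "((\<lambda>x. f x * g x) has_derivative (\<lambda>h. f x * (\<Sum>i\<in>UNIV. partial_deriv i g x * h $ i) + (\<Sum>i\<in>UNIV. partial_deriv i f x * h $ i) * g x)) (at x)" for x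
      by (intro has_derivative_mult Ck_has_derivative[OF Suc.prems(1)] Ck_has_derivative[OF Suc.prems(2)])
    show "Ck k (\<lambda>x. f x * (\<Sum>j\<in>UNIV. partial_deriv j g x * axis i 1 $ j) + (\<Sum>j\<in>UNIV. partial_deriv j f x * axis i 1 $ j) * g x)" for i
      unfolding sum_axis using Suc.prems Ck_Suc_imp[OF Suc.prems(1)] Ck_Suc_imp[OF Suc.prems(2)]
      by (intro Ck_add Suc.IH) auto
  qed
qed

lemma Ck_coord: "Ck k (\<lambda>x. x $ i)"
proof (cases k)
  case 0 then show ?thesis by (auto intro!: continuous_intros)
next
  case (Suc n)
  show ?thesis unfolding Suc
    by (rule Ck_SucI[where D="\<lambda>x h. h $ i"])
       (auto intro: Ck_const bounded_linear_imp_has_derivative bounded_linear_vec_nth)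
qed

lemma smooth_const [simp]: "smooth (\<lambda>x. c)" by (simp add: smooth_def Ck_const)
lemma smooth_coord [simp]: "smooth (\<lambda>x. x $ i)" by (simp add: smooth_def Ck_coord)
lemma smooth_add [intro]: "smooth f \<Longrightarrow> smooth g \<Longrightarrow> smooth (\<lambda>x. f x + g x)" by (simp add: smooth_def Ck_add)
lemma smooth_mult [intro]: "smooth f \<Longrightarrow> smooth g \<Longrightarrow> smooth (\<lambda>x. f x * g x)" by (simp add: smooth_def Ck_mult)
lemma smooth_cmult [intro]: "smooth f \<Longrightarrow> smooth (\<lambda>x. c * f x)" by (intro smooth_mult smooth_const)
lemma smooth_minus [intro]: "smooth f \<Longrightarrow> smooth (\<lambda>x. - f x)" using smooth_cmult[of f "-1"] by simp
lemma smooth_diff [intro]: "smooth f \<Longrightarrow> smooth g \<Longrightarrow> smooth (\<lambda>x. f x - g x)"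
  using smooth_add[OF _ smooth_minus, of f g] by simp
lemma smooth_prod [intro]: "(\<And>i. i \<in> I \<Longrightarrow> smooth (f i)) \<Longrightarrow> smooth (\<lambda>x. \<Prod>i\<in>I. f i x)"
  by (induction I rule: infinite_finite_induct) auto

lemma smooth_continuous: "smooth f \<Longrightarrow> continuous_on UNIV f"
  using Ck_continuous smooth_def by blast

lemma smooth_partial [intro]: "smooth f \<Longrightarrow> smooth (partial_deriv i f)"
  unfolding smooth_def using Ck.simps(2) by blast

lemma smooth_has_derivative:
  "smooth f \<Longrightarrow> (f has_derivative (\<lambda>h. \<Sum>i\<in>UNIV. partial_deriv i f x * h $ i)) (at x)"
  unfolding smooth_def using Ck_has_derivative by blast

lemma partial_deriv_mult:
  assumes "smooth f" "smooth g"
  shows "partial_deriv i (\<lambda>x. f x * g x) x = f x * partial_deriv i g x + partial_deriv i f x * g x"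
  using partial_deriv_eq[OF has_derivative_mult[OF smooth_has_derivative[OF assms(1)] smooth_has_derivative[OF assms(2)]], where i=i]
  by (simp add: sum_axis)

lemma partial_deriv_const [simp]: "partial_deriv i (\<lambda>x. c) x = 0"
  using partial_deriv_eq[OF has_derivative_const] by simp

lemma Ck_affine: "Ck k f \<Longrightarrow> Ck k (\<lambda>x. f (c *\<^sub>R x + d))"
proof (induction k arbitrary: f)
  case 0 then show ?case by (auto intro!: continuous_on_compose2[of UNIV f] continuous_intros)
next
  case (Suc k)
  show ?case
  proof (rule Ck_SucI)
    show "((\<lambda>x. f (c *\<^sub>R x + d)) has_derivative (\<lambda>h. \<Sum>i\<in>UNIV. partial_deriv i f (c *\<^sub>R x + d) * (c *\<^sub>R h) $ i)) (at x)" for x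
      by (rule has_derivative_compose[of "\<lambda>x. c *\<^sub>R x + d" "\<lambda>h. c *\<^sub>R h" _ _ f])
         (auto intro!: derivative_eq_intros Ck_has_derivative[OF Suc.prems])
    have "Ck k (\<lambda>x. c * partial_deriv i f (c *\<^sub>R x + d))" for i
      using Suc by (intro Ck_mult Ck_const) auto
    moreover have "(\<Sum>j\<in>UNIV. partial_deriv j f (c *\<^sub>R x + d) * (c *\<^sub>R axis i 1) $ j) = c * partial_deriv i f (c *\<^sub>R x + d)" for i x
      using sum_axis[of "\<lambda>j. partial_deriv j f (c *\<^sub>R x + d) * c" i] by (simp add: mult_ac)
    ultimately show "Ck k (\<lambda>x. \<Sum>j\<in>UNIV. partial_deriv j f (c *\<^sub>R x + d) * (c *\<^sub>R axis i 1) $ j)" for i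
      by simp
  qed
qed

lemma smooth_affine: "smooth f \<Longrightarrow> smooth (\<lambda>x. f (c *\<^sub>R x + d))"
  by (simp add: smooth_def Ck_affine)

lemma partial_deriv_affine:
  assumes "smooth f"
  shows "partial_deriv i (\<lambda>x. f (c *\<^sub>R x + d)) x = c * partial_deriv i f (c *\<^sub>R x + d)"
proof -
  have "((\<lambda>x. f (c *\<^sub>R x + d)) has_derivative (\<lambda>h. \<Sum>i\<in>UNIV. partial_deriv i f (c *\<^sub>R x + d) * (c *\<^sub>R h) $ i)) (at x)"
    by (rule has_derivative_compose[of "\<lambda>x. c *\<^sub>R x + d" "\<lambda>h. c *\<^sub>R h" _ _ f])
         (auto intro!: derivative_eq_intros smooth_has_derivative[OF assms])
  from partial_deriv_eq[OF this, of i] show ?thesis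
    using sum_axis[of "\<lambda>j. partial_deriv j f (c *\<^sub>R x + d) * c" i] by (simp add: mult_ac)
qed

lemma smooth_shift: "smooth f \<Longrightarrow> smooth (\<lambda>x. f (x + d))"
  using smooth_affine[of f 1 d] by simp

lemma partial_deriv_shift: "smooth f \<Longrightarrow> partial_deriv i (\<lambda>x. f (x + d)) x = partial_deriv i f (x + d)"
  using partial_deriv_affine[of f i 1 d x] by simp

lemma has_derivative_dist_sq:
  "((\<lambda>x. (norm (x - y))\<^sup>2) has_derivative (\<lambda>h. 2 * ((x - y) \<bullet> h))) (at (x::real^3))"
  unfolding power2_norm_eq_inner
  by (auto intro!: derivative_eq_intros simp: inner_commute)

lemma smooth_dist_sq: "smooth (\<lambda>x. (norm (x - y))\<^sup>2)"
proof -
  have "Ck (Suc k) (\<lambda>x. (norm (x - y))\<^sup>2)" for k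
  proof (rule Ck_SucI[OF has_derivative_dist_sq])
    have "smooth (\<lambda>x. 2 * (x $ i - y $ i))" for i by (intro smooth_cmult smooth_diff) auto
    then show "Ck k (\<lambda>x. 2 * ((x - y) \<bullet> axis i 1))" for i
      by (simp add: inner_axis smooth_def)
  qed
  then show ?thesis unfolding smooth_def using Ck_Suc_imp by blast
qed

text \<open>Differentiation changes the exponent, so the induction runs over all exponents at once.\<close>

lemma smooth_powr:
  assumes p: "smooth p" and pos: "\<And>x. 0 < p x"
  shows "smooth (\<lambda>x. p x powr s)"
proof -
  have "Ck k (\<lambda>x. p x powr s)" for k s
  proof (induction k arbitrary: s)
    case 0
    show ?case using smooth_continuous[OF p] pos by (auto intro!: continuous_on_powr continuous_on_const simp: less_imp_neq[symmetric])
  next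
    case (Suc k)
    show ?case
    proof (rule Ck_SucI)
      show "((\<lambda>x. p x powr s) has_derivative (\<lambda>h. (\<Sum>i\<in>UNIV. partial_deriv i p x * h $ i) * (s * p x powr (s - 1)))) (at x)" for x
      proof (rule has_derivative_compose[OF smooth_has_derivative[OF p], of "\<lambda>t. t powr s" "\<lambda>h. h * (s * p x powr (s - 1))", simplified o_def])
        show "((\<lambda>t. t powr s) has_derivative (\<lambda>h. h * (s * p x powr (s - 1)))) (at (p x))"
          using has_real_derivative_powr[OF pos[of x], of s] by (simp add: has_field_derivative_def mult_commute_abs)
      qed
      show "Ck k (\<lambda>x. (\<Sum>j\<in>UNIV. partial_deriv j p x * axis i 1 $ j) * (s * p x powr (s - 1)))" for i
        unfolding sum_axis using p Suc by (intro Ck_mult Ck_const) (auto simp: smooth_def dest: spec[of _ "Suc k"])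
    qed
  qed
  then show ?thesis by (simp add: smooth_def)
qed

lemma partial_deriv_powr:
  assumes p: "smooth p" and pos: "\<And>x. 0 < p x"
  shows "partial_deriv i (\<lambda>x. p x powr s) x = partial_deriv i p x * (s * p x powr (s - 1))"
proof -
  have "((\<lambda>x. p x powr s) has_derivative (\<lambda>h. (\<Sum>i\<in>UNIV. partial_deriv i p x * h $ i) * (s * p x powr (s - 1)))) (at x)"
  proof (rule has_derivative_compose[OF smooth_has_derivative[OF p], of "\<lambda>t. t powr s" "\<lambda>h. h * (s * p x powr (s - 1))", simplified o_def])
    show "((\<lambda>t. t powr s) has_derivative (\<lambda>h. h * (s * p x powr (s - 1)))) (at (p x))"
      using has_real_derivative_powr[OF pos[of x], of s] by (simp add: has_field_derivative_def mult_commute_abs)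
  qed
  from partial_deriv_eq[OF this] show ?thesis by (simp add: sum_axis)
qed

text \<open>The functions exp(-1/t)/t^n on the positive half-line, extended by 0: a family that is closed under
differentiation up to linear combinations and hence consists of smooth functions.\<close>

definition bumpf :: "nat \<Rightarrow> real \<Rightarrow> real" where
  "bumpf n t = (if 0 < t then exp (- 1 / t) / t ^ n else 0)"

lemma bumpf_tendsto_0: "(bumpf n \<longlongrightarrow> 0) (at 0)"
proof (rule filterlim_split_at)
  show "(bumpf n \<longlongrightarrow> 0) (at_left 0)"
    by (rule tendsto_eventually) (auto simp: bumpf_def eventually_at_filter)
  have "((\<lambda>u::real. u ^ n / exp u) \<longlongrightarrow> 0) at_top" by (rule tendsto_power_div_exp_0)
  moreover have "\<forall>\<^sub>F u in at_top. u ^ n / exp u = bumpf n (inverse u)"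
    using eventually_gt_at_top[of "0::real"]
    by eventually_elim (simp add: bumpf_def exp_minus field_simps)
  ultimately have "((\<lambda>u. bumpf n (inverse u)) \<longlongrightarrow> 0) at_top"
    by (rule Lim_transform_eventually)
  then show "(bumpf n \<longlongrightarrow> 0) (at_right 0)"
    by (simp add: filterlim_at_right_to_top)
qed

lemma bumpf_has_derivative:
  "(bumpf n has_real_derivative - real n * bumpf (Suc n) t + bumpf (Suc (Suc n)) t) (at t)"
proof -
  consider "t > 0" | "t < 0" | "t = 0" by linarith
  then show ?thesis
  proof cases
    case 1
    have "((\<lambda>t. exp (- 1 / t) / t ^ n) has_real_derivative - real n * bumpf (Suc n) t + bumpf (Suc (Suc n)) t) (at t)"
      using 1 by (auto intro!: derivative_eq_intros simp: bumpf_def) (cases n; simp add: field_simps power2_eq_square)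
    then show ?thesis
      by (rule has_field_derivative_transform_within_open[where S="{0<..}"]) (use 1 in \<open>auto simp: bumpf_def\<close>)
  next
    case 2
    have "((\<lambda>t. 0) has_real_derivative - real n * bumpf (Suc n) t + bumpf (Suc (Suc n)) t) (at t)"
      using 2 by (auto simp: bumpf_def)
    then show ?thesis
      by (rule has_field_derivative_transform_within_open[where S="{..<0}"]) (use 2 in \<open>auto simp: bumpf_def\<close>)
  next
    case 3
    have "(bumpf (Suc n) \<longlongrightarrow> 0) (at 0)" by (rule bumpf_tendsto_0)
    moreover have "bumpf (Suc n) = (\<lambda>h. (bumpf n (0 + h) - bumpf n 0) / h)"
      by (simp add: bumpf_def fun_eq_iff)
    ultimately have "((\<lambda>h. (bumpf n (0 + h) - bumpf n 0) / h) \<longlongrightarrow> 0) (at 0)" by (simp only:)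
    then have "(bumpf n has_real_derivative 0) (at 0)" by (simp add: DERIV_def)
    then show ?thesis using 3 by (simp add: bumpf_def)
  qed
qed

lemma bumpf_nonneg: "0 \<le> bumpf n t" and bumpf_0_le_1: "bumpf 0 t \<le> 1"
  and bumpf_pos: "0 < t \<Longrightarrow> 0 < bumpf n t" and bumpf_eq_0: "t \<le> 0 \<Longrightarrow> bumpf n t = 0"
  by (auto simp: bumpf_def)

lemma smooth_bumpf:
  assumes p: "smooth p"
  shows "smooth (\<lambda>x. bumpf n (p x))"
proof -
  have "Ck k (\<lambda>x. bumpf n (p x))" for k n
  proof (induction k arbitrary: n)
    case 0
    have "continuous_on UNIV (bumpf n)"
      using bumpf_has_derivative by (intro DERIV_continuous_on) auto
    then show ?case using smooth_continuous[OF p] by (auto intro: continuous_on_compose2)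
  next
    case (Suc k)
    show ?case
    proof (rule Ck_SucI)
      show "((\<lambda>x. bumpf n (p x)) has_derivative (\<lambda>h. (\<Sum>i\<in>UNIV. partial_deriv i p x * h $ i) * (- real n * bumpf (Suc n) (p x) + bumpf (Suc (Suc n)) (p x)))) (at x)" for x
      proof (rule has_derivative_compose[OF smooth_has_derivative[OF p], of "bumpf n" "\<lambda>h. h * (- real n * bumpf (Suc n) (p x) + bumpf (Suc (Suc n)) (p x))", simplified o_def])
        show "(bumpf n has_derivative (\<lambda>h. h * (- real n * bumpf (Suc n) (p x) + bumpf (Suc (Suc n)) (p x)))) (at (p x))"
          using bumpf_has_derivative[of n "p x"] unfolding has_field_derivative_def by (simp add: mult_commute_abs)
      qed
      show "Ck k (\<lambda>x. (\<Sum>j\<in>UNIV. partial_deriv j p x * axis i 1 $ j) * (- real n * bumpf (Suc n) (p x) + bumpf (Suc (Suc n)) (p x)))" for i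
        unfolding sum_axis using p Suc by (intro Ck_mult Ck_const Ck_add) (auto simp: smooth_def dest: spec[of _ "Suc k"])
    qed
  qed
  then show ?thesis by (simp add: smooth_def)
qed

section \<open>Test functions and weak derivatives\<close>

lemma partial_deriv_diff:
  assumes "smooth f" "smooth g"
  shows "partial_deriv i (\<lambda>x. f x - g x) x = partial_deriv i f x - partial_deriv i g x"
  using partial_deriv_eq[OF has_derivative_diff[OF smooth_has_derivative[OF assms(1)] smooth_has_derivative[OF assms(2)]], where i=i]
  by (simp add: sum_axis)

lemma Cc_infinityI:
  assumes "smooth f" "\<And>x. R < norm x \<Longrightarrow> f x = 0"
  shows "f \<in> Cc_infinity"
proof -
  have "{x. f x \<noteq> 0} \<subseteq> cball 0 R" using assms(2) by (force simp: not_less[symmetric])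
  then have "bounded {x. f x \<noteq> 0}" by (rule bounded_subset[OF bounded_cball])
  then show ?thesis using assms(1) by (simp add: Cc_infinity_def smooth_def compact_eq_bounded_closed bounded_closure)
qed

lemma Cc_infinityD:
  assumes "f \<in> Cc_infinity"
  shows "smooth f" "\<exists>R>0. \<forall>x. R < norm x \<longrightarrow> f x = 0"
proof -
  show "smooth f" using assms by (simp add: Cc_infinity_def smooth_def)
  have "bounded {x. f x \<noteq> 0}"
    using assms bounded_subset[OF compact_imp_bounded closure_subset] by (auto simp: Cc_infinity_def)
  then obtain R where "R > 0" "\<forall>x\<in>{x. f x \<noteq> 0}. norm x \<le> R" unfolding bounded_pos by blast
  then show "\<exists>R>0. \<forall>x. R < norm x \<longrightarrow> f x = 0" by (intro exI[of _ R]) force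
qed

lemma partial_deriv_zero:
  assumes "smooth f" "\<And>x. R < norm x \<Longrightarrow> f x = 0" "R < norm x"
  shows "partial_deriv i f x = 0"
proof -
  have o: "open {x::real^3. R < norm x}" by (intro open_Collect_less continuous_intros)
  have "((\<lambda>x. 0) has_derivative (\<lambda>h. \<Sum>i\<in>UNIV. partial_deriv i f x * h $ i)) (at x)"
    by (rule has_derivative_transform_within_open[OF smooth_has_derivative[OF assms(1)] o]) (use assms in auto)
  from partial_deriv_eq[OF this, of i] show ?thesis by (simp add: sum_axis)
qed

lemma Cc_infinity_partial: "f \<in> Cc_infinity \<Longrightarrow> partial_deriv i f \<in> Cc_infinity"
  using Cc_infinityD[of f] partial_deriv_zero[of f] by (metis Cc_infinityI smooth_partial)

lemma Cc_infinity_mult: "f \<in> Cc_infinity \<Longrightarrow> smooth g \<Longrightarrow> (\<lambda>x. f x * g x) \<in> Cc_infinity"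
  using Cc_infinityD[of f] by (auto intro!: Cc_infinityI)

lemma Cc_infinity_add: 
  assumes "f \<in> Cc_infinity" "g \<in> Cc_infinity" shows "(\<lambda>x. f x + g x) \<in> Cc_infinity"
proof -
  from Cc_infinityD[OF assms(1)] Cc_infinityD[OF assms(2)] obtain R S where
    "\<forall>x. R < norm x \<longrightarrow> f x = 0" "\<forall>x. S < norm x \<longrightarrow> g x = 0" "smooth f" "smooth g" by blast
  then show ?thesis by (intro Cc_infinityI[of _ "max R S"]) auto
qed

lemma Cc_infinity_shift:
  assumes "f \<in> Cc_infinity" shows "(\<lambda>x. f (x + d)) \<in> Cc_infinity"
proof -
  from Cc_infinityD[OF assms] obtain R where R: "\<forall>x. R < norm x \<longrightarrow> f x = 0" "smooth f" by blast
  have "R < norm (x + d)" if "R + norm d < norm x" for x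
    using that norm_triangle_ineq4[of "x + d" d] by simp
  then show ?thesis using R by (intro Cc_infinityI[of _ "R + norm d"] smooth_shift) auto
qed

lemma Cc_infinity_bounded:
  assumes "f \<in> Cc_infinity" shows "\<exists>B>0. \<forall>x. \<bar>f x\<bar> \<le> B"
proof -
  from Cc_infinityD[OF assms] obtain R where R: "\<forall>x. R < norm x \<longrightarrow> f x = 0" "smooth f" "R > 0" by blast
  have "compact (f ` cball 0 R)"
    by (intro compact_continuous_image continuous_on_subset[OF smooth_continuous[OF R(2)]]) auto
  then obtain B where B: "B > 0" "\<forall>y\<in>f ` cball 0 R. norm y \<le> B"
    using compact_imp_bounded bounded_pos by blast
  have "\<bar>f x\<bar> \<le> B" for x
    using B R by (cases "norm x \<le> R") (auto simp: less_imp_le)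
  then show ?thesis using B(1) by blast
qed

lemma Cc_infinity_measurable [measurable_dest]: "f \<in> Cc_infinity \<Longrightarrow> f \<in> borel_measurable borel"
  by (intro borel_measurable_continuous_onI smooth_continuous Cc_infinityD)

lemma borel_lebesgue_measurable: "f \<in> borel_measurable borel \<Longrightarrow> f \<in> borel_measurable lebesgue"
  by (simp add: measurable_completion)

lemma Cc_infinity_measurable_leb: "f \<in> Cc_infinity \<Longrightarrow> f \<in> borel_measurable lebesgue"
  by (intro borel_lebesgue_measurable Cc_infinity_measurable)

lemma finite_cball_lebesgue: "emeasure lebesgue (cball (0::real^3) R) < \<infinity>"
  using emeasure_lborel_cball_finite[of "0::real^3" R] by simp

lemma integrable_bounded_supp:
  fixes f :: "real^3 \<Rightarrow> real"
  assumes "f \<in> borel_measurable lebesgue" "\<And>x. \<bar>f x\<bar> \<le> B" "\<And>x. R < norm x \<Longrightarrow> f x = 0"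
  shows "integrable lebesgue f"
proof (rule Bochner_Integration.integrable_bound)
  show "integrable lebesgue (\<lambda>x. B * indicator (cball (0::real^3) R) x)"
    using finite_cball_lebesgue by (intro integrable_mult_right integrable_real_indicator) auto
  show "AE x in lebesgue. norm (f x) \<le> norm (B * indicator (cball (0::real^3) R) x)"
  proof (rule AE_I2)
    fix x show "norm (f x) \<le> norm (B * indicator (cball (0::real^3) R) x)"
      using assms(2)[of x] assms(3)[of x] by (cases "norm x \<le> R") (auto simp: indicator_def)
  qed
qed (rule assms)

lemma Cc_infinity_integrable: "f \<in> Cc_infinity \<Longrightarrow> integrable lebesgue f"
  using Cc_infinityD[of f] Cc_infinity_bounded[of f] Cc_infinity_measurable_leb[of f]
  by (metis integrable_bounded_supp)

lemma Cc_infinity_lipschitz: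
  assumes "f \<in> Cc_infinity"
  shows "\<exists>C>0. \<forall>x h. \<bar>f (x + h) - f x\<bar> \<le> C * norm h \<and> \<bar>\<Sum>i\<in>UNIV. partial_deriv i f x * h $ i\<bar> \<le> C * norm h"
proof -
  have "\<exists>B>0. \<forall>x. \<bar>partial_deriv i f x\<bar> \<le> B" for i
    by (rule Cc_infinity_bounded[OF Cc_infinity_partial[OF assms]])
  then obtain B where B: "\<And>i. B i > 0" "\<And>i x. \<bar>partial_deriv i f x\<bar> \<le> B i" by metis
  define C where "C = (\<Sum>i\<in>UNIV. B i)"
  have "C > 0" unfolding C_def by (rule sum_pos) (use B in auto)
  have D: "\<bar>\<Sum>i\<in>UNIV. partial_deriv i f x * h $ i\<bar> \<le> C * norm h" for x h
  proof -
    have "\<bar>\<Sum>i\<in>UNIV. partial_deriv i f x * h $ i\<bar> \<le> (\<Sum>i\<in>UNIV. \<bar>partial_deriv i f x * h $ i\<bar>)" by (rule sum_abs)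
    also have "\<dots> \<le> (\<Sum>i\<in>UNIV. B i * norm h)"
      unfolding abs_mult by (intro sum_mono mult_mono B component_le_norm_cart) (use B(1) less_imp_le in auto)
    finally show ?thesis by (simp add: C_def sum_distrib_right)
  qed
  have "norm (f (x + h) - f x) \<le> C * norm (x + h - x)" for x h
  proof (rule differentiable_bound[of UNIV f "\<lambda>x h. \<Sum>i\<in>UNIV. partial_deriv i f x * h $ i"])
    show "onorm (\<lambda>h. \<Sum>i\<in>UNIV. partial_deriv i f x * h $ i) \<le> C" for x
      by (rule onorm_le) (use D in simp)
  qed (use smooth_has_derivative[OF Cc_infinityD(1)[OF assms]] in auto)
  then show ?thesis using D \<open>C > 0\<close> by auto
qed

definition loc_int :: "(real^3 \<Rightarrow> real) \<Rightarrow> bool" where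
  "loc_int f \<longleftrightarrow> f \<in> borel_measurable lebesgue \<and> (\<forall>R. integrable lebesgue (\<lambda>x. indicator (cball 0 R) x * f x))"

lemma loc_int_mult_integrable:
  assumes f: "loc_int f" and "g \<in> borel_measurable lebesgue" "\<And>x. \<bar>g x\<bar> \<le> B" "\<And>x. R < norm x \<Longrightarrow> g x = 0"
  shows "integrable lebesgue (\<lambda>x. f x * g x)"
proof (rule Bochner_Integration.integrable_bound)
  show "integrable lebesgue (\<lambda>x. B * (indicator (cball 0 R) x * f x))"
    using f by (intro integrable_mult_right) (auto simp: loc_int_def)
  show "AE x in lebesgue. norm (f x * g x) \<le> norm (B * (indicator (cball 0 R) x * f x))"
  proof (rule AE_I2)
    fix x show "norm (f x * g x) \<le> norm (B * (indicator (cball 0 R) x * f x))"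
      using assms(3)[of x] assms(4)[of x]
      by (cases "norm x \<le> R") (auto simp: indicator_def abs_mult mult.commute[of B] intro!: mult_left_mono)
  qed
qed (use assms in \<open>auto simp: loc_int_def\<close>)

lemma loc_int_Cc_integrable:
  assumes "loc_int f" "g \<in> Cc_infinity"
  shows "integrable lebesgue (\<lambda>x. f x * g x)"
  using Cc_infinityD[OF assms(2)] Cc_infinity_bounded[OF assms(2)] Cc_infinity_measurable_leb[OF assms(2)]
    loc_int_mult_integrable[OF assms(1)] by metis

lemma loc_int_const: "loc_int (\<lambda>x. c)"
  unfolding loc_int_def using finite_cball_lebesgue
  by (auto intro!: integrable_mult_left integrable_real_indicator)

text \<open>Dominated convergence: the difference quotients of a test function are bounded by its Lipschitz
constant and supported in a fixed ball. The step size 1/(n+1) is chosen to keep the shift at most 1.\<close>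

lemma difference_quotient_integral:
  assumes f: "loc_int f" and g: "g \<in> Cc_infinity"
  shows "(\<lambda>n. \<integral>x. f x * ((g (x + inverse (real (Suc n)) *\<^sub>R axis i 1) - g x) * real (Suc n)) \<partial>lebesgue)
           \<longlonglongrightarrow> (\<integral>x. f x * partial_deriv i g x \<partial>lebesgue)"
proof -
  from Cc_infinityD[OF g] obtain R where R: "\<And>x. R < norm x \<Longrightarrow> g x = 0" "smooth g" "R > 0" by blast
  from Cc_infinity_lipschitz[OF g] obtain C where C: "C > 0" "\<And>x h. \<bar>g (x + h) - g x\<bar> \<le> C * norm h" by blast
  define h where "h n = inverse (real (Suc n)) *\<^sub>R (axis i 1 :: real^3)" for n
  have nh: "norm (h n) = inverse (real (Suc n))" for n by (simp add: h_def)
  have nh1: "norm (h n) \<le> 1" for n unfolding nh by (simp add: field_simps)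
  have [measurable]: "f \<in> borel_measurable lebesgue" using f by (simp add: loc_int_def)
  have mg: "g \<in> borel_measurable borel" by (rule Cc_infinity_measurable[OF g])
  have mgh: "(\<lambda>x. g (x + h n)) \<in> borel_measurable borel" for n
    using Cc_infinity_measurable[OF Cc_infinity_shift[OF g]] .
  have [measurable]: "g \<in> borel_measurable lebesgue" "(\<lambda>x. g (x + h n)) \<in> borel_measurable lebesgue"
    "partial_deriv i g \<in> borel_measurable lebesgue" for n
    using borel_lebesgue_measurable[OF mg] borel_lebesgue_measurable[OF mgh]
      Cc_infinity_measurable_leb[OF Cc_infinity_partial[OF g]] by auto
  have "(\<lambda>n. \<integral>x. f x * ((g (x + h n) - g x) * real (Suc n)) \<partial>lebesgue) \<longlonglongrightarrow> (\<integral>x. f x * partial_deriv i g x \<partial>lebesgue)"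
  proof (rule integral_dominated_convergence[where w="\<lambda>x. C * \<bar>indicator (cball 0 (R+1)) x * f x\<bar>"])
    show "integrable lebesgue (\<lambda>x. C * \<bar>indicator (cball 0 (R+1)) x * f x\<bar>)"
      using f unfolding loc_int_def by (intro integrable_mult_right integrable_abs) blast
    show "AE x in lebesgue. (\<lambda>n. f x * ((g (x + h n) - g x) * real (Suc n))) \<longlonglongrightarrow> f x * partial_deriv i g x"
    proof (rule AE_I2, rule tendsto_mult_left)
      fix x
      define F where "F t = g (x + t *\<^sub>R axis i 1)" for t
      have "(F has_derivative (\<lambda>t. \<Sum>j\<in>UNIV. partial_deriv j g (x + 0 *\<^sub>R axis i 1) * (t *\<^sub>R axis i 1) $ j)) (at 0)"
        unfolding F_def by (rule has_derivative_compose[OF _ smooth_has_derivative[OF R(2)]]) (auto intro!: derivative_eq_intros)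
      moreover have "(\<Sum>j\<in>UNIV. partial_deriv j g x * (t *\<^sub>R axis i 1) $ j) = partial_deriv i g x * t" for t
        using sum_axis[of "\<lambda>j. partial_deriv j g x * t" i] by (simp add: mult_ac)
      ultimately have "(F has_real_derivative partial_deriv i g x) (at 0)"
        by (simp add: has_field_derivative_def)
      then have l: "((\<lambda>t. (F t - F 0) / t) \<longlongrightarrow> partial_deriv i g x) (at 0)" by (simp add: DERIV_def)
      have "filterlim (\<lambda>n. inverse (real (Suc n))) (at 0) sequentially"
        using LIMSEQ_inverse_real_of_nat by (simp add: filterlim_at)
      from filterlim_compose[OF l this]
      show "(\<lambda>n. (g (x + h n) - g x) * real (Suc n)) \<longlonglongrightarrow> partial_deriv i g x"
        by (simp add: F_def h_def divide_inverse)
    qed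
    show "AE x in lebesgue. norm (f x * ((g (x + h n) - g x) * real (Suc n))) \<le> C * \<bar>indicator (cball 0 (R+1)) x * f x\<bar>" for n
    proof (rule AE_I2)
      fix x
      show "norm (f x * ((g (x + h n) - g x) * real (Suc n))) \<le> C * \<bar>indicator (cball 0 (R+1)) x * f x\<bar>"
      proof (cases "norm x \<le> R + 1")
        case True
        have "\<bar>g (x + h n) - g x\<bar> * real (Suc n) \<le> C * norm (h n) * real (Suc n)"
          by (intro mult_right_mono C) auto
        also have "\<dots> = C" by (simp add: nh)
        finally have "\<bar>f x\<bar> * (\<bar>g (x + h n) - g x\<bar> * real (Suc n)) \<le> \<bar>f x\<bar> * C" by (intro mult_left_mono) auto
        then show ?thesis using True by (simp add: abs_mult mult.commute)
      next
        case False
        have "norm x \<le> norm (x + h n) + norm (h n)" using norm_triangle_ineq4[of "x + h n" "h n"] by simp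
        then have "R < norm (x + h n)" using False nh1[of n] by linarith
        then show ?thesis using R(1) False by simp
      qed
    qed
  qed measurable
  then show ?thesis unfolding h_def .
qed

lemma lebesgue_integral_shift:
  fixes f :: "real^3 \<Rightarrow> real"
  assumes [measurable]: "f \<in> borel_measurable borel"
  shows "(\<integral>x. f (x + h) \<partial>lebesgue) = (\<integral>x. f x \<partial>lebesgue)"
    and "integrable lebesgue (\<lambda>x. f (x + h)) \<longleftrightarrow> integrable lebesgue f"
proof -
  have *: "lborel = distr lborel borel ((+) h)" by (rule lborel_distr_plus[symmetric])
  have "(\<integral>x. f x \<partial>lborel) = (\<integral>x. f (h + x) \<partial>lborel)"
    by (subst *, subst integral_distr) auto
  then show "(\<integral>x. f (x + h) \<partial>lebesgue) = (\<integral>x. f x \<partial>lebesgue)"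
    by (simp add: integral_completion add.commute)
  have "integrable lborel f = integrable lborel (\<lambda>x. f (h + x))"
    by (subst *, subst integrable_distr_eq) auto
  then show "integrable lebesgue (\<lambda>x. f (x + h)) \<longleftrightarrow> integrable lebesgue f"
    by (simp add: integrable_completion add.commute)
qed

text \<open>Translation invariance: every difference quotient has integral 0.\<close>

lemma integral_partial_deriv_zero:
  assumes g: "g \<in> Cc_infinity"
  shows "(\<integral>x. partial_deriv i g x \<partial>lebesgue) = 0"
proof -
  have 0: "(\<integral>x. 1 * ((g (x + h) - g x) * c) \<partial>lebesgue) = 0" for h c
  proof -
    have "(\<integral>x. g (x + h) - g x \<partial>lebesgue) = 0"
      using Cc_infinity_integrable[OF Cc_infinity_shift[OF g], of h] Cc_infinity_integrable[OF g]
        lebesgue_integral_shift(1)[OF Cc_infinity_measurable[OF g], of h] by simp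
    then show ?thesis by simp
  qed
  show ?thesis
    using LIMSEQ_unique[OF difference_quotient_integral[OF loc_int_const[of 1] g, of i, unfolded 0] tendsto_const]
    by simp
qed

text \<open>The integral of a partial derivative of the compactly supported product f \<phi> vanishes.\<close>

lemma smooth_is_weak_gradient:
  assumes "smooth f" "\<And>x i. g x $ i = partial_deriv i f x"
  shows "is_weak_gradient f g"
  unfolding is_weak_gradient_def
proof (intro ballI allI)
  fix \<phi> i assume \<phi>: "\<phi> \<in> Cc_infinity"
  note s = Cc_infinityD(1)[OF \<phi>]
  have int: "integrable lebesgue (\<lambda>x. f x * partial_deriv i \<phi> x)" "integrable lebesgue (\<lambda>x. partial_deriv i f x * \<phi> x)"
    using Cc_infinity_integrable[OF Cc_infinity_mult[OF Cc_infinity_partial[OF \<phi>] assms(1)], of i]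
      Cc_infinity_integrable[OF Cc_infinity_mult[OF \<phi> smooth_partial[OF assms(1)]], of i]
    by (simp_all add: mult.commute)
  have "0 = (\<integral>x. partial_deriv i (\<lambda>x. \<phi> x * f x) x \<partial>lebesgue)"
    using integral_partial_deriv_zero[OF Cc_infinity_mult[OF \<phi> assms(1)]] by simp
  also have "\<dots> = (\<integral>x. f x * partial_deriv i \<phi> x + partial_deriv i f x * \<phi> x \<partial>lebesgue)"
    by (simp add: partial_deriv_mult[OF s assms(1)] algebra_simps)
  also have "\<dots> = (\<integral>x. f x * partial_deriv i \<phi> x \<partial>lebesgue) + (\<integral>x. partial_deriv i f x * \<phi> x \<partial>lebesgue)"
    using int by simp
  finally show "(\<integral>x. f x * partial_deriv i \<phi> x \<partial>lebesgue) = - (\<integral>x. g x $ i * \<phi> x \<partial>lebesgue)"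
    by (simp add: assms(2))
qed

text \<open>Symmetry of second derivatives in the weak sense. Replacing one derivative of \<psi> by a difference
quotient gives a test function whose other derivative is the difference quotient of that derivative.\<close>

lemma weak_gradient_curl_free:
  assumes v: "loc_int v" and gl: "\<And>i. loc_int (\<lambda>x. g x $ i)" and w: "is_weak_gradient v g" and \<psi>: "\<psi> \<in> Cc_infinity"
  shows "(\<integral>x. g x $ i * partial_deriv j \<psi> x \<partial>lebesgue) = (\<integral>x. g x $ j * partial_deriv i \<psi> x \<partial>lebesgue)"
proof -
  define h where "h n = inverse (real (Suc n)) *\<^sub>R (axis j 1 :: real^3)" for n
  define q where "q n x = (\<psi> (x + h n) - \<psi> x) * real (Suc n)" for n x
  have qC: "q n \<in> Cc_infinity" for n
    unfolding q_def
    using Cc_infinity_mult[OF Cc_infinity_add[OF Cc_infinity_shift[OF \<psi>, of "h n"] Cc_infinity_mult[OF \<psi>, of "\<lambda>x. -1"]],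
      of "\<lambda>x. real (Suc n)"] by simp
  have s: "smooth \<psi>" using Cc_infinityD(1)[OF \<psi>] .
  have qi: "partial_deriv i (q n) x = (partial_deriv i \<psi> (x + h n) - partial_deriv i \<psi> x) * real (Suc n)" for n x
    unfolding q_def
    by (subst partial_deriv_mult[OF smooth_diff[OF smooth_shift[OF s] s] smooth_const])
      (simp add: partial_deriv_diff smooth_shift s partial_deriv_shift)
  have 1: "(\<lambda>n. \<integral>x. g x $ i * ((\<psi> (x + h n) - \<psi> x) * real (Suc n)) \<partial>lebesgue) \<longlonglongrightarrow> (\<integral>x. g x $ i * partial_deriv j \<psi> x \<partial>lebesgue)"
    unfolding h_def by (rule difference_quotient_integral[OF gl \<psi>])
  have 2: "(\<lambda>n. \<integral>x. v x * ((partial_deriv i \<psi> (x + h n) - partial_deriv i \<psi> x) * real (Suc n)) \<partial>lebesgue)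
      \<longlonglongrightarrow> (\<integral>x. v x * partial_deriv j (partial_deriv i \<psi>) x \<partial>lebesgue)"
    unfolding h_def by (rule difference_quotient_integral[OF v Cc_infinity_partial[OF \<psi>]])
  have "(\<integral>x. v x * ((partial_deriv i \<psi> (x + h n) - partial_deriv i \<psi> x) * real (Suc n)) \<partial>lebesgue)
     = - (\<integral>x. g x $ i * ((\<psi> (x + h n) - \<psi> x) * real (Suc n)) \<partial>lebesgue)" for n
    using w qC[of n] unfolding is_weak_gradient_def by (simp add: qi[symmetric] q_def del: of_nat_Suc)
  then have "(\<integral>x. v x * partial_deriv j (partial_deriv i \<psi>) x \<partial>lebesgue) = - (\<integral>x. g x $ i * partial_deriv j \<psi> x \<partial>lebesgue)"
    using LIMSEQ_unique[OF 2] tendsto_minus[OF 1] by simp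
  moreover have "(\<integral>x. v x * partial_deriv j (partial_deriv i \<psi>) x \<partial>lebesgue) = - (\<integral>x. g x $ j * partial_deriv i \<psi> x \<partial>lebesgue)"
    using w Cc_infinity_partial[OF \<psi>, of i] unfolding is_weak_gradient_def by simp
  ultimately show ?thesis by simp
qed

section \<open>The fundamental lemma and smoothing by convolution\<close>

lemma bumpf_limit:
  assumes "t > 0"
  shows "(\<lambda>n. bumpf 0 (real (Suc n) * t)) \<longlonglongrightarrow> 1"
proof -
  have "(\<lambda>n. exp (- (inverse (real (Suc n)) * (1 / t)))) \<longlonglongrightarrow> exp (- (0 * (1 / t)))"
    by (intro tendsto_intros LIMSEQ_inverse_real_of_nat)
  moreover have "exp (- (inverse (real (Suc n)) * (1 / t))) = bumpf 0 (real (Suc n) * t)" for n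
    using assms by (simp add: bumpf_def field_simps del: of_nat_Suc)
  ultimately show ?thesis by simp
qed

lemma box_subset_cball_0: "\<exists>R. box a b \<subseteq> cball (0::real^3) R"
proof -
  obtain R where "\<forall>x\<in>box a b. norm x \<le> R"
    using bounded_box[of a b] unfolding bounded_iff by blast
  then show ?thesis by (intro exI[of _ R]) auto
qed

lemma box_cball_sets [measurable]: "box a b \<in> sets lebesgue" "cball c R \<in> sets lebesgue" for a b c :: "real^3"
  by simp_all

text \<open>The indicator of an open box is the bounded pointwise limit of products of one-dimensional bumps.\<close>

lemma integral_box_zero:
  assumes f: "loc_int f" and 0: "\<And>\<phi>. \<phi> \<in> Cc_infinity \<Longrightarrow> (\<integral>x. f x * \<phi> x \<partial>lebesgue) = 0"
  shows "(\<integral>x. f x * indicator (box a b) x \<partial>lebesgue) = 0"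
proof (cases "box a b = {}")
  case False
  then have ab: "a $ i \<le> b $ i" for i
    by (meson interval_eq_empty_cart(1) linorder_le_cases)
  define \<phi> where "\<phi> n x = (\<Prod>i\<in>UNIV. bumpf 0 (real (Suc n) * ((x $ i - a $ i) * (b $ i - x $ i))))" for n and x :: "real^3"
  obtain R where R: "box a b \<subseteq> cball 0 R" using box_subset_cball_0 by blast
  have z: "\<phi> n x = 0" if "x \<notin> box a b" for n x
  proof -
    from that obtain i where i: "x $ i \<le> a $ i \<or> b $ i \<le> x $ i" by (auto simp: mem_box_cart not_less)
    then have "(x $ i - a $ i) * (b $ i - x $ i) \<le> 0"
      using ab[of i] by (auto simp: mult_le_0_iff)
    then have "real (Suc n) * ((x $ i - a $ i) * (b $ i - x $ i)) \<le> 0"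
      by (simp add: mult_le_0_iff)
    then have "bumpf 0 (real (Suc n) * ((x $ i - a $ i) * (b $ i - x $ i))) = 0" by (rule bumpf_eq_0)
    then show ?thesis unfolding \<phi>_def by (intro prod_zero bexI[of _ i]) auto
  qed
  have zR: "\<phi> n x = 0" if "R < norm x" for n x
    using z[of x n] R that by force
  have le1: "\<bar>\<phi> n x\<bar> \<le> 1" for n x
    unfolding \<phi>_def by (auto simp: abs_prod intro!: prod_le_1 bumpf_nonneg bumpf_0_le_1 simp: bumpf_nonneg)
  have sm: "smooth (\<phi> n)" for n
    unfolding \<phi>_def by (intro smooth_prod smooth_bumpf smooth_mult smooth_diff smooth_const smooth_coord)
  have C: "\<phi> n \<in> Cc_infinity" for n by (rule Cc_infinityI[OF sm zR])
  have lim: "(\<lambda>n. \<phi> n x) \<longlonglongrightarrow> indicator (box a b) x" for x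
  proof (cases "x \<in> box a b")
    case True
    then have "(x $ i - a $ i) * (b $ i - x $ i) > 0" for i by (auto simp: mem_box_cart)
    then have "(\<lambda>n. \<phi> n x) \<longlonglongrightarrow> (\<Prod>i\<in>(UNIV::3 set). 1)"
      unfolding \<phi>_def by (intro tendsto_prod bumpf_limit)
    then show ?thesis using True by simp
  qed (simp add: z)
  have [measurable]: "f \<in> borel_measurable lebesgue" "\<phi> n \<in> borel_measurable lebesgue" for n
    using f C Cc_infinity_measurable_leb by (auto simp: loc_int_def)
  have "(\<lambda>n. \<integral>x. f x * \<phi> n x \<partial>lebesgue) \<longlonglongrightarrow> (\<integral>x. f x * indicator (box a b) x \<partial>lebesgue)"
  proof (rule integral_dominated_convergence[where w="\<lambda>x. \<bar>indicator (cball 0 R) x * f x\<bar>"])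
    show "integrable lebesgue (\<lambda>x. \<bar>indicator (cball 0 R) x * f x\<bar>)"
      using f unfolding loc_int_def by (intro integrable_abs) blast
    show "AE x in lebesgue. (\<lambda>n. f x * \<phi> n x) \<longlonglongrightarrow> f x * indicator (box a b) x"
      by (intro AE_I2 tendsto_mult_left lim)
    show "AE x in lebesgue. norm (f x * \<phi> n x) \<le> \<bar>indicator (cball 0 R) x * f x\<bar>" for n
    proof (rule AE_I2)
      fix x show "norm (f x * \<phi> n x) \<le> \<bar>indicator (cball 0 R) x * f x\<bar>"
        using zR[of x n] mult_left_mono[OF le1[of n x], of "\<bar>f x\<bar>"]
        by (cases "norm x \<le> R") (auto simp: abs_mult)
    qed
  qed measurable
  then show ?thesis using 0[OF C] LIMSEQ_unique[OF _ tendsto_const] by simp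
qed simp

text \<open>The positive and the negative part of f define measures that agree on all boxes, hence on all Borel
sets.\<close>

lemma fundamental_lemma:
  assumes f: "loc_int f" and 0: "\<And>\<phi>. \<phi> \<in> Cc_infinity \<Longrightarrow> (\<integral>x. f x * \<phi> x \<partial>lebesgue) = 0"
  shows "AE x in lebesgue. f x = 0"
proof -
  have "f \<in> borel_measurable lebesgue" using f by (simp add: loc_int_def)
  then obtain f' where f' [measurable]: "f' \<in> borel_measurable lborel" and eq: "AE x in lborel. f x = f' x"
    using completion_ex_borel_measurable_real by blast
  have eql: "AE x in lebesgue. f x = f' x" using AE_completion[OF eq] .
  have [measurable]: "f' \<in> borel_measurable borel" using f' by simp
  have [measurable]: "f' \<in> borel_measurable lebesgue" "f \<in> borel_measurable lebesgue"
    using f by (auto simp: loc_int_def intro: borel_lebesgue_measurable)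
  have int: "integrable lborel (\<lambda>x. f' x * indicator (box a b) x)" for a b
  proof -
    obtain R where R: "box a b \<subseteq> cball 0 R" using box_subset_cball_0 by blast
    have "integrable lebesgue (\<lambda>x. f x * indicator (box a b) x)"
      by (rule loc_int_mult_integrable[OF f, of _ 1 R]) (use R in \<open>auto simp: indicator_def intro!: borel_lebesgue_measurable\<close>)
    moreover have "(\<lambda>x. f' x * indicator (box a b) x) \<in> borel_measurable lebesgue" by measurable
    moreover have "AE x in lebesgue. f x * indicator (box a b) x = f' x * indicator (box a b) x"
      using eql by eventually_elim simp
    ultimately have "integrable lebesgue (\<lambda>x. f' x * indicator (box a b) x)"
      by (rule integrable_cong_AE_imp)
    then show ?thesis by (simp add: integrable_completion)
  qed
  have zero: "(\<integral>x. f' x * indicator (box a b) x \<partial>lborel) = 0" for a b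
  proof -
    have "(\<integral>x. f' x * indicator (box a b) x \<partial>lborel) = (\<integral>x. f' x * indicator (box a b) x \<partial>lebesgue)"
      by (simp add: integral_completion)
    also have "\<dots> = (\<integral>x. f x * indicator (box a b) x \<partial>lebesgue)"
    proof (rule integral_cong_AE)
      show "AE x in lebesgue. f' x * indicator (box a b) x = f x * indicator (box a b) x"
        using eql by eventually_elim simp
    qed measurable
    also have "\<dots> = 0" by (rule integral_box_zero[OF f 0])
    finally show ?thesis .
  qed
  define p m where "p x = max (f' x) 0" "m x = max (- f' x) 0" for x
  have [measurable]: "p \<in> borel_measurable borel" "m \<in> borel_measurable borel" unfolding p_m_def by auto
  have pm: "emeasure (density lborel (\<lambda>x. ennreal (p x))) (box a b) = ennreal (\<integral>x. p x * indicator (box a b) x \<partial>lborel)"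
     "emeasure (density lborel (\<lambda>x. ennreal (m x))) (box a b) = ennreal (\<integral>x. m x * indicator (box a b) x \<partial>lborel)"
     "(\<integral>x. p x * indicator (box a b) x \<partial>lborel) = (\<integral>x. m x * indicator (box a b) x \<partial>lborel)" for a b
  proof -
    have ip: "integrable lborel (\<lambda>x. p x * indicator (box a b) x)"
      by (rule Bochner_Integration.integrable_bound[OF int[of a b]]) (auto simp: p_m_def indicator_def)
    have im: "integrable lborel (\<lambda>x. m x * indicator (box a b) x)"
      by (rule Bochner_Integration.integrable_bound[OF int[of a b]]) (auto simp: p_m_def indicator_def)
    show "emeasure (density lborel (\<lambda>x. ennreal (p x))) (box a b) = ennreal (\<integral>x. p x * indicator (box a b) x \<partial>lborel)"
      using ip by (subst nn_integral_eq_integral[symmetric])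
        (auto simp: emeasure_density p_m_def ennreal_mult' ennreal_indicator)
    show "emeasure (density lborel (\<lambda>x. ennreal (m x))) (box a b) = ennreal (\<integral>x. m x * indicator (box a b) x \<partial>lborel)"
      using im by (subst nn_integral_eq_integral[symmetric])
        (auto simp: emeasure_density p_m_def ennreal_mult' ennreal_indicator)
    have "(\<integral>x. p x * indicator (box a b) x \<partial>lborel) - (\<integral>x. m x * indicator (box a b) x \<partial>lborel)
      = (\<integral>x. p x * indicator (box a b) x - m x * indicator (box a b) x \<partial>lborel)" using ip im by simp
    also have "\<dots> = (\<integral>x. f' x * indicator (box a b) x \<partial>lborel)"
      by (rule Bochner_Integration.integral_cong) (auto simp: p_m_def indicator_def)
    finally show "(\<integral>x. p x * indicator (box a b) x \<partial>lborel) = (\<integral>x. m x * indicator (box a b) x \<partial>lborel)"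
      using zero by simp
  qed
  have "density lborel (\<lambda>x. ennreal (p x)) = density lborel (\<lambda>x. ennreal (m x))"
  proof (rule measure_eqI_generator_eq)
    let ?E = "range (\<lambda>(a, b). box a b::(real^3) set)"
    show "Int_stable ?E" by (auto simp: Int_stable_def box_Int_box)
    show "?E \<subseteq> Pow UNIV" "sets (density lborel (\<lambda>x. ennreal (p x))) = sigma_sets UNIV ?E"
      "sets (density lborel (\<lambda>x. ennreal (m x))) = sigma_sets UNIV ?E"
      by (simp_all add: borel_eq_box)
    let ?A = "\<lambda>n::nat. box (- (real n *\<^sub>R One)) (real n *\<^sub>R One) :: (real^3) set"
    show "range ?A \<subseteq> ?E" "(\<Union>i. ?A i) = UNIV" unfolding UN_box_eq_UNIV by auto
    show "emeasure (density lborel (\<lambda>x. ennreal (p x))) (?A i) \<noteq> \<infinity>" for i unfolding pm(1) by simp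
    show "emeasure (density lborel (\<lambda>x. ennreal (p x))) X = emeasure (density lborel (\<lambda>x. ennreal (m x))) X" if "X \<in> ?E" for X
    proof -
      from that obtain a b where "X = box a b" by auto
      then show ?thesis by (simp only: pm)
    qed
  qed
  then have "AE x in lborel. ennreal (p x) = ennreal (m x)"
    by (subst (asm) sigma_finite_measure.density_unique_iff[OF sigma_finite_lborel]) measurable
  then have "AE x in lborel. f' x = 0"
    by eventually_elim (auto simp: p_m_def max_def split: if_splits)
  then have "AE x in lebesgue. f' x = 0" by (rule AE_completion)
  with eql show ?thesis by eventually_elim simp
qed

lemma L2_indicator_cball: "(\<lambda>x. indicator (cball (0::real^3) R) x :: real) \<in> L2 lebesgue"
proof (rule L2I)
  have "integrable lebesgue (\<lambda>x. indicator (cball (0::real^3) R) x :: real)"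
    using finite_cball_lebesgue by (intro integrable_real_indicator) auto
  then show "integrable lebesgue (\<lambda>x. (norm (indicator (cball (0::real^3) R) x :: real))\<^sup>2)"
    by (rule Bochner_Integration.integrable_cong[THEN iffD1, rotated -1]) (auto simp: indicator_def)
qed (rule borel_measurable_indicator, simp)

lemma L2_loc_int: "f \<in> L2 lebesgue \<Longrightarrow> loc_int f"
  unfolding loc_int_def using L2_mult_integrable[OF L2_indicator_cball] L2_meas by auto

lemma one_plus_norm_sq_pos [simp]: "0 < 1 + (norm x)\<^sup>2" "1 + (norm x)\<^sup>2 \<noteq> 0"
  by (auto simp: add_pos_nonneg add_nonneg_eq_0_iff)

lemma theta_pos: "0 < theta x"
  by (simp add: theta_def)

lemma theta_sq: "(theta x)\<^sup>2 = 1 / (1 + (norm x)\<^sup>2)"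
proof -
  have "(theta x)\<^sup>2 = (1 + (norm x)\<^sup>2) powr (- 1)"
    unfolding theta_def power2_eq_square by (simp flip: powr_add)
  then show ?thesis by (simp add: powr_minus add_pos_nonneg divide_inverse)
qed

lemma theta_continuous: "continuous_on UNIV theta"
  unfolding theta_def by (intro continuous_intros) (auto simp: add_nonneg_eq_0_iff)

lemma theta_measurable [measurable]: "theta \<in> borel_measurable borel"
  by (rule borel_measurable_continuous_onI[OF theta_continuous])

lemma theta_measurable_leb [measurable]: "theta \<in> borel_measurable lebesgue"
  by (rule borel_lebesgue_measurable[OF theta_measurable])

lemma L2_theta_measurable:
  assumes "u \<in> L2_theta" shows "u \<in> borel_measurable lebesgue"
proof -
  have "(\<lambda>x. u x * theta x) \<in> borel_measurable lebesgue" using assms by (auto simp: L2_theta_def L2_def)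
  then have "(\<lambda>x. (u x * theta x) / theta x) \<in> borel_measurable lebesgue" by measurable
  moreover have "(u x * theta x) / theta x = u x" for x using theta_pos[of x] by simp
  ultimately show ?thesis by simp
qed

lemma theta_lower: "norm x \<le> R \<Longrightarrow> 1 / theta x \<le> 1 + R"
proof -
  assume "norm x \<le> R"
  have "(1 / theta x)\<^sup>2 = 1 + (norm x)\<^sup>2" by (simp add: power_divide theta_sq)
  also have "\<dots> \<le> (1 + norm x)\<^sup>2" by (simp add: power2_sum)
  finally have "1 / theta x \<le> 1 + norm x" using theta_pos[of x] by (intro power2_le_imp_le[of "1 / theta x"]) auto
  then show ?thesis using \<open>norm x \<le> R\<close> by linarith
qed

text \<open>The weight is bounded below on balls.\<close>

lemma L2_theta_loc_int:
  assumes u: "u \<in> L2_theta" shows "loc_int u"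
  unfolding loc_int_def
proof (intro conjI allI)
  show m: "u \<in> borel_measurable lebesgue" by (rule L2_theta_measurable[OF u])
  fix R
  have "(\<lambda>x. u x * theta x) \<in> L2 lebesgue" using u by (simp add: L2_theta_def)
  from L2_mult_integrable[OF L2_indicator_cball[of R] this]
  have i: "integrable lebesgue (\<lambda>x. (1 + R) * (indicator (cball 0 R) x * (u x * theta x)))"
    by (rule integrable_mult_right)
  show "integrable lebesgue (\<lambda>x. indicator (cball 0 R) x * u x)"
  proof (rule Bochner_Integration.integrable_bound[OF i])
    show "AE x in lebesgue. norm (indicator (cball 0 R) x * u x) \<le> norm ((1 + R) * (indicator (cball 0 R) x * (u x * theta x)))"
    proof (rule AE_I2)
      fix x :: "real^3"
      have "\<bar>u x\<bar> \<le> \<bar>1 + R\<bar> * (\<bar>u x\<bar> * theta x)" if "norm x \<le> R"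
      proof -
        have "1 \<le> (1 + R) * theta x" using theta_lower[OF that] theta_pos[of x] by (simp add: field_simps)
        also have "\<dots> \<le> \<bar>1 + R\<bar> * theta x" using theta_pos[of x] by (intro mult_right_mono) auto
        finally have "\<bar>u x\<bar> * 1 \<le> \<bar>u x\<bar> * (\<bar>1 + R\<bar> * theta x)" by (intro mult_left_mono) auto
        then show ?thesis by (simp add: mult_ac)
      qed
      then show "norm (indicator (cball 0 R) x * u x) \<le> norm ((1 + R) * (indicator (cball 0 R) x * (u x * theta x)))"
        using theta_pos[of x] by (auto simp: indicator_def abs_mult)
    qed
  qed (intro borel_measurable_times borel_measurable_indicator m, simp)
qed

lemma weak_gradient_unique:
  assumes "g \<in> L2 lebesgue" "g' \<in> L2 lebesgue" "is_weak_gradient v g" "is_weak_gradient v g'"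
  shows "AE x in lebesgue. g x = g' x"
proof -
  have li: "loc_int (\<lambda>x. g x $ i)" "loc_int (\<lambda>x. g' x $ i)" "loc_int (\<lambda>x. g x $ i - g' x $ i)" for i
    using assms(1,2) by (auto intro!: L2_loc_int L2_component L2_diff)
  have "AE x in lebesgue. g x $ i - g' x $ i = 0" for i
  proof (rule fundamental_lemma[OF li(3)])
    fix \<phi> assume \<phi>: "\<phi> \<in> Cc_infinity"
    have "(\<integral>x. (g x $ i - g' x $ i) * \<phi> x \<partial>lebesgue) = (\<integral>x. g x $ i * \<phi> x - g' x $ i * \<phi> x \<partial>lebesgue)"
      by (simp add: algebra_simps)
    also have "\<dots> = (\<integral>x. g x $ i * \<phi> x \<partial>lebesgue) - (\<integral>x. g' x $ i * \<phi> x \<partial>lebesgue)"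
      by (intro Bochner_Integration.integral_diff loc_int_Cc_integrable li \<phi>)
    also have "\<dots> = 0"
    proof -
      have "(\<integral>x. v x * partial_deriv i \<phi> x \<partial>lebesgue) = - (\<integral>x. g x $ i * \<phi> x \<partial>lebesgue)"
        using assms(3) \<phi> unfolding is_weak_gradient_def by blast
      moreover have "(\<integral>x. v x * partial_deriv i \<phi> x \<partial>lebesgue) = - (\<integral>x. g' x $ i * \<phi> x \<partial>lebesgue)"
        using assms(4) \<phi> unfolding is_weak_gradient_def by blast
      ultimately show ?thesis by simp
    qed
    finally show "(\<integral>x. (g x $ i - g' x $ i) * \<phi> x \<partial>lebesgue) = 0" .
  qed
  then have "AE x in lebesgue. \<forall>i. g x $ i - g' x $ i = 0" by (simp add: AE_all_countable)
  then show ?thesis by eventually_elim (simp add: vec_eq_iff)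
qed

lemma weak_gradient_props:
  assumes "u \<in> BL1"
  shows "weak_gradient u \<in> L2 lebesgue" "is_weak_gradient u (weak_gradient u)" "u \<in> L2_theta"
proof -
  have "\<exists>g. g \<in> L2 lebesgue \<and> is_weak_gradient u g" using assms by (auto simp: BL1_def)
  from someI_ex[OF this] show "weak_gradient u \<in> L2 lebesgue" "is_weak_gradient u (weak_gradient u)"
    by (simp_all add: weak_gradient_def)
  show "u \<in> L2_theta" using assms by (simp add: BL1_def)
qed

lemma continuous_loc_int:
  assumes "continuous_on UNIV F" shows "loc_int F"
  unfolding loc_int_def
proof (intro conjI allI)
  show m: "F \<in> borel_measurable lebesgue" by (intro borel_lebesgue_measurable borel_measurable_continuous_onI assms)
  fix R
  have "compact (F ` cball 0 R)" by (intro compact_continuous_image continuous_on_subset[OF assms]) auto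
  then obtain B where B: "B > 0" "\<forall>y\<in>F ` cball 0 R. norm y \<le> B" using compact_imp_bounded bounded_pos by blast
  show "integrable lebesgue (\<lambda>x. indicator (cball 0 R) x * F x)"
  proof (rule integrable_bounded_supp[of _ B R])
    show "(\<lambda>x. indicator (cball 0 R) x * F x) \<in> borel_measurable lebesgue" using m by measurable
    show "\<bar>indicator (cball 0 R) x * F x\<bar> \<le> B" for x using B by (auto simp: indicator_def)
  qed (auto simp: indicator_def)
qed

definition conv :: "(real^3 \<Rightarrow> real) \<Rightarrow> (real^3 \<Rightarrow> real) \<Rightarrow> real^3 \<Rightarrow> real" where
  "conv \<eta> F x = (\<integral>z. \<eta> (z - x) * F z \<partial>lebesgue)"

lemma conv_integrable:
  assumes \<eta>: "\<eta> \<in> Cc_infinity" and F: "continuous_on UNIV F"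
  shows "integrable lebesgue (\<lambda>z. \<eta> (z - x) * F z)"
  using loc_int_Cc_integrable[OF continuous_loc_int[OF F] Cc_infinity_shift[OF \<eta>, of "- x"]] by (simp add: mult.commute)

text \<open>The derivative falls on the kernel, whose difference quotients are bounded by its Lipschitz constant;
dominated convergence then applies for every continuous F.\<close>

lemma conv_has_derivative:
  assumes \<eta>: "\<eta> \<in> Cc_infinity" and F: "continuous_on UNIV F"
  shows "(conv \<eta> F has_derivative (\<lambda>h. \<Sum>i\<in>UNIV. - conv (partial_deriv i \<eta>) F x * h $ i)) (at x)"
  unfolding has_derivative_iff_norm tendsto_at_iff_sequentially
proof (intro conjI allI impI)
  show "bounded_linear (\<lambda>h. \<Sum>i\<in>UNIV. - conv (partial_deriv i \<eta>) F x * h $ i)"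
    by (intro bounded_linear_sum bounded_linear_const_mult bounded_linear_vec_nth)
  fix X assume X: "\<forall>i. X i \<in> UNIV - {x}" "X \<longlonglongrightarrow> x"
  define h where "h n = X n - x" for n
  have h0: "h n \<noteq> 0" for n using X(1) by (auto simp: h_def)
  have hlim: "h \<longlonglongrightarrow> 0" unfolding h_def using X(2) by (simp add: LIM_zero_iff)
  obtain H where H: "\<And>n. norm (h n) \<le> H" using convergent_imp_Bseq[OF convergentI[OF hlim]] unfolding Bseq_def by blast
  from Cc_infinityD[OF \<eta>] obtain R where R: "\<And>x. R < norm x \<Longrightarrow> \<eta> x = 0" "smooth \<eta>" by blast
  from Cc_infinity_lipschitz[OF \<eta>] obtain C where C: "C > 0" "\<And>x h. \<bar>\<eta> (x + h) - \<eta> x\<bar> \<le> C * norm h"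
     "\<And>x h. \<bar>\<Sum>i\<in>UNIV. partial_deriv i \<eta> x * h $ i\<bar> \<le> C * norm h" by blast
  define r where "r n z = \<eta> (z - X n) - \<eta> (z - x) + (\<Sum>i\<in>UNIV. partial_deriv i \<eta> (z - x) * h n $ i)" for n z
  define E where "E n z = r n z / norm (h n) * F z" for n z
  note int1 = conv_integrable[OF \<eta> F] and int2 = conv_integrable[OF Cc_infinity_partial[OF \<eta>] F]
  have rF: "r n z * F z = \<eta> (z - X n) * F z - \<eta> (z - x) * F z + (\<Sum>i\<in>UNIV. h n $ i * (partial_deriv i \<eta> (z - x) * F z))" for n z
    unfolding r_def by (simp add: algebra_simps sum_distrib_left sum_distrib_right)
  have int_rF: "integrable lebesgue (\<lambda>z. r n z * F z)" for n
    unfolding rF using int1 int2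
    by (intro Bochner_Integration.integrable_add Bochner_Integration.integrable_diff Bochner_Integration.integrable_sum integrable_mult_right)
  have key: "conv \<eta> F (X n) - conv \<eta> F x - (\<Sum>i\<in>UNIV. - conv (partial_deriv i \<eta>) F x * (X n - x) $ i) = (\<integral>z. r n z * F z \<partial>lebesgue)" for n
  proof -
    have "(\<integral>z. r n z * F z \<partial>lebesgue) = conv \<eta> F (X n) - conv \<eta> F x + (\<Sum>i\<in>UNIV. h n $ i * conv (partial_deriv i \<eta>) F x)"
    proof -
      have s: "integrable lebesgue (\<lambda>z. h n $ i * (partial_deriv i \<eta> (z - x) * F z))" for i
        by (rule integrable_mult_right[OF int2])
      have "(\<integral>z. r n z * F z \<partial>lebesgue) = (\<integral>z. \<eta> (z - X n) * F z - \<eta> (z - x) * F z \<partial>lebesgue)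
          + (\<integral>z. (\<Sum>i\<in>UNIV. h n $ i * (partial_deriv i \<eta> (z - x) * F z)) \<partial>lebesgue)"
        unfolding rF by (intro Bochner_Integration.integral_add Bochner_Integration.integrable_diff Bochner_Integration.integrable_sum int1 s)
      also have "(\<integral>z. \<eta> (z - X n) * F z - \<eta> (z - x) * F z \<partial>lebesgue) = conv \<eta> F (X n) - conv \<eta> F x"
        unfolding conv_def by (rule Bochner_Integration.integral_diff[OF int1 int1])
      also have "(\<integral>z. (\<Sum>i\<in>UNIV. h n $ i * (partial_deriv i \<eta> (z - x) * F z)) \<partial>lebesgue)
          = (\<Sum>i\<in>UNIV. \<integral>z. h n $ i * (partial_deriv i \<eta> (z - x) * F z) \<partial>lebesgue)"
        by (rule Bochner_Integration.integral_sum[OF s])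
      also have "\<dots> = (\<Sum>i\<in>UNIV. h n $ i * conv (partial_deriv i \<eta>) F x)"
        unfolding conv_def by simp
      finally show ?thesis .
    qed
    then show ?thesis by (simp add: h_def sum_negf mult.commute)
  qed
  have FL: "loc_int F" by (rule continuous_loc_int[OF F])
  have mF [measurable]: "F \<in> borel_measurable lebesgue" using FL by (simp add: loc_int_def)
  have [measurable]: "E n \<in> borel_measurable lebesgue" for n
    using borel_measurable_integrable[OF int_rF[of n]] unfolding E_def times_divide_eq_left by measurable
  have "(\<lambda>n. \<integral>z. E n z \<partial>lebesgue) \<longlonglongrightarrow> (\<integral>z. 0 \<partial>(lebesgue :: (real^3) measure))"
  proof (rule integral_dominated_convergence[where w="\<lambda>z. (2 * C) * \<bar>indicator (cball 0 (R + norm x + H)) z * F z\<bar>"])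
    show "integrable lebesgue (\<lambda>z. (2 * C) * \<bar>indicator (cball 0 (R + norm x + H)) z * F z\<bar>)"
      using FL unfolding loc_int_def by (intro integrable_mult_right integrable_abs) blast
    show "AE z in lebesgue. (\<lambda>n. E n z) \<longlonglongrightarrow> 0"
    proof (rule AE_I2)
      fix z
      have "((\<lambda>y. norm (\<eta> y - \<eta> (z - x) - (\<Sum>i\<in>UNIV. partial_deriv i \<eta> (z - x) * (y - (z - x)) $ i)) / norm (y - (z - x))) \<longlongrightarrow> 0) (at (z - x))"
        using smooth_has_derivative[OF R(2), of "z - x"] unfolding has_derivative_iff_norm by blast
      moreover have "filterlim (\<lambda>n. z - X n) (at (z - x)) sequentially"
        using X by (auto simp: filterlim_at intro!: tendsto_intros)
      ultimately have "(\<lambda>n. norm (\<eta> (z - X n) - \<eta> (z - x) - (\<Sum>i\<in>UNIV. partial_deriv i \<eta> (z - x) * (z - X n - (z - x)) $ i)) / norm (z - X n - (z - x))) \<longlonglongrightarrow> 0"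
        by (rule filterlim_compose)
      moreover have "(\<eta> (z - X n) - \<eta> (z - x) - (\<Sum>i\<in>UNIV. partial_deriv i \<eta> (z - x) * (z - X n - (z - x)) $ i)) = r n z" for n
        by (simp add: r_def h_def sum_subtractf algebra_simps)
      moreover have "norm (z - X n - (z - x)) = norm (h n)" for n by (simp add: h_def norm_minus_commute)
      ultimately have "(\<lambda>n. norm (r n z) / norm (h n)) \<longlonglongrightarrow> 0" by simp
      then have "(\<lambda>n. r n z / norm (h n)) \<longlonglongrightarrow> 0"
        by (subst tendsto_norm_zero_iff[symmetric]) simp
      then show "(\<lambda>n. E n z) \<longlonglongrightarrow> 0" unfolding E_def by (rule tendsto_mult_left_zero)
    qed
    show "AE z in lebesgue. norm (E n z) \<le> (2 * C) * \<bar>indicator (cball 0 (R + norm x + H)) z * F z\<bar>" for n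
    proof (rule AE_I2)
      fix z
      show "norm (E n z) \<le> (2 * C) * \<bar>indicator (cball 0 (R + norm x + H)) z * F z\<bar>"
      proof (cases "norm z \<le> R + norm x + H")
        case True
        have "\<bar>\<eta> ((z - x) + (- h n)) - \<eta> (z - x)\<bar> \<le> C * norm (- h n)" by (rule C(2))
        then have "\<bar>\<eta> (z - X n) - \<eta> (z - x)\<bar> \<le> C * norm (h n)" by (simp add: h_def norm_minus_commute)
        then have "\<bar>r n z\<bar> \<le> 2 * C * norm (h n)" using C(3)[of "z - x" "h n"] unfolding r_def by linarith
        then have "\<bar>r n z\<bar> / norm (h n) \<le> 2 * C" using h0[of n] by (simp add: field_simps)
        then have "\<bar>r n z\<bar> / norm (h n) * \<bar>F z\<bar> \<le> 2 * C * \<bar>F z\<bar>" by (intro mult_right_mono) auto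
        then show ?thesis using True by (simp add: E_def abs_mult)
      next
        case False
        have H0: "0 \<le> H" using order_trans[OF norm_ge_zero H] .
        have "norm z \<le> norm (z - x) + norm x" using norm_triangle_ineq[of "z - x" x] by simp
        then have 1: "R < norm (z - x)" using False H0 by linarith
        have "norm z \<le> norm (z - X n) + norm x + norm (h n)"
          using norm_triangle_ineq[of "z - X n" "x + h n"] norm_triangle_ineq[of x "h n"] by (simp add: h_def)
        then have 2: "R < norm (z - X n)" using False H[of n] by linarith
        have "r n z = 0" unfolding r_def using R(1)[OF 1] R(1)[OF 2] partial_deriv_zero[OF R(2,1) 1] by simp
        then show ?thesis using C(1) by (simp add: E_def)
      qed
    qed
  qed auto
  moreover have "\<bar>\<integral>z. E n z \<partial>lebesgue\<bar> = norm (\<integral>z. r n z * F z \<partial>lebesgue) / norm (h n)" for n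
    unfolding E_def times_divide_eq_left by simp
  ultimately have "(\<lambda>n. norm (\<integral>z. r n z * F z \<partial>lebesgue) / norm (h n)) \<longlonglongrightarrow> 0"
    using tendsto_rabs_zero by fastforce
  then show "((\<lambda>y. norm (conv \<eta> F y - conv \<eta> F x - (\<Sum>i\<in>UNIV. - conv (partial_deriv i \<eta>) F x * (y - x) $ i)) / norm (y - x)) \<circ> X) \<longlonglongrightarrow> 0"
    unfolding o_def key by (simp add: h_def)
qed

text \<open>Each derivative is again a convolution, with a derivative of the kernel.\<close>

lemma smooth_conv:
  assumes F: "continuous_on UNIV F" and "\<eta> \<in> Cc_infinity"
  shows "smooth (conv \<eta> F)"
proof -
  have "Ck k (conv \<eta> F)" if "\<eta> \<in> Cc_infinity" for k \<eta> using that
  proof (induction k arbitrary: \<eta>)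
    case 0
    show ?case using conv_has_derivative[OF 0 F]
      by (auto intro!: continuous_at_imp_continuous_on has_derivative_continuous)
  next
    case (Suc k)
    show ?case
    proof (rule Ck_SucI[OF conv_has_derivative[OF Suc.prems F]])
      have "Ck k (\<lambda>x. (-1) * conv (partial_deriv i \<eta>) F x)" for i
        by (intro Ck_mult Ck_const Suc.IH Cc_infinity_partial Suc.prems)
      then show "Ck k (\<lambda>x. \<Sum>j\<in>UNIV. - conv (partial_deriv j \<eta>) F x * axis i 1 $ j)" for i
        by (simp only: sum_axis mult_minus1)
    qed
  qed
  then show ?thesis using assms(2) by (simp add: smooth_def)
qed

section \<open>The regularised Newton kernel\<close>

declare box_cball_sets [measurable del]

lemma borel_lebesgue_measurable_vec: "f \<in> borel_measurable borel \<Longrightarrow> (f :: real^3 \<Rightarrow> real^3) \<in> borel_measurable lebesgue"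
  by (simp add: measurable_completion)

lemma theta_le_1: "theta x \<le> 1"
proof -
  have "(theta x)\<^sup>2 \<le> 1\<^sup>2" by (simp add: theta_sq)
  then show ?thesis by (rule power2_le_imp_le) simp
qed

text \<open>On the dyadic shell between the radii 2^(n-1) and 2^n the function is at most 16 (1/16)^n, while the
ball of radius 2^n has volume of order 8^n.\<close>

lemma theta_power4_integrable_lborel: "integrable lborel (\<lambda>x. theta x ^ 4)"
proof (rule integrableI_bounded)
  have pt: "ennreal (theta x ^ 4) \<le> (\<Sum>n. ennreal (16 * (1/16)^n) * indicator (cball 0 (2^n)) x)" for x :: "real^3"
  proof -
    have "\<exists>n. theta x ^ 4 \<le> 16 * (1/16)^n \<and> norm x \<le> 2^n"
    proof (cases "norm x \<le> 1")
      case True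
      have "theta x ^ 4 \<le> 1" using theta_le_1 theta_pos less_imp_le by (intro power_le_one) auto
      then show ?thesis using True by (intro exI[of _ 0]) auto
    next
      case False
      obtain m where m: "norm x \<le> 2^m"
        using real_arch_pow[of 2 "norm x"] by (auto dest: less_imp_le)
      define n where "n = (LEAST m. norm x \<le> 2^m)"
      have n: "norm x \<le> 2^n" unfolding n_def using m by (rule LeastI)
      then have "n \<noteq> 0" using False by (intro notI) simp
      then obtain k where k: "n = Suc k" using not0_implies_Suc by blast
      have "k < (LEAST m. norm x \<le> 2^m)" using k unfolding n_def by simp
      then have "\<not> norm x \<le> 2^k" by (rule not_less_Least)
      then have lt: "2^k \<le> norm x" by simp
      have "theta x ^ 4 = ((theta x)\<^sup>2)\<^sup>2" by simp
      also have "\<dots> = (1 / (1 + (norm x)\<^sup>2))\<^sup>2" by (simp only: theta_sq)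
      also have "\<dots> \<le> (1 / (2^k)\<^sup>2)\<^sup>2"
      proof (intro power_mono divide_left_mono)
        have "(2^k)\<^sup>2 \<le> (norm x)\<^sup>2" using lt by (intro power_mono) auto
        then show "(2 ^ k)\<^sup>2 \<le> 1 + (norm x)\<^sup>2" by linarith
      qed (auto simp: zero_less_mult_iff)
      also have "\<dots> = 16 * (1/16)^n"
        unfolding k by (simp add: power_divide flip: power_mult) (simp add: mult.commute[of k] power_mult)
      finally show ?thesis using n by blast
    qed
    then obtain n where n: "theta x ^ 4 \<le> 16 * (1/16)^n" "norm x \<le> 2^n" by blast
    have "ennreal (theta x ^ 4) \<le> ennreal (16 * (1/16)^n) * indicator (cball 0 (2^n)) x"
      using n by (simp add: ennreal_leI)
    also have "\<dots> \<le> (\<Sum>n. ennreal (16 * (1/16)^n) * indicator (cball 0 (2^n)) x)"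
      using sum_le_suminf[of "\<lambda>n. ennreal (16 * (1/16)^n) * indicator (cball 0 (2^n)) x" "{n}"]
      by (simp only: sum.insert[OF finite.emptyI, of n] sum.empty add_0_right empty_iff not_False_eq_True finite.intros summableI zero_le simp_thms if_True)
    finally show ?thesis .
  qed
  have "(\<integral>\<^sup>+x. ennreal (norm (theta x ^ 4)) \<partial>lborel) \<le> (\<integral>\<^sup>+x. (\<Sum>n. ennreal (16 * (1/16)^n) * indicator (cball (0::real^3) (2^n)) x) \<partial>lborel)"
    using pt theta_pos less_imp_le by (intro nn_integral_mono) auto
  also have "\<dots> = (\<Sum>n. \<integral>\<^sup>+x. ennreal (16 * (1/16)^n) * indicator (cball (0::real^3) (2^n)) x \<partial>lborel)"
    by (rule nn_integral_suminf) (intro borel_measurable_times_ennreal borel_measurable_indicator borel_measurable_const, simp)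
  also have "\<dots> = (\<Sum>n. ennreal (16 * (1/16)^n * (unit_ball_vol 3 * (2^n)^3)))"
    by (rule suminf_cong) (simp add: nn_integral_cmult_indicator emeasure_cball ennreal_mult)
  also have "\<dots> = (\<Sum>n. ennreal (16 * unit_ball_vol 3 * (1/2)^n))"
  proof (rule suminf_cong)
    fix n
    have "(1/16::real)^n * (2^n)^3 = (1/2)^n"
      by (simp add: power3_eq_cube flip: power_mult_distrib)
    then show "ennreal (16 * (1/16)^n * (unit_ball_vol 3 * (2^n)^3)) = ennreal (16 * unit_ball_vol 3 * (1/2)^n)"
      by (simp add: mult_ac)
  qed
  also have "\<dots> < \<infinity>"
  proof -
    have "summable (\<lambda>n. 16 * unit_ball_vol 3 * (1/2::real)^n)" by (rule summable_mult, rule summable_geometric) simp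
    then show ?thesis by (subst suminf_ennreal2) auto
  qed
  finally show "(\<integral>\<^sup>+x. ennreal (norm (theta x ^ 4)) \<partial>lborel) < \<infinity>" .
qed measurable

lemma theta_power4_integrable: "integrable lebesgue (\<lambda>x. theta x ^ 4)"
  using theta_power4_integrable_lborel by (simp add: integrable_completion)

lemma theta_sq_L2: "(\<lambda>x. (theta x)\<^sup>2) \<in> L2 lebesgue"
proof (rule L2I)
  have "(norm ((theta x)\<^sup>2))\<^sup>2 = theta x ^ 4" for x by simp
  then show "integrable lebesgue (\<lambda>x. (norm ((theta x)\<^sup>2))\<^sup>2)"
    using theta_power4_integrable by simp
qed measurable

text \<open>The Newton kernel 1/|z|, regularised at the scale \<tau> so that it is smooth.\<close>

definition newton :: "real \<Rightarrow> real^3 \<Rightarrow> real" where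
  "newton \<tau> z = (\<tau>\<^sup>2 + (norm z)\<^sup>2) powr (- 1 / 2)"

definition grad_newton :: "real \<Rightarrow> real^3 \<Rightarrow> real^3" where
  "grad_newton \<tau> z = - (newton \<tau> z ^ 3) *\<^sub>R z"

text \<open>Minus the Laplacian of the regularised Newton kernel: a positive kernel concentrated at scale \<tau>,
known as the Plummer density.\<close>

definition plummer :: "real \<Rightarrow> real^3 \<Rightarrow> real" where
  "plummer \<tau> z = 3 * \<tau>\<^sup>2 * newton \<tau> z ^ 5"

context
  fixes \<tau> :: real
  assumes \<tau>: "0 < \<tau>"
begin

lemma newton_arg_pos: "0 < \<tau>\<^sup>2 + (norm z)\<^sup>2"
  using \<tau> by (simp add: add_pos_nonneg)

lemma newton_pos: "0 < newton \<tau> z"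
  using \<tau> by (simp add: newton_def)

lemma newton_sq: "(newton \<tau> z)\<^sup>2 = 1 / (\<tau>\<^sup>2 + (norm z)\<^sup>2)"
proof -
  have "(newton \<tau> z)\<^sup>2 = (\<tau>\<^sup>2 + (norm z)\<^sup>2) powr (- 1)"
    unfolding newton_def power2_eq_square[of "_ powr _"] by (simp flip: powr_add)
  then show ?thesis using newton_arg_pos[of z] by (simp add: powr_minus divide_inverse)
qed

lemma newton_norm_le: "newton \<tau> z * norm z \<le> 1"
proof (rule power2_le_imp_le)
  show "(newton \<tau> z * norm z)\<^sup>2 \<le> 1\<^sup>2"
    using newton_arg_pos[of z] by (simp add: power_mult_distrib newton_sq)
qed simp

lemma newton_power: "newton \<tau> z ^ n = (\<tau>\<^sup>2 + (norm z)\<^sup>2) powr (- (real n) / 2)"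
  unfolding newton_def by (simp add: powr_power[OF less_imp_neq[OF newton_arg_pos, symmetric]])

lemma smooth_newton_power: "smooth (\<lambda>x. newton \<tau> (x - y) ^ n)"
  unfolding newton_power
  by (intro smooth_powr smooth_add smooth_const smooth_dist_sq newton_arg_pos)

lemma smooth_newton: "smooth (\<lambda>x. newton \<tau> (x - y))"
  using smooth_newton_power[of y 1] by simp

lemma partial_newton_power:
  "partial_deriv i (\<lambda>x. newton \<tau> (x - y) ^ n) x = - real n * ((x $ i - y $ i) * newton \<tau> (x - y) ^ (n + 2))"
proof -
  let ?p = "\<lambda>x. \<tau>\<^sup>2 + (norm (x - y))\<^sup>2"
  have sp: "smooth ?p" by (intro smooth_add smooth_const smooth_dist_sq)
  have "((\<lambda>x. ?p x) has_derivative (\<lambda>h. 0 + 2 * ((x - y) \<bullet> h))) (at x)"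
    by (intro has_derivative_add has_derivative_const has_derivative_dist_sq)
  then have pp: "partial_deriv i ?p x = 2 * (x $ i - y $ i)"
    using partial_deriv_eq[of ?p _ x i] by (simp add: inner_axis)
  have "newton \<tau> (x - y) ^ (n + 2) = ?p x powr (- (real n) / 2 - 1)"
    unfolding newton_power by (rule arg_cong[where f="\<lambda>s. ?p x powr s"]) (simp add: field_simps)
  then show ?thesis
    unfolding newton_power[of _ n] partial_deriv_powr[OF sp newton_arg_pos] pp by simp
qed

lemma partial_newton: "partial_deriv i (\<lambda>x. newton \<tau> (x - y)) x = grad_newton \<tau> (x - y) $ i"
  using partial_newton_power[of i y 1 x] by (simp add: grad_newton_def eval_nat_numeral)

lemma smooth_grad_newton: "smooth (\<lambda>x. grad_newton \<tau> (x - y) $ i)"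
  using smooth_partial[OF smooth_newton[of y], of i] unfolding partial_newton[abs_def] .

text \<open>The kernel gradient has divergence minus the Plummer density; the regularisation replaces the
point mass of the Newton potential.\<close>

lemma laplace_newton:
  "(\<Sum>i\<in>UNIV. partial_deriv i (\<lambda>x. grad_newton \<tau> (x - y) $ i) x) = - plummer \<tau> (x - y)"
proof -
  let ?q = "newton \<tau> (x - y)"
  have sc: "smooth (\<lambda>x. y $ i - x $ i)" for i by (intro smooth_diff) auto
  have "partial_deriv i (\<lambda>x. grad_newton \<tau> (x - y) $ i) x = 3 * (x $ i - y $ i)\<^sup>2 * ?q ^ 5 - ?q ^ 3" for i
  proof -
    have eq: "(\<lambda>x. grad_newton \<tau> (x - y) $ i) = (\<lambda>x. newton \<tau> (x - y) ^ 3 * (y $ i - x $ i))"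
      by (auto simp: grad_newton_def algebra_simps)
    have "((\<lambda>x. y $ i - x $ i) has_derivative (\<lambda>h. 0 - h $ i)) (at x)"
      by (intro has_derivative_diff has_derivative_const bounded_linear_imp_has_derivative bounded_linear_vec_nth)
    then have 1: "partial_deriv i (\<lambda>x. y $ i - x $ i) x = - 1"
      using partial_deriv_eq[of _ _ x i] by fastforce
    show ?thesis unfolding eq partial_deriv_mult[OF smooth_newton_power sc] partial_newton_power 1
      by (simp add: power2_eq_square algebra_simps)
  qed
  then have "(\<Sum>i\<in>UNIV. partial_deriv i (\<lambda>x. grad_newton \<tau> (x - y) $ i) x) = 3 * ?q ^ 5 * (\<Sum>i\<in>UNIV. (x $ i - y $ i)\<^sup>2) - 3 * ?q ^ 3"
    by (simp add: sum_subtractf sum_distrib_left mult_ac)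
  also have "(\<Sum>i\<in>UNIV. (x $ i - y $ i)\<^sup>2) = (norm (x - y))\<^sup>2"
    by (simp add: norm_vec_def L2_set_def sum_nonneg)
  also have "3 * ?q ^ 5 * (norm (x - y))\<^sup>2 - 3 * ?q ^ 3 = 3 * ?q ^ 5 * ((norm (x - y))\<^sup>2 - (\<tau>\<^sup>2 + (norm (x - y))\<^sup>2))"
  proof -
    have "?q ^ 5 * (\<tau>\<^sup>2 + (norm (x - y))\<^sup>2) = ?q ^ 3 * (?q\<^sup>2 * (\<tau>\<^sup>2 + (norm (x - y))\<^sup>2))"
      by (simp add: power2_eq_square eval_nat_numeral mult_ac)
    also have "?q\<^sup>2 * (\<tau>\<^sup>2 + (norm (x - y))\<^sup>2) = 1"
      unfolding newton_sq using less_imp_neq[OF newton_arg_pos[of "x - y"], symmetric]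
      by (simp only: times_divide_eq_left mult_1 divide_self_if if_False)
    finally show ?thesis by (simp add: algebra_simps)
  qed
  finally show ?thesis by (simp add: plummer_def algebra_simps)
qed

lemma newton_le_theta: "\<exists>C>0. \<forall>x. newton \<tau> (x - y) \<le> C * theta x"
proof -
  define C where "C = sqrt ((1 + 2 * (norm y)\<^sup>2) / \<tau>\<^sup>2 + 2)"
  have pos: "0 < (1 + 2 * (norm y)\<^sup>2) / \<tau>\<^sup>2 + 2" by (simp add: add_nonneg_pos)
  then have C: "C > 0" "C\<^sup>2 = (1 + 2 * (norm y)\<^sup>2) / \<tau>\<^sup>2 + 2" by (auto simp: C_def)
  have "newton \<tau> (x - y) \<le> C * theta x" for x
  proof (rule power2_le_imp_le)
    have "norm x \<le> norm (x - y) + norm y" using norm_triangle_ineq[of "x - y" y] by simp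
    then have "(norm x)\<^sup>2 \<le> (norm (x - y) + norm y)\<^sup>2" by (intro power_mono) auto
    also have "\<dots> \<le> 2 * (norm (x - y))\<^sup>2 + 2 * (norm y)\<^sup>2"
      using sum_squares_bound[of "norm (x - y)" "norm y"] by (simp add: power2_sum)
    finally have "1 + (norm x)\<^sup>2 \<le> (1 + 2 * (norm y)\<^sup>2) + 2 * (norm (x - y))\<^sup>2" by simp
    also have "\<dots> \<le> (1 + 2 * (norm y)\<^sup>2) / \<tau>\<^sup>2 * (\<tau>\<^sup>2 + (norm (x - y))\<^sup>2) + 2 * (\<tau>\<^sup>2 + (norm (x - y))\<^sup>2)"
    proof (intro add_mono)
      have "(1 + 2 * (norm y)\<^sup>2) = (1 + 2 * (norm y)\<^sup>2) / \<tau>\<^sup>2 * \<tau>\<^sup>2" using \<tau> by simp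
      also have "\<dots> \<le> (1 + 2 * (norm y)\<^sup>2) / \<tau>\<^sup>2 * (\<tau>\<^sup>2 + (norm (x - y))\<^sup>2)"
        by (intro mult_left_mono) auto
      finally show "(1 + 2 * (norm y)\<^sup>2) \<le> (1 + 2 * (norm y)\<^sup>2) / \<tau>\<^sup>2 * (\<tau>\<^sup>2 + (norm (x - y))\<^sup>2)" .
    qed auto
    also have "\<dots> = C\<^sup>2 * (\<tau>\<^sup>2 + (norm (x - y))\<^sup>2)" by (simp add: C(2) distrib_right)
    finally have "1 / (\<tau>\<^sup>2 + (norm (x - y))\<^sup>2) \<le> C\<^sup>2 / (1 + (norm x)\<^sup>2)"
      using newton_arg_pos[of "x - y"] one_plus_norm_sq_pos(1)[of x] by (simp add: field_simps)
    then show "(newton \<tau> (x - y))\<^sup>2 \<le> (C * theta x)\<^sup>2"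
      by (simp add: newton_sq power_mult_distrib theta_sq)
  qed (use C theta_pos[of x] in simp)
  then show ?thesis using C(1) by blast
qed

lemma norm_grad_newton_le: "norm (grad_newton \<tau> z) \<le> (newton \<tau> z)\<^sup>2"
proof -
  have "norm (grad_newton \<tau> z) = (newton \<tau> z)\<^sup>2 * (newton \<tau> z * norm z)"
    using newton_pos[of z] by (simp add: grad_newton_def power2_eq_square eval_nat_numeral)
  also have "\<dots> \<le> (newton \<tau> z)\<^sup>2 * 1" by (intro mult_left_mono newton_norm_le) simp
  finally show ?thesis by simp
qed

lemma plummer_nonneg: "0 \<le> plummer \<tau> z"
  using newton_pos[of z] by (simp add: plummer_def)

lemma newton_continuous: "continuous_on UNIV (newton \<tau>)"
  using smooth_continuous[OF smooth_newton[of 0]] by simp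

lemma newton_measurable [measurable]: "newton \<tau> \<in> borel_measurable borel"
  by (rule borel_measurable_continuous_onI[OF newton_continuous])

lemma plummer_measurable [measurable]: "plummer \<tau> \<in> borel_measurable borel"
  unfolding plummer_def[abs_def] by measurable

lemma grad_newton_measurable [measurable]: "grad_newton \<tau> \<in> borel_measurable borel"
  unfolding grad_newton_def[abs_def] by measurable

lemma grad_newton_L2: "(\<lambda>x. grad_newton \<tau> (x - y)) \<in> L2 lebesgue"
proof -
  obtain C where C: "C > 0" "\<And>x. newton \<tau> (x - y) \<le> C * theta x" using newton_le_theta by blast
  show ?thesis
  proof (rule L2_bound[OF _ L2_cmult[OF theta_sq_L2, of "C\<^sup>2"]])
    show "(\<lambda>x. grad_newton \<tau> (x - y)) \<in> borel_measurable lebesgue"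
      by (rule borel_lebesgue_measurable_vec) measurable
    show "AE x in lebesgue. norm (grad_newton \<tau> (x - y)) \<le> norm (C\<^sup>2 * (theta x)\<^sup>2)"
    proof (rule AE_I2)
      fix x
      have "norm (grad_newton \<tau> (x - y)) \<le> (newton \<tau> (x - y))\<^sup>2" by (rule norm_grad_newton_le)
      also have "\<dots> \<le> (C * theta x)\<^sup>2" using C(2)[of x] newton_pos[of "x - y"] by (intro power_mono) auto
      finally show "norm (grad_newton \<tau> (x - y)) \<le> norm (C\<^sup>2 * (theta x)\<^sup>2)" by (simp add: power_mult_distrib)
    qed
  qed
qed

text \<open>The kernel and its gradient decay like theta and the square of theta, which makes translated kernels
admissible directions for weak convergence in BL1.\<close>

lemma newton_BL1: "(\<lambda>x. newton \<tau> (x - y)) \<in> BL1"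
proof -
  obtain C where C: "C > 0" "\<And>x. newton \<tau> (x - y) \<le> C * theta x" using newton_le_theta by blast
  have "(\<lambda>x. newton \<tau> (x - y) * theta x) \<in> L2 lebesgue"
  proof (rule L2_bound[OF _ L2_cmult[OF theta_sq_L2, of C]])
    show "(\<lambda>x. newton \<tau> (x - y) * theta x) \<in> borel_measurable lebesgue"
      by (rule borel_lebesgue_measurable) measurable
    show "AE x in lebesgue. norm (newton \<tau> (x - y) * theta x) \<le> norm (C * (theta x)\<^sup>2)"
    proof (rule AE_I2)
      fix x
      have "newton \<tau> (x - y) * theta x \<le> C * theta x * theta x" using C theta_pos[of x] by (intro mult_right_mono) auto
      then show "norm (newton \<tau> (x - y) * theta x) \<le> norm (C * (theta x)\<^sup>2)"
        using C(1) theta_pos[of x] newton_pos[of "x - y"] by (simp add: abs_mult power2_eq_square mult_ac)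
    qed
  qed
  moreover have "is_weak_gradient (\<lambda>x. newton \<tau> (x - y)) (\<lambda>x. grad_newton \<tau> (x - y))"
    by (rule smooth_is_weak_gradient[OF smooth_newton]) (simp add: partial_newton)
  ultimately show ?thesis using grad_newton_L2[of y] unfolding BL1_def L2_theta_def by blast
qed

text \<open>Weak convergence in BL1 is used only through these inner products.\<close>

lemma BL1_inner_newton:
  assumes "v \<in> BL1"
  shows "BL1_inner v (\<lambda>x. newton \<tau> (x - y)) = (\<integral>x. weak_gradient v x \<bullet> grad_newton \<tau> (x - y) \<partial>lebesgue)"
proof -
  have wg: "is_weak_gradient (\<lambda>x. newton \<tau> (x - y)) (\<lambda>x. grad_newton \<tau> (x - y))"
    by (rule smooth_is_weak_gradient[OF smooth_newton]) (simp add: partial_newton)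
  note W = weak_gradient_props[OF newton_BL1[of y]]
  have "AE x in lebesgue. weak_gradient (\<lambda>x. newton \<tau> (x - y)) x = grad_newton \<tau> (x - y)"
    by (rule weak_gradient_unique[OF W(1) grad_newton_L2 W(2) wg])
  then have ae: "AE x in lebesgue. weak_gradient v x \<bullet> weak_gradient (\<lambda>x. newton \<tau> (x - y)) x = weak_gradient v x \<bullet> grad_newton \<tau> (x - y)"
    by eventually_elim simp
  show ?thesis unfolding BL1_inner_def
    by (rule integral_cong_AE[OF borel_measurable_integrable borel_measurable_integrable ae])
       (intro L2_inner_integrable weak_gradient_props(1)[OF assms] W(1) grad_newton_L2)+
qed

end

section \<open>Representation of a function by its gradient\<close>

text \<open>The factor exp 1 normalises the value at the origin to 1, so that rescaled cutoffs tend to 1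
pointwise.\<close>

definition cutoff :: "real^3 \<Rightarrow> real" where
  "cutoff x = exp 1 * bumpf 0 (1 - (norm x)\<^sup>2)"

lemma smooth_cutoff: "smooth cutoff"
proof -
  have "smooth (\<lambda>x. exp 1 * bumpf 0 (1 - (norm (x - 0))\<^sup>2))"
    by (intro smooth_cmult smooth_bumpf smooth_diff smooth_const smooth_dist_sq)
  then show ?thesis by (simp add: cutoff_def[abs_def])
qed

lemma cutoff_0: "cutoff 0 = 1"
  by (simp add: cutoff_def bumpf_def exp_minus)

lemma cutoff_zero: "1 < norm x \<Longrightarrow> cutoff x = 0"
  unfolding cutoff_def using one_le_power[of "norm x" 2] by (subst bumpf_eq_0) auto

lemma cutoff_Cc: "cutoff \<in> Cc_infinity"
  by (rule Cc_infinityI[OF smooth_cutoff cutoff_zero])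

text \<open>Integration by parts of v against the kernel gradient. The weak formulation is applied to
cutoff(r x) times the kernel gradient; the term in which the derivative hits the cutoff is supported
where the weight is at least of order r, which makes it dominated by the integrable function
|v theta| theta^2 uniformly in r, and it tends to 0 pointwise.\<close>

lemma newton_representation:
  assumes \<tau>: "0 < \<tau>" and v: "v \<in> L2_theta" and g: "g \<in> L2 lebesgue" and w: "is_weak_gradient v g"
  shows "integrable lebesgue (\<lambda>x. v x * plummer \<tau> (x - y))"
    and "(\<integral>x. v x * plummer \<tau> (x - y) \<partial>lebesgue) = (\<integral>x. g x \<bullet> grad_newton \<tau> (x - y) \<partial>lebesgue)"
proof -
  obtain C where C: "C > 0" "\<And>x. newton \<tau> (x - y) \<le> C * theta x" using newton_le_theta[OF \<tau>] by blast
  have vth: "(\<lambda>x. v x * theta x) \<in> L2 lebesgue" using v by (simp add: L2_theta_def)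
  have vL: "loc_int v" by (rule L2_theta_loc_int[OF v])
  have [measurable]: "v \<in> borel_measurable lebesgue" "g \<in> borel_measurable lebesgue"
    using L2_theta_measurable[OF v] L2_meas[OF g] by auto
  have [measurable]: "(\<lambda>x. grad_newton \<tau> (x - y)) \<in> borel_measurable lebesgue"
     "(\<lambda>x. plummer \<tau> (x - y)) \<in> borel_measurable lebesgue"
    using plummer_measurable[OF \<tau>] L2_meas[OF grad_newton_L2[OF \<tau>]]
    by (auto intro!: borel_lebesgue_measurable)
  have dom: "integrable lebesgue (\<lambda>x. \<bar>v x * theta x\<bar> * (theta x)\<^sup>2)"
    using L2_prod_integrable[OF vth theta_sq_L2] by simp
  have gk: "norm (grad_newton \<tau> (x - y)) \<le> C\<^sup>2 * (theta x)\<^sup>2" for x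
  proof -
    have "norm (grad_newton \<tau> (x - y)) \<le> (newton \<tau> (x - y))\<^sup>2" by (rule norm_grad_newton_le[OF \<tau>])
    also have "\<dots> \<le> (C * theta x)\<^sup>2" using C(2)[of x] newton_pos[OF \<tau>, of "x - y"] by (intro power_mono) auto
    finally show ?thesis by (simp add: power_mult_distrib)
  qed
  define D where "D = 3 * \<tau>\<^sup>2 * C ^ 5"
  have D0: "0 \<le> D" using C(1) by (simp add: D_def)
  have pl: "plummer \<tau> (x - y) \<le> D * (theta x * (theta x)\<^sup>2)" for x
  proof -
    have "newton \<tau> (x - y) ^ 5 \<le> (C * theta x) ^ 5" using C(2)[of x] newton_pos[OF \<tau>, of "x - y"] by (intro power_mono) auto
    also have "\<dots> = C ^ 5 * (theta x * (theta x)\<^sup>2 * (theta x)\<^sup>2)" by (simp add: power_mult_distrib power2_eq_square eval_nat_numeral)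
    also have "\<dots> \<le> C ^ 5 * (theta x * (theta x)\<^sup>2 * 1)"
      using C(1) theta_pos[of x] theta_le_1[of x] by (intro mult_left_mono) (auto simp: power_le_one)
    finally show ?thesis unfolding plummer_def D_def by (simp add: mult.assoc mult_left_mono)
  qed
  have vpl: "\<bar>v x * plummer \<tau> (x - y)\<bar> \<le> D * (\<bar>v x * theta x\<bar> * (theta x)\<^sup>2)" for x
    using mult_left_mono[OF pl[of x], of "\<bar>v x\<bar>"] plummer_nonneg[OF \<tau>, of "x - y"] theta_pos[of x] by (simp add: abs_mult mult_ac)
  show int1: "integrable lebesgue (\<lambda>x. v x * plummer \<tau> (x - y))"
    by (rule Bochner_Integration.integrable_bound[OF integrable_mult_right[OF dom, of D]]) (use vpl D0 in auto)
  have int2: "integrable lebesgue (\<lambda>x. g x \<bullet> grad_newton \<tau> (x - y))"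
    by (rule L2_inner_integrable[OF g grad_newton_L2[OF \<tau>]])
  define r where "r n = inverse (real (Suc n))" for n
  have r: "0 < r n" "r n \<le> 1" "r \<longlonglongrightarrow> 0" for n
  proof -
    show "r \<longlonglongrightarrow> 0" unfolding r_def by (rule LIMSEQ_inverse_real_of_nat)
    show "0 < r n" "r n \<le> 1" unfolding r_def by (auto simp: field_simps)
  qed
  define ct where "ct n x = cutoff (r n *\<^sub>R x)" for n x
  have sct: "smooth (ct n)" for n unfolding ct_def using smooth_affine[OF smooth_cutoff, of "r n" 0] by simp
  have pct: "partial_deriv i (ct n) x = r n * partial_deriv i cutoff (r n *\<^sub>R x)" for i n x
    unfolding ct_def using partial_deriv_affine[OF smooth_cutoff, of i "r n" 0 x] by simp
  have ct0: "ct n x = 0" if "1 / r n < norm x" for n x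
    unfolding ct_def using that r(1)[of n] by (intro cutoff_zero) (simp add: field_simps)
  have ctC: "ct n \<in> Cc_infinity" for n by (rule Cc_infinityI[OF sct ct0])
  obtain B where B: "B > 0" "\<And>x. \<bar>cutoff x\<bar> \<le> B" using Cc_infinity_bounded[OF cutoff_Cc] by blast
  obtain L where L: "L > 0" "\<And>x h. \<bar>\<Sum>i\<in>UNIV. partial_deriv i cutoff x * h $ i\<bar> \<le> L * norm h"
    using Cc_infinity_lipschitz[OF cutoff_Cc] by blast
  define \<phi> where "\<phi> n i x = ct n x * grad_newton \<tau> (x - y) $ i" for n i x
  have \<phi>C: "\<phi> n i \<in> Cc_infinity" for n i unfolding \<phi>_def by (intro Cc_infinity_mult ctC smooth_grad_newton \<tau>)
  define E where "E n x = r n * (\<Sum>i\<in>UNIV. partial_deriv i cutoff (r n *\<^sub>R x) * grad_newton \<tau> (x - y) $ i)" for n x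
  have div: "(\<Sum>i\<in>UNIV. partial_deriv i (\<phi> n i) x) = E n x - ct n x * plummer \<tau> (x - y)" for n x
  proof -
    have "(\<Sum>i\<in>UNIV. partial_deriv i (\<phi> n i) x)
      = (\<Sum>i\<in>UNIV. ct n x * partial_deriv i (\<lambda>x. grad_newton \<tau> (x - y) $ i) x + partial_deriv i (ct n) x * grad_newton \<tau> (x - y) $ i)"
      unfolding \<phi>_def by (intro sum.cong refl partial_deriv_mult sct smooth_grad_newton \<tau>)
    also have "\<dots> = ct n x * (\<Sum>i\<in>UNIV. partial_deriv i (\<lambda>x. grad_newton \<tau> (x - y) $ i) x) + E n x"
      unfolding E_def pct by (simp add: sum.distrib sum_distrib_left mult.assoc)
    finally show ?thesis unfolding laplace_newton[OF \<tau>] by simp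
  qed
  have Ebound: "\<bar>E n x\<bar> \<le> 2 * L * C\<^sup>2 * (theta x * (theta x)\<^sup>2)" for n x
  proof (cases "1 / r n < norm x")
    case True
    then have "1 < norm (r n *\<^sub>R x)" using r(1)[of n] by (simp add: field_simps)
    then have "partial_deriv i cutoff (r n *\<^sub>R x) = 0" for i
      by (intro partial_deriv_zero[of cutoff 1, OF smooth_cutoff cutoff_zero])
    then show ?thesis using L(1) theta_pos[of x] by (simp add: E_def)
  next
    case False
    have "1 / r n \<ge> 1" using r(1)[of n] r(2)[of n] by simp
    have "1 / theta x \<le> 1 + 1 / r n" by (rule theta_lower) (use False in simp)
    also have "\<dots> \<le> 2 * (1 / r n)" using \<open>1 / r n \<ge> 1\<close> by simp
    finally have rt: "r n \<le> 2 * theta x" using r(1)[of n] theta_pos[of x] by (simp add: field_simps)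
    have "\<bar>E n x\<bar> \<le> r n * (L * norm (grad_newton \<tau> (x - y)))"
      unfolding E_def abs_mult using r(1)[of n] L(2)[of "r n *\<^sub>R x" "grad_newton \<tau> (x - y)"] by (simp add: mult_left_mono)
    also have "\<dots> \<le> (2 * theta x) * (L * (C\<^sup>2 * (theta x)\<^sup>2))"
      using rt gk[of x] L(1) r(1)[of n] theta_pos[of x] by (intro mult_mono mult_left_mono) auto
    finally show ?thesis by (simp add: mult_ac)
  qed
  have Elim: "(\<lambda>n. E n x) \<longlonglongrightarrow> 0" for x
  proof (rule tendsto_0_le[of r _ _ "L * norm (grad_newton \<tau> (x - y))"])
    show "\<forall>\<^sub>F n in sequentially. norm (E n x) \<le> norm (r n) * (L * norm (grad_newton \<tau> (x - y)))"
      unfolding E_def using r(1) L(2) by (auto simp: abs_mult intro!: mult_left_mono always_eventually)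
  qed (rule r(3))
  have ctlim: "(\<lambda>n. ct n x) \<longlonglongrightarrow> 1" for x
  proof -
    have "(\<lambda>n. r n *\<^sub>R x) \<longlonglongrightarrow> 0" using tendsto_scaleR[OF r(3) tendsto_const, of x] by simp
    moreover have "isCont cutoff 0" using smooth_continuous[OF smooth_cutoff] by (simp add: continuous_on_eq_continuous_at)
    ultimately have "(\<lambda>n. cutoff (r n *\<^sub>R x)) \<longlonglongrightarrow> cutoff 0" by (rule isCont_tendsto_compose[rotated])
    then show ?thesis by (simp add: ct_def cutoff_0)
  qed
  have [measurable]: "ct n \<in> borel_measurable lebesgue" for n by (rule Cc_infinity_measurable_leb[OF ctC])
  have p\<phi>m: "partial_deriv i (\<phi> n i) \<in> borel_measurable lebesgue" for n i
    by (rule Cc_infinity_measurable_leb[OF Cc_infinity_partial[OF \<phi>C]])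
  have Em: "(\<lambda>x. E n x - ct n x * plummer \<tau> (x - y)) \<in> borel_measurable lebesgue" for n
    unfolding div[symmetric] using p\<phi>m by measurable
  have gi: "loc_int (\<lambda>x. g x $ i)" for i by (intro L2_loc_int L2_component g)
  have fin: "(\<integral>x. v x * (E n x - ct n x * plummer \<tau> (x - y)) \<partial>lebesgue) = - (\<integral>x. ct n x * (g x \<bullet> grad_newton \<tau> (x - y)) \<partial>lebesgue)" for n
  proof -
    have i1: "integrable lebesgue (\<lambda>x. v x * partial_deriv i (\<phi> n i) x)" for i
      by (rule loc_int_Cc_integrable[OF vL Cc_infinity_partial[OF \<phi>C]])
    have i2: "integrable lebesgue (\<lambda>x. g x $ i * \<phi> n i x)" for i
      by (rule loc_int_Cc_integrable[OF gi \<phi>C])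
    have "(\<integral>x. v x * (E n x - ct n x * plummer \<tau> (x - y)) \<partial>lebesgue) = (\<Sum>i\<in>UNIV. \<integral>x. v x * partial_deriv i (\<phi> n i) x \<partial>lebesgue)"
      unfolding div[symmetric] sum_distrib_left by (rule Bochner_Integration.integral_sum[OF i1])
    also have "\<dots> = (\<Sum>i\<in>UNIV. - (\<integral>x. g x $ i * \<phi> n i x \<partial>lebesgue))"
      using w \<phi>C unfolding is_weak_gradient_def by (intro sum.cong refl) blast
    also have "\<dots> = - (\<integral>x. (\<Sum>i\<in>UNIV. g x $ i * \<phi> n i x) \<partial>lebesgue)"
      by (simp add: sum_negf Bochner_Integration.integral_sum[OF i2])
    also have "(\<integral>x. (\<Sum>i\<in>UNIV. g x $ i * \<phi> n i x) \<partial>lebesgue) = (\<integral>x. ct n x * (g x \<bullet> grad_newton \<tau> (x - y)) \<partial>lebesgue)"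
      unfolding \<phi>_def by (simp add: inner_vec_def sum_distrib_left mult_ac)
    finally show ?thesis .
  qed
  have lim1: "(\<lambda>n. \<integral>x. v x * (E n x - ct n x * plummer \<tau> (x - y)) \<partial>lebesgue) \<longlonglongrightarrow> (\<integral>x. v x * (0 - 1 * plummer \<tau> (x - y)) \<partial>lebesgue)"
  proof (rule integral_dominated_convergence[where w="\<lambda>x. (2 * L * C\<^sup>2 + B * D) * (\<bar>v x * theta x\<bar> * (theta x)\<^sup>2)"])
    show "AE x in lebesgue. (\<lambda>n. v x * (E n x - ct n x * plummer \<tau> (x - y))) \<longlonglongrightarrow> v x * (0 - 1 * plummer \<tau> (x - y))"
      by (intro AE_I2 tendsto_intros Elim ctlim)
    show "AE x in lebesgue. norm (v x * (E n x - ct n x * plummer \<tau> (x - y))) \<le> (2 * L * C\<^sup>2 + B * D) * (\<bar>v x * theta x\<bar> * (theta x)\<^sup>2)" for n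
    proof (rule AE_I2)
      fix x
      have "\<bar>ct n x * plummer \<tau> (x - y)\<bar> \<le> B * (D * (theta x * (theta x)\<^sup>2))"
        unfolding abs_mult ct_def using B pl[of x] plummer_nonneg[OF \<tau>, of "x - y"] by (intro mult_mono) auto
      then have "\<bar>E n x - ct n x * plummer \<tau> (x - y)\<bar> \<le> (2 * L * C\<^sup>2 + B * D) * (theta x * (theta x)\<^sup>2)"
        using Ebound[of n x] by (simp add: distrib_right mult.assoc)
      from mult_left_mono[OF this, of "\<bar>v x\<bar>"]
      show "norm (v x * (E n x - ct n x * plummer \<tau> (x - y))) \<le> (2 * L * C\<^sup>2 + B * D) * (\<bar>v x * theta x\<bar> * (theta x)\<^sup>2)"
        using theta_pos[of x] by (simp add: abs_mult mult_ac)
    qed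
    show "(\<lambda>x. v x * (E n x - ct n x * plummer \<tau> (x - y))) \<in> borel_measurable lebesgue" for n
      by (intro borel_measurable_times Em L2_theta_measurable[OF v])
    show "(\<lambda>x. v x * (0 - 1 * plummer \<tau> (x - y))) \<in> borel_measurable lebesgue"
      using borel_measurable_uminus[OF borel_measurable_integrable[OF int1]] by simp
  qed (intro integrable_mult_right dom)
  have lim2: "(\<lambda>n. \<integral>x. ct n x * (g x \<bullet> grad_newton \<tau> (x - y)) \<partial>lebesgue) \<longlonglongrightarrow> (\<integral>x. 1 * (g x \<bullet> grad_newton \<tau> (x - y)) \<partial>lebesgue)"
  proof (rule integral_dominated_convergence[where w="\<lambda>x. B * \<bar>g x \<bullet> grad_newton \<tau> (x - y)\<bar>"])
    show "integrable lebesgue (\<lambda>x. B * \<bar>g x \<bullet> grad_newton \<tau> (x - y)\<bar>)" using int2 by (intro integrable_mult_right integrable_abs)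
    show "AE x in lebesgue. (\<lambda>n. ct n x * (g x \<bullet> grad_newton \<tau> (x - y))) \<longlonglongrightarrow> 1 * (g x \<bullet> grad_newton \<tau> (x - y))"
      by (intro AE_I2 tendsto_intros ctlim)
    show "AE x in lebesgue. norm (ct n x * (g x \<bullet> grad_newton \<tau> (x - y))) \<le> B * \<bar>g x \<bullet> grad_newton \<tau> (x - y)\<bar>" for n
      using B by (intro AE_I2) (auto simp: abs_mult ct_def intro!: mult_right_mono)
    show "(\<lambda>x. ct n x * (g x \<bullet> grad_newton \<tau> (x - y))) \<in> borel_measurable lebesgue" for n
      by (intro borel_measurable_times Cc_infinity_measurable_leb[OF ctC] borel_measurable_integrable[OF int2])
    show "(\<lambda>x. 1 * (g x \<bullet> grad_newton \<tau> (x - y))) \<in> borel_measurable lebesgue"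
      using borel_measurable_integrable[OF int2] by simp
  qed
  from LIMSEQ_unique[OF lim1[unfolded fin] tendsto_minus[OF lim2]]
  show "(\<integral>x. v x * plummer \<tau> (x - y) \<partial>lebesgue) = (\<integral>x. g x \<bullet> grad_newton \<tau> (x - y) \<partial>lebesgue)"
    by simp
qed

lemma lborel_shift:
  fixes f :: "real^3 \<Rightarrow> 'b::euclidean_space"
  assumes [measurable]: "f \<in> borel_measurable borel"
  shows "(\<integral>x. f (x + h) \<partial>lborel) = (\<integral>x. f x \<partial>lborel)"
    and "integrable lborel (\<lambda>x. f (x + h)) \<longleftrightarrow> integrable lborel f"
proof -
  have *: "lborel = distr lborel borel ((+) h)" by (rule lborel_distr_plus[symmetric])
  have "(\<integral>x. f x \<partial>lborel) = (\<integral>x. f (h + x) \<partial>lborel)"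
    by (subst *, subst integral_distr) auto
  then show "(\<integral>x. f (x + h) \<partial>lborel) = (\<integral>x. f x \<partial>lborel)" by (simp add: add.commute)
  have "integrable lborel f = integrable lborel (\<lambda>x. f (h + x))"
    by (subst *, subst integrable_distr_eq) auto
  then show "integrable lborel (\<lambda>x. f (x + h)) \<longleftrightarrow> integrable lborel f" by (simp add: add.commute)
qed

lemma lborel_scale:
  fixes f :: "real^3 \<Rightarrow> real"
  assumes [measurable]: "f \<in> borel_measurable borel" and c: "c \<noteq> 0"
  shows "(\<integral>x. f x \<partial>lborel) = \<bar>c\<bar> ^ 3 * (\<integral>x. f (t + c *\<^sub>R x) \<partial>lborel)"
    and "integrable lborel (\<lambda>x. f (t + c *\<^sub>R x)) \<longleftrightarrow> integrable lborel f"
proof -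
  have *: "(lborel :: (real^3) measure) = density (distr lborel borel (\<lambda>x. t + c *\<^sub>R x)) (\<lambda>_. ennreal (\<bar>c\<bar> ^ 3))"
    using lborel_affine[OF c, of t] by (simp add: ennreal_power)
  show "(\<integral>x. f x \<partial>lborel) = \<bar>c\<bar> ^ 3 * (\<integral>x. f (t + c *\<^sub>R x) \<partial>lborel)"
    by (subst *) (simp add: integral_density integral_distr)
  have "integrable lborel f = integrable (density (distr lborel borel (\<lambda>x. t + c *\<^sub>R x)) (\<lambda>_. ennreal (\<bar>c\<bar> ^ 3))) f"
    using * by simp
  also have "\<dots> = integrable lborel (\<lambda>x. \<bar>c\<bar> ^ 3 * f (t + c *\<^sub>R x))"
    by (subst integrable_density) (auto simp: integrable_distr_eq)
  also have "\<dots> = integrable lborel (\<lambda>x. f (t + c *\<^sub>R x))" using c by simp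
  finally show "integrable lborel (\<lambda>x. f (t + c *\<^sub>R x)) \<longleftrightarrow> integrable lborel f" by simp
qed

lemma L2_leb_iff:
  fixes f :: "real^3 \<Rightarrow> 'b::euclidean_space"
  assumes [measurable]: "f \<in> borel_measurable borel"
  shows "f \<in> L2 lebesgue \<longleftrightarrow> f \<in> L2 lborel" "nrm2 lebesgue f = nrm2 lborel f"
proof -
  have "f \<in> borel_measurable lebesgue" using assms by (simp add: measurable_completion)
  then show "f \<in> L2 lebesgue \<longleftrightarrow> f \<in> L2 lborel" by (simp add: L2_def integrable_completion)
  show "nrm2 lebesgue f = nrm2 lborel f" by (simp add: nrm2_def integral_completion)
qed

lemma L2_shift:
  fixes f :: "real^3 \<Rightarrow> 'b::euclidean_space"
  assumes f: "f \<in> L2 lborel"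
  shows "(\<lambda>x. f (x + h)) \<in> L2 lborel" "nrm2 lborel (\<lambda>x. f (x + h)) = nrm2 lborel f"
proof -
  have [measurable]: "f \<in> borel_measurable borel" using f by (simp add: L2_def)
  have [measurable]: "(\<lambda>x. (norm (f x))\<^sup>2) \<in> borel_measurable borel" by measurable
  show "(\<lambda>x. f (x + h)) \<in> L2 lborel"
    using f lborel_shift(2)[of "\<lambda>x. (norm (f x))\<^sup>2" h] by (simp add: L2_def)
  show "nrm2 lborel (\<lambda>x. f (x + h)) = nrm2 lborel f"
    unfolding nrm2_def using lborel_shift(1)[of "\<lambda>x. (norm (f x))\<^sup>2" h] by simp
qed

text \<open>Young's inequality in trilinear form, by Fubini: for fixed z the integral over y is bounded by the
Cauchy-Schwarz inequality and translation invariance.\<close>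

lemma young_trilinear:
  fixes k g :: "real^3 \<Rightarrow> real^3" and \<psi> :: "real^3 \<Rightarrow> real"
  assumes \<psi>: "\<psi> \<in> L2 lborel" and g: "g \<in> L2 lborel" and k: "integrable lborel k"
  shows "\<bar>\<integral>y. \<psi> y * (\<integral>z. g (z + y) \<bullet> k z \<partial>lborel) \<partial>lborel\<bar> \<le> (\<integral>z. norm (k z) \<partial>lborel) * (nrm2 lborel \<psi> * nrm2 lborel g)"
proof -
  have [measurable]: "\<psi> \<in> borel_measurable borel" "g \<in> borel_measurable borel" "k \<in> borel_measurable borel"
    using \<psi> g borel_measurable_integrable[OF k] by (auto simp: L2_def)
  define N where "N = nrm2 lborel \<psi> * nrm2 lborel g"
  define F where "F z y = \<psi> y * (g (z + y) \<bullet> k z)" for z y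
  have Fm [measurable]: "case_prod F \<in> borel_measurable (lborel \<Otimes>\<^sub>M lborel)"
    unfolding F_def by measurable
  have gs: "(\<lambda>y. g (z + y)) \<in> L2 lborel" "nrm2 lborel (\<lambda>y. g (z + y)) = nrm2 lborel g" for z
    using L2_shift[OF g, of z] by (simp_all add: add.commute)
  have i0: "integrable lborel (\<lambda>y. norm (\<psi> y) * norm (g (z + y)))" for z
    by (rule L2_prod_integrable[OF \<psi> gs(1)])
  have Fb: "norm (F z y) \<le> norm (k z) * (norm (\<psi> y) * norm (g (z + y)))" for z y
    unfolding F_def using mult_left_mono[OF Cauchy_Schwarz_ineq2[of "g (z + y)" "k z"], of "\<bar>\<psi> y\<bar>"]
    by (simp add: abs_mult mult_ac)
  have i1: "integrable lborel (F z)" for z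
    by (rule Bochner_Integration.integrable_bound[OF integrable_mult_right[OF i0[of z], of "norm (k z)"]])
       (use Fb in \<open>auto simp: F_def\<close>)
  have b: "(\<integral>y. norm (F z y) \<partial>lborel) \<le> norm (k z) * N" for z
  proof -
    have "(\<integral>y. norm (F z y) \<partial>lborel) \<le> (\<integral>y. norm (k z) * (norm (\<psi> y) * norm (g (z + y))) \<partial>lborel)"
      by (rule integral_mono[OF integrable_norm[OF i1] integrable_mult_right[OF i0] Fb])
    also have "\<dots> = norm (k z) * (\<integral>y. norm (\<psi> y) * norm (g (z + y)) \<partial>lborel)" by simp
    also have "\<dots> \<le> norm (k z) * N"
      unfolding N_def using L2_Cauchy_Schwarz_norm[OF \<psi> gs(1)[of z]] gs(2) by (intro mult_left_mono) auto
    finally show ?thesis .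
  qed
  have int: "integrable (lborel \<Otimes>\<^sub>M lborel) (case_prod F)"
  proof (rule lborel_pair.Fubini_integrable)
    show "integrable lborel (\<lambda>z. \<integral>y. norm (case_prod F (z, y)) \<partial>lborel)"
    proof (rule Bochner_Integration.integrable_bound[OF integrable_mult_left[OF integrable_norm[OF k], of N]])
      show "AE z in lborel. norm (\<integral>y. norm (case_prod F (z, y)) \<partial>lborel) \<le> norm (norm (k z) * N)"
        using b by (intro AE_I2) (auto simp: N_def)
    qed measurable
  qed (use i1 in auto)
  have "(\<integral>y. \<psi> y * (\<integral>z. g (z + y) \<bullet> k z \<partial>lborel) \<partial>lborel) = (\<integral>y. (\<integral>z. F z y \<partial>lborel) \<partial>lborel)"
    unfolding F_def by simp
  also have "\<dots> = (\<integral>z. (\<integral>y. F z y \<partial>lborel) \<partial>lborel)"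
    by (rule lborel_pair.Fubini_integral[OF int])
  finally have "\<bar>\<integral>y. \<psi> y * (\<integral>z. g (z + y) \<bullet> k z \<partial>lborel) \<partial>lborel\<bar> \<le> (\<integral>z. norm (\<integral>y. F z y \<partial>lborel) \<partial>lborel)"
    using integral_norm_bound[of lborel "\<lambda>z. \<integral>y. F z y \<partial>lborel"] by simp
  also have "\<dots> \<le> (\<integral>z. norm (k z) * N \<partial>lborel)"
  proof (rule integral_mono)
    show "integrable lborel (\<lambda>z. norm (\<integral>y. F z y \<partial>lborel))"
      using lborel_pair.integrable_fst'[OF int] by simp
    show "integrable lborel (\<lambda>z. norm (k z) * N)" by (rule integrable_mult_left[OF integrable_norm[OF k]])
    show "norm (\<integral>y. F z y \<partial>lborel) \<le> norm (k z) * N" for z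
      using order_trans[OF integral_norm_bound b] by simp
  qed
  finally show ?thesis by (simp add: N_def)
qed

section \<open>Scaling of the kernel and its dyadic differences\<close>

lemma newton_scale:
  assumes "0 < a" "0 < t"
  shows "newton (t * a) (t *\<^sub>R w) = newton a w / t"
proof (rule power2_eq_imp_eq)
  have "(newton (t * a) (t *\<^sub>R w))\<^sup>2 = 1 / (t\<^sup>2 * (a\<^sup>2 + (norm w)\<^sup>2))"
    using assms by (simp add: newton_sq power_mult_distrib distrib_left)
  also have "\<dots> = (newton a w / t)\<^sup>2" using assms by (simp add: newton_sq power_divide)
  finally show "(newton (t * a) (t *\<^sub>R w))\<^sup>2 = (newton a w / t)\<^sup>2" .
qed (use assms newton_pos[of "t * a" "t *\<^sub>R w"] newton_pos[of a w] in auto)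

lemma newton_1: "newton 1 = theta"
  by (auto simp: newton_def theta_def)

lemma plummer_scale: 
  assumes "0 < t" shows "plummer t (t *\<^sub>R w) = plummer 1 w / t ^ 3"
proof -
  have n: "newton t (t *\<^sub>R w) = newton 1 w / t" using newton_scale[of 1 t w] assms by simp
  show ?thesis unfolding plummer_def n using assms by (simp add: field_simps eval_nat_numeral)
qed

lemma grad_newton_scale:
  assumes "0 < a" "0 < t" shows "grad_newton (t * a) (t *\<^sub>R w) = (1 / t\<^sup>2) *\<^sub>R grad_newton a w"
proof -
  have "newton (t * a) (t *\<^sub>R w) ^ 3 * t = newton a w ^ 3 / t\<^sup>2"
    unfolding newton_scale[OF assms] using assms by (simp add: field_simps eval_nat_numeral)
  then show ?thesis unfolding grad_newton_def by simp
qed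

text \<open>The Plummer density decays like the fifth power of theta.\<close>

lemma plummer_1_integrable: "integrable lborel (plummer 1)"
proof (rule Bochner_Integration.integrable_bound[OF integrable_mult_right[OF theta_power4_integrable_lborel, of 3]])
  show "AE x in lborel. norm (plummer 1 x) \<le> norm (3 * theta x ^ 4)"
  proof (rule AE_I2)
    fix x
    have "theta x ^ 5 \<le> theta x ^ 4" using theta_pos[of x] theta_le_1[of x] by (intro power_decreasing) auto
    then show "norm (plummer 1 x) \<le> norm (3 * theta x ^ 4)"
      using theta_pos[of x] by (simp add: plummer_def newton_1)
  qed
qed (simp add: plummer_measurable)

definition plummer_mass :: real where "plummer_mass = (\<integral>z. plummer 1 z \<partial>lborel)"

lemma plummer_mass_pos: "0 < plummer_mass"
proof -
  have "plummer_mass \<noteq> 0"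
  proof
    assume "plummer_mass = 0"
    then have "AE z in lborel. plummer 1 z = 0"
      unfolding plummer_mass_def
      by (subst (asm) integral_nonneg_eq_0_iff_AE[OF plummer_1_integrable]) (auto simp: plummer_nonneg)
    then have "AE z in (lborel :: (real^3) measure). False"
      by eventually_elim (use theta_pos in \<open>simp add: plummer_def newton_1 less_imp_neq[symmetric]\<close>)
    then show False by (simp add: AE_iff_null null_sets_def emeasure_lborel_UNIV)
  qed
  moreover have "0 \<le> plummer_mass" unfolding plummer_mass_def by (simp add: plummer_nonneg)
  ultimately show ?thesis by simp
qed

text \<open>The kernel gradient itself decays only like |z|^(-2) and is not integrable, but its change between
two consecutive dyadic scales is.\<close>

definition dyadic_kernel :: "real \<Rightarrow> real^3 \<Rightarrow> real^3" where
  "dyadic_kernel t z = grad_newton (t / 2) z - grad_newton t z"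

lemma dyadic_kernel_measurable: "0 < t \<Longrightarrow> dyadic_kernel t \<in> borel_measurable borel"
  using grad_newton_measurable[of t] grad_newton_measurable[of "t/2"] unfolding dyadic_kernel_def[abs_def] by measurable

text \<open>With a and b the kernels at the scales 1/2 and 1, the identity a^2 - b^2 = (3/4) a^2 b^2 gives
a - b \<le> (3/2) b^3, so that a^3 - b^3, which multiplies -x in the difference of the gradients, is at
most (3/2) 7 b^5 \<le> 14 b^5, and b |x| is at most 1.\<close>

lemma dyadic_kernel_1_integrable: "integrable lborel (dyadic_kernel 1)"
proof (rule Bochner_Integration.integrable_bound[OF integrable_mult_right[OF theta_power4_integrable_lborel, of 14]])
  show "AE x in lborel. norm (dyadic_kernel 1 x) \<le> norm (14 * theta x ^ 4)"
  proof (rule AE_I2)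
    fix x :: "real^3"
    define a b where "a = newton (1/2) x" "b = newton 1 x"
    have a0: "0 < a" and b0: "0 < b" unfolding a_b_def by (simp_all add: newton_pos)
    have a2: "a\<^sup>2 * (1/4 + (norm x)\<^sup>2) = 1" and b2: "b\<^sup>2 * (1 + (norm x)\<^sup>2) = 1"
      unfolding a_b_def using newton_arg_pos[of "1/2" x] by (simp_all add: newton_sq power_divide)
    have d: "a\<^sup>2 - b\<^sup>2 = 3/4 * (a\<^sup>2 * b\<^sup>2)"
    proof -
      have "a\<^sup>2 - b\<^sup>2 = a\<^sup>2 * (b\<^sup>2 * (1 + (norm x)\<^sup>2)) - b\<^sup>2 * (a\<^sup>2 * (1/4 + (norm x)\<^sup>2))" by (simp add: a2 b2)
      also have "\<dots> = 3/4 * (a\<^sup>2 * b\<^sup>2)" by (simp add: algebra_simps)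
      finally show ?thesis .
    qed
    have "0 \<le> a\<^sup>2 * b\<^sup>2" by simp
    then have "b\<^sup>2 \<le> a\<^sup>2" using d by linarith
    then have ba: "b \<le> a" by (rule power2_le_imp_le) (use a0 in simp)
    have a2b: "a \<le> 2 * b"
    proof (rule power2_le_imp_le)
      have "a\<^sup>2 * (1 + (norm x)\<^sup>2) \<le> 4 * (a\<^sup>2 * (1/4 + (norm x)\<^sup>2))" by (simp add: algebra_simps)
      then have "a\<^sup>2 * (1 + (norm x)\<^sup>2) \<le> 4 * (b\<^sup>2 * (1 + (norm x)\<^sup>2))" by (simp add: a2 b2)
      then show "a\<^sup>2 \<le> (2 * b)\<^sup>2" using one_plus_norm_sq_pos(1)[of x] by (simp add: power_mult_distrib flip: mult.assoc)
    qed (use b0 in simp)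
    have "(a - b) * (2 * b) \<le> (a - b) * (a + b)" using ba b0 by (intro mult_left_mono) auto
    also have "\<dots> = 3/4 * (a\<^sup>2 * b\<^sup>2)" using d by (simp add: power2_eq_square algebra_simps)
    also have "\<dots> \<le> 3/4 * ((2 * b)\<^sup>2 * b\<^sup>2)" using a2b a0 by (intro mult_left_mono mult_right_mono power_mono) auto
    also have "\<dots> = (3/2 * b ^ 3) * (2 * b)" by (simp add: power2_eq_square eval_nat_numeral)
    finally have ab: "a - b \<le> 3/2 * b ^ 3" using b0 by (simp only: mult_le_cancel_right)
    have "a ^ 3 - b ^ 3 = (a - b) * (a\<^sup>2 + a * b + b\<^sup>2)" by (simp add: algebra_simps power2_eq_square eval_nat_numeral)
    also have "\<dots> \<le> (3/2 * b ^ 3) * ((2 * b)\<^sup>2 + (2 * b) * b + b\<^sup>2)"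
      using ab a2b ba a0 b0 by (intro mult_mono add_mono power_mono mult_right_mono) auto
    also have "\<dots> \<le> 14 * b ^ 5" using b0 by (simp add: power2_eq_square eval_nat_numeral)
    finally have c: "a ^ 3 - b ^ 3 \<le> 14 * b ^ 5" .
    have "norm (dyadic_kernel 1 x) = (a ^ 3 - b ^ 3) * norm x"
    proof -
      have "dyadic_kernel 1 x = - ((a ^ 3 - b ^ 3) *\<^sub>R x)"
        by (simp add: dyadic_kernel_def grad_newton_def a_b_def scaleR_diff_left)
      moreover have "b ^ 3 \<le> a ^ 3" using ba b0 by (intro power_mono) auto
      ultimately show ?thesis by simp
    qed
    also have "\<dots> \<le> 14 * b ^ 5 * norm x" using c by (intro mult_right_mono) auto
    also have "\<dots> = 14 * b ^ 4 * (b * norm x)" by (simp add: eval_nat_numeral)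
    also have "\<dots> \<le> 14 * b ^ 4 * 1" using newton_norm_le[of 1 x] b0 unfolding a_b_def by (intro mult_left_mono) auto
    finally show "norm (dyadic_kernel 1 x) \<le> norm (14 * theta x ^ 4)" unfolding a_b_def newton_1 by simp
  qed
qed (simp add: dyadic_kernel_measurable)

text \<open>The kernel gradient is homogeneous of degree -2 in (\<tau>, z), so the integral over three-dimensional
space gains one power of t.\<close>

lemma dyadic_kernel_integral:
  assumes t: "0 < t"
  shows "integrable lborel (dyadic_kernel t)"
    "(\<integral>z. norm (dyadic_kernel t z) \<partial>lborel) = t * (\<integral>z. norm (dyadic_kernel 1 z) \<partial>lborel)"
proof -
  have [measurable]: "dyadic_kernel t \<in> borel_measurable borel" "dyadic_kernel 1 \<in> borel_measurable borel"
    using t by (auto simp: dyadic_kernel_measurable)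
  have m: "(\<lambda>z. norm (dyadic_kernel t z)) \<in> borel_measurable borel" by measurable
  have eq: "norm (dyadic_kernel t (0 + t *\<^sub>R w)) = (1 / t\<^sup>2) * norm (dyadic_kernel 1 w)" for w
    using grad_newton_scale[of "1/2" t w] grad_newton_scale[of 1 t w] t
    unfolding dyadic_kernel_def by (simp flip: scaleR_diff_right)
  have "integrable lborel (\<lambda>w. norm (dyadic_kernel t (0 + t *\<^sub>R w)))"
    unfolding eq by (intro integrable_mult_right integrable_norm dyadic_kernel_1_integrable)
  then have "integrable lborel (\<lambda>z. norm (dyadic_kernel t z))"
    using lborel_scale(2)[OF m, of t 0] t by simp
  then show "integrable lborel (dyadic_kernel t)" by (subst (asm) integrable_norm_iff) auto
  show "(\<integral>z. norm (dyadic_kernel t z) \<partial>lborel) = t * (\<integral>z. norm (dyadic_kernel 1 z) \<partial>lborel)"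
    using lborel_scale(1)[OF m, of t 0] t unfolding eq by (simp add: power2_eq_square eval_nat_numeral)
qed

lemma plummer_convolution:
  assumes \<tau>: "0 < \<tau>" and [measurable]: "\<psi> \<in> borel_measurable borel" and B: "\<And>x. \<bar>\<psi> x\<bar> \<le> B"
  shows "(\<integral>y. plummer \<tau> (x - y) * \<psi> y \<partial>lborel) = (\<integral>z. plummer 1 z * \<psi> (x - \<tau> *\<^sub>R z) \<partial>lborel)"
    and "integrable lborel (\<lambda>y. plummer \<tau> (x - y) * \<psi> y)"
    and "integrable lborel (\<lambda>z. plummer 1 z * \<psi> (x - \<tau> *\<^sub>R z))"
proof -
  note [measurable] = plummer_measurable[OF \<tau>] plummer_measurable[of 1, simplified]
  have m: "(\<lambda>y. plummer \<tau> (x - y) * \<psi> y) \<in> borel_measurable borel" by measurable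
  have eq: "plummer \<tau> (x - (x + (-\<tau>) *\<^sub>R z)) * \<psi> (x + (-\<tau>) *\<^sub>R z) = (1 / \<tau> ^ 3) * (plummer 1 z * \<psi> (x - \<tau> *\<^sub>R z))" for z
    using plummer_scale[OF \<tau>, of z] by simp
  show i: "integrable lborel (\<lambda>z. plummer 1 z * \<psi> (x - \<tau> *\<^sub>R z))"
  proof (rule Bochner_Integration.integrable_bound[OF integrable_mult_right[OF plummer_1_integrable, of B]])
    show "AE z in lborel. norm (plummer 1 z * \<psi> (x - \<tau> *\<^sub>R z)) \<le> norm (B * plummer 1 z)"
    proof (rule AE_I2)
      fix z
      have "plummer 1 z * \<bar>\<psi> (x - \<tau> *\<^sub>R z)\<bar> \<le> plummer 1 z * \<bar>B\<bar>"
        using order_trans[OF B abs_ge_self] by (intro mult_left_mono plummer_nonneg) auto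
      then show "norm (plummer 1 z * \<psi> (x - \<tau> *\<^sub>R z)) \<le> norm (B * plummer 1 z)"
        using plummer_nonneg[of 1 z] by (simp add: abs_mult mult.commute)
    qed
  qed measurable
  show "integrable lborel (\<lambda>y. plummer \<tau> (x - y) * \<psi> y)"
    using integrable_mult_right[OF i, of "1 / \<tau> ^ 3"] lborel_scale(2)[OF m, of "-\<tau>" x] \<tau> unfolding eq by simp
  show "(\<integral>y. plummer \<tau> (x - y) * \<psi> y \<partial>lborel) = (\<integral>z. plummer 1 z * \<psi> (x - \<tau> *\<^sub>R z) \<partial>lborel)"
    using lborel_scale(1)[OF m, of "-\<tau>" x] \<tau> unfolding eq by simp
qed

text \<open>For |x| > 2R the distance |x - y| is at least |x|/2, so the kernel is at most 4 theta x; the constant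
is 3 times 4^5, and two powers of theta are given away.\<close>

lemma plummer_far:
  assumes "0 < \<tau>" "\<tau> \<le> 1" "1 \<le> R" "2 * R < norm x" "norm y \<le> R"
  shows "plummer \<tau> (x - y) \<le> 3072 * theta x ^ 3"
proof -
  have nx: "1 \<le> norm x" "0 < norm x" using assms by auto
  have "norm x \<le> norm (x - y) + norm y" using norm_triangle_ineq[of "x - y" y] by simp
  then have h: "norm x / 2 \<le> norm (x - y)" using assms by simp
  have "newton \<tau> (x - y) * (norm x / 2) \<le> newton \<tau> (x - y) * norm (x - y)"
    using newton_pos[OF assms(1), of "x - y"] by (intro mult_left_mono h) auto
  also have "\<dots> \<le> 1" by (rule newton_norm_le[OF assms(1)])
  finally have q: "newton \<tau> (x - y) \<le> 2 / norm x" using nx by (simp add: field_simps)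
  have t: "1 / norm x \<le> 2 * theta x"
  proof (rule power2_le_imp_le)
    have "1\<^sup>2 \<le> (norm x)\<^sup>2" using nx by (intro power_mono) auto
    then have "1 + (norm x)\<^sup>2 \<le> 4 * (norm x)\<^sup>2" by simp
    then show "(1 / norm x)\<^sup>2 \<le> (2 * theta x)\<^sup>2"
      using nx one_plus_norm_sq_pos(1)[of x] by (simp add: power_divide power_mult_distrib theta_sq field_simps)
  qed (use theta_pos[of x] in simp)
  have "newton \<tau> (x - y) \<le> 4 * theta x" using q t by (simp add: field_simps) 
  then have "newton \<tau> (x - y) ^ 5 \<le> (4 * theta x) ^ 5"
    using newton_pos[OF assms(1), of "x - y"] by (intro power_mono) auto
  also have "\<dots> = 1024 * theta x ^ 5" by (simp add: power_mult_distrib)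
  also have "\<dots> \<le> 1024 * theta x ^ 3" using theta_pos[of x] theta_le_1[of x] by (intro mult_left_mono power_decreasing) auto
  finally have 5: "newton \<tau> (x - y) ^ 5 \<le> 1024 * theta x ^ 3" .
  have "\<tau>\<^sup>2 \<le> 1" using assms by (simp add: power_le_one)
  then have "3 * \<tau>\<^sup>2 * newton \<tau> (x - y) ^ 5 \<le> 3 * 1 * (1024 * theta x ^ 3)"
    using 5 newton_pos[OF assms(1), of "x - y"] by (intro mult_mono) auto
  then show ?thesis by (simp add: plummer_def)
qed

text \<open>The smoothing of a bounded function with bounded support decays like the third power of theta,
uniformly in the scale, which makes it integrable against functions in the weighted space. Near the
support the total mass of the kernel is used, far away its decay.\<close>

lemma plummer_convolution_bound:
  assumes \<tau>: "0 < \<tau>" "\<tau> \<le> 1" and \<psi>m [measurable]: "\<psi> \<in> borel_measurable borel" and B: "\<And>x. \<bar>\<psi> x\<bar> \<le> B"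
    and R: "1 \<le> R" "\<And>x. R < norm x \<Longrightarrow> \<psi> x = 0"
  shows "(\<integral>y. plummer \<tau> (x - y) * \<bar>\<psi> y\<bar> \<partial>lborel) \<le>
     (B * plummer_mass * (1 + 2 * R) ^ 3 + 3072 * B * measure lborel (cball (0::real^3) R)) * theta x ^ 3"
proof -
  have B0: "0 \<le> B" using order_trans[OF abs_ge_zero B] .
  have am: "(\<lambda>x. \<bar>\<psi> x\<bar>) \<in> borel_measurable borel" "\<And>x. \<bar>\<bar>\<psi> x\<bar>\<bar> \<le> B" using B by auto
  note pc = plummer_convolution[OF \<tau>(1) am, of x]
  have th: "0 \<le> theta x ^ 3" using theta_pos[of x] by simp
  show ?thesis
  proof (cases "norm x \<le> 2 * R")
    case True
    have "(\<integral>y. plummer \<tau> (x - y) * \<bar>\<psi> y\<bar> \<partial>lborel) \<le> (\<integral>z. plummer 1 z * B \<partial>lborel)"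
      unfolding pc(1) by (intro integral_mono pc(3) integrable_mult_left plummer_1_integrable mult_left_mono B plummer_nonneg) auto
    also have "\<dots> = B * plummer_mass * 1" by (simp add: plummer_mass_def)
    also have "\<dots> \<le> B * plummer_mass * ((1 + 2 * R) * theta x) ^ 3"
    proof (intro mult_left_mono one_le_power)
      show "1 \<le> (1 + 2 * R) * theta x" using theta_lower[OF True] theta_pos[of x] by (simp add: field_simps)
    qed (use B0 plummer_mass_pos in auto)
    also have "\<dots> \<le> (B * plummer_mass * (1 + 2 * R) ^ 3 + 3072 * B * measure lborel (cball (0::real^3) R)) * theta x ^ 3"
    proof -
      have "0 \<le> 3072 * B * measure lborel (cball (0::real^3) R) * theta x ^ 3" using B0 th by simp
      moreover have "B * plummer_mass * ((1 + 2 * R) * theta x) ^ 3 = B * plummer_mass * (1 + 2 * R) ^ 3 * theta x ^ 3"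
        unfolding power_mult_distrib[of "1 + 2 * R"] by (simp only: mult.assoc)
      ultimately show ?thesis
        unfolding distrib_right[of "B * plummer_mass * (1 + 2 * R) ^ 3"] by linarith
    qed
    finally show ?thesis .
  next
    case False
    have fin: "emeasure lborel (cball (0::real^3) R) < \<infinity>" by (rule emeasure_lborel_cball_finite)
    have "(\<integral>y. plummer \<tau> (x - y) * \<bar>\<psi> y\<bar> \<partial>lborel) \<le> (\<integral>y. (3072 * theta x ^ 3 * B) * indicator (cball (0::real^3) R) y \<partial>lborel)"
    proof (rule integral_mono)
      show "integrable lborel (\<lambda>y. plummer \<tau> (x - y) * \<bar>\<psi> y\<bar>)" by (rule pc(2))
      show "integrable lborel (\<lambda>y. (3072 * theta x ^ 3 * B) * indicator (cball (0::real^3) R) y)"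
        using fin by (intro integrable_mult_right integrable_real_indicator) auto
      show "plummer \<tau> (x - y) * \<bar>\<psi> y\<bar> \<le> (3072 * theta x ^ 3 * B) * indicator (cball 0 R) y" for y
      proof (cases "norm y \<le> R")
        case True
        then show ?thesis using plummer_far[OF \<tau> R(1), of x y] False B[of y] B0 th
          by (auto intro!: mult_mono)
      qed (use R(2)[of y] in auto)
    qed
    also have "\<dots> = 3072 * B * measure lborel (cball (0::real^3) R) * theta x ^ 3" by simp
    also have "\<dots> \<le> (B * plummer_mass * (1 + 2 * R) ^ 3 + 3072 * B * measure lborel (cball (0::real^3) R)) * theta x ^ 3"
      using B0 th R(1) plummer_mass_pos by (simp add: distrib_right)
    finally show ?thesis .
  qed
qed

section \<open>Strong compactness against bounded test functions\<close>

text \<open>A geometric series of increments.\<close>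

lemma telescoping_bound:
  fixes I :: "nat \<Rightarrow> real"
  assumes step: "\<And>k. \<bar>I (Suc k) - I k\<bar> \<le> c * (1/2)^k" and lim: "I \<longlonglongrightarrow> L"
  shows "\<bar>L - I 0\<bar> \<le> 2 * c"
proof -
  have c: "0 \<le> c" using order_trans[OF abs_ge_zero step[of 0]] by simp
  have le: "\<bar>I k - I 0\<bar> \<le> 2 * c * (1 - (1/2)^k)" for k
  proof (induction k)
    case (Suc k)
    have "\<bar>I (Suc k) - I 0\<bar> \<le> c * (1/2)^k + 2 * c * (1 - (1/2)^k)" using Suc step[of k] by linarith
    also have "\<dots> = 2 * c * (1 - (1/2)^Suc k)" by (simp add: algebra_simps)
    finally show ?case .
  qed simp
  have "\<bar>I k - I 0\<bar> \<le> 2 * c" for k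
  proof -
    have "c * (1/2)^k \<ge> 0" using c by simp
    then have "2 * c * (1 - (1/2)^k) \<le> 2 * c" by (simp add: right_diff_distrib)
    then show ?thesis using le[of k] by linarith
  qed
  moreover have "(\<lambda>k. \<bar>I k - I 0\<bar>) \<longlonglongrightarrow> \<bar>L - I 0\<bar>" by (intro tendsto_intros lim)
  ultimately show ?thesis by (intro LIMSEQ_le_const2[of "\<lambda>k. \<bar>I k - I 0\<bar>"]) auto
qed

text \<open>The representation of the smoothed function at y, read as a function of the field g alone.\<close>

definition newton_flux :: "(real^3 \<Rightarrow> real^3) \<Rightarrow> real \<Rightarrow> real^3 \<Rightarrow> real" where
  "newton_flux g \<tau> y = (\<integral>x. g x \<bullet> grad_newton \<tau> (x - y) \<partial>lborel)"

lemma newton_flux_measurable: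
  assumes [measurable]: "g \<in> borel_measurable borel" and "0 < \<tau>"
  shows "newton_flux g \<tau> \<in> borel_measurable borel"
proof -
  have [measurable]: "grad_newton \<tau> \<in> borel_measurable borel" by (rule grad_newton_measurable[OF assms(2)])
  have "(\<lambda>y. \<integral>x. g x \<bullet> grad_newton \<tau> (x - y) \<partial>lborel) \<in> borel_measurable lborel" by measurable
  then show ?thesis unfolding newton_flux_def[abs_def] by simp
qed

lemma grad_newton_L2_lborel:
  assumes "0 < \<tau>"
  shows "(\<lambda>x. grad_newton \<tau> (x - y)) \<in> L2 lborel" "nrm2 lborel (\<lambda>x. grad_newton \<tau> (x - y)) = nrm2 lborel (grad_newton \<tau>)"
proof -
  have [measurable]: "grad_newton \<tau> \<in> borel_measurable borel" by (rule grad_newton_measurable[OF assms])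
  have 0: "grad_newton \<tau> \<in> L2 lborel"
    using grad_newton_L2[OF assms, of 0] by (simp add: L2_leb_iff)
  show "(\<lambda>x. grad_newton \<tau> (x - y)) \<in> L2 lborel" "nrm2 lborel (\<lambda>x. grad_newton \<tau> (x - y)) = nrm2 lborel (grad_newton \<tau>)"
    using L2_shift[OF 0, of "-y"] by simp_all
qed

lemma newton_flux_bound:
  assumes "g \<in> L2 lborel" "0 < \<tau>"
  shows "\<bar>newton_flux g \<tau> y\<bar> \<le> nrm2 lborel g * nrm2 lborel (grad_newton \<tau>)"
  unfolding newton_flux_def grad_newton_L2_lborel(2)[OF assms(2), of y, symmetric]
  by (rule L2_Cauchy_Schwarz[OF assms(1) grad_newton_L2_lborel(1)[OF assms(2)]])

text \<open>Between the scales \<delta>/2^k and \<delta>/2^(k+1) the flux changes by the convolution with a dyadic kernel of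
integral of order \<delta>/2^k, and Young's inequality bounds the pairing with \<psi>. The increments sum up to
the total error between the scale \<delta> and the limit of vanishing scale, which is v times the mass of
the Plummer kernel.\<close>

lemma mollification_error:
  assumes v: "v \<in> L2_theta" and vm [measurable]: "v \<in> borel_measurable borel"
    and g: "g \<in> L2 lborel" and w: "is_weak_gradient v g"
    and \<psi>c: "continuous_on UNIV \<psi>" and B: "\<And>x. \<bar>\<psi> x\<bar> \<le> B"
    and R: "1 \<le> R" "\<And>x. R < norm x \<Longrightarrow> \<psi> x = 0"
    and \<delta>: "0 < \<delta>" "\<delta> \<le> 1"
  shows "\<bar>plummer_mass * (\<integral>x. v x * \<psi> x \<partial>lborel) - (\<integral>y. \<psi> y * newton_flux g \<delta> y \<partial>lborel)\<bar>
    \<le> 2 * (\<delta> * (\<integral>z. norm (dyadic_kernel 1 z) \<partial>lborel) * (nrm2 lborel \<psi> * nrm2 lborel g))"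
proof -
  have \<psi>m [measurable]: "\<psi> \<in> borel_measurable borel" by (rule borel_measurable_continuous_onI[OF \<psi>c])
  have gm [measurable]: "g \<in> borel_measurable borel" using g by (simp add: L2_def)
  have gL: "g \<in> L2 lebesgue" using g by (simp add: L2_leb_iff)
  have vth: "(\<lambda>x. v x * theta x) \<in> L2 lborel" using v by (subst L2_leb_iff[symmetric]) (auto simp: L2_theta_def)
  have th2: "(\<lambda>x. (theta x)\<^sup>2) \<in> L2 lborel" using theta_sq_L2 by (simp add: L2_leb_iff)
  have \<psi>int: "integrable lborel \<psi>"
    using integrable_bounded_supp[OF borel_lebesgue_measurable[OF \<psi>m] B R(2)] by (simp add: integrable_completion)
  have \<psi>2: "\<psi> \<in> L2 lborel"
  proof (rule L2I)
    have "integrable lebesgue (\<lambda>x. \<psi> x * \<psi> x)"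
    proof (rule integrable_bounded_supp)
      show "(\<lambda>x. \<psi> x * \<psi> x) \<in> borel_measurable lebesgue" by (intro borel_lebesgue_measurable borel_measurable_times \<psi>m)
      show "\<bar>\<psi> x * \<psi> x\<bar> \<le> B * B" for x
        unfolding abs_mult using order_trans[OF abs_ge_zero B] by (intro mult_mono B) auto
      show "\<psi> x * \<psi> x = 0" if "R < norm x" for x using R(2)[OF that] by simp
    qed
    then show "integrable lborel (\<lambda>x. (norm (\<psi> x))\<^sup>2)" by (simp add: integrable_completion power2_eq_square)
  qed simp
  define t where "t k = \<delta> * (1/2)^k" for k :: nat
  have t: "0 < t k" "t k \<le> 1" for k
    unfolding t_def using \<delta> mult_mono[of \<delta> 1 "(1/2)^k" 1] by (auto simp: power_le_one)
  have tlim: "t \<longlonglongrightarrow> 0"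
    unfolding t_def[abs_def] using tendsto_mult_right_zero[OF LIMSEQ_power_zero[of "1/2::real"]] by simp
  define I where "I k = (\<integral>y. \<psi> y * newton_flux g (t k) y \<partial>lborel)" for k
  have flux_int: "integrable lborel (\<lambda>y. \<psi> y * newton_flux g \<tau> y)" if "0 < \<tau>" for \<tau>
  proof (rule Bochner_Integration.integrable_bound[OF integrable_mult_right[OF \<psi>int, of "nrm2 lborel g * nrm2 lborel (grad_newton \<tau>)"]])
    show "AE y in lborel. norm (\<psi> y * newton_flux g \<tau> y) \<le> norm (nrm2 lborel g * nrm2 lborel (grad_newton \<tau>) * \<psi> y)"
    proof (rule AE_I2)
      fix y
      show "norm (\<psi> y * newton_flux g \<tau> y) \<le> norm (nrm2 lborel g * nrm2 lborel (grad_newton \<tau>) * \<psi> y)"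
        using mult_left_mono[OF newton_flux_bound[OF g that, of y] abs_ge_zero, of "\<psi> y"]
        by (simp add: abs_mult mult.commute[of _ "\<bar>\<psi> y\<bar>"])
    qed
    show "(\<lambda>y. \<psi> y * newton_flux g \<tau> y) \<in> borel_measurable lborel" using newton_flux_measurable[OF gm that] by measurable
  qed
  have step: "\<bar>I (Suc k) - I k\<bar> \<le> (\<delta> * (\<integral>z. norm (dyadic_kernel 1 z) \<partial>lborel) * (nrm2 lborel \<psi> * nrm2 lborel g)) * (1/2)^k" for k
  proof -
    have half: "t (Suc k) = t k / 2" by (simp add: t_def)
    have [measurable]: "dyadic_kernel (t k) \<in> borel_measurable borel" by (rule dyadic_kernel_measurable[OF t(1)])
    have "newton_flux g (t (Suc k)) y - newton_flux g (t k) y = (\<integral>z. g (z + y) \<bullet> dyadic_kernel (t k) z \<partial>lborel)" for y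
    proof -
      have "newton_flux g (t (Suc k)) y - newton_flux g (t k) y = (\<integral>x. g x \<bullet> grad_newton (t (Suc k)) (x - y) - g x \<bullet> grad_newton (t k) (x - y) \<partial>lborel)"
        unfolding newton_flux_def
        by (rule Bochner_Integration.integral_diff[symmetric]) (intro L2_inner_integrable g grad_newton_L2_lborel t)+
      also have "\<dots> = (\<integral>x. g x \<bullet> dyadic_kernel (t k) (x - y) \<partial>lborel)"
        unfolding half dyadic_kernel_def by (simp add: inner_diff_right)
      also have "\<dots> = (\<integral>z. g (z + y) \<bullet> dyadic_kernel (t k) (z + y - y) \<partial>lborel)"
        by (rule lborel_shift(1)[symmetric]) measurable
      finally show ?thesis by simp
    qed
    then have "I (Suc k) - I k = (\<integral>y. \<psi> y * (\<integral>z. g (z + y) \<bullet> dyadic_kernel (t k) z \<partial>lborel) \<partial>lborel)"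
      unfolding I_def by (simp add: Bochner_Integration.integral_diff[OF flux_int flux_int, OF t(1) t(1), symmetric] right_diff_distrib[symmetric])
    then have "\<bar>I (Suc k) - I k\<bar> \<le> (\<integral>z. norm (dyadic_kernel (t k) z) \<partial>lborel) * (nrm2 lborel \<psi> * nrm2 lborel g)"
      using young_trilinear[OF \<psi>2 g dyadic_kernel_integral(1)[OF t(1)], of k] by simp
    then show ?thesis unfolding dyadic_kernel_integral(2)[OF t(1)] by (simp add: t_def mult_ac)
  qed
  define D where "D = B * plummer_mass * (1 + 2 * R) ^ 3 + 3072 * B * measure lborel (cball (0::real^3) R)"
  have dom: "integrable lborel (\<lambda>x. D * (\<bar>v x * theta x\<bar> * (theta x)\<^sup>2))"
    using L2_prod_integrable[OF vth th2] by (intro integrable_mult_right) simp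
  define S where "S k x = (\<integral>y. plummer (t k) (x - y) * \<psi> y \<partial>lborel)" for k x
  have pm [measurable]: "plummer (t k) \<in> borel_measurable borel" for k by (rule plummer_measurable[OF t(1)])
  have Sabs: "(\<integral>y. plummer (t k) (x - y) * \<bar>\<psi> y\<bar> \<partial>lborel) \<le> D * theta x ^ 3" for k x
    unfolding D_def by (rule plummer_convolution_bound[OF t \<psi>m B R])
  have vth3: "\<bar>v x\<bar> * (D * theta x ^ 3) = D * (\<bar>v x * theta x\<bar> * (theta x)\<^sup>2)" for x
    using theta_pos[of x] by (simp add: abs_mult eval_nat_numeral mult_ac)
  have I_eq: "I k = (\<integral>x. v x * S k x \<partial>lborel)" for k
  proof -
    define F where "F x y = v x * (plummer (t k) (x - y) * \<psi> y)" for x y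
    have [measurable]: "case_prod F \<in> borel_measurable (lborel \<Otimes>\<^sub>M lborel)" unfolding F_def by measurable
    have i1: "integrable lborel (F x)" for x
      unfolding F_def by (intro integrable_mult_right plummer_convolution(2)[OF t(1) \<psi>m B])
    have nF: "(\<integral>y. norm (F x y) \<partial>lborel) \<le> D * (\<bar>v x * theta x\<bar> * (theta x)\<^sup>2)" for x
    proof -
      have "(\<integral>y. norm (F x y) \<partial>lborel) = \<bar>v x\<bar> * (\<integral>y. plummer (t k) (x - y) * \<bar>\<psi> y\<bar> \<partial>lborel)"
        unfolding F_def using plummer_nonneg[OF t(1)] by (simp add: abs_mult)
      also have "\<dots> \<le> \<bar>v x\<bar> * (D * theta x ^ 3)" by (intro mult_left_mono Sabs) simp
      finally show ?thesis unfolding vth3 .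
    qed
    have int: "integrable (lborel \<Otimes>\<^sub>M lborel) (case_prod F)"
    proof (rule lborel_pair.Fubini_integrable)
      show "integrable lborel (\<lambda>x. \<integral>y. norm (case_prod F (x, y)) \<partial>lborel)"
        by (rule Bochner_Integration.integrable_bound[OF dom])
           (use order_trans[OF nF abs_ge_self] in \<open>auto intro!: AE_I2\<close>)
    qed (use i1 in auto)
    have "I k = (\<integral>y. (\<integral>x. F x y \<partial>lborel) \<partial>lborel)"
    proof -
      have "\<psi> y * newton_flux g (t k) y = (\<integral>x. F x y \<partial>lborel)" for y
      proof -
        have [measurable]: "grad_newton (t k) \<in> borel_measurable borel" by (rule grad_newton_measurable[OF t(1)])
        have "newton_flux g (t k) y = (\<integral>x. v x * plummer (t k) (x - y) \<partial>lborel)"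
          using newton_representation(2)[OF t(1)[of k] v gL w, of y] unfolding newton_flux_def
          by (simp add: integral_completion)
        then show ?thesis unfolding F_def by (simp add: mult.commute[of "\<psi> y"] flip: mult.assoc)
      qed
      then show ?thesis unfolding I_def by simp
    qed
    also have "\<dots> = (\<integral>x. (\<integral>y. F x y \<partial>lborel) \<partial>lborel)" by (rule lborel_pair.Fubini_integral[OF int])
    finally show ?thesis unfolding F_def S_def by simp
  qed
  have Slim: "(\<lambda>k. S k x) \<longlonglongrightarrow> plummer_mass * \<psi> x" for x
  proof -
    have "(\<lambda>k. \<integral>z. plummer 1 z * \<psi> (x - t k *\<^sub>R z) \<partial>lborel) \<longlonglongrightarrow> (\<integral>z. plummer 1 z * \<psi> x \<partial>lborel)"
    proof (rule integral_dominated_convergence[where w="\<lambda>z. plummer 1 z * B"])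
      have p1 [measurable]: "plummer 1 \<in> borel_measurable borel" by (simp add: plummer_measurable)
      show "(\<lambda>z. plummer 1 z * \<psi> x) \<in> borel_measurable lborel" "(\<lambda>z. plummer 1 z * \<psi> (x - t k *\<^sub>R z)) \<in> borel_measurable lborel" for k
        by measurable
      show "integrable lborel (\<lambda>z. plummer 1 z * B)" by (intro integrable_mult_left plummer_1_integrable)
      show "AE z in lborel. (\<lambda>k. plummer 1 z * \<psi> (x - t k *\<^sub>R z)) \<longlonglongrightarrow> plummer 1 z * \<psi> x"
      proof (intro AE_I2 tendsto_mult_left)
        fix z
        have "(\<lambda>k. x - t k *\<^sub>R z) \<longlonglongrightarrow> x - 0 *\<^sub>R z" by (intro tendsto_intros tlim)
        then have "(\<lambda>k. x - t k *\<^sub>R z) \<longlonglongrightarrow> x" by simp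
        moreover have "isCont \<psi> x" using \<psi>c by (simp add: continuous_on_eq_continuous_at)
        ultimately show "(\<lambda>k. \<psi> (x - t k *\<^sub>R z)) \<longlonglongrightarrow> \<psi> x" by (rule isCont_tendsto_compose[rotated])
      qed
      show "AE z in lborel. norm (plummer 1 z * \<psi> (x - t k *\<^sub>R z)) \<le> plummer 1 z * B" for k
        using plummer_nonneg[of 1] by (intro AE_I2) (auto simp: abs_mult intro!: mult_left_mono B)
    qed
    then show ?thesis unfolding S_def plummer_convolution(1)[OF t(1) \<psi>m B] by (simp add: plummer_mass_def)
  qed
  have "I \<longlonglongrightarrow> (\<integral>x. v x * (plummer_mass * \<psi> x) \<partial>lborel)"
    unfolding I_eq
  proof (rule integral_dominated_convergence[OF _ _ dom])
    show "AE x in lborel. (\<lambda>k. v x * S k x) \<longlonglongrightarrow> v x * (plummer_mass * \<psi> x)"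
      by (intro AE_I2 tendsto_mult_left Slim)
    show "AE x in lborel. norm (v x * S k x) \<le> D * (\<bar>v x * theta x\<bar> * (theta x)\<^sup>2)" for k
    proof (rule AE_I2)
      fix x
      have "\<bar>S k x\<bar> \<le> (\<integral>y. norm (plummer (t k) (x - y) * \<psi> y) \<partial>lborel)" unfolding S_def
        using integral_norm_bound[of lborel "\<lambda>y. plummer (t k) (x - y) * \<psi> y"] by simp
      also have "\<dots> = (\<integral>y. plummer (t k) (x - y) * \<bar>\<psi> y\<bar> \<partial>lborel)"
        using plummer_nonneg[OF t(1)] by (simp add: abs_mult)
      also have "\<dots> \<le> D * theta x ^ 3" by (rule Sabs)
      finally have "\<bar>v x\<bar> * \<bar>S k x\<bar> \<le> \<bar>v x\<bar> * (D * theta x ^ 3)" by (intro mult_left_mono) auto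
      then show "norm (v x * S k x) \<le> D * (\<bar>v x * theta x\<bar> * (theta x)\<^sup>2)" unfolding vth3 by (simp add: abs_mult)
    qed
    show "(\<lambda>x. v x * (plummer_mass * \<psi> x)) \<in> borel_measurable lborel" "(\<lambda>x. v x * S k x) \<in> borel_measurable lborel" for k
      unfolding S_def by measurable
  qed
  moreover have "(\<integral>x. v x * (plummer_mass * \<psi> x) \<partial>lborel) = plummer_mass * (\<integral>x. v x * \<psi> x \<partial>lborel)"
    by (simp add: mult.left_commute)
  ultimately have "\<bar>plummer_mass * (\<integral>x. v x * \<psi> x \<partial>lborel) - I 0\<bar> \<le> 2 * (\<delta> * (\<integral>z. norm (dyadic_kernel 1 z) \<partial>lborel) * (nrm2 lborel \<psi> * nrm2 lborel g))"
    using telescoping_bound[OF step] by simp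
  moreover have "t 0 = \<delta>" by (simp add: t_def)
  ultimately show ?thesis unfolding I_def by simp
qed

text \<open>The strong compactness statement: the test functions \<psi> n may oscillate arbitrarily with n. At a
fixed scale the flux tends to 0 boundedly, by dominated convergence on the common support; the error
of replacing v n by its smoothing is uniformly small.\<close>

lemma vanishing_flux_imp_vanishing_pairing:
  assumes v: "\<And>n. v n \<in> L2_theta" "\<And>n::nat. v n \<in> borel_measurable borel"
    and g: "\<And>n. g n \<in> L2 lborel" "\<And>n. is_weak_gradient (v n) (g n)" "\<And>n. nrm2 lborel (g n) \<le> C"
    and flux: "\<And>\<tau> y. 0 < \<tau> \<Longrightarrow> (\<lambda>n. newton_flux (g n) \<tau> y) \<longlonglongrightarrow> 0"
    and \<psi>: "\<And>n. continuous_on UNIV (\<psi> n)" "\<And>n x. \<bar>\<psi> n x\<bar> \<le> B" "1 \<le> R" "\<And>n x. R < norm x \<Longrightarrow> \<psi> n x = 0"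
  shows "(\<lambda>n. \<integral>x. v n x * \<psi> n x \<partial>lborel) \<longlonglongrightarrow> 0"
proof -
  have C0: "0 \<le> C" using order_trans[OF nrm2_nonneg g(3)] .
  have B0: "0 \<le> B" using order_trans[OF abs_ge_zero \<psi>(2)] .
  have \<psi>m [measurable]: "\<psi> n \<in> borel_measurable borel" for n by (rule borel_measurable_continuous_onI[OF \<psi>(1)])
  define G where "G = (\<lambda>x::real^3. B * indicator (cball 0 R) x)"
  have G2: "G \<in> L2 lborel"
    unfolding G_def using L2_cmult[OF L2_indicator_cball[of R], of B]
    by (subst L2_leb_iff[symmetric]) (intro borel_measurable_times borel_measurable_indicator borel_measurable_const, simp)
  have Gint: "integrable lborel G"
    unfolding G_def using emeasure_lborel_cball_finite[of "0::real^3" R]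
    by (intro integrable_mult_right integrable_real_indicator) auto
  have \<psi>G: "\<bar>\<psi> n x\<bar> \<le> G x" for n x
    unfolding G_def using \<psi>(2)[of n x] \<psi>(4)[of x n] by (cases "norm x \<le> R") auto
  have G0: "0 \<le> G x" for x using order_trans[OF abs_ge_zero \<psi>G] .
  have \<psi>n: "nrm2 lborel (\<psi> n) \<le> nrm2 lborel G" for n
    by (rule nrm2_mono[OF _ G2]) (use \<psi>G G0 in auto)
  define K where "K = 2 * ((\<integral>z. norm (dyadic_kernel 1 z) \<partial>lborel) * (nrm2 lborel G * C))"
  have K0: "0 \<le> K" unfolding K_def using C0 by simp
  have err: "\<bar>plummer_mass * (\<integral>x. v n x * \<psi> n x \<partial>lborel) - (\<integral>y. \<psi> n y * newton_flux (g n) \<delta> y \<partial>lborel)\<bar> \<le> \<delta> * K"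
    if "0 < \<delta>" "\<delta> \<le> 1" for n \<delta>
  proof -
    have "\<bar>plummer_mass * (\<integral>x. v n x * \<psi> n x \<partial>lborel) - (\<integral>y. \<psi> n y * newton_flux (g n) \<delta> y \<partial>lborel)\<bar>
      \<le> 2 * (\<delta> * (\<integral>z. norm (dyadic_kernel 1 z) \<partial>lborel) * (nrm2 lborel (\<psi> n) * nrm2 lborel (g n)))"
      by (rule mollification_error[OF v(1) v(2) g(1) g(2) \<psi>(1) \<psi>(2) \<psi>(3) \<psi>(4) that])
    also have "\<dots> \<le> 2 * (\<delta> * (\<integral>z. norm (dyadic_kernel 1 z) \<partial>lborel) * (nrm2 lborel G * C))"
      using that C0 \<psi>n[of n] g(3)[of n] by (intro mult_left_mono mult_mono) auto
    finally show ?thesis by (simp add: K_def mult_ac)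
  qed
  have van: "(\<lambda>n. \<integral>y. \<psi> n y * newton_flux (g n) \<delta> y \<partial>lborel) \<longlonglongrightarrow> 0" if \<delta>: "0 < \<delta>" for \<delta>
  proof -
    have fb: "\<bar>newton_flux (g n) \<delta> y\<bar> \<le> C * nrm2 lborel (grad_newton \<delta>)" for n y
      using newton_flux_bound[OF g(1) \<delta>, of n y] mult_right_mono[OF g(3)[of n], of "nrm2 lborel (grad_newton \<delta>)"] by simp
    have [measurable]: "newton_flux (g n) \<delta> \<in> borel_measurable borel" for n
      using g(1)[of n] by (intro newton_flux_measurable \<delta>) (simp add: L2_def)
    have "(\<lambda>n. \<integral>y. \<psi> n y * newton_flux (g n) \<delta> y \<partial>lborel) \<longlonglongrightarrow> (\<integral>y. 0 \<partial>(lborel :: (real^3) measure))"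
    proof (rule integral_dominated_convergence[where w="\<lambda>y. G y * (C * nrm2 lborel (grad_newton \<delta>))"])
      show "integrable lborel (\<lambda>y. G y * (C * nrm2 lborel (grad_newton \<delta>)))" by (intro integrable_mult_left Gint)
      show "AE y in lborel. (\<lambda>n. \<psi> n y * newton_flux (g n) \<delta> y) \<longlonglongrightarrow> 0"
      proof (rule AE_I2)
        fix y
        show "(\<lambda>n. \<psi> n y * newton_flux (g n) \<delta> y) \<longlonglongrightarrow> 0"
        proof (rule tendsto_0_le[OF flux[OF \<delta>, of y]])
          show "\<forall>\<^sub>F n in sequentially. norm (\<psi> n y * newton_flux (g n) \<delta> y) \<le> norm (newton_flux (g n) \<delta> y) * G y"
          proof (intro always_eventually allI)
            fix n
            show "norm (\<psi> n y * newton_flux (g n) \<delta> y) \<le> norm (newton_flux (g n) \<delta> y) * G y"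
              using mult_right_mono[OF \<psi>G[of n y] abs_ge_zero, of "newton_flux (g n) \<delta> y"]
              by (simp add: abs_mult mult.commute)
          qed
        qed
      qed
      show "AE y in lborel. norm (\<psi> n y * newton_flux (g n) \<delta> y) \<le> G y * (C * nrm2 lborel (grad_newton \<delta>))" for n
        unfolding real_norm_def abs_mult by (intro AE_I2 mult_mono \<psi>G fb G0) auto
    qed measurable
    then show ?thesis by simp
  qed
  show ?thesis
  proof (rule LIMSEQ_I)
    fix e :: real assume e: "0 < e"
    define e' where "e' = plummer_mass * e / 2"
    have e': "0 < e'" unfolding e'_def using e plummer_mass_pos by simp
    define \<delta> where "\<delta> = min 1 (e' / (K + 1))"
    have \<delta>: "0 < \<delta>" "\<delta> \<le> 1" unfolding \<delta>_def using e' K0 by auto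
    have "\<delta> * K \<le> e' / (K + 1) * K" unfolding \<delta>_def using K0 by (intro mult_right_mono) auto
    also have "\<dots> \<le> e'" using K0 e' by (simp add: field_simps)
    finally have \<delta>K: "\<delta> * K \<le> e'" .
    obtain N where N: "\<And>n. n \<ge> N \<Longrightarrow> \<bar>\<integral>y. \<psi> n y * newton_flux (g n) \<delta> y \<partial>lborel\<bar> < e'"
      using LIMSEQ_D[OF van[OF \<delta>(1)] e'] by auto
    have "\<bar>\<integral>x. v n x * \<psi> n x \<partial>lborel\<bar> < e" if "n \<ge> N" for n
    proof -
      have "plummer_mass * \<bar>\<integral>x. v n x * \<psi> n x \<partial>lborel\<bar> = \<bar>plummer_mass * (\<integral>x. v n x * \<psi> n x \<partial>lborel)\<bar>"
        using plummer_mass_pos by (simp add: abs_mult)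
      also have "\<dots> < e' + e'" using err[OF \<delta>, of n] N[OF that] \<delta>K by linarith
      also have "\<dots> = plummer_mass * e" by (simp add: e'_def)
      finally show ?thesis using plummer_mass_pos by simp
    qed
    then show "\<exists>no. \<forall>n\<ge>no. norm ((\<integral>x. v n x * \<psi> n x \<partial>lborel) - 0) < e" by (intro exI[of _ N]) simp
  qed
qed

section \<open>Ergodic averages along a typical trajectory\<close>

context stochastic_setting
begin

lemma continuous_measurable:
  fixes f :: "'w \<Rightarrow> 'c::topological_space"
  assumes "continuous_on UNIV f" shows "f \<in> borel_measurable P"
proof (rule measurableI)
  fix A :: "'c set" assume "A \<in> sets borel"
  then have "f -` A \<inter> space borel \<in> sets borel"
    by (rule measurable_sets[OF borel_measurable_continuous_onI[OF assms]])
  then show "f -` A \<inter> space P \<in> sets P" using borel_subset by (auto simp: space_P)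
qed simp

lemma continuous_bounded:
  fixes f :: "'w \<Rightarrow> real"
  assumes "continuous_on UNIV f" shows "\<exists>B>0. \<forall>\<omega>. \<bar>f \<omega>\<bar> \<le> B"
proof -
  have "bounded (range f)" using compact_imp_bounded[OF compact_continuous_image[OF assms compact_UNIV]] .
  then show ?thesis unfolding bounded_pos by auto
qed

lemma continuous_integrable:
  fixes f :: "'w \<Rightarrow> real"
  assumes "continuous_on UNIV f" shows "integrable P f"
proof -
  obtain B where "\<And>\<omega>. \<bar>f \<omega>\<bar> \<le> B" using continuous_bounded[OF assms] by blast
  then show ?thesis by (intro integrable_const_bound[of _ B] AE_I2 continuous_measurable assms) auto
qed

lemma continuous_L2:
  fixes f :: "'w \<Rightarrow> real"
  assumes "continuous_on UNIV f" shows "f \<in> L2 P"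
proof (rule L2I)
  show "integrable P (\<lambda>x. (norm (f x))\<^sup>2)"
    by (intro continuous_integrable continuous_intros assms)
qed (rule continuous_measurable[OF assms])

lemma trajectory_continuous: "continuous_on UNIV (\<lambda>x. T x \<omega>)"
  using continuous_on_compose2[OF T_joint_continuous, of UNIV "\<lambda>x. (x, \<omega>)"]
  by (simp add: continuous_on_Pair)

lemma T_continuous: "continuous_on UNIV (T x)"
  using continuous_on_compose2[OF T_joint_continuous, of UNIV "\<lambda>\<omega>. (x, \<omega>)"]
  by (simp add: continuous_on_Pair)

lemma along_trajectory_continuous:
  assumes "continuous_on UNIV f" shows "continuous_on UNIV (\<lambda>x. f (T x \<omega>))"
  by (rule continuous_on_compose2[OF assms trajectory_continuous]) simp

lemma T_distr: "distr P P (T x) = P"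
proof (rule measure_eqI)
  fix A assume "A \<in> sets (distr P P (T x))"
  then have A: "A \<in> sets P" by simp
  then have "emeasure (distr P P (T x)) A = emeasure P (T x -` A)"
    by (subst emeasure_distr[OF T_measurable]) (auto simp: space_P)
  also have "\<dots> = emeasure P A"
    using T_preserving[OF A, of x] measurable_sets[OF T_measurable A, of x] A
    by (simp add: emeasure_eq_measure space_P)
  finally show "emeasure (distr P P (T x)) A = emeasure P A" .
qed simp

lemma T_integral:
  fixes f :: "'w \<Rightarrow> 'c::euclidean_space"
  assumes "f \<in> borel_measurable P"
  shows "(\<integral>\<omega>. f (T x \<omega>) \<partial>P) = (\<integral>\<omega>. f \<omega> \<partial>P)" "integrable P (\<lambda>\<omega>. f (T x \<omega>)) \<longleftrightarrow> integrable P f"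
  using integral_distr[OF T_measurable assms, of x] integrable_distr_eq[OF T_measurable assms, of x]
  by (simp_all add: T_distr)

lemma T_inverse: "T x (T (- x) \<omega>) = \<omega>" "T (- x) (T x \<omega>) = \<omega>"
  using T_add[of x "- x"] T_add[of "- x" x] T_zero by (simp_all add: fun_eq_iff o_def)

lemma T_comp: "T x (T y \<omega>) = T (x + y) \<omega>"
  by (simp add: T_add)

end

locale typical_trajectory = stochastic_setting +
  fixes \<omega>0
  assumes \<omega>0: "\<omega>0 \<in> typical P T (\<lambda>_. 1)"
begin

lemma oscillation_measurable:
  fixes b :: "'a \<Rightarrow> real"
  assumes "continuous_on UNIV b" shows "(\<lambda>x. b (T (x /\<^sub>R \<epsilon>) \<omega>0)) \<in> borel_measurable borel"
proof (rule borel_measurable_continuous_onI)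
  show "continuous_on UNIV (\<lambda>x. b (T (x /\<^sub>R \<epsilon>) \<omega>0))"
    by (rule continuous_on_compose2[OF along_trajectory_continuous[OF assms]]) (auto intro!: continuous_intros)
qed

text \<open>The defining property of a typical point with f = b and t = 1/\<epsilon>, after the change of variables that
turns the dilated set into a fixed one.\<close>

lemma oscillation_indicator:
  fixes b :: "'a \<Rightarrow> real"
  assumes A: "A \<in> sets borel" "bounded A" and b: "continuous_on UNIV b"
  shows "((\<lambda>\<epsilon>. \<integral>x. indicator A x * b (T (x /\<^sub>R \<epsilon>) \<omega>0) \<partial>lborel) \<longlongrightarrow> measure lborel A * (\<integral>\<omega>. b \<omega> \<partial>P)) (at_right 0)"
proof (cases "measure lborel A = 0")
  case True
  have "emeasure lborel A \<noteq> \<infinity>" using emeasure_bounded_finite[OF A(2)] by simp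
  then have "emeasure lborel A = 0" using True by (simp add: measure_def enn2real_eq_0_iff)
  then have "AE x in lborel. x \<notin> A" using A(1) by (intro AE_not_in) (auto simp: null_sets_def)
  then have z: "AE x in lborel. indicator A x * b (T (x /\<^sub>R \<epsilon>) \<omega>0) = 0" for \<epsilon>
    by eventually_elim simp
  have "(\<integral>x. indicator A x * b (T (x /\<^sub>R \<epsilon>) \<omega>0) \<partial>lborel) = 0" for \<epsilon>
    by (rule integral_eq_zero_AE[OF z])
  then show ?thesis using True by simp
next
  case False
  then have pos: "0 < measure lebesgue A" using A(1) by (simp add: measure_completion zero_less_measure_iff)
  have "((\<lambda>t. 1 / (t ^ 3 * measure lebesgue A) * (LINT x:(\<lambda>x. t *\<^sub>R x) ` A|lebesgue. b (T x \<omega>0) * 1))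
          \<longlongrightarrow> (\<integral>\<omega>. b \<omega> * 1 \<partial>P)) at_top"
    using \<omega>0 A pos b unfolding typical_def by blast
  then have "((\<lambda>\<epsilon>. 1 / (inverse \<epsilon> ^ 3 * measure lebesgue A) * (LINT x:(\<lambda>x. inverse \<epsilon> *\<^sub>R x) ` A|lebesgue. b (T x \<omega>0) * 1))
          \<longlongrightarrow> (\<integral>\<omega>. b \<omega> * 1 \<partial>P)) (at_right 0)"
    by (rule filterlim_compose) (rule filterlim_inverse_at_top_right)
  from tendsto_mult_left[OF this, of "measure lebesgue A"]
  have lim: "((\<lambda>\<epsilon>. measure lebesgue A * (1 / (inverse \<epsilon> ^ 3 * measure lebesgue A) * (LINT x:(\<lambda>x. inverse \<epsilon> *\<^sub>R x) ` A|lebesgue. b (T x \<omega>0) * 1)))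
          \<longlongrightarrow> measure lborel A * (\<integral>\<omega>. b \<omega> \<partial>P)) (at_right 0)"
    using A(1) by (simp add: measure_completion)
  have eq: "measure lebesgue A * (1 / (inverse \<epsilon> ^ 3 * measure lebesgue A) * (LINT x:(\<lambda>x. inverse \<epsilon> *\<^sub>R x) ` A|lebesgue. b (T x \<omega>0) * 1))
     = (\<integral>x. indicator A x * b (T (x /\<^sub>R \<epsilon>) \<omega>0) \<partial>lborel)" if \<epsilon>: "0 < \<epsilon>" for \<epsilon>
  proof -
    let ?tA = "(\<lambda>x. inverse \<epsilon> *\<^sub>R x) ` A"
    have "?tA = (\<lambda>x. \<epsilon> *\<^sub>R x) -` A \<inter> space borel"
      using \<epsilon> by (auto simp: image_iff intro!: bexI[of _ "\<epsilon> *\<^sub>R _"])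
    moreover have "(\<lambda>x. \<epsilon> *\<^sub>R x) -` A \<inter> space borel \<in> sets borel"
      by (rule measurable_sets[OF _ A(1)]) measurable
    ultimately have tA: "?tA \<in> sets borel" by simp
    have bm: "(\<lambda>x. b (T x \<omega>0)) \<in> borel_measurable borel"
      by (intro borel_measurable_continuous_onI along_trajectory_continuous b)
    have m: "(\<lambda>x. indicator ?tA x * b (T x \<omega>0)) \<in> borel_measurable borel"
      by (intro borel_measurable_times borel_measurable_indicator tA bm)
    have "(LINT x:?tA|lebesgue. b (T x \<omega>0) * 1) = (\<integral>x. indicator ?tA x * b (T x \<omega>0) \<partial>lborel)"
      unfolding set_lebesgue_integral_def using m by (simp add: integral_completion)
    also have "\<dots> = \<bar>inverse \<epsilon>\<bar> ^ 3 * (\<integral>x. indicator ?tA (0 + inverse \<epsilon> *\<^sub>R x) * b (T (0 + inverse \<epsilon> *\<^sub>R x) \<omega>0) \<partial>lborel)"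
      by (rule lborel_scale(1)[OF m]) (use \<epsilon> in simp)
    also have "(\<lambda>x. indicator ?tA (0 + inverse \<epsilon> *\<^sub>R x) :: real) = indicator A"
      using \<epsilon> by (auto simp: fun_eq_iff indicator_def)
    finally have "(LINT x:?tA|lebesgue. b (T x \<omega>0) * 1) = inverse \<epsilon> ^ 3 * (\<integral>x. indicator A x * b (T (x /\<^sub>R \<epsilon>) \<omega>0) \<partial>lborel)"
      using \<epsilon> by simp
    moreover have "m * (1 / (c * m) * (c * X)) = X" if "0 < m" "0 < c" for m c X :: real using that by simp
    ultimately show ?thesis using \<epsilon> pos by (simp only:) simp
  qed
  show ?thesis
    by (rule Lim_transform_eventually[OF lim]) (use eq in \<open>auto simp: eventually_at_filter\<close>)
qed

text \<open>The ergodic limit for the weight \<phi>; the class of such \<phi> turns out to be all of L1.\<close>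

definition oscillates :: "(real^3 \<Rightarrow> real) \<Rightarrow> ('a \<Rightarrow> real) \<Rightarrow> bool" where
  "oscillates \<phi> b \<longleftrightarrow> ((\<lambda>\<epsilon>. \<integral>x. \<phi> x * b (T (x /\<^sub>R \<epsilon>) \<omega>0) \<partial>lborel) \<longlongrightarrow> (\<integral>x. \<phi> x \<partial>lborel) * (\<integral>\<omega>. b \<omega> \<partial>P)) (at_right 0)"

lemma oscillation_integrable:
  fixes b :: "'a \<Rightarrow> real"
  assumes "integrable lborel \<phi>" and b: "continuous_on UNIV b"
  shows "integrable lborel (\<lambda>x. \<phi> x * b (T (x /\<^sub>R \<epsilon>) \<omega>0))"
proof -
  obtain B where B: "\<And>\<omega>. \<bar>b \<omega>\<bar> \<le> B" using continuous_bounded[OF b] by blast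
  show ?thesis
  proof (rule Bochner_Integration.integrable_bound[OF integrable_mult_left[OF assms(1), of B]])
    show "AE x in lborel. norm (\<phi> x * b (T (x /\<^sub>R \<epsilon>) \<omega>0)) \<le> norm (\<phi> x * B)"
      using order_trans[OF B abs_ge_self] by (intro AE_I2) (auto simp: abs_mult intro!: mult_left_mono)
    show "(\<lambda>x. \<phi> x * b (T (x /\<^sub>R \<epsilon>) \<omega>0)) \<in> borel_measurable lborel"
      using oscillation_measurable[OF b] borel_measurable_integrable[OF assms(1)] by measurable
  qed
qed

text \<open>Both sides depend continuously on \<phi> in L1, uniformly in \<epsilon>, because b is bounded.\<close>

lemma oscillates_approx:
  fixes b :: "'a \<Rightarrow> real"
  assumes \<phi>: "integrable lborel \<phi>" and b: "continuous_on UNIV b"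
    and ap: "\<And>\<eta>. 0 < \<eta> \<Longrightarrow> \<exists>g. integrable lborel g \<and> oscillates g b \<and> (\<integral>x. \<bar>\<phi> x - g x\<bar> \<partial>lborel) < \<eta>"
  shows "oscillates \<phi> b"
  unfolding oscillates_def
proof (rule tendstoI)
  fix e :: real assume e: "0 < e"
  obtain B where B0: "B > 0" and B: "\<And>\<omega>. \<bar>b \<omega>\<bar> \<le> B" using continuous_bounded[OF b] by blast
  have "0 < e / (3 * B)" using e B0 by simp
  then obtain g where g: "integrable lborel g" "oscillates g b" "(\<integral>x. \<bar>\<phi> x - g x\<bar> \<partial>lborel) < e / (3 * B)" using ap by blast
  let ?d = "(\<integral>x. \<bar>\<phi> x - g x\<bar> \<partial>lborel)"
  have d: "?d * B < e / 3" using g(3) B0 by (simp add: field_simps)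
  have idiff: "integrable lborel (\<lambda>x. \<phi> x - g x)" using \<phi> g(1) by simp
  have Eb: "\<bar>\<integral>\<omega>. b \<omega> \<partial>P\<bar> \<le> B"
  proof -
    have "\<bar>\<integral>\<omega>. b \<omega> \<partial>P\<bar> \<le> (\<integral>\<omega>. \<bar>b \<omega>\<bar> \<partial>P)" by (rule integral_abs_bound)
    also have "\<dots> \<le> (\<integral>\<omega>. B \<partial>P)" by (intro integral_mono integrable_abs continuous_integrable b B) simp
    finally show ?thesis by (simp add: prob_space)
  qed
  have 1: "\<bar>(\<integral>x. \<phi> x * b (T (x /\<^sub>R \<epsilon>) \<omega>0) \<partial>lborel) - (\<integral>x. g x * b (T (x /\<^sub>R \<epsilon>) \<omega>0) \<partial>lborel)\<bar> \<le> ?d * B" for \<epsilon>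
  proof -
    have "(\<integral>x. \<phi> x * b (T (x /\<^sub>R \<epsilon>) \<omega>0) \<partial>lborel) - (\<integral>x. g x * b (T (x /\<^sub>R \<epsilon>) \<omega>0) \<partial>lborel)
      = (\<integral>x. (\<phi> x - g x) * b (T (x /\<^sub>R \<epsilon>) \<omega>0) \<partial>lborel)"
      using oscillation_integrable[OF \<phi> b] oscillation_integrable[OF g(1) b] by (simp add: left_diff_distrib)
    also have "\<bar>\<dots>\<bar> \<le> (\<integral>x. \<bar>(\<phi> x - g x) * b (T (x /\<^sub>R \<epsilon>) \<omega>0)\<bar> \<partial>lborel)" by (rule integral_abs_bound)
    also have "\<dots> \<le> (\<integral>x. \<bar>\<phi> x - g x\<bar> * B \<partial>lborel)"
      using B by (intro integral_mono integrable_abs oscillation_integrable idiff b integrable_mult_left) (auto simp: abs_mult intro!: mult_left_mono)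
    finally show ?thesis by simp
  qed
  have 2: "\<bar>(\<integral>x. \<phi> x \<partial>lborel) * (\<integral>\<omega>. b \<omega> \<partial>P) - (\<integral>x. g x \<partial>lborel) * (\<integral>\<omega>. b \<omega> \<partial>P)\<bar> \<le> ?d * B"
  proof -
    have "(\<integral>x. \<phi> x \<partial>lborel) * (\<integral>\<omega>. b \<omega> \<partial>P) - (\<integral>x. g x \<partial>lborel) * (\<integral>\<omega>. b \<omega> \<partial>P) = (\<integral>x. \<phi> x - g x \<partial>lborel) * (\<integral>\<omega>. b \<omega> \<partial>P)"
      using \<phi> g(1) by (simp add: left_diff_distrib)
    also have "\<bar>\<dots>\<bar> \<le> ?d * B" unfolding abs_mult by (intro mult_mono Eb integral_abs_bound) auto
    finally show ?thesis .
  qed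
  have "\<forall>\<^sub>F \<epsilon> in at_right 0. dist (\<integral>x. g x * b (T (x /\<^sub>R \<epsilon>) \<omega>0) \<partial>lborel) ((\<integral>x. g x \<partial>lborel) * (\<integral>\<omega>. b \<omega> \<partial>P)) < e / 3"
    using g(2) e unfolding oscillates_def by (intro tendstoD) auto
  then show "\<forall>\<^sub>F \<epsilon> in at_right 0. dist (\<integral>x. \<phi> x * b (T (x /\<^sub>R \<epsilon>) \<omega>0) \<partial>lborel) ((\<integral>x. \<phi> x \<partial>lborel) * (\<integral>\<omega>. b \<omega> \<partial>P)) < e"
  proof eventually_elim
    case (elim \<epsilon>)
    define e3 where "e3 = e / 3"
    have e3: "e = 3 * e3" by (simp add: e3_def)
    show ?case using elim 1[of \<epsilon>] 2 d unfolding dist_real_def e3_def[symmetric] e3 by linarith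
  qed
qed

text \<open>Induction over the construction of integrable functions; sets of finite measure are exhausted by
bounded ones.\<close>

lemma oscillates_L1_lborel:
  fixes b :: "'a \<Rightarrow> real"
  assumes "integrable lborel \<phi>" and b: "continuous_on UNIV b"
  shows "oscillates \<phi> b"
  using assms(1)
proof (induction rule: integrable_induct)
  case (base A c)
  have iA: "integrable lborel (\<lambda>x. indicator A x *\<^sub>R c)" using base by simp
  show ?case
  proof (rule oscillates_approx[OF iA b])
    fix \<eta> :: real assume \<eta>: "0 < \<eta>"
    let ?A = "\<lambda>n::nat. A \<inter> cball 0 (real n)"
    have Am: "A \<in> sets borel" "?A n \<in> sets borel" for n using base(1) by auto
    have "(\<lambda>n. \<integral>x. \<bar>indicator A x *\<^sub>R c - indicator (?A n) x *\<^sub>R c\<bar> \<partial>lborel) \<longlonglongrightarrow> (\<integral>x. 0 \<partial>(lborel :: (real^3) measure))"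
    proof (rule integral_dominated_convergence[where w="\<lambda>x. \<bar>indicator A x *\<^sub>R c\<bar>"])
      show "AE x in lborel. (\<lambda>n. \<bar>indicator A x *\<^sub>R c - indicator (?A n) x *\<^sub>R c\<bar>) \<longlonglongrightarrow> 0"
      proof (intro AE_I2 tendsto_eventually)
        fix x :: "real^3"
        obtain N where "norm x \<le> real N" using real_arch_simple by blast
        then show "\<forall>\<^sub>F n in sequentially. \<bar>indicator A x *\<^sub>R c - indicator (?A n) x *\<^sub>R c\<bar> = 0"
          by (auto simp: eventually_sequentially indicator_def intro!: exI[of _ N])
      qed
      show "AE x in lborel. norm \<bar>indicator A x *\<^sub>R c - indicator (?A n) x *\<^sub>R c\<bar> \<le> \<bar>indicator A x *\<^sub>R c\<bar>" for n
        by (auto simp: indicator_def)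
      show "(\<lambda>x. \<bar>indicator A x *\<^sub>R c - indicator (?A n) x *\<^sub>R c\<bar>) \<in> borel_measurable lborel" for n
        using Am by (intro borel_measurable_abs borel_measurable_diff borel_measurable_scaleR borel_measurable_indicator) auto
      show "integrable lborel (\<lambda>x. \<bar>indicator A x *\<^sub>R c\<bar>)" by (rule integrable_abs[OF iA])
    qed simp
    then have "\<forall>\<^sub>F n in sequentially. (\<integral>x. \<bar>indicator A x *\<^sub>R c - indicator (?A n) x *\<^sub>R c\<bar> \<partial>lborel) < \<eta>"
      using \<eta> by (intro order_tendstoD(2)[of _ 0]) auto
    then obtain n where n: "(\<integral>x. \<bar>indicator A x *\<^sub>R c - indicator (?A n) x *\<^sub>R c\<bar> \<partial>lborel) < \<eta>"
      by (auto simp: eventually_sequentially)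
    have bA: "bounded (?A n)" by (rule bounded_subset[OF bounded_cball]) auto
    have fA: "emeasure lborel (?A n) < \<infinity>" using emeasure_bounded_finite[OF bA] .
    have "oscillates (\<lambda>x. indicator (?A n) x *\<^sub>R c) b"
      using tendsto_mult_left[OF oscillation_indicator[OF Am(2) bA b], of c]
      unfolding oscillates_def by (simp add: mult_ac)
    moreover have "integrable lborel (\<lambda>x. indicator (?A n) x *\<^sub>R c)" using fA Am by simp
    ultimately show "\<exists>g. integrable lborel g \<and> oscillates g b \<and> (\<integral>x. \<bar>indicator A x *\<^sub>R c - g x\<bar> \<partial>lborel) < \<eta>"
      using n by blast
  qed
next
  case (add f g)
  have "((\<lambda>\<epsilon>. (\<integral>x. f x * b (T (x /\<^sub>R \<epsilon>) \<omega>0) \<partial>lborel) + (\<integral>x. g x * b (T (x /\<^sub>R \<epsilon>) \<omega>0) \<partial>lborel)) \<longlongrightarrow>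
     (\<integral>x. f x \<partial>lborel) * (\<integral>\<omega>. b \<omega> \<partial>P) + (\<integral>x. g x \<partial>lborel) * (\<integral>\<omega>. b \<omega> \<partial>P)) (at_right 0)"
    using add unfolding oscillates_def by (intro tendsto_add)
  then show ?case unfolding oscillates_def
    using add(1,2) oscillation_integrable[OF add(1) b] oscillation_integrable[OF add(2) b] by (simp add: distrib_right)
next
  case (lim f s)
  show ?case
  proof (rule oscillates_approx[OF lim.hyps(4) b])
    fix \<eta> :: real assume \<eta>: "0 < \<eta>"
    have "(\<lambda>n. \<integral>x. \<bar>f x - s n x\<bar> \<partial>lborel) \<longlonglongrightarrow> (\<integral>x. 0 \<partial>(lborel :: (real^3) measure))"
    proof (rule integral_dominated_convergence[where w="\<lambda>x. 3 * \<bar>f x\<bar>"])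
      show "AE x in lborel. (\<lambda>n. \<bar>f x - s n x\<bar>) \<longlonglongrightarrow> 0"
        using lim.hyps(2) by (intro AE_I2 tendsto_rabs_zero) (auto intro!: tendsto_eq_intros)
      show "AE x in lborel. norm \<bar>f x - s n x\<bar> \<le> 3 * \<bar>f x\<bar>" for n
      proof (rule AE_I2)
        fix x :: "real^3"
        have "\<bar>s n x\<bar> \<le> 2 * \<bar>f x\<bar>" using lim.hyps(3)[of x n] by simp
        then show "norm \<bar>f x - s n x\<bar> \<le> 3 * \<bar>f x\<bar>" by simp
      qed
    qed (use lim in auto)
    then have "\<forall>\<^sub>F n in sequentially. (\<integral>x. \<bar>f x - s n x\<bar> \<partial>lborel) < \<eta>"
      using \<eta> by (intro order_tendstoD(2)[of _ 0]) auto
    then obtain n where "(\<integral>x. \<bar>f x - s n x\<bar> \<partial>lborel) < \<eta>" by (auto simp: eventually_sequentially)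
    then show "\<exists>g. integrable lborel g \<and> oscillates g b \<and> (\<integral>x. \<bar>f x - g x\<bar> \<partial>lborel) < \<eta>" using lim.hyps(1) lim.IH by blast
  qed
qed

lemma oscillation_limit:
  fixes b :: "'a \<Rightarrow> real"
  assumes \<phi>: "integrable lebesgue \<phi>" and b: "continuous_on UNIV b"
  shows "((\<lambda>\<epsilon>. \<integral>x. \<phi> x * b (T (x /\<^sub>R \<epsilon>) \<omega>0) \<partial>lebesgue) \<longlongrightarrow> (\<integral>x. \<phi> x \<partial>lebesgue) * (\<integral>\<omega>. b \<omega> \<partial>P)) (at_right 0)"
    and "integrable lebesgue (\<lambda>x. \<phi> x * b (T (x /\<^sub>R \<epsilon>) \<omega>0))"
proof -
  have \<phi>m: "\<phi> \<in> borel_measurable lebesgue" using \<phi> by auto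
  then obtain f where f: "f \<in> borel_measurable lborel" and eq: "AE x in lborel. \<phi> x = f x"
    using completion_ex_borel_measurable_real by blast
  have fl: "f \<in> borel_measurable lebesgue" using f by (simp add: measurable_completion)
  have eql: "AE x in lebesgue. \<phi> x = f x" using AE_completion[OF eq] .
  have "integrable lebesgue f" by (rule integrable_cong_AE_imp[OF \<phi> fl eql])
  then have fi: "integrable lborel f" using f by (simp add: integrable_completion)
  have bm: "(\<lambda>x. b (T (x /\<^sub>R \<epsilon>) \<omega>0)) \<in> borel_measurable lebesgue" for \<epsilon>
    by (rule borel_lebesgue_measurable[OF oscillation_measurable[OF b]])
  have fbm: "(\<lambda>x. f x * b (T (x /\<^sub>R \<epsilon>) \<omega>0)) \<in> borel_measurable lborel" for \<epsilon>
    using oscillation_measurable[OF b] f by measurable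
  have ae: "AE x in lebesgue. \<phi> x * b (T (x /\<^sub>R \<epsilon>) \<omega>0) = f x * b (T (x /\<^sub>R \<epsilon>) \<omega>0)" for \<epsilon>
    using eql by eventually_elim simp
  have 1: "(\<integral>x. \<phi> x * b (T (x /\<^sub>R \<epsilon>) \<omega>0) \<partial>lebesgue) = (\<integral>x. f x * b (T (x /\<^sub>R \<epsilon>) \<omega>0) \<partial>lborel)" for \<epsilon>
    using integral_cong_AE[OF borel_measurable_times[OF \<phi>m bm] borel_measurable_times[OF fl bm] ae] fbm
    by (simp add: integral_completion)
  have 2: "(\<integral>x. \<phi> x \<partial>lebesgue) = (\<integral>x. f x \<partial>lborel)"
    using integral_cong_AE[OF \<phi>m fl eql] f by (simp add: integral_completion)
  show "((\<lambda>\<epsilon>. \<integral>x. \<phi> x * b (T (x /\<^sub>R \<epsilon>) \<omega>0) \<partial>lebesgue) \<longlongrightarrow> (\<integral>x. \<phi> x \<partial>lebesgue) * (\<integral>\<omega>. b \<omega> \<partial>P)) (at_right 0)"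
    unfolding 1 2 using oscillates_L1_lborel[OF fi b] by (simp add: oscillates_def)
  have "integrable lebesgue (\<lambda>x. f x * b (T (x /\<^sub>R \<epsilon>) \<omega>0))"
    using oscillation_integrable[OF fi b] fbm by (simp add: integrable_completion)
  then show "integrable lebesgue (\<lambda>x. \<phi> x * b (T (x /\<^sub>R \<epsilon>) \<omega>0))"
  proof (rule integrable_cong_AE_imp[OF _ borel_measurable_times[OF \<phi>m bm]])
    show "AE x in lebesgue. f x * b (T (x /\<^sub>R \<epsilon>) \<omega>0) = \<phi> x * b (T (x /\<^sub>R \<epsilon>) \<omega>0)"
      using ae[of \<epsilon>] by eventually_elim (rule sym)
  qed
qed

end

section \<open>The two-scale limit of the functions\<close>

text \<open>Fubini's theorem is applied to expressions such as g(z + y), which are measurable with respect to the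
product sigma-algebra when g is Borel.\<close>

lemma borel_version:
  fixes f :: "real^3 \<Rightarrow> real"
  assumes "f \<in> borel_measurable lebesgue"
  shows "\<exists>f'. f' \<in> borel_measurable borel \<and> (AE x in lebesgue. f x = f' x)"
proof -
  obtain f' where "f' \<in> borel_measurable lborel" "AE x in lborel. f x = f' x"
    using completion_ex_borel_measurable_real[OF assms] by blast
  then show ?thesis using AE_completion[of "\<lambda>x. f x = f' x" lborel] by (intro exI[of _ f']) simp
qed

lemma borel_version_vec:
  fixes g :: "real^3 \<Rightarrow> real^3"
  assumes [measurable]: "g \<in> borel_measurable lebesgue"
  shows "\<exists>g'. g' \<in> borel_measurable borel \<and> (AE x in lebesgue. g x = g' x)"
proof -
  have "\<forall>i. \<exists>f'. f' \<in> borel_measurable borel \<and> (AE x in lebesgue. g x $ i = f' x)"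
    by (intro allI borel_version) measurable
  then obtain G where G: "\<And>i. G i \<in> borel_measurable borel" "\<And>i. AE x in lebesgue. g x $ i = G i x"
    by (auto dest!: choice)
  define g' where "g' x = (\<chi> i. G i x)" for x
  have "g' \<in> borel_measurable borel"
  proof (subst borel_measurable_euclidean_space, intro ballI)
    fix b :: "real^3" assume "b \<in> Basis"
    then obtain i where "b = axis i 1" by (auto simp: Basis_vec_def)
    then show "(\<lambda>x. g' x \<bullet> b) \<in> borel_measurable borel" using G(1)[of i] by (simp add: inner_axis g'_def)
  qed
  moreover have "AE x in lebesgue. g x = g' x"
  proof -
    have "AE x in lebesgue. \<forall>i. g x $ i = G i x" using G(2) by (simp add: AE_all_countable)
    then show ?thesis by eventually_elim (simp add: g'_def vec_eq_iff)
  qed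
  ultimately show ?thesis by blast
qed

lemma L2_cong_AE:
  fixes f g :: "'a \<Rightarrow> 'b::euclidean_space"
  assumes "f \<in> L2 M" "g \<in> borel_measurable M" "AE x in M. f x = g x"
  shows "g \<in> L2 M"
  by (rule L2_bound[OF assms(2,1)]) (use assms(3) in \<open>eventually_elim, simp\<close>)

lemma is_weak_gradient_diff:
  assumes u: "loc_int u" "loc_int v" and g: "\<And>i. loc_int (\<lambda>x. g x $ i)" "\<And>i. loc_int (\<lambda>x. h x $ i)"
    and w: "is_weak_gradient u g" "is_weak_gradient v h"
  shows "is_weak_gradient (\<lambda>x. u x - v x) (\<lambda>x. g x - h x)"
  unfolding is_weak_gradient_def
proof (intro ballI allI)
  fix \<phi> i assume \<phi>: "\<phi> \<in> Cc_infinity"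
  have 1: "(\<integral>x. (u x - v x) * partial_deriv i \<phi> x \<partial>lebesgue) = (\<integral>x. u x * partial_deriv i \<phi> x \<partial>lebesgue) - (\<integral>x. v x * partial_deriv i \<phi> x \<partial>lebesgue)"
    unfolding left_diff_distrib
    by (intro Bochner_Integration.integral_diff loc_int_Cc_integrable u Cc_infinity_partial \<phi>)
  have 2: "(\<integral>x. (g x - h x) $ i * \<phi> x \<partial>lebesgue) = (\<integral>x. g x $ i * \<phi> x \<partial>lebesgue) - (\<integral>x. h x $ i * \<phi> x \<partial>lebesgue)"
    unfolding left_diff_distrib vector_minus_component
    by (intro Bochner_Integration.integral_diff loc_int_Cc_integrable g \<phi>)
  have "(\<integral>x. u x * partial_deriv i \<phi> x \<partial>lebesgue) = - (\<integral>x. g x $ i * \<phi> x \<partial>lebesgue)"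
       "(\<integral>x. v x * partial_deriv i \<phi> x \<partial>lebesgue) = - (\<integral>x. h x $ i * \<phi> x \<partial>lebesgue)"
    using w \<phi> unfolding is_weak_gradient_def by blast+
  then show "(\<integral>x. (u x - v x) * partial_deriv i \<phi> x \<partial>lebesgue) = - (\<integral>x. (g x - h x) $ i * \<phi> x \<partial>lebesgue)"
    unfolding 1 2 by simp
qed

lemma is_weak_gradient_cong:
  assumes w: "is_weak_gradient u g"
    and m: "u \<in> borel_measurable lebesgue" "u' \<in> borel_measurable lebesgue" "g \<in> borel_measurable lebesgue" "g' \<in> borel_measurable lebesgue"
    and ae: "AE x in lebesgue. u x = u' x" "AE x in lebesgue. g x = g' x"
  shows "is_weak_gradient u' g'"
  unfolding is_weak_gradient_def
proof (intro ballI allI)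
  fix \<phi> i assume \<phi>: "\<phi> \<in> Cc_infinity"
  note pm = Cc_infinity_measurable_leb[OF \<phi>] Cc_infinity_measurable_leb[OF Cc_infinity_partial[OF \<phi>]]
  have "(\<integral>x. u' x * partial_deriv i \<phi> x \<partial>lebesgue) = (\<integral>x. u x * partial_deriv i \<phi> x \<partial>lebesgue)"
    by (intro integral_cong_AE borel_measurable_times m pm) (use ae(1) in \<open>eventually_elim, simp\<close>)
  moreover have "(\<integral>x. g' x $ i * \<phi> x \<partial>lebesgue) = (\<integral>x. g x $ i * \<phi> x \<partial>lebesgue)"
    by (intro integral_cong_AE borel_measurable_times m pm vec_nth_measurable) (use ae(2) in \<open>eventually_elim, simp\<close>)
  ultimately show "(\<integral>x. u' x * partial_deriv i \<phi> x \<partial>lebesgue) = - (\<integral>x. g' x $ i * \<phi> x \<partial>lebesgue)"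
    using w \<phi> unfolding is_weak_gradient_def by simp
qed

lemma BL1_norm_eq: "BL1_norm u = nrm2 lebesgue (weak_gradient u)"
  by (simp add: BL1_norm_def BL1_inner_def nrm2_def power2_norm_eq_inner)

lemma tendsto_at_right_0I:
  fixes f :: "real \<Rightarrow> real"
  assumes "\<And>e. (\<And>n. 0 < e n) \<Longrightarrow> e \<longlonglongrightarrow> 0 \<Longrightarrow> (\<lambda>n. f (e n)) \<longlonglongrightarrow> l"
  shows "(f \<longlongrightarrow> l) (at_right 0)"
  unfolding tendsto_at_iff_sequentially o_def using assms by auto

lemma filterlim_at_right_0:
  fixes e :: "nat \<Rightarrow> real"
  assumes "\<And>n. 0 < e n" "e \<longlonglongrightarrow> 0"
  shows "filterlim e (at_right 0) sequentially"
  using assms by (auto simp: filterlim_at intro!: always_eventually less_imp_neq[symmetric])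

lemma sigma_finite_lebesgue: "sigma_finite_measure (lebesgue :: (real^3) measure)"
proof (rule sigma_finite_measure.intro)
  obtain A :: "(real^3) set set" where A: "countable A" "A \<subseteq> sets lborel" "\<Union>A = space lborel" "\<forall>a\<in>A. emeasure lborel a \<noteq> \<infinity>"
    using lborel.sigma_finite_countable by blast
  show "\<exists>A. countable A \<and> A \<subseteq> sets (lebesgue :: (real^3) measure) \<and> \<Union>A = space lebesgue \<and> (\<forall>a\<in>A. emeasure lebesgue a \<noteq> \<infinity>)"
    using A by (intro exI[of _ A]) auto
qed

context typical_trajectory
begin

text \<open>The difference u - u_inf has vanishing flux at every scale, because the translated kernels are
elements of BL1; the oscillating test function is uniformly bounded with fixed support. What is left is the
ergodic limit for the fixed integrable function u_inf \<phi>.\<close>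

lemma oscillating_pairing_limit:
  fixes b :: "'a \<Rightarrow> real"
  assumes u: "\<And>\<epsilon>. 0 < \<epsilon> \<Longrightarrow> u \<epsilon> \<in> BL1" "\<And>\<epsilon>. 0 < \<epsilon> \<Longrightarrow> BL1_norm (u \<epsilon>) \<le> C"
    and ui: "u_inf \<in> BL1" and wc: "BL1_weak_conv u u_inf (at_right 0)"
    and \<phi>: "\<phi> \<in> Cc_infinity" and b: "continuous_on UNIV b"
  shows "((\<lambda>\<epsilon>. \<integral>x. u \<epsilon> x * \<phi> x * b (T (x /\<^sub>R \<epsilon>) \<omega>0) \<partial>lebesgue) \<longlongrightarrow> (\<integral>x. u_inf x * \<phi> x \<partial>lebesgue) * (\<integral>\<omega>. b \<omega> \<partial>P)) (at_right 0)"
proof (rule tendsto_at_right_0I)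
  fix e :: "nat \<Rightarrow> real" assume e: "\<And>n. 0 < e n" "e \<longlonglongrightarrow> 0"
  note fe = filterlim_at_right_0[OF e]
  define v g where "v n x = u (e n) x - u_inf x" "g n x = weak_gradient (u (e n)) x - weak_gradient u_inf x" for n x
  note pu = weak_gradient_props[OF u(1)[OF e(1)]] and pi = weak_gradient_props[OF ui]
  have lu: "loc_int (u (e n))" "loc_int u_inf" for n using pu(3) pi(3) by (auto intro: L2_theta_loc_int)
  have lg: "loc_int (\<lambda>x. weak_gradient (u (e n)) x $ i)" "loc_int (\<lambda>x. weak_gradient u_inf x $ i)" for n i
    by (intro L2_loc_int L2_component pu(1) pi(1))+
  have vw: "is_weak_gradient (v n) (g n)" for n
    unfolding v_g_def by (intro is_weak_gradient_diff lu lg pu pi)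
  have gL: "g n \<in> L2 lebesgue" for n unfolding v_g_def by (intro L2_diff pu pi)
  have vth: "(\<lambda>x. v n x * theta x) \<in> L2 lebesgue" for n
    unfolding v_g_def left_diff_distrib using pu(3) pi(3) by (intro L2_diff) (auto simp: L2_theta_def)
  then have vm: "v n \<in> borel_measurable lebesgue" for n by (intro L2_theta_measurable) (simp add: L2_theta_def)
  have gm: "g n \<in> borel_measurable lebesgue" for n using gL by (rule L2_meas)
  have "\<forall>n. \<exists>V. V \<in> borel_measurable borel \<and> (AE x in lebesgue. v n x = V x)"
    by (intro allI borel_version vm)
  then obtain V where V: "\<And>n. V n \<in> borel_measurable borel" "\<And>n. AE x in lebesgue. v n x = V n x" by (auto dest!: choice)
  have "\<forall>n. \<exists>G. G \<in> borel_measurable borel \<and> (AE x in lebesgue. g n x = G x)"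
    by (intro allI borel_version_vec gm)
  then obtain G where G: "\<And>n. G n \<in> borel_measurable borel" "\<And>n. AE x in lebesgue. g n x = G n x" by (auto dest!: choice)
  have Vm: "V n \<in> borel_measurable lebesgue" for n by (rule borel_lebesgue_measurable[OF V(1)])
  have Gm: "G n \<in> borel_measurable lebesgue" for n by (rule borel_lebesgue_measurable_vec[OF G(1)])
  have Vth: "V n \<in> L2_theta" for n
    unfolding L2_theta_def mem_Collect_eq
    by (rule L2_cong_AE[OF vth[of n]]) (intro borel_measurable_times Vm theta_measurable_leb, use V(2)[of n] in \<open>eventually_elim, simp\<close>)
  have GL: "G n \<in> L2 lebesgue" for n by (rule L2_cong_AE[OF gL[of n] Gm G(2)])
  have GLb: "G n \<in> L2 lborel" for n using GL L2_leb_iff(1)[OF G(1)] by simp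
  have Vw: "is_weak_gradient (V n) (G n)" for n
    by (rule is_weak_gradient_cong[OF vw vm Vm gm Gm V(2) G(2)])
  have Gn: "nrm2 lborel (G n) \<le> C + BL1_norm u_inf" for n
  proof -
    have "nrm2 lborel (G n) = nrm2 lebesgue (g n)"
      using L2_leb_iff(2)[OF G(1)] nrm2_cong_AE[OF gm Gm G(2)] by simp
    also have "\<dots> \<le> BL1_norm (u (e n)) + BL1_norm u_inf"
      unfolding v_g_def BL1_norm_eq by (intro nrm2_triangle_diff pu pi)
    finally show ?thesis using u(2)[OF e(1), of n] by simp
  qed
  have flux: "(\<lambda>n. newton_flux (G n) \<tau> y) \<longlonglongrightarrow> 0" if \<tau>: "0 < \<tau>" for \<tau> y
  proof -
    have km: "(\<lambda>x. grad_newton \<tau> (x - y)) \<in> borel_measurable lebesgue" using grad_newton_L2[OF \<tau>] by (rule L2_meas)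
    have "newton_flux (G n) \<tau> y = BL1_inner (u (e n)) (\<lambda>x. newton \<tau> (x - y)) - BL1_inner u_inf (\<lambda>x. newton \<tau> (x - y))" for n
    proof -
      have "(\<lambda>x. G n x \<bullet> grad_newton \<tau> (x - y)) \<in> borel_measurable lborel"
        using L2_inner_integrable[OF GLb grad_newton_L2_lborel(1)[OF \<tau>]] by (rule borel_measurable_integrable)
      then have "newton_flux (G n) \<tau> y = (\<integral>x. G n x \<bullet> grad_newton \<tau> (x - y) \<partial>lebesgue)"
        unfolding newton_flux_def by (simp add: integral_completion)
      also have "\<dots> = (\<integral>x. g n x \<bullet> grad_newton \<tau> (x - y) \<partial>lebesgue)"
        by (intro integral_cong_AE borel_measurable_inner Gm gm km) (use G(2)[of n] in \<open>eventually_elim, simp\<close>)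
      also have "\<dots> = (\<integral>x. weak_gradient (u (e n)) x \<bullet> grad_newton \<tau> (x - y) \<partial>lebesgue) - (\<integral>x. weak_gradient u_inf x \<bullet> grad_newton \<tau> (x - y) \<partial>lebesgue)"
        unfolding v_g_def inner_diff_left
        by (intro Bochner_Integration.integral_diff L2_inner_integrable pu pi grad_newton_L2 \<tau>)
      finally show ?thesis using BL1_inner_newton[OF \<tau> u(1)[OF e(1)]] BL1_inner_newton[OF \<tau> ui] by simp
    qed
    moreover have "(\<lambda>n. BL1_inner (u (e n)) (\<lambda>x. newton \<tau> (x - y))) \<longlonglongrightarrow> BL1_inner u_inf (\<lambda>x. newton \<tau> (x - y))"
      using wc newton_BL1[OF \<tau>, of y] unfolding BL1_weak_conv_def
      by (intro filterlim_compose[OF _ fe, of "\<lambda>\<epsilon>. BL1_inner (u \<epsilon>) (\<lambda>x. newton \<tau> (x - y))"]) blast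
    ultimately show ?thesis by (simp add: LIM_zero_iff)
  qed
  define \<psi> where "\<psi> n x = \<phi> x * b (T (x /\<^sub>R e n) \<omega>0)" for n x
  obtain B1 where B1: "B1 > 0" "\<And>x. \<bar>\<phi> x\<bar> \<le> B1" using Cc_infinity_bounded[OF \<phi>] by blast
  obtain B2 where B2: "B2 > 0" "\<And>\<omega>. \<bar>b \<omega>\<bar> \<le> B2" using continuous_bounded[OF b] by blast
  obtain R where R: "R > 0" "\<And>x. R < norm x \<Longrightarrow> \<phi> x = 0" using Cc_infinityD(2)[OF \<phi>] by blast
  have \<psi>c: "continuous_on UNIV (\<psi> n)" for n
    unfolding \<psi>_def
    by (intro continuous_on_mult smooth_continuous Cc_infinityD(1) \<phi> continuous_on_compose2[OF along_trajectory_continuous[OF b]])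
       (auto intro!: continuous_intros)
  have \<psi>B: "\<bar>\<psi> n x\<bar> \<le> B1 * B2" for n x
    unfolding \<psi>_def abs_mult using B1 B2 by (intro mult_mono) auto
  have \<psi>0: "\<psi> n x = 0" if "max 1 R < norm x" for n x using R(2)[of x] that by (simp add: \<psi>_def)
  have \<psi>m: "\<psi> n \<in> borel_measurable lebesgue" for n
    by (intro borel_lebesgue_measurable borel_measurable_continuous_onI \<psi>c)
  have van: "(\<lambda>n. \<integral>x. V n x * \<psi> n x \<partial>lborel) \<longlonglongrightarrow> 0"
    by (rule vanishing_flux_imp_vanishing_pairing[OF Vth V(1) GLb Vw Gn flux \<psi>c \<psi>B max.cobounded1 \<psi>0])
  have split: "(\<integral>x. u (e n) x * \<phi> x * b (T (x /\<^sub>R e n) \<omega>0) \<partial>lebesgue) = (\<integral>x. V n x * \<psi> n x \<partial>lborel) + (\<integral>x. (u_inf x * \<phi> x) * b (T (x /\<^sub>R e n) \<omega>0) \<partial>lebesgue)" for n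
  proof -
    have i: "integrable lebesgue (\<lambda>x. u (e n) x * \<psi> n x)" "integrable lebesgue (\<lambda>x. u_inf x * \<psi> n x)"
      using loc_int_mult_integrable[OF lu(1) \<psi>m \<psi>B \<psi>0] loc_int_mult_integrable[OF lu(2) \<psi>m \<psi>B \<psi>0] by blast+
    have mb: "(\<lambda>x. V n x * \<psi> n x) \<in> borel_measurable borel"
      by (intro borel_measurable_times V borel_measurable_continuous_onI \<psi>c)
    have "(\<integral>x. V n x * \<psi> n x \<partial>lborel) = (\<integral>x. V n x * \<psi> n x \<partial>lebesgue)" using mb by (simp add: integral_completion)
    also have "\<dots> = (\<integral>x. v n x * \<psi> n x \<partial>lebesgue)"
      by (intro integral_cong_AE borel_measurable_times Vm vm \<psi>m) (use V(2)[of n] in \<open>eventually_elim, simp\<close>)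
    also have "\<dots> = (\<integral>x. u (e n) x * \<psi> n x \<partial>lebesgue) - (\<integral>x. u_inf x * \<psi> n x \<partial>lebesgue)"
      unfolding v_g_def left_diff_distrib by (rule Bochner_Integration.integral_diff[OF i])
    finally show ?thesis by (simp add: \<psi>_def mult.assoc)
  qed
  have "integrable lebesgue (\<lambda>x. u_inf x * \<phi> x)" by (rule loc_int_Cc_integrable[OF lu(2) \<phi>])
  from filterlim_compose[OF oscillation_limit(1)[OF this b] fe]
  have "(\<lambda>n. \<integral>x. (u_inf x * \<phi> x) * b (T (x /\<^sub>R e n) \<omega>0) \<partial>lebesgue) \<longlonglongrightarrow> (\<integral>x. u_inf x * \<phi> x \<partial>lebesgue) * (\<integral>\<omega>. b \<omega> \<partial>P)" .
  from tendsto_add[OF van this]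
  show "(\<lambda>n. \<integral>x. u (e n) x * \<phi> x * b (T (x /\<^sub>R e n) \<omega>0) \<partial>lebesgue) \<longlonglongrightarrow> (\<integral>x. u_inf x * \<phi> x \<partial>lebesgue) * (\<integral>\<omega>. b \<omega> \<partial>P)"
    unfolding split by simp
qed

lemma L2_prod_const:
  fixes f :: "real^3 \<Rightarrow> 'c::euclidean_space"
  assumes f: "f \<in> L2 lebesgue"
  shows "(\<lambda>z. f (fst z)) \<in> L2 (lebesgue \<Otimes>\<^sub>M P)"
proof (rule L2I)
  interpret L: sigma_finite_measure "lebesgue :: (real^3) measure" by (rule sigma_finite_lebesgue)
  interpret pair_sigma_finite "lebesgue :: (real^3) measure" P ..
  have [measurable]: "f \<in> borel_measurable lebesgue" using f by (rule L2_meas)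
  show "(\<lambda>z. f (fst z)) \<in> borel_measurable (lebesgue \<Otimes>\<^sub>M P)" by measurable
  have "integrable (lebesgue \<Otimes>\<^sub>M P) (\<lambda>(x, y). (norm (f x))\<^sup>2)"
  proof (rule Fubini_integrable)
    show "(\<lambda>(x, y). (norm (f x))\<^sup>2) \<in> borel_measurable (lebesgue \<Otimes>\<^sub>M P)" by measurable
    show "integrable lebesgue (\<lambda>x. \<integral>y. norm (case (x, y) of (x, y) \<Rightarrow> (norm (f x))\<^sup>2) \<partial>P)"
      using L2_integrable[OF f] by (simp add: prob_space)
    show "AE x in lebesgue. integrable P (\<lambda>y. case (x, y) of (x, y) \<Rightarrow> (norm (f x))\<^sup>2)" by simp
  qed
  then show "integrable (lebesgue \<Otimes>\<^sub>M P) (\<lambda>z. (norm (f (fst z)))\<^sup>2)" by (simp add: case_prod_beta')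
qed

lemma two_scale_L2_theta_limit:
  assumes u: "\<And>\<epsilon>. 0 < \<epsilon> \<Longrightarrow> u \<epsilon> \<in> BL1" "\<And>\<epsilon>. 0 < \<epsilon> \<Longrightarrow> BL1_norm (u \<epsilon>) \<le> C"
    and ui: "u_inf \<in> BL1" and wc: "BL1_weak_conv u u_inf (at_right 0)"
  shows "two_scale_L2_theta P T \<omega>0 (at_right 0) u (\<lambda>(x, \<omega>). u_inf x)"
  unfolding two_scale_L2_theta_def
proof (intro conjI allI impI)
  note pi = weak_gradient_props[OF ui]
  show "u \<epsilon> \<in> L2_theta" if "0 < \<epsilon>" for \<epsilon> using weak_gradient_props(3)[OF u(1)[OF that]] .
  show "(\<lambda>x. \<integral>\<omega>. (case (x, \<omega>) of (x, \<omega>) \<Rightarrow> u_inf x) \<partial>P) \<in> L2_theta" using pi(3) by (simp add: prob_space)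
  show "two_scale_identity P T \<omega>0 (at_right 0) u (\<lambda>(x, \<omega>). u_inf x)"
    unfolding two_scale_identity_def
  proof (intro ballI allI impI)
    fix \<phi> and b :: "'a \<Rightarrow> real" assume \<phi>: "\<phi> \<in> Cc_infinity" and b: "continuous_on UNIV b"
    have "(\<integral>x. \<integral>\<omega>. (case (x, \<omega>) of (x, \<omega>) \<Rightarrow> u_inf x) * \<phi> x * b \<omega> \<partial>P \<partial>lebesgue) = (\<integral>x. u_inf x * \<phi> x \<partial>lebesgue) * (\<integral>\<omega>. b \<omega> \<partial>P)"
      by simp
    then show "((\<lambda>\<epsilon>. \<integral>x. u \<epsilon> x * \<phi> x * b (T (x /\<^sub>R \<epsilon>) \<omega>0) \<partial>lebesgue) \<longlongrightarrow> (\<integral>x. \<integral>\<omega>. (case (x, \<omega>) of (x, \<omega>) \<Rightarrow> u_inf x) * \<phi> x * b \<omega> \<partial>P \<partial>lebesgue)) (at_right 0)"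
      using oscillating_pairing_limit[OF u ui wc \<phi> b] by simp
  qed
  show "(\<lambda>(x, \<omega>). u_inf x) \<in> L2_loc P"
    unfolding L2_loc_def
  proof (intro CollectI allI impI)
    fix K :: "(real^3) set" assume K: "compact K"
    then obtain R where R: "\<forall>x\<in>K. norm x \<le> R" using compact_imp_bounded bounded_iff by blast
    have Km: "K \<in> sets lebesgue" using K by (simp add: borel_compact)
    have "(\<lambda>x. indicator K x * u_inf x) \<in> L2 lebesgue"
    proof (rule L2_bound[OF _ L2_cmult[of "\<lambda>x. u_inf x * theta x" lebesgue "1 + R"]])
      show "(\<lambda>x. indicator K x * u_inf x) \<in> borel_measurable lebesgue"
        by (intro borel_measurable_times borel_measurable_indicator Km L2_theta_measurable pi)
      show "(\<lambda>x. u_inf x * theta x) \<in> L2 lebesgue" using pi(3) by (simp add: L2_theta_def)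
      show "AE x in lebesgue. norm (indicator K x * u_inf x) \<le> norm ((1 + R) * (u_inf x * theta x))"
      proof (rule AE_I2)
        fix x :: "real^3"
        show "norm (indicator K x * u_inf x) \<le> norm ((1 + R) * (u_inf x * theta x))"
        proof (cases "x \<in> K")
          case True
          then have "1 \<le> (1 + R) * theta x" using theta_lower[of x R] R theta_pos[of x] by (simp add: field_simps)
          from mult_left_mono[OF this, of "\<bar>u_inf x\<bar>"] True order_trans[OF norm_ge_zero, of x R] R
          show ?thesis using theta_pos[of x] by (simp add: abs_mult mult_ac)
        qed simp
      qed
    qed
    from L2_prod_const[OF this]
    show "(\<lambda>z. indicator (K \<times> UNIV) z * (case z of (x, \<omega>) \<Rightarrow> u_inf x)) \<in> L2 (lebesgue \<Otimes>\<^sub>M P)"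
      by (simp add: case_prod_beta indicator_times)
  qed
qed

end

section \<open>Smoothing along the orbits\<close>

lemma floor_grid_limit: "(\<lambda>m. of_int \<lfloor>real (Suc m) * t\<rfloor> / real (Suc m)) \<longlonglongrightarrow> t"
proof (rule LIM_zero_cancel, rule tendsto_0_le[OF LIMSEQ_inverse_real_of_nat, of _ 1])
  show "\<forall>\<^sub>F m in sequentially. norm (of_int \<lfloor>real (Suc m) * t\<rfloor> / real (Suc m) - t) \<le> norm (inverse (real (Suc m))) * 1"
  proof (intro always_eventually allI)
    fix m
    define s where "s = real (Suc m)"
    have s: "0 < s" by (simp add: s_def)
    have "\<bar>of_int \<lfloor>s * t\<rfloor> - s * t\<bar> \<le> 1" by linarith
    then have "\<bar>(of_int \<lfloor>s * t\<rfloor> - s * t) / s\<bar> \<le> 1 / s" using s by (simp add: abs_divide divide_right_mono)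
    moreover have "(of_int \<lfloor>s * t\<rfloor> - s * t) / s = of_int \<lfloor>s * t\<rfloor> / s - t" using s by (simp add: diff_divide_distrib)
    ultimately show "norm (of_int \<lfloor>real (Suc m) * t\<rfloor> / real (Suc m) - t) \<le> norm (inverse (real (Suc m))) * 1"
      using s unfolding s_def[symmetric] by (simp add: divide_inverse)
  qed
qed

text \<open>The index of the cube of the grid with mesh 1/(m+1) that contains x.\<close>

definition cell :: "nat \<Rightarrow> real^3 \<Rightarrow> int \<times> int \<times> int" where
  "cell m x = (\<lfloor>real (Suc m) * x $ 1\<rfloor>, \<lfloor>real (Suc m) * x $ 2\<rfloor>, \<lfloor>real (Suc m) * x $ 3\<rfloor>)"

definition corner :: "nat \<Rightarrow> int \<times> int \<times> int \<Rightarrow> real^3" where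
  "corner m t = (case t of (i, j, k) \<Rightarrow>
     \<chi> l. if l = 1 then of_int i / real (Suc m) else if l = 2 then of_int j / real (Suc m) else of_int k / real (Suc m))"

lemma corner_cell_nth: "corner m (cell m x) $ l = of_int \<lfloor>real (Suc m) * x $ l\<rfloor> / real (Suc m)"
  using exhaust_3[of l] by (auto simp: corner_def cell_def simp del: of_nat_Suc)

lemma corner_cell_limit: "(\<lambda>m. corner m (cell m x)) \<longlonglongrightarrow> x"
  by (rule vec_tendstoI) (simp only: corner_cell_nth floor_grid_limit)

lemma cell_measurable: "cell m \<in> measurable borel (count_space UNIV)"
proof -
  have "(\<lambda>x. \<lfloor>real (Suc m) * x $ l\<rfloor>) \<in> measurable borel (count_space UNIV)" for l :: 3
    by measurable
  then have "(\<lambda>x :: real^3. (\<lfloor>real (Suc m) * x $ 1\<rfloor>, \<lfloor>real (Suc m) * x $ 2\<rfloor>, \<lfloor>real (Suc m) * x $ 3\<rfloor>))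
     \<in> measurable borel (count_space UNIV \<Otimes>\<^sub>M (count_space UNIV \<Otimes>\<^sub>M count_space UNIV))"
    by (intro measurable_Pair)
  then show ?thesis unfolding cell_def[abs_def] by (simp add: pair_measure_countable)
qed

text \<open>Rounding the first argument to a grid makes the function measurable piece by piece, and continuity
recovers it in the limit.\<close>

lemma Caratheodory_measurable:
  fixes f :: "real^3 \<Rightarrow> 'a \<Rightarrow> real"
  assumes c: "\<And>\<omega>. continuous_on UNIV (\<lambda>z. f z \<omega>)" and m: "\<And>z. f z \<in> borel_measurable M"
  shows "(\<lambda>(z, \<omega>). f z \<omega>) \<in> borel_measurable (borel \<Otimes>\<^sub>M M)"
proof (rule borel_measurable_LIMSEQ_real)
  show "(\<lambda>x. f (corner m (cell m (fst x))) (snd x)) \<in> borel_measurable (borel \<Otimes>\<^sub>M M)" for m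
  proof (rule measurable_compose_countable[where g="\<lambda>x. cell m (fst x)" and f="\<lambda>t x. f (corner m t) (snd x)"])
    show "(\<lambda>x. f (corner m t) (snd x)) \<in> borel_measurable (borel \<Otimes>\<^sub>M M)" for t
      by (rule measurable_compose[OF measurable_snd m])
    show "(\<lambda>x. cell m (fst x)) \<in> measurable (borel \<Otimes>\<^sub>M M) (count_space UNIV)"
      by (rule measurable_compose[OF measurable_fst cell_measurable])
  qed
  show "(\<lambda>m. f (corner m (cell m (fst x))) (snd x)) \<longlonglongrightarrow> (case x of (z, \<omega>) \<Rightarrow> f z \<omega>)" for x
  proof -
    have "isCont (\<lambda>z. f z (snd x)) (fst x)" using c[of "snd x"] by (simp add: continuous_on_eq_continuous_at)
    from isCont_tendsto_compose[OF this corner_cell_limit]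
    show ?thesis by (simp add: case_prod_beta)
  qed
qed

context stochastic_setting
begin

text \<open>For continuous g this is measurability with respect to the product measure itself and not merely
its completion, which is what Fubini's theorem requires.\<close>

lemma trajectory_measurable:
  fixes g :: "'w \<Rightarrow> real"
  assumes g: "continuous_on UNIV g" and [measurable]: "\<tau> \<in> borel_measurable N"
  shows "(\<lambda>(s, \<omega>). g (T (\<tau> s) \<omega>)) \<in> borel_measurable (N \<Otimes>\<^sub>M P)"
proof -
  have "(\<lambda>(z, \<omega>). g (T z \<omega>)) \<in> borel_measurable (borel \<Otimes>\<^sub>M P)"
  proof (rule Caratheodory_measurable)
    show "continuous_on UNIV (\<lambda>z. g (T z \<omega>))" for \<omega> by (rule along_trajectory_continuous[OF g])
    show "(\<lambda>\<omega>. g (T z \<omega>)) \<in> borel_measurable P" for z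
      by (rule measurable_compose[OF T_measurable continuous_measurable[OF g]])
  qed
  moreover have "(\<lambda>(s, \<omega>). (\<tau> s, \<omega>)) \<in> measurable (N \<Otimes>\<^sub>M P) (borel \<Otimes>\<^sub>M P)" by measurable
  ultimately have "(\<lambda>(z, \<omega>). g (T z \<omega>)) \<circ> (\<lambda>(s, \<omega>). (\<tau> s, \<omega>)) \<in> borel_measurable (N \<Otimes>\<^sub>M P)"
    by (rule measurable_comp[rotated])
  then show ?thesis by (simp add: o_def case_prod_beta')
qed

lemma T_nrm2:
  fixes f :: "'w \<Rightarrow> 'c::euclidean_space"
  assumes "f \<in> L2 P" shows "(\<lambda>\<omega>. f (T y \<omega>)) \<in> L2 P" "nrm2 P (\<lambda>\<omega>. f (T y \<omega>)) = nrm2 P f"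
proof -
  have m: "f \<in> borel_measurable P" using assms by (rule L2_meas)
  have m2: "(\<lambda>\<omega>. (norm (f \<omega>))\<^sup>2) \<in> borel_measurable P" using m by measurable
  show "(\<lambda>\<omega>. f (T y \<omega>)) \<in> L2 P"
    using L2_integrable[OF assms] T_integral(2)[OF m2, of y] measurable_compose[OF T_measurable m, of y]
    by (intro L2I) auto
  show "nrm2 P (\<lambda>\<omega>. f (T y \<omega>)) = nrm2 P f" unfolding nrm2_def using T_integral(1)[OF m2, of y] by simp
qed

text \<open>Averages along the orbit over a general measure space N, so that it covers both the smoothing over
three-dimensional space and the integration over segments.\<close>

lemma averaging_Fubini:
  fixes g h :: "'w \<Rightarrow> real" and \<kappa> :: "'s \<Rightarrow> real"
  assumes N: "sigma_finite_measure N" and \<tau>: "\<tau> \<in> borel_measurable N" and \<kappa>: "integrable N \<kappa>"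
    and g: "continuous_on UNIV g" and h: "continuous_on UNIV h"
  shows "(\<integral>\<omega>. (\<integral>s. \<kappa> s * g (T (\<tau> s) \<omega>) \<partial>N) * h \<omega> \<partial>P) = (\<integral>s. \<kappa> s * (\<integral>\<omega>. g (T (\<tau> s) \<omega>) * h \<omega> \<partial>P) \<partial>N)"
proof -
  interpret N: sigma_finite_measure N by fact
  interpret NP: pair_sigma_finite N P ..
  obtain B1 where B1: "B1 > 0" "\<And>\<omega>. \<bar>g \<omega>\<bar> \<le> B1" using continuous_bounded[OF g] by blast
  obtain B2 where B2: "B2 > 0" "\<And>\<omega>. \<bar>h \<omega>\<bar> \<le> B2" using continuous_bounded[OF h] by blast
  define F where "F s \<omega> = \<kappa> s * (g (T (\<tau> s) \<omega>) * h \<omega>)" for s \<omega>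
  have [measurable]: "(\<lambda>(s, \<omega>). g (T (\<tau> s) \<omega>)) \<in> borel_measurable (N \<Otimes>\<^sub>M P)" by (rule trajectory_measurable[OF g \<tau>])
  have [measurable]: "\<kappa> \<in> borel_measurable N" "h \<in> borel_measurable P" using \<kappa> continuous_measurable[OF h] by auto
  have Fm: "case_prod F \<in> borel_measurable (N \<Otimes>\<^sub>M P)"
  proof -
    have "(\<lambda>z. \<kappa> (fst z) * ((\<lambda>(s, \<omega>). g (T (\<tau> s) \<omega>)) z * h (snd z))) \<in> borel_measurable (N \<Otimes>\<^sub>M P)" by measurable
    then show ?thesis by (simp add: F_def case_prod_beta')
  qed
  have gT: "continuous_on UNIV (\<lambda>\<omega>. g (T z \<omega>))" for z
    by (rule continuous_on_compose2[OF g T_continuous]) simp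
  have ghc: "integrable P (\<lambda>\<omega>. g (T z \<omega>) * h \<omega>)" for z
    by (intro continuous_integrable continuous_on_mult gT h)
  have Fi: "integrable P (F s)" for s unfolding F_def by (intro integrable_mult_right ghc)
  have Fb: "\<bar>F s \<omega>\<bar> \<le> \<bar>\<kappa> s\<bar> * (B1 * B2)" for s \<omega>
    unfolding F_def abs_mult using B1 B2 by (intro mult_left_mono mult_mono) auto
  have int: "integrable (N \<Otimes>\<^sub>M P) (case_prod F)"
  proof (rule NP.Fubini_integrable[OF Fm])
    show "integrable N (\<lambda>s. \<integral>\<omega>. norm (case_prod F (s, \<omega>)) \<partial>P)"
    proof (rule Bochner_Integration.integrable_bound[OF integrable_mult_left[OF integrable_abs[OF \<kappa>], of "B1 * B2"]])
      have "(\<integral>\<omega>. \<bar>F s \<omega>\<bar> \<partial>P) \<le> \<bar>\<kappa> s\<bar> * (B1 * B2)" for s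
      proof -
        have "(\<integral>\<omega>. \<bar>F s \<omega>\<bar> \<partial>P) \<le> (\<integral>\<omega>. \<bar>\<kappa> s\<bar> * (B1 * B2) \<partial>P)"
          by (intro integral_mono integrable_abs Fi Fb) simp
        then show ?thesis by (simp add: prob_space)
      qed
      then show "AE s in N. norm (\<integral>\<omega>. norm (case_prod F (s, \<omega>)) \<partial>P) \<le> norm (\<bar>\<kappa> s\<bar> * (B1 * B2))"
        using B1(1) B2(1) by (intro AE_I2) (simp add: abs_mult)
      show "(\<lambda>s. \<integral>\<omega>. norm (case_prod F (s, \<omega>)) \<partial>P) \<in> borel_measurable N"
        using Fm by (intro borel_measurable_lebesgue_integral) (simp add: case_prod_beta')
    qed
  qed (use Fi in simp)
  have "(\<integral>\<omega>. (\<integral>s. \<kappa> s * g (T (\<tau> s) \<omega>) \<partial>N) * h \<omega> \<partial>P) = (\<integral>\<omega>. (\<integral>s. F s \<omega> \<partial>N) \<partial>P)"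
    unfolding F_def by (simp flip: mult.assoc)
  also have "\<dots> = (\<integral>s. (\<integral>\<omega>. F s \<omega> \<partial>P) \<partial>N)" by (rule NP.Fubini_integral[OF int])
  also have "\<dots> = (\<integral>s. \<kappa> s * (\<integral>\<omega>. g (T (\<tau> s) \<omega>) * h \<omega> \<partial>P) \<partial>N)" unfolding F_def by simp
  finally show ?thesis .
qed

text \<open>By duality: pairing the average H with itself and exchanging the integrals gives the square of its
norm on one side and at most the asserted bound times its norm on the other.\<close>

lemma averaging_contraction:
  fixes g :: "'w \<Rightarrow> real" and \<kappa> :: "'s \<Rightarrow> real"
  assumes N: "sigma_finite_measure N" and \<tau>: "\<tau> \<in> borel_measurable N" and \<kappa>: "integrable N \<kappa>"
    and g: "continuous_on UNIV g" and A: "continuous_on UNIV (\<lambda>\<omega>. \<integral>s. \<kappa> s * g (T (\<tau> s) \<omega>) \<partial>N)"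
  shows "nrm2 P (\<lambda>\<omega>. \<integral>s. \<kappa> s * g (T (\<tau> s) \<omega>) \<partial>N) \<le> (\<integral>s. \<bar>\<kappa> s\<bar> \<partial>N) * nrm2 P g"
proof -
  define H where "H \<omega> = (\<integral>s. \<kappa> s * g (T (\<tau> s) \<omega>) \<partial>N)" for \<omega>
  have Hc: "continuous_on UNIV H" using A unfolding H_def .
  have HL: "H \<in> L2 P" by (rule continuous_L2[OF Hc])
  have gL: "g \<in> L2 P" by (rule continuous_L2[OF g])
  let ?a = "\<lambda>s. \<integral>\<omega>. g (T (\<tau> s) \<omega>) * H \<omega> \<partial>P"
  have ab: "\<bar>?a s\<bar> \<le> nrm2 P g * nrm2 P H" for s
    using L2_Cauchy_Schwarz_real[OF T_nrm2(1)[OF gL, of "\<tau> s"] HL] T_nrm2(2)[OF gL, of "\<tau> s"] by simp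
  have "(nrm2 P H)\<^sup>2 = (\<integral>\<omega>. H \<omega> * H \<omega> \<partial>P)" unfolding nrm2_sq by (simp add: power2_eq_square)
  also have "\<dots> = (\<integral>s. \<kappa> s * ?a s \<partial>N)"
    using averaging_Fubini[OF N \<tau> \<kappa> g Hc] unfolding H_def .
  also have "\<dots> \<le> (\<integral>s. \<bar>\<kappa> s\<bar> * (nrm2 P g * nrm2 P H) \<partial>N)"
  proof (rule integral_mono')
    show "integrable N (\<lambda>s. \<bar>\<kappa> s\<bar> * (nrm2 P g * nrm2 P H))" by (intro integrable_mult_left integrable_abs \<kappa>)
    show "\<kappa> s * ?a s \<le> \<bar>\<kappa> s\<bar> * (nrm2 P g * nrm2 P H)" for s
      using order_trans[OF abs_ge_self, of "\<kappa> s * ?a s" "\<bar>\<kappa> s\<bar> * (nrm2 P g * nrm2 P H)"] ab[of s]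
      by (simp add: abs_mult mult_left_mono)
  qed simp
  also have "\<dots> = (\<integral>s. \<bar>\<kappa> s\<bar> \<partial>N) * nrm2 P g * nrm2 P H" by simp
  finally have "nrm2 P H * nrm2 P H \<le> (\<integral>s. \<bar>\<kappa> s\<bar> \<partial>N) * nrm2 P g * nrm2 P H" by (simp add: power2_eq_square)
  then have "nrm2 P H \<le> (\<integral>s. \<bar>\<kappa> s\<bar> \<partial>N) * nrm2 P g"
    by (cases "nrm2 P H = 0") (auto simp: mult_le_cancel_right less_le)
  then show ?thesis unfolding H_def .
qed

text \<open>Convolution along the orbits. The result is differentiable along every orbit.\<close>

definition mollify :: "(real^3 \<Rightarrow> real) \<Rightarrow> ('w \<Rightarrow> real) \<Rightarrow> 'w \<Rightarrow> real" where
  "mollify \<kappa> g \<omega> = (\<integral>z. \<kappa> z * g (T z \<omega>) \<partial>lebesgue)"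

lemma mollify_orbit:
  assumes \<kappa>: "\<kappa> \<in> Cc_infinity" and g: "continuous_on UNIV g"
  shows "mollify \<kappa> g (T x \<omega>) = conv \<kappa> (\<lambda>z. g (T z \<omega>)) x"
proof -
  have gm: "(\<lambda>z. g (T z \<omega>)) \<in> borel_measurable borel"
    by (intro borel_measurable_continuous_onI along_trajectory_continuous g)
  have "(\<lambda>z. \<kappa> (z - x)) \<in> borel_measurable borel"
    using Cc_infinity_measurable[OF Cc_infinity_shift[OF \<kappa>, of "-x"]] by simp
  then have "(\<lambda>z. \<kappa> (z - x) * g (T z \<omega>)) \<in> borel_measurable borel"
    using gm by (intro borel_measurable_times)
  from lebesgue_integral_shift(1)[OF this, of x] show ?thesis
    unfolding mollify_def conv_def by (simp add: T_comp)
qed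

lemma mollify_continuous:
  assumes \<kappa>: "\<kappa> \<in> Cc_infinity" and g: "continuous_on UNIV g"
  shows "continuous_on UNIV (mollify \<kappa> g)"
  unfolding continuous_on_sequentially o_def mollify_def
proof (intro allI ballI impI)
  fix ws :: "nat \<Rightarrow> 'w" and \<omega> assume lim: "(\<forall>n. ws n \<in> UNIV) \<and> ws \<longlonglongrightarrow> \<omega>"
  obtain B where B: "B > 0" "\<And>\<omega>. \<bar>g \<omega>\<bar> \<le> B" using continuous_bounded[OF g] by blast
  have m: "(\<lambda>z. \<kappa> z * g (T z \<omega>)) \<in> borel_measurable lebesgue" for \<omega>
    by (intro borel_measurable_times Cc_infinity_measurable_leb \<kappa> borel_lebesgue_measurable
        borel_measurable_continuous_onI along_trajectory_continuous g)
  show "(\<lambda>n. \<integral>z. \<kappa> z * g (T z (ws n)) \<partial>lebesgue) \<longlonglongrightarrow> (\<integral>z. \<kappa> z * g (T z \<omega>) \<partial>lebesgue)"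
  proof (rule integral_dominated_convergence[OF m m, where w="\<lambda>z. \<bar>\<kappa> z\<bar> * B"])
    show "integrable lebesgue (\<lambda>z. \<bar>\<kappa> z\<bar> * B)" by (intro integrable_mult_left integrable_abs Cc_infinity_integrable \<kappa>)
    show "AE z in lebesgue. (\<lambda>n. \<kappa> z * g (T z (ws n))) \<longlonglongrightarrow> \<kappa> z * g (T z \<omega>)"
    proof (intro AE_I2 tendsto_mult_left)
      fix z
      have "continuous_on UNIV (\<lambda>\<omega>. g (T z \<omega>))" by (rule continuous_on_compose2[OF g T_continuous]) simp
      then have c: "isCont (\<lambda>\<omega>. g (T z \<omega>)) \<omega>" by (simp add: continuous_on_eq_continuous_at)
      have "ws \<longlonglongrightarrow> \<omega>" using lim by blast
      from isCont_tendsto_compose[OF c this]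
      show "(\<lambda>n. g (T z (ws n))) \<longlonglongrightarrow> g (T z \<omega>)" .
    qed
    show "AE z in lebesgue. norm (\<kappa> z * g (T z (ws n))) \<le> \<bar>\<kappa> z\<bar> * B" for n
      using B by (intro AE_I2) (auto simp: abs_mult intro!: mult_left_mono)
  qed
qed

text \<open>Restricted to an orbit, smoothing is the convolution of a continuous function with \<kappa>.\<close>

lemma mollify_smooth_orbit:
  assumes \<kappa>: "\<kappa> \<in> Cc_infinity" and g: "continuous_on UNIV g"
  shows "((\<lambda>x. mollify \<kappa> g (T x \<omega>)) has_derivative (\<lambda>h. \<Sum>i\<in>UNIV. - mollify (partial_deriv i \<kappa>) g (T x \<omega>) * h $ i)) (at x)"
    and "smooth (\<lambda>x. mollify \<kappa> g (T x \<omega>))"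
    and "partial_deriv i (\<lambda>x. mollify \<kappa> g (T x \<omega>)) x = - mollify (partial_deriv i \<kappa>) g (T x \<omega>)"
proof -
  note ac = along_trajectory_continuous[OF g, of \<omega>]
  show 1: "((\<lambda>x. mollify \<kappa> g (T x \<omega>)) has_derivative (\<lambda>h. \<Sum>i\<in>UNIV. - mollify (partial_deriv i \<kappa>) g (T x \<omega>) * h $ i)) (at x)"
    unfolding mollify_orbit[OF \<kappa> g] mollify_orbit[OF Cc_infinity_partial[OF \<kappa>] g]
    by (rule conv_has_derivative[OF \<kappa> ac])
  show "smooth (\<lambda>x. mollify \<kappa> g (T x \<omega>))"
    unfolding mollify_orbit[OF \<kappa> g] by (rule smooth_conv[OF ac \<kappa>])
  show "partial_deriv i (\<lambda>x. mollify \<kappa> g (T x \<omega>)) x = - mollify (partial_deriv i \<kappa>) g (T x \<omega>)"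
    using partial_deriv_eq[OF 1, of i] by (simp only: sum_axis)
qed

lemma diff_quot_limit:
  assumes "((\<lambda>t. f (T (t *\<^sub>R axis i 1) \<omega>)) has_real_derivative l) (at 0)"
  shows "(diff_quot T i f \<omega> \<longlongrightarrow> l) (at 0)" "D_omega T i f \<omega> = l"
proof -
  show 1: "(diff_quot T i f \<omega> \<longlongrightarrow> l) (at 0)"
    using assms unfolding DERIV_def diff_quot_def[abs_def] by (simp add: T_zero)
  show "D_omega T i f \<omega> = l" unfolding D_omega_def by (rule tendsto_Lim[OF _ 1]) simp
qed

lemma C1_omegaI:
  assumes "continuous_on UNIV f" "\<And>i. continuous_on UNIV (d i)"
    "\<And>i \<omega>. ((\<lambda>t. f (T (t *\<^sub>R axis i 1) \<omega>)) has_real_derivative d i \<omega>) (at 0)"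
  shows "f \<in> C1_omega T" "D_omega T i f = d i"
proof -
  have "D_omega T i f = d i" for i using diff_quot_limit(2)[OF assms(3)] by blast
  moreover have "\<exists>l. (diff_quot T i f \<omega> \<longlongrightarrow> l) (at 0)" for i \<omega> using diff_quot_limit(1)[OF assms(3)] by blast
  ultimately show "f \<in> C1_omega T" "D_omega T i f = d i"
    using assms(1,2) unfolding C1_omega_def by auto
qed

lemma C1_omegaD:
  assumes f: "f \<in> C1_omega T"
  shows "continuous_on UNIV f" "continuous_on UNIV (D_omega T i f)"
    "((\<lambda>t. f (T (t *\<^sub>R axis i 1) \<omega>)) has_real_derivative D_omega T i f \<omega>) (at 0)"
proof -
  show "continuous_on UNIV f" "continuous_on UNIV (D_omega T i f)" using f by (auto simp: C1_omega_def)
  obtain l where l: "(diff_quot T i f \<omega> \<longlongrightarrow> l) (at 0)" using f by (auto simp: C1_omega_def)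
  then have "((\<lambda>t. f (T (t *\<^sub>R axis i 1) \<omega>)) has_real_derivative l) (at 0)"
    unfolding DERIV_def diff_quot_def[abs_def] by (simp add: T_zero)
  with diff_quot_limit(2)[OF this]
  show "((\<lambda>t. f (T (t *\<^sub>R axis i 1) \<omega>)) has_real_derivative D_omega T i f \<omega>) (at 0)" by simp
qed

lemma C1_omega_lincomb:
  assumes f: "f \<in> C1_omega T" and g: "g \<in> C1_omega T"
  shows "(\<lambda>\<omega>. a * f \<omega> + b * g \<omega>) \<in> C1_omega T"
    "grad_omega T (\<lambda>\<omega>. a * f \<omega> + b * g \<omega>) \<omega> = a *\<^sub>R grad_omega T f \<omega> + b *\<^sub>R grad_omega T g \<omega>"
proof -
  let ?d = "\<lambda>i \<omega>. a * D_omega T i f \<omega> + b * D_omega T i g \<omega>"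
  have 1: "((\<lambda>t. a * f (T (t *\<^sub>R axis i 1) \<omega>) + b * g (T (t *\<^sub>R axis i 1) \<omega>)) has_real_derivative ?d i \<omega>) (at 0)" for i \<omega>
    by (intro DERIV_add DERIV_cmult C1_omegaD f g)
  have 2: "continuous_on UNIV (\<lambda>\<omega>. a * f \<omega> + b * g \<omega>)" "continuous_on UNIV (?d i)" for i
    by (intro continuous_on_add continuous_on_mult continuous_on_const C1_omegaD f g)+
  show "(\<lambda>\<omega>. a * f \<omega> + b * g \<omega>) \<in> C1_omega T" by (rule C1_omegaI(1)[where d="?d", OF 2 1])
  show "grad_omega T (\<lambda>\<omega>. a * f \<omega> + b * g \<omega>) \<omega> = a *\<^sub>R grad_omega T f \<omega> + b *\<^sub>R grad_omega T g \<omega>"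
    unfolding grad_omega_def by (simp add: C1_omegaI(2)[where d="?d", OF 2 1] vec_eq_iff)
qed

lemma grad_omega_measurable:
  assumes f: "f \<in> C1_omega T" shows "grad_omega T f \<in> L2 P"
  by (rule L2_vec) (simp add: grad_omega_def continuous_L2 C1_omegaD(2)[OF f])

lemma mollify_contraction:
  assumes \<kappa>: "\<kappa> \<in> Cc_infinity" and g: "continuous_on UNIV g"
  shows "nrm2 P (mollify \<kappa> g) \<le> (\<integral>z. \<bar>\<kappa> z\<bar> \<partial>lebesgue) * nrm2 P g"
proof -
  have id: "(\<lambda>z. z) \<in> borel_measurable (lebesgue :: (real^3) measure)" by (rule borel_lebesgue_measurable_vec) simp
  show ?thesis
    using averaging_contraction[OF sigma_finite_lebesgue id Cc_infinity_integrable[OF \<kappa>] g] mollify_continuous[OF \<kappa> g]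
    unfolding mollify_def[abs_def] by simp
qed

text \<open>Invariance of the measure moves T z to the other factor as T (-z); an odd kernel contributes the
sign.\<close>

lemma mollify_adjoint:
  assumes \<kappa>: "\<kappa> \<in> Cc_infinity" and odd: "\<And>z. \<kappa> (- z) = - \<kappa> z" and g: "continuous_on UNIV g" and h: "continuous_on UNIV h"
  shows "(\<integral>\<omega>. mollify \<kappa> g \<omega> * h \<omega> \<partial>P) = - (\<integral>\<omega>. g \<omega> * mollify \<kappa> h \<omega> \<partial>P)"
proof -
  have id: "(\<lambda>z. z) \<in> borel_measurable (lebesgue :: (real^3) measure)"
    "(\<lambda>z. - z) \<in> borel_measurable (lebesgue :: (real^3) measure)"
    by (rule borel_lebesgue_measurable_vec, simp)+
  note F = averaging_Fubini[OF sigma_finite_lebesgue _ Cc_infinity_integrable[OF \<kappa>]]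
  have "(\<integral>\<omega>. mollify \<kappa> g \<omega> * h \<omega> \<partial>P) = (\<integral>z. \<kappa> z * (\<integral>\<omega>. g (T z \<omega>) * h \<omega> \<partial>P) \<partial>lebesgue)"
    unfolding mollify_def by (rule F[OF id(1) g h])
  also have "\<dots> = (\<integral>z. \<kappa> z * (\<integral>\<omega>. h (T (- z) \<omega>) * g \<omega> \<partial>P) \<partial>lebesgue)"
  proof -
    have "(\<integral>\<omega>. g (T z \<omega>) * h \<omega> \<partial>P) = (\<integral>\<omega>. h (T (- z) \<omega>) * g \<omega> \<partial>P)" for z
    proof -
      have m: "(\<lambda>\<omega>. g (T z \<omega>) * h \<omega>) \<in> borel_measurable P"
        by (intro continuous_measurable continuous_on_mult h continuous_on_compose2[OF g T_continuous]) simp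
      show ?thesis using T_integral(1)[OF m, of "- z"] by (simp add: T_inverse mult.commute)
    qed
    then show ?thesis by simp
  qed
  also have "\<dots> = (\<integral>\<omega>. (\<integral>z. \<kappa> z * h (T (- z) \<omega>) \<partial>lebesgue) * g \<omega> \<partial>P)"
    by (rule F[OF id(2) h g, symmetric])
  also have "\<dots> = (\<integral>\<omega>. - mollify \<kappa> h \<omega> * g \<omega> \<partial>P)"
  proof -
    have "(\<integral>z. \<kappa> z * h (T (- z) \<omega>) \<partial>lebesgue) = - mollify \<kappa> h \<omega>" for \<omega>
    proof -
      have km: "\<kappa> \<in> borel_measurable borel" by (rule Cc_infinity_measurable[OF \<kappa>])
      have hm: "(\<lambda>z. h (T z \<omega>)) \<in> borel_measurable borel"
        by (intro borel_measurable_continuous_onI along_trajectory_continuous h)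
      have hm': "(\<lambda>z. h (T (- z) \<omega>)) \<in> borel_measurable borel"
        using measurable_compose[OF _ hm, of uminus borel] by simp
      have m: "(\<lambda>z. \<kappa> z * h (T (- z) \<omega>)) \<in> borel_measurable borel" by (intro borel_measurable_times km hm')
      have m2: "(\<lambda>z. \<kappa> z * h (T z \<omega>)) \<in> borel_measurable borel" by (intro borel_measurable_times km hm)
      have "(\<integral>z. \<kappa> z * h (T (- z) \<omega>) \<partial>lebesgue) = (\<integral>z. \<kappa> z * h (T (- z) \<omega>) \<partial>lborel)" using m by (simp add: integral_completion)
      also have "\<dots> = (\<integral>z. \<kappa> (- z) * h (T z \<omega>) \<partial>lborel)" using lborel_scale(1)[OF m, of "-1" 0] by simp
      also have "\<dots> = - (\<integral>z. \<kappa> z * h (T z \<omega>) \<partial>lborel)" by (simp add: odd)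
      finally show ?thesis unfolding mollify_def using m2 by (simp add: integral_completion)
    qed
    then show ?thesis by simp
  qed
  finally show ?thesis by (simp add: mult.commute)
qed

end

section \<open>Curl-free fields are gradients up to averages\<close>

lemma cutoff_nonneg: "0 \<le> cutoff x" by (simp add: cutoff_def bumpf_nonneg)

lemma cutoff_even: "cutoff (- x) = cutoff x" by (simp add: cutoff_def)

lemma cutoff_scaled_Cc: 
  assumes c: "0 < c" shows "(\<lambda>x. cutoff (c *\<^sub>R x)) \<in> Cc_infinity"
proof (rule Cc_infinityI)
  show "smooth (\<lambda>x. cutoff (c *\<^sub>R x))" using smooth_affine[OF smooth_cutoff, of c 0] by simp
  show "cutoff (c *\<^sub>R x) = 0" if "1 / c < norm x" for x
    using that c by (intro cutoff_zero) (simp add: field_simps)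
qed

lemma cutoff_scaled_integral_pos:
  assumes c: "0 < c" shows "0 < (\<integral>x. cutoff (c *\<^sub>R x) \<partial>lebesgue)"
proof -
  let ?f = "\<lambda>x. cutoff (c *\<^sub>R x)"
  note C = cutoff_scaled_Cc[OF c]
  have fm: "?f \<in> borel_measurable lborel" using Cc_infinity_measurable[OF C] by simp
  have i: "integrable lborel ?f" using Cc_infinity_integrable[OF C] fm by (simp add: integrable_completion)
  have "(\<integral>x. ?f x \<partial>lborel) \<noteq> 0"
  proof
    assume "(\<integral>x. ?f x \<partial>lborel) = 0"
    then have "AE x in lborel. ?f x = 0" by (subst (asm) integral_nonneg_eq_0_iff_AE[OF i]) (auto simp: cutoff_nonneg)
    then have "AE x in lborel. x \<notin> ball (0::real^3) (1 / c)"
    proof eventually_elim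
      case (elim x)
      show ?case
      proof
        assume "x \<in> ball 0 (1 / c)"
        then have "c * norm x < 1" using c by (simp add: field_simps)
        then have "(c * norm x)\<^sup>2 < 1\<^sup>2" using c by (intro power_strict_mono) auto
        then have "0 < bumpf 0 (1 - (norm (c *\<^sub>R x))\<^sup>2)" using c by (intro bumpf_pos) (simp add: power_mult_distrib)
        then show False using elim by (simp add: cutoff_def)
      qed
    qed
    then have "emeasure lborel {x \<in> space lborel. \<not> x \<notin> ball (0::real^3) (1 / c)} = 0"
      by (intro emeasure_eq_0_AE) simp
    then have "emeasure lborel (ball (0::real^3) (1 / c)) = 0" by (simp add: ball_def)
    moreover have "emeasure lborel (ball (0::real^3) (1 / c)) \<noteq> 0"
      using c content_ball_pos[of "1/c" "0::real^3"] by (auto simp: measure_def)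
    ultimately show False by simp
  qed
  moreover have "0 \<le> (\<integral>x. ?f x \<partial>lborel)" by (simp add: cutoff_nonneg)
  ultimately show ?thesis using fm by (simp add: integral_completion)
qed

text \<open>A smooth even probability density supported in the ball of radius 1/(m+1).\<close>

definition moll :: "nat \<Rightarrow> real^3 \<Rightarrow> real" where
  "moll m x = cutoff (real (Suc m) *\<^sub>R x) * inverse (\<integral>x. cutoff (real (Suc m) *\<^sub>R x) \<partial>lebesgue)"

lemma moll_Cc: "moll m \<in> Cc_infinity"
  unfolding moll_def[abs_def] by (intro Cc_infinity_mult cutoff_scaled_Cc smooth_const) simp

lemma moll_nonneg: "0 \<le> moll m x"
  unfolding moll_def using cutoff_scaled_integral_pos[of "real (Suc m)"] cutoff_nonneg by simp

lemma moll_integral: "(\<integral>x. moll m x \<partial>lebesgue) = 1"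
  unfolding moll_def using cutoff_scaled_integral_pos[of "real (Suc m)"] by (simp del: of_nat_Suc)

lemma moll_zero: "1 / real (Suc m) < norm x \<Longrightarrow> moll m x = 0"
  unfolding moll_def by (subst cutoff_zero) (auto simp: field_simps simp del: of_nat_Suc)

lemma moll_even: "moll m (- x) = moll m x"
  unfolding moll_def using cutoff_even[of "real (Suc m) *\<^sub>R x"] by simp

lemma moll_partial_odd: "partial_deriv i (moll m) (- z) = - partial_deriv i (moll m) z"
proof -
  have "partial_deriv i (\<lambda>x. moll m ((-1) *\<^sub>R x + 0)) z = (-1) * partial_deriv i (moll m) ((-1) *\<^sub>R z + 0)"
    by (rule partial_deriv_affine[OF Cc_infinityD(1)[OF moll_Cc]])
  then show ?thesis by (simp add: moll_even)
qed

context stochastic_setting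
begin

text \<open>Uniform continuity on the compact product of the unit ball with \<Omega>.\<close>

lemma uniform_orbit:
  fixes g :: "'w \<Rightarrow> real"
  assumes g: "continuous_on UNIV g" and e: "0 < e"
  shows "\<exists>\<delta>>0. \<forall>z \<omega>. norm z < \<delta> \<longrightarrow> \<bar>g (T z \<omega>) - g \<omega>\<bar> < e"
proof -
  let ?K = "cball (0::real^3) 1 \<times> (UNIV :: 'w set)"
  have "continuous_on UNIV (\<lambda>p. g (case p of (x, \<omega>) \<Rightarrow> T x \<omega>))"
    by (rule continuous_on_compose2[OF g T_joint_continuous]) simp
  then have "continuous_on ?K (\<lambda>p. g (case p of (x, \<omega>) \<Rightarrow> T x \<omega>))"
    by (rule continuous_on_subset) simp
  then have "uniformly_continuous_on ?K (\<lambda>p. g (case p of (x, \<omega>) \<Rightarrow> T x \<omega>))"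
    by (rule compact_uniformly_continuous) (intro compact_Times compact_UNIV compact_cball)
  then obtain d where d: "d > 0" "\<And>p q. p \<in> ?K \<Longrightarrow> q \<in> ?K \<Longrightarrow> dist q p < d \<Longrightarrow>
      dist (g (case q of (x, \<omega>) \<Rightarrow> T x \<omega>)) (g (case p of (x, \<omega>) \<Rightarrow> T x \<omega>)) < e"
    using e unfolding uniformly_continuous_on_def by blast
  have "\<bar>g (T z \<omega>) - g \<omega>\<bar> < e" if "norm z < min 1 d" for z \<omega>
    using d(2)[of "(0, \<omega>)" "(z, \<omega>)"] that by (simp add: dist_Pair_Pair dist_real_def T_zero)
  then show ?thesis using d(1) by (intro exI[of _ "min 1 d"]) auto
qed

lemma mollify_diff:
  assumes \<kappa>: "\<kappa> \<in> Cc_infinity" and g: "continuous_on UNIV g" and h: "continuous_on UNIV h"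
  shows "mollify \<kappa> (\<lambda>\<omega>. g \<omega> - h \<omega>) \<omega> = mollify \<kappa> g \<omega> - mollify \<kappa> h \<omega>"
  using Bochner_Integration.integral_diff[OF conv_integrable[OF \<kappa> along_trajectory_continuous[OF g], of 0 \<omega>]
      conv_integrable[OF \<kappa> along_trajectory_continuous[OF h], of 0 \<omega>]]
  unfolding mollify_def by (simp add: right_diff_distrib)

lemma mollify_approx:
  fixes g :: "'w \<Rightarrow> real"
  assumes g: "continuous_on UNIV g" and e: "0 < e"
  shows "\<exists>m0. \<forall>m\<ge>m0. \<forall>\<omega>. \<bar>mollify (moll m) g \<omega> - g \<omega>\<bar> \<le> e"
proof -
  obtain \<delta> where \<delta>: "\<delta> > 0" "\<And>z \<omega>. norm z < \<delta> \<Longrightarrow> \<bar>g (T z \<omega>) - g \<omega>\<bar> < e" using uniform_orbit[OF g e] by blast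
  obtain m0 where m0: "inverse (real (Suc m0)) < \<delta>" using reals_Archimedean[OF \<delta>(1)] by blast
  have "\<bar>mollify (moll m) g \<omega> - g \<omega>\<bar> \<le> e" if "m \<ge> m0" for m \<omega>
  proof -
    have sm: "1 / real (Suc m) < \<delta>"
    proof -
      have "inverse (real (Suc m)) \<le> inverse (real (Suc m0))" using that by (intro le_imp_inverse_le) auto
      then show ?thesis using m0 by (simp add: inverse_eq_divide)
    qed
    have i1: "integrable lebesgue (\<lambda>z. moll m z * g (T z \<omega>))"
      using conv_integrable[OF moll_Cc along_trajectory_continuous[OF g], of m 0 \<omega>] by simp
    have i2: "integrable lebesgue (\<lambda>z. moll m z * c)" for c by (intro integrable_mult_left Cc_infinity_integrable moll_Cc)
    have "mollify (moll m) g \<omega> - g \<omega> = (\<integral>z. moll m z * g (T z \<omega>) \<partial>lebesgue) - (\<integral>z. moll m z * g \<omega> \<partial>lebesgue)"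
      by (simp add: mollify_def moll_integral)
    also have "\<dots> = (\<integral>z. moll m z * g (T z \<omega>) - moll m z * g \<omega> \<partial>lebesgue)"
      by (rule Bochner_Integration.integral_diff[OF i1 i2, symmetric])
    finally have "\<bar>mollify (moll m) g \<omega> - g \<omega>\<bar> \<le> (\<integral>z. \<bar>moll m z * g (T z \<omega>) - moll m z * g \<omega>\<bar> \<partial>lebesgue)"
      by (simp only: integral_abs_bound)
    also have "\<dots> \<le> (\<integral>z. moll m z * e \<partial>lebesgue)"
    proof (rule integral_mono)
      show "\<bar>moll m z * g (T z \<omega>) - moll m z * g \<omega>\<bar> \<le> moll m z * e" for z
      proof (cases "1 / real (Suc m) < norm z")
        case False
        then have "\<bar>g (T z \<omega>) - g \<omega>\<bar> < e" using sm by (intro \<delta>(2)) linarith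
        then have "moll m z * \<bar>g (T z \<omega>) - g \<omega>\<bar> \<le> moll m z * e" by (intro mult_left_mono moll_nonneg) auto
        then show ?thesis using moll_nonneg[of m z] by (simp add: abs_mult flip: right_diff_distrib)
      qed (simp add: moll_zero)
    qed (intro integrable_abs Bochner_Integration.integrable_diff i1 i2)+
    also have "\<dots> = e" by (simp add: moll_integral)
    finally show ?thesis .
  qed
  then show ?thesis by blast
qed

text \<open>Weak vanishing of the curl. The test functions are the derivatives along the orbits of the smoothed
functions mollify (moll m) q, which up to sign are mollify (partial_deriv i (moll m)) q.\<close>

definition curl_free :: "('w \<Rightarrow> real^3) \<Rightarrow> bool" where
  "curl_free W \<longleftrightarrow> (\<forall>m q i j. continuous_on UNIV q \<longrightarrow>
     (\<integral>\<omega>. W \<omega> $ j * mollify (partial_deriv i (moll m)) q \<omega> \<partial>P) = (\<integral>\<omega>. W \<omega> $ i * mollify (partial_deriv j (moll m)) q \<omega> \<partial>P))"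

text \<open>The entry D_i G_j - D_j G_i of the curl of the smoothed field G = mollify (moll m) g; the derivative
of a smoothed function is minus the smoothing with the derivative of the kernel.\<close>

definition curl_entry :: "nat \<Rightarrow> (3 \<Rightarrow> 'w \<Rightarrow> real) \<Rightarrow> 3 \<Rightarrow> 3 \<Rightarrow> 'w \<Rightarrow> real" where
  "curl_entry m g i j \<omega> = mollify (partial_deriv j (moll m)) (g i) \<omega> - mollify (partial_deriv i (moll m)) (g j) \<omega>"

definition moll_grad_mass :: "nat \<Rightarrow> real" where
  "moll_grad_mass m = (\<Sum>i\<in>UNIV. \<integral>z. \<bar>partial_deriv i (moll m) z\<bar> \<partial>lebesgue)"

lemma moll_grad_mass_nonneg: "0 \<le> moll_grad_mass m"
  unfolding moll_grad_mass_def by (intro sum_nonneg) simp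

lemma mollify_partial_bound:
  assumes "continuous_on UNIV h"
  shows "nrm2 P (mollify (partial_deriv i (moll m)) h) \<le> moll_grad_mass m * nrm2 P h"
proof -
  have "(\<integral>z. \<bar>partial_deriv i (moll m) z\<bar> \<partial>lebesgue) \<le> moll_grad_mass m"
    unfolding moll_grad_mass_def by (rule member_le_sum) auto
  then show ?thesis
    using mollify_contraction[OF Cc_infinity_partial[OF moll_Cc] assms, of i m]
    by (elim order_trans) (simp add: mult_right_mono)
qed

lemma curl_entry_continuous:
  assumes "\<And>j. continuous_on UNIV (g j)" shows "continuous_on UNIV (curl_entry m g i j)"
  unfolding curl_entry_def by (intro continuous_on_diff mollify_continuous Cc_infinity_partial moll_Cc assms)

text \<open>The curl h of the smoothed field is paired with itself and moved by adjointness to derivatives of the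
smoothing of h. There g may be replaced by W at a cost proportional to their distance, and the
contribution of W vanishes.\<close>

lemma curl_entry_bound:
  assumes W: "W \<in> L2 P" "curl_free W" and g: "\<And>j. continuous_on UNIV (g j)"
    and e: "\<And>j. nrm2 P (\<lambda>\<omega>. W \<omega> $ j - g j \<omega>) \<le> e"
  shows "nrm2 P (curl_entry m g i j) \<le> 2 * moll_grad_mass m * e"
proof -
  define h where "h = curl_entry m g i j"
  have hc: "continuous_on UNIV h" unfolding h_def by (rule curl_entry_continuous[OF g])
  let ?M = "\<lambda>i q. mollify (partial_deriv i (moll m)) q"
  note pC = Cc_infinity_partial[OF moll_Cc, of _ m]
  have Mc: "continuous_on UNIV (?M i q)" if "continuous_on UNIV q" for i q by (rule mollify_continuous[OF pC that])
  have adj: "(\<integral>\<omega>. ?M i q \<omega> * h \<omega> \<partial>P) = - (\<integral>\<omega>. q \<omega> * ?M i h \<omega> \<partial>P)" if "continuous_on UNIV q" for i q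
    by (rule mollify_adjoint[OF pC moll_partial_odd that hc])
  have wc: "(\<lambda>\<omega>. W \<omega> $ i) \<in> L2 P" for i by (rule L2_component[OF W(1)])
  have gL: "g i \<in> L2 P" for i by (rule continuous_L2[OF g])
  have mhL: "?M i h \<in> L2 P" for i by (rule continuous_L2[OF Mc[OF hc]])
  have wg: "(\<integral>\<omega>. (W \<omega> $ k - g k \<omega>) * ?M l h \<omega> \<partial>P) = (\<integral>\<omega>. W \<omega> $ k * ?M l h \<omega> \<partial>P) - (\<integral>\<omega>. g k \<omega> * ?M l h \<omega> \<partial>P)" for k l
    unfolding left_diff_distrib by (intro Bochner_Integration.integral_diff L2_mult_integrable wc gL mhL)
  have bound: "\<bar>\<integral>\<omega>. (W \<omega> $ k - g k \<omega>) * ?M l h \<omega> \<partial>P\<bar> \<le> e * (moll_grad_mass m * nrm2 P h)" for k l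
    by (rule order_trans[OF L2_Cauchy_Schwarz_real[OF L2_diff[OF wc gL] mhL]])
       (intro mult_mono e mollify_partial_bound hc order_trans[OF nrm2_nonneg e] nrm2_nonneg)
  have "(nrm2 P h)\<^sup>2 = (\<integral>\<omega>. ?M j (g i) \<omega> * h \<omega> - ?M i (g j) \<omega> * h \<omega> \<partial>P)"
    unfolding nrm2_sq by (simp add: h_def curl_entry_def power2_eq_square left_diff_distrib)
  also have "\<dots> = (\<integral>\<omega>. ?M j (g i) \<omega> * h \<omega> \<partial>P) - (\<integral>\<omega>. ?M i (g j) \<omega> * h \<omega> \<partial>P)"
    by (intro Bochner_Integration.integral_diff continuous_integrable continuous_on_mult Mc g hc)
  also have "\<dots> = (\<integral>\<omega>. g j \<omega> * ?M i h \<omega> \<partial>P) - (\<integral>\<omega>. g i \<omega> * ?M j h \<omega> \<partial>P)"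
    by (simp add: adj[OF g])
  also have "\<dots> = (\<integral>\<omega>. (W \<omega> $ i - g i \<omega>) * ?M j h \<omega> \<partial>P) - (\<integral>\<omega>. (W \<omega> $ j - g j \<omega>) * ?M i h \<omega> \<partial>P)"
    using W(2) hc unfolding wg curl_free_def by simp
  also have "\<dots> \<le> 2 * moll_grad_mass m * e * nrm2 P h" using bound[of i j] bound[of j i] by (simp add: mult_ac) 
  finally have "nrm2 P h * nrm2 P h \<le> 2 * moll_grad_mass m * e * nrm2 P h" by (simp add: power2_eq_square)
  moreover have "0 \<le> 2 * moll_grad_mass m * e" using moll_grad_mass_nonneg order_trans[OF nrm2_nonneg e] by simp
  ultimately show ?thesis unfolding h_def[symmetric]
    by (cases "nrm2 P h = 0") (auto simp: mult_le_cancel_right less_le)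
qed

text \<open>The mean over the segment of the orbit from \<omega> to T y \<omega>.\<close>

definition line_mean :: "real^3 \<Rightarrow> ('w \<Rightarrow> real) \<Rightarrow> 'w \<Rightarrow> real" where
  "line_mean y f \<omega> = integral (cbox 0 1) (\<lambda>s::real. f (T (s *\<^sub>R y) \<omega>))"

lemma line_continuous:
  assumes "continuous_on UNIV f" shows "continuous_on UNIV (\<lambda>(\<omega>, s). f (T (s *\<^sub>R y) \<omega>))"
proof -
  have "continuous_on UNIV (\<lambda>p. f (case (snd p *\<^sub>R y, fst p) of (x, \<omega>) \<Rightarrow> T x \<omega>))"
    by (rule continuous_on_compose2[OF assms], rule continuous_on_compose2[OF T_joint_continuous])
       (auto intro!: continuous_intros)
  then show ?thesis by (simp add: case_prod_beta')
qed

lemma line_mean_continuous: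
  assumes f: "continuous_on UNIV f" shows "continuous_on UNIV (line_mean y f)"
  unfolding line_mean_def[abs_def]
  by (rule integral_continuous_on_param) (rule continuous_on_subset[OF line_continuous[OF f]], simp)

lemma line_mean_contraction:
  assumes f: "continuous_on UNIV f" shows "nrm2 P (line_mean y f) \<le> nrm2 P f"
proof -
  have eq: "line_mean y f \<omega> = (\<integral>s. indicator {0..1::real} s * f (T (s *\<^sub>R y) \<omega>) \<partial>lborel)" for \<omega>
  proof -
    have c: "continuous_on {0..1} (\<lambda>s::real. f (T (s *\<^sub>R y) \<omega>))"
      by (rule continuous_on_compose2[OF along_trajectory_continuous[OF f]]) (auto intro!: continuous_intros)
    have "(LINT s:{0..1}|lborel. f (T (s *\<^sub>R y) \<omega>)) = integral {0..1} (\<lambda>s. f (T (s *\<^sub>R y) \<omega>))"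
      by (rule set_borel_integral_eq_integral(2)) (rule borel_integrable_atLeastAtMost'[OF c])
    then show ?thesis unfolding line_mean_def set_lebesgue_integral_def by simp
  qed
  have i: "integrable lborel (indicator {0..1} :: real \<Rightarrow> real)" by simp
  have m: "(\<lambda>s::real. s *\<^sub>R y) \<in> borel_measurable lborel" by measurable
  show ?thesis
    using averaging_contraction[OF sigma_finite_lborel m i f] line_mean_continuous[OF f, of y]
    unfolding eq[abs_def] by simp
qed

text \<open>The potential of a smooth field obtained by integration along segments, as in the Poincare lemma.
Exchanging D_i with D_j at the cost of the curl turns the integrand of D_i f into the derivative of the
i-th component along the segment, to which the fundamental theorem of calculus applies.\<close>

lemma line_potential:
  fixes g :: "3 \<Rightarrow> 'w \<Rightarrow> real" and y :: "real^3" and m :: nat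
  assumes g: "\<And>j. continuous_on UNIV (g j)"
  defines "f \<equiv> line_mean y (\<lambda>\<omega>. \<Sum>j\<in>UNIV. y $ j * mollify (moll m) (g j) \<omega>)"
  shows "f \<in> C1_omega T"
    and "D_omega T i f \<omega> = mollify (moll m) (g i) (T y \<omega>) - mollify (moll m) (g i) \<omega>
      + line_mean y (\<lambda>\<omega>. \<Sum>j\<in>UNIV. y $ j * curl_entry m g i j \<omega>) \<omega>"
proof -
  let ?G = "\<lambda>j. mollify (moll m) (g j)" and ?D = "\<lambda>i j \<omega>. - mollify (partial_deriv i (moll m)) (g j) \<omega>"
  define F where "F = (\<lambda>\<omega>. \<Sum>j\<in>UNIV. y $ j * ?G j \<omega>)"
  define F' where "F' i = (\<lambda>\<omega>. \<Sum>j\<in>UNIV. y $ j * ?D i j \<omega>)" for i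
  have Gc: "continuous_on UNIV (?G j)" for j by (intro mollify_continuous moll_Cc g)
  have Dc: "continuous_on UNIV (?D i j)" for i j by (intro continuous_on_minus mollify_continuous Cc_infinity_partial moll_Cc g)
  have Fc: "continuous_on UNIV F" unfolding F_def by (intro continuous_on_sum continuous_on_mult continuous_on_const Gc)
  have F'c: "continuous_on UNIV (F' i)" for i unfolding F'_def by (intro continuous_on_sum continuous_on_mult continuous_on_const Dc)
  have Gd: "((\<lambda>t. ?G j (T (t *\<^sub>R axis i 1) \<omega>)) has_real_derivative ?D i j (T (h *\<^sub>R axis i 1) \<omega>)) (at h)" for i j h \<omega>
  proof -
    have "((\<lambda>t. ?G j (T (t *\<^sub>R axis i 1) \<omega>)) has_derivative (\<lambda>t. \<Sum>k\<in>UNIV. ?D k j (T (h *\<^sub>R axis i 1) \<omega>) * (t *\<^sub>R axis i 1) $ k)) (at h)"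
      by (rule has_derivative_compose[OF _ mollify_smooth_orbit(1)[OF moll_Cc g]]) (auto intro!: derivative_eq_intros)
    moreover have "(\<Sum>k\<in>UNIV. a k * (t *\<^sub>R axis i 1) $ k) = a i * t" for a :: "3 \<Rightarrow> real" and t
      using sum_axis[of "\<lambda>k. a k * t" i] by (simp add: mult_ac)
    ultimately show ?thesis by (simp only: has_field_derivative_def)
  qed
  have Fd: "((\<lambda>h. F (T (s *\<^sub>R y) (T (h *\<^sub>R axis i 1) \<omega>))) has_real_derivative F' i (T (s *\<^sub>R y) (T (h *\<^sub>R axis i 1) \<omega>))) (at h)" for i s h \<omega>
  proof -
    have c: "T (s *\<^sub>R y) (T (h *\<^sub>R axis i 1) \<omega>) = T (h *\<^sub>R axis i 1) (T (s *\<^sub>R y) \<omega>)" for h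
      by (simp add: T_comp add.commute)
    show ?thesis unfolding c F_def F'_def by (intro DERIV_sum DERIV_cmult Gd)
  qed
  have d0: "((\<lambda>t. line_mean y F (T (t *\<^sub>R axis i 1) \<omega>)) has_real_derivative line_mean y (F' i) \<omega>) (at 0)" for i \<omega>
  proof -
    have "((\<lambda>t. integral (cbox 0 1) (\<lambda>s. F (T (s *\<^sub>R y) (T (t *\<^sub>R axis i 1) \<omega>)))) has_real_derivative
       integral (cbox 0 1) (\<lambda>s. F' i (T (s *\<^sub>R y) (T (0 *\<^sub>R axis i 1) \<omega>)))) (at 0 within UNIV)"
    proof (rule leibniz_rule_field_derivative)
      show "((\<lambda>t. F (T (s *\<^sub>R y) (T (t *\<^sub>R axis i 1) \<omega>))) has_real_derivative F' i (T (s *\<^sub>R y) (T (t *\<^sub>R axis i 1) \<omega>))) (at t within UNIV)" for t s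
        using Fd by simp
      show "(\<lambda>s. F (T (s *\<^sub>R y) (T (t *\<^sub>R axis i 1) \<omega>))) integrable_on cbox 0 1" for t
        by (intro integrable_continuous continuous_on_compose2[OF along_trajectory_continuous[OF Fc]]) (auto intro!: continuous_intros)
      have tc: "continuous_on UNIV (\<lambda>p::real \<times> real. T (fst p *\<^sub>R axis i 1) \<omega>)"
        by (rule continuous_on_compose2[OF trajectory_continuous[of \<omega>]]) (auto intro!: continuous_intros)
      have "continuous_on UNIV (\<lambda>p::real \<times> real. (T (fst p *\<^sub>R axis i 1) \<omega>, snd p))"
        by (intro continuous_on_Pair tc continuous_on_snd continuous_on_id)
      from continuous_on_compose[OF this continuous_on_subset[OF line_continuous[where y=y, OF F'c[of i]] subset_UNIV]]
      have "continuous_on UNIV (\<lambda>p. F' i (T (snd p *\<^sub>R y) (T (fst p *\<^sub>R axis i 1) \<omega>)))"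
        by (simp add: o_def)
      then show "continuous_on (UNIV \<times> cbox 0 1) (\<lambda>(t, s). F' i (T (s *\<^sub>R y) (T (t *\<^sub>R axis i 1) \<omega>)))"
        using continuous_on_subset[OF _ subset_UNIV] by (simp add: case_prod_beta')
    qed auto
    then show ?thesis unfolding line_mean_def by (simp add: T_zero)
  qed
  have f_eq: "f = line_mean y F" unfolding f_def F_def ..
  show "f \<in> C1_omega T" unfolding f_eq
    by (rule C1_omegaI(1)[where d="\<lambda>i. line_mean y (F' i)"]) (intro line_mean_continuous Fc F'c d0)+
  have D: "D_omega T i f \<omega> = line_mean y (F' i) \<omega>"
    unfolding f_eq by (subst C1_omegaI(2)[where d="\<lambda>i. line_mean y (F' i)"]) (intro line_mean_continuous Fc F'c d0 refl)+
  define E where "E = (\<lambda>\<omega>. \<Sum>j\<in>UNIV. y $ j * ?D j i \<omega>)"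
  have Ec: "continuous_on UNIV E" unfolding E_def by (intro continuous_on_sum continuous_on_mult continuous_on_const Dc)
  have FTC: "line_mean y E \<omega> = ?G i (T y \<omega>) - ?G i \<omega>"
  proof -
    have "((\<lambda>s. E (T (s *\<^sub>R y) \<omega>)) has_integral (?G i (T (1 *\<^sub>R y) \<omega>) - ?G i (T (0 *\<^sub>R y) \<omega>))) {0..1}"
    proof (rule fundamental_theorem_of_calculus)
      fix s :: real
      have "((\<lambda>t. ?G i (T (t *\<^sub>R y) \<omega>)) has_derivative (\<lambda>t. \<Sum>k\<in>UNIV. ?D k i (T (s *\<^sub>R y) \<omega>) * (t *\<^sub>R y) $ k)) (at s)"
        by (rule has_derivative_compose[OF _ mollify_smooth_orbit(1)[OF moll_Cc g]]) (auto intro!: derivative_eq_intros)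
      moreover have "(\<Sum>k\<in>UNIV. ?D k i (T (s *\<^sub>R y) \<omega>) * (t *\<^sub>R y) $ k) = t *\<^sub>R E (T (s *\<^sub>R y) \<omega>)" for t
        unfolding E_def by (simp add: sum_distrib_left mult_ac)
      ultimately show "((\<lambda>t. ?G i (T (t *\<^sub>R y) \<omega>)) has_vector_derivative E (T (s *\<^sub>R y) \<omega>)) (at s within {0..1})"
        by (simp only: has_vector_derivative_def has_derivative_at_withinI)
    qed simp
    then show ?thesis unfolding line_mean_def by (simp add: integral_unique T_zero)
  qed
  have "line_mean y (F' i) \<omega> = line_mean y E \<omega> + line_mean y (\<lambda>\<omega>. \<Sum>j\<in>UNIV. y $ j * curl_entry m g i j \<omega>) \<omega>"
  proof -
    let ?c = "\<lambda>\<omega>. \<Sum>j\<in>UNIV. y $ j * curl_entry m g i j \<omega>"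
    have cc: "continuous_on UNIV ?c" by (intro continuous_on_sum continuous_on_mult continuous_on_const curl_entry_continuous g)
    have int: "(\<lambda>s. h (T (s *\<^sub>R y) \<omega>)) integrable_on cbox 0 (1::real)" if "continuous_on UNIV h" for h :: "'w \<Rightarrow> real"
      by (intro integrable_continuous continuous_on_compose2[OF along_trajectory_continuous[OF that]]) (auto intro!: continuous_intros)
    have "F' i \<omega> = E \<omega> + ?c \<omega>" for \<omega>
      unfolding F'_def E_def curl_entry_def by (simp add: sum.distrib[symmetric] algebra_simps)
    then show ?thesis unfolding line_mean_def using Henstock_Kurzweil_Integration.integral_add[OF int[OF Ec] int[OF cc]] by simp
  qed
  then show "D_omega T i f \<omega> = ?G i (T y \<omega>) - ?G i \<omega> + line_mean y (\<lambda>\<omega>. \<Sum>j\<in>UNIV. y $ j * curl_entry m g i j \<omega>) \<omega>"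
    unfolding D FTC by simp
qed

text \<open>Dyadic convex combinations of the translations, given as operators so that the same combination can
be applied to a field and to its smooth approximations.\<close>

inductive_set avg_ops :: "(('w \<Rightarrow> real^3) \<Rightarrow> 'w \<Rightarrow> real^3) set" where
  shift: "(\<lambda>F \<omega>. F (T y \<omega>)) \<in> avg_ops"
| mid: "S1 \<in> avg_ops \<Longrightarrow> S2 \<in> avg_ops \<Longrightarrow> (\<lambda>F \<omega>. (1/2) *\<^sub>R (S1 F \<omega> + S2 F \<omega>)) \<in> avg_ops"

lemma avg_ops_diff: "S \<in> avg_ops \<Longrightarrow> S (\<lambda>\<omega>. F \<omega> - G \<omega>) \<omega> = S F \<omega> - S G \<omega>"
  by (induction arbitrary: \<omega> rule: avg_ops.induct) (auto simp: scaleR_add_right scaleR_diff_right)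

lemma avg_ops_shift: "S \<in> avg_ops \<Longrightarrow> \<exists>S'\<in>avg_ops. \<forall>F \<omega>. S F (T y \<omega>) = S' F \<omega>"
proof (induction rule: avg_ops.induct)
  case (shift z)
  show ?case by (rule bexI[OF _ avg_ops.shift[of "z + y"]]) (simp add: T_add)
next
  case (mid S1 S2)
  then obtain S1' S2' where "S1' \<in> avg_ops" "S2' \<in> avg_ops" "\<forall>F \<omega>. S1 F (T y \<omega>) = S1' F \<omega>" "\<forall>F \<omega>. S2 F (T y \<omega>) = S2' F \<omega>"
    by blast
  then show ?case by (intro bexI[OF _ avg_ops.mid[of S1' S2']]) auto
qed

lemma avg_ops_L2:
  "S \<in> avg_ops \<Longrightarrow> F \<in> L2 P \<Longrightarrow> S F \<in> L2 P \<and> nrm2 P (S F) \<le> nrm2 P F"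
proof (induction rule: avg_ops.induct)
  case (shift y)
  then show ?case using T_nrm2[of F y] by simp
next
  case (mid S1 S2)
  have m: "(\<lambda>\<omega>. S1 F \<omega> + S2 F \<omega>) \<in> L2 P" using mid by (intro L2_add) auto
  have "nrm2 P (\<lambda>\<omega>. (1/2) *\<^sub>R (S1 F \<omega> + S2 F \<omega>)) = 1/2 * nrm2 P (\<lambda>\<omega>. S1 F \<omega> + S2 F \<omega>)"
    using nrm2_scale[of P "1/2" "\<lambda>\<omega>. S1 F \<omega> + S2 F \<omega>"] by simp
  also have "\<dots> \<le> 1/2 * (nrm2 P (S1 F) + nrm2 P (S2 F))" using mid by (intro mult_left_mono nrm2_triangle) auto
  also have "\<dots> \<le> nrm2 P F" using mid by simp
  finally show ?case using L2_scale[OF m, of "1/2"] by simp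
qed

lemma avg_ops_mean:
  "S \<in> avg_ops \<Longrightarrow> F \<in> L2 P \<Longrightarrow> (\<integral>\<omega>. S F \<omega> $ i \<partial>P) = (\<integral>\<omega>. F \<omega> $ i \<partial>P)"
proof (induction rule: avg_ops.induct)
  case (shift y)
  then show ?case using T_integral(1)[OF L2_meas[OF L2_component[of F P i]], of y] by simp
next
  case (mid S1 S2)
  have i: "integrable P (\<lambda>\<omega>. G \<omega> $ i)" if "G \<in> L2 P" for G :: "'w \<Rightarrow> real^3"
  proof -
    have "(\<lambda>\<omega>. 1::real) \<in> L2 P" by (rule continuous_L2) simp
    from L2_mult_integrable[OF L2_component[OF that, of i] this] show ?thesis by simp
  qed
  have "integrable P (\<lambda>\<omega>. S1 F \<omega> $ i)" "integrable P (\<lambda>\<omega>. S2 F \<omega> $ i)"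
    using mid avg_ops_L2 by (auto intro!: i)
  then show ?case using mid by simp
qed

text \<open>The error constant Y depends on the averaging operator only, not on the degree of smoothing; this
permits fixing the operator before the approximation is chosen.\<close>

lemma avg_ops_potential:
  "S \<in> avg_ops \<Longrightarrow> \<exists>Y\<ge>0. \<forall>m g H. (\<forall>j. continuous_on UNIV (g j)) \<longrightarrow> (\<forall>i j. nrm2 P (curl_entry m g i j) \<le> H) \<longrightarrow>
     (\<exists>f\<in>C1_omega T. nrm2 P (\<lambda>\<omega>. grad_omega T f \<omega> -
        (S (\<lambda>\<omega>. \<chi> j. mollify (moll m) (g j) \<omega>) \<omega> - (\<chi> j. mollify (moll m) (g j) \<omega>))) \<le> Y * H)"
proof (induction rule: avg_ops.induct)
  case (shift y)
  define Y where "Y = 2 * (\<Sum>j\<in>UNIV. \<bar>y $ j\<bar>)"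
  have "\<exists>f\<in>C1_omega T. nrm2 P (\<lambda>\<omega>. grad_omega T f \<omega> -
        ((\<chi> j. mollify (moll m) (g j) (T y \<omega>)) - (\<chi> j. mollify (moll m) (g j) \<omega>))) \<le> Y * H"
    if g: "\<forall>j. continuous_on UNIV (g j)" and H: "\<forall>i j. nrm2 P (curl_entry m g i j) \<le> H" for m g H
  proof -
    have g': "continuous_on UNIV (g j)" for j using g by blast
    note lp = line_potential[where g=g and y=y and m=m, OF g']
    let ?f = "line_mean y (\<lambda>\<omega>. \<Sum>j\<in>UNIV. y $ j * mollify (moll m) (g j) \<omega>)"
    let ?c = "\<lambda>i \<omega>. \<Sum>j\<in>UNIV. y $ j * curl_entry m g i j \<omega>"
    let ?E = "\<lambda>\<omega>. grad_omega T ?f \<omega> - ((\<chi> j. mollify (moll m) (g j) (T y \<omega>)) - (\<chi> j. mollify (moll m) (g j) \<omega>))"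
    have E: "(\<lambda>\<omega>. ?E \<omega> $ i) = line_mean y (?c i)" for i
      by (rule ext) (simp add: grad_omega_def lp(2))
    have ec: "continuous_on UNIV (curl_entry m g i j)" for i j by (rule curl_entry_continuous[OF g'])
    have cc: "continuous_on UNIV (?c i)" for i by (intro continuous_on_sum continuous_on_mult continuous_on_const ec)
    have cb: "nrm2 P (?c i) \<le> (\<Sum>j\<in>UNIV. \<bar>y $ j\<bar>) * H" for i
    proof -
      have "nrm2 P (\<lambda>\<omega>. \<Sum>j\<in>A. y $ j * curl_entry m g i j \<omega>) \<le> (\<Sum>j\<in>A. \<bar>y $ j\<bar>) * H" if "finite A" for A
        using that
      proof (induction A)
        case empty then show ?case by (simp add: nrm2_def)
      next
        case (insert k A)
        have L: "(\<lambda>\<omega>. y $ k * curl_entry m g i k \<omega>) \<in> L2 P" "(\<lambda>\<omega>. \<Sum>j\<in>A. y $ j * curl_entry m g i j \<omega>) \<in> L2 P"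
          by (intro continuous_L2 continuous_on_sum continuous_on_mult continuous_on_const ec)+
        have "nrm2 P (\<lambda>\<omega>. y $ k * curl_entry m g i k \<omega>) \<le> \<bar>y $ k\<bar> * H"
          using nrm2_scale[of P "y $ k" "curl_entry m g i k"] H by (simp add: mult_left_mono)
        then show ?case using nrm2_triangle[OF L] insert by (simp add: distrib_right)
      qed
      then show ?thesis by simp
    qed
    have "nrm2 P ?E \<le> 2 * ((\<Sum>j\<in>UNIV. \<bar>y $ j\<bar>) * H)"
    proof (rule nrm2_vec_le)
      show "(\<lambda>\<omega>. ?E \<omega> $ i) \<in> L2 P" for i unfolding E by (intro continuous_L2 line_mean_continuous cc)
      show "nrm2 P (\<lambda>\<omega>. ?E \<omega> $ i) \<le> (\<Sum>j\<in>UNIV. \<bar>y $ j\<bar>) * H" for i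
        unfolding E by (rule order_trans[OF line_mean_contraction[OF cc] cb])
    qed
    then show ?thesis using lp(1) by (intro bexI[of _ ?f]) (auto simp: Y_def)
  qed
  moreover have "0 \<le> Y" unfolding Y_def by (simp add: sum_nonneg)
  ultimately show ?case by blast
next
  case (mid S1 S2)
  from mid.IH obtain Y1 Y2 where Y: "0 \<le> Y1" "0 \<le> Y2"
    and f1: "\<And>m g H. (\<forall>j. continuous_on UNIV (g j)) \<Longrightarrow> (\<forall>i j. nrm2 P (curl_entry m g i j) \<le> H) \<Longrightarrow>
     (\<exists>f\<in>C1_omega T. nrm2 P (\<lambda>\<omega>. grad_omega T f \<omega> - (S1 (\<lambda>\<omega>. \<chi> j. mollify (moll m) (g j) \<omega>) \<omega> - (\<chi> j. mollify (moll m) (g j) \<omega>))) \<le> Y1 * H)"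
    and f2: "\<And>m g H. (\<forall>j. continuous_on UNIV (g j)) \<Longrightarrow> (\<forall>i j. nrm2 P (curl_entry m g i j) \<le> H) \<Longrightarrow>
     (\<exists>f\<in>C1_omega T. nrm2 P (\<lambda>\<omega>. grad_omega T f \<omega> - (S2 (\<lambda>\<omega>. \<chi> j. mollify (moll m) (g j) \<omega>) \<omega> - (\<chi> j. mollify (moll m) (g j) \<omega>))) \<le> Y2 * H)"
    by auto
  have "\<exists>f\<in>C1_omega T. nrm2 P (\<lambda>\<omega>. grad_omega T f \<omega> -
        ((1/2) *\<^sub>R (S1 (\<lambda>\<omega>. \<chi> j. mollify (moll m) (g j) \<omega>) \<omega> + S2 (\<lambda>\<omega>. \<chi> j. mollify (moll m) (g j) \<omega>) \<omega>) - (\<chi> j. mollify (moll m) (g j) \<omega>))) \<le> ((Y1 + Y2) / 2) * H"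
    if g: "\<forall>j. continuous_on UNIV (g j)" and H: "\<forall>i j. nrm2 P (curl_entry m g i j) \<le> H" for m g H
  proof -
    let ?G = "\<lambda>\<omega>. \<chi> j. mollify (moll m) (g j) \<omega>"
    have GL: "?G \<in> L2 P" by (rule L2_vec) (simp add: continuous_L2 mollify_continuous moll_Cc g)
    obtain h1 where h1: "h1 \<in> C1_omega T" "nrm2 P (\<lambda>\<omega>. grad_omega T h1 \<omega> - (S1 ?G \<omega> - ?G \<omega>)) \<le> Y1 * H"
      using f1[OF g H] by blast
    obtain h2 where h2: "h2 \<in> C1_omega T" "nrm2 P (\<lambda>\<omega>. grad_omega T h2 \<omega> - (S2 ?G \<omega> - ?G \<omega>)) \<le> Y2 * H"
      using f2[OF g H] by blast
    let ?E1 = "\<lambda>\<omega>. grad_omega T h1 \<omega> - (S1 ?G \<omega> - ?G \<omega>)" and ?E2 = "\<lambda>\<omega>. grad_omega T h2 \<omega> - (S2 ?G \<omega> - ?G \<omega>)"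
    have L: "?E1 \<in> L2 P" "?E2 \<in> L2 P"
      using avg_ops_L2[OF mid.hyps(1) GL] avg_ops_L2[OF mid.hyps(2) GL]
      by (auto intro!: L2_diff grad_omega_measurable h1 h2 GL)
    note lc = C1_omega_lincomb[OF h1(1) h2(1), of "1/2" "1/2"]
    have eq: "grad_omega T (\<lambda>\<omega>. 1/2 * h1 \<omega> + 1/2 * h2 \<omega>) \<omega> - ((1/2) *\<^sub>R (S1 ?G \<omega> + S2 ?G \<omega>) - ?G \<omega>)
      = (1/2) *\<^sub>R (?E1 \<omega> + ?E2 \<omega>)" for \<omega>
      unfolding lc(2) by (simp add: vec_eq_iff algebra_simps)
    have "nrm2 P (\<lambda>\<omega>. (1/2) *\<^sub>R (?E1 \<omega> + ?E2 \<omega>)) = 1/2 * nrm2 P (\<lambda>\<omega>. ?E1 \<omega> + ?E2 \<omega>)"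
      using nrm2_scale[of P "1/2" "\<lambda>\<omega>. ?E1 \<omega> + ?E2 \<omega>"] by simp
    also have "\<dots> \<le> 1/2 * (Y1 * H + Y2 * H)" using nrm2_triangle[OF L] h1(2) h2(2) by simp
    finally have "nrm2 P (\<lambda>\<omega>. grad_omega T (\<lambda>\<omega>. 1/2 * h1 \<omega> + 1/2 * h2 \<omega>) \<omega> - ((1/2) *\<^sub>R (S1 ?G \<omega> + S2 ?G \<omega>) - ?G \<omega>)) \<le> ((Y1 + Y2) / 2) * H"
      unfolding eq by (simp add: algebra_simps)
    then show ?thesis using lc(1) by blast
  qed
  then show ?case using Y by (intro exI[of _ "(Y1 + Y2) / 2"]) auto
qed

text \<open>The set on which f exceeds its mean is invariant up to null sets, hence null or of full measure; in
both cases f minus its mean has a fixed sign and integral zero.\<close>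

lemma ergodic_constant:
  fixes f :: "'w \<Rightarrow> real"
  assumes f: "integrable P f" and inv: "\<And>y. AE \<omega> in P. f (T y \<omega>) = f \<omega>"
  shows "AE \<omega> in P. f \<omega> = (\<integral>\<omega>. f \<omega> \<partial>P)"
proof -
  define c where "c = (\<integral>\<omega>. f \<omega> \<partial>P)"
  have [measurable]: "f \<in> borel_measurable P" using f by auto
  define A where "A = {\<omega>. c < f \<omega>}"
  have A: "A \<in> sets P"
  proof -
    have "{\<omega> \<in> space P. c < f \<omega>} \<in> sets P" by measurable
    then show ?thesis by (simp add: A_def space_P)
  qed
  have im: "T y ` A = {\<omega>. c < f (T (- y) \<omega>)}" for y
  proof
    show "T y ` A \<subseteq> {\<omega>. c < f (T (- y) \<omega>)}" by (auto simp: A_def T_inverse)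
    show "{\<omega>. c < f (T (- y) \<omega>)} \<subseteq> T y ` A"
    proof
      fix \<omega> assume "\<omega> \<in> {\<omega>. c < f (T (- y) \<omega>)}"
      then have "T (- y) \<omega> \<in> A" by (simp add: A_def)
      then show "\<omega> \<in> T y ` A" using T_inverse(1)[of y \<omega>] by (metis imageI)
    qed
  qed
  have TA: "T y ` A \<in> sets P" for y
  proof -
    have "T (- y) -` A \<inter> space P \<in> sets P" by (rule measurable_sets[OF T_measurable A])
    then show ?thesis unfolding im by (simp add: A_def space_P vimage_def)
  qed
  have null: "(T y ` A - A) \<union> (A - T y ` A) \<in> null_sets P" for y
  proof -
    have "AE \<omega> in P. \<omega> \<notin> (T y ` A - A) \<union> (A - T y ` A)"
      using inv[of "- y"] unfolding im unfolding A_def by eventually_elim auto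
    then have "emeasure P {\<omega> \<in> space P. \<omega> \<in> (T y ` A - A) \<union> (A - T y ` A)} = 0" by (rule emeasure_eq_0_AE)
    moreover have "{\<omega> \<in> space P. \<omega> \<in> (T y ` A - A) \<union> (A - T y ` A)} = (T y ` A - A) \<union> (A - T y ` A)"
      by (auto simp: space_P)
    moreover have "(T y ` A - A) \<union> (A - T y ` A) \<in> sets P" by (intro sets.Un sets.Diff A TA)
    ultimately show ?thesis by (simp only: null_setsI)
  qed
  have "measure P A = 0 \<or> measure P A = 1" by (rule ergodic[OF A null])
  then consider "measure P A = 0" | "measure P A = 1" by blast
  then show ?thesis
  proof cases
    case 1
    then have "AE \<omega> in P. \<omega> \<notin> A" using A by (intro AE_not_in) (simp add: null_sets_def emeasure_eq_measure)
    then have le: "AE \<omega> in P. 0 \<le> c - f \<omega>" by eventually_elim (simp add: A_def)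
    have i: "integrable P (\<lambda>\<omega>. c - f \<omega>)" using f by simp
    have "(\<integral>\<omega>. c - f \<omega> \<partial>P) = 0" using f by (simp add: c_def prob_space)
    then have "AE \<omega> in P. c - f \<omega> = 0" using integral_nonneg_eq_0_iff_AE[OF i le] by simp
    then show ?thesis unfolding c_def[symmetric] by eventually_elim simp
  next
    case 2
    then have ae: "AE \<omega> in P. \<omega> \<in> A" using A prob_eq_1 by simp
    then have le: "AE \<omega> in P. 0 \<le> f \<omega> - c" by eventually_elim (simp add: A_def)
    have i: "integrable P (\<lambda>\<omega>. f \<omega> - c)" using f by simp
    have "(\<integral>\<omega>. f \<omega> - c \<partial>P) = 0" using f by (simp add: c_def prob_space)
    then have "AE \<omega> in P. f \<omega> - c = 0" using integral_nonneg_eq_0_iff_AE[OF i le] by simp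
    then show ?thesis unfolding c_def[symmetric] by eventually_elim simp
  qed
qed

end

section \<open>Curl-free fields of mean zero are potential\<close>

context stochastic_setting
begin

text \<open>A minimising sequence for the norm over the averages of W converges to some g. Averaging an element
with its own translate stays admissible, so by the parallelogram identity g is invariant, hence constant
by ergodicity, and the constant is the mean zero of W.\<close>

lemma mean_ergodic:
  assumes W: "W \<in> L2 P" and mean: "\<And>i. (\<integral>\<omega>. W \<omega> $ i \<partial>P) = 0" and e: "0 < e"
  shows "\<exists>S\<in>avg_ops. nrm2 P (S W) < e"
proof -
  define D where "D = (\<lambda>S. S W) ` avg_ops"
  have DL: "D \<subseteq> L2 P" using avg_ops_L2[OF _ W] by (auto simp: D_def)
  have Dm: "(\<lambda>\<omega>. (1/2) *\<^sub>R (f \<omega> + g \<omega>)) \<in> D" if "f \<in> D" "g \<in> D" for f g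
    using that avg_ops.mid unfolding D_def by (auto intro!: image_eqI)
  have Dne: "D \<noteq> {}" using avg_ops.shift[of 0] by (auto simp: D_def)
  have Dshift: "(\<lambda>\<omega>. f (T y \<omega>)) \<in> D" if f: "f \<in> D" for f y
  proof -
    obtain S where S: "S \<in> avg_ops" "f = S W" using f by (auto simp: D_def)
    obtain S' where S': "S' \<in> avg_ops" "\<forall>F \<omega>. S F (T y \<omega>) = S' F \<omega>" using avg_ops_shift[OF S(1)] by blast
    have "(\<lambda>\<omega>. f (T y \<omega>)) = S' W" using S(2) S'(2) by (simp add: fun_eq_iff)
    then show ?thesis using S'(1) by (simp add: D_def)
  qed
  obtain d g I where d: "\<And>n::nat. d n \<in> D" and g: "g \<in> L2 P" and lim: "(\<lambda>n. nrm2 P (\<lambda>\<omega>. d n \<omega> - g \<omega>)) \<longlonglongrightarrow> 0"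
    and I: "\<And>f. f \<in> D \<Longrightarrow> I \<le> (nrm2 P f)\<^sup>2 - 0" and J: "(\<lambda>n. (nrm2 P (d n))\<^sup>2 - 0) \<longlonglongrightarrow> I"
  proof (rule L2_minimising_sequence[where D=D and M=P and L="\<lambda>_. 0" and c=0])
    show "D \<subseteq> L2 P" by (rule DL)
    show "D \<noteq> {}" by (rule Dne)
    show "(\<lambda>x. (1/2) *\<^sub>R (f x + g x)) \<in> D" if "f \<in> D" "g \<in> D" for f g by (rule Dm[OF that])
    show "(0::real) = (0 + 0) / 2" by simp
    show "0 \<le> (nrm2 P f)\<^sup>2 - 0" for f :: "'w \<Rightarrow> real^3" by simp
  qed (rule that)
  have dL: "d n \<in> L2 P" for n using d[of n] DL by (rule subsetD[rotated])
  have inv: "AE \<omega> in P. g (T y \<omega>) = g \<omega>" for y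
  proof -
    have gT: "(\<lambda>\<omega>. g (T y \<omega>)) \<in> L2 P" by (rule T_nrm2(1)[OF g])
    have dT: "(\<lambda>\<omega>. d n (T y \<omega>)) \<in> L2 P" "nrm2 P (\<lambda>\<omega>. d n (T y \<omega>)) = nrm2 P (d n)" for n by (rule T_nrm2[OF dL])+
    have par: "(nrm2 P (\<lambda>\<omega>. d n \<omega> - d n (T y \<omega>)))\<^sup>2 \<le> 4 * ((nrm2 P (d n))\<^sup>2 - I)" for n
    proof -
      have 1: "(nrm2 P (\<lambda>\<omega>. d n \<omega> - d n (T y \<omega>)))\<^sup>2 = (nrm2 P (d n))\<^sup>2 - 2 * (\<integral>\<omega>. d n \<omega> \<bullet> d n (T y \<omega>) \<partial>P) + (nrm2 P (d n))\<^sup>2"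
        using nrm2_add_sq[OF dL[of n] L2_scale[OF dT(1)[of n], of "-1"]] nrm2_scale[of P "-1" "\<lambda>\<omega>. d n (T y \<omega>)"] dT(2) by simp
      have 2: "(nrm2 P (\<lambda>\<omega>. d n \<omega> + d n (T y \<omega>)))\<^sup>2 = (nrm2 P (d n))\<^sup>2 + 2 * (\<integral>\<omega>. d n \<omega> \<bullet> d n (T y \<omega>) \<partial>P) + (nrm2 P (d n))\<^sup>2"
        using nrm2_add_sq[OF dL[of n] dT(1)[of n]] dT(2) by simp
      have "I \<le> (nrm2 P (\<lambda>\<omega>. (1/2) *\<^sub>R (d n \<omega> + d n (T y \<omega>))))\<^sup>2"
        using I[OF Dm[OF d[of n] Dshift[OF d[of n], of y]]] by simp
      also have "\<dots> = (nrm2 P (\<lambda>\<omega>. d n \<omega> + d n (T y \<omega>)))\<^sup>2 / 4"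
        unfolding nrm2_scale[of P "1/2" "\<lambda>\<omega>. d n \<omega> + d n (T y \<omega>)"] by (simp add: power_divide)
      finally have 3: "4 * I \<le> (nrm2 P (\<lambda>\<omega>. d n \<omega> + d n (T y \<omega>)))\<^sup>2" by simp
      have ar: "x \<le> 4 * (a - J)" if "4 * J \<le> y" "x = a - 2 * c + a" "y = a + 2 * c + a" for x y a c J :: real
        using that by simp
      show ?thesis by (rule ar[OF 3 1 2])
    qed
    have lim0: "(\<lambda>n. nrm2 P (\<lambda>\<omega>. d n \<omega> - d n (T y \<omega>))) \<longlonglongrightarrow> 0"
    proof -
      have "(\<lambda>n. 4 * ((nrm2 P (d n))\<^sup>2 - I)) \<longlonglongrightarrow> 4 * (I - I)"
        by (intro tendsto_mult tendsto_diff tendsto_const J[simplified])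
      then have "(\<lambda>n. 4 * ((nrm2 P (d n))\<^sup>2 - I)) \<longlonglongrightarrow> 0" by simp
      then have "(\<lambda>n. (nrm2 P (\<lambda>\<omega>. d n \<omega> - d n (T y \<omega>)))\<^sup>2) \<longlonglongrightarrow> 0"
        by (rule Lim_null_comparison[rotated]) (use par in simp)
      then have "(\<lambda>n. sqrt ((nrm2 P (\<lambda>\<omega>. d n \<omega> - d n (T y \<omega>)))\<^sup>2)) \<longlonglongrightarrow> sqrt 0" by (rule tendsto_real_sqrt)
      then show ?thesis by simp
    qed
    have bnd: "nrm2 P (\<lambda>\<omega>. g \<omega> - g (T y \<omega>)) \<le> nrm2 P (\<lambda>\<omega>. d n \<omega> - g \<omega>) + nrm2 P (\<lambda>\<omega>. d n \<omega> - d n (T y \<omega>)) + nrm2 P (\<lambda>\<omega>. d n \<omega> - g \<omega>)" for n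
    proof -
      have s: "nrm2 P (\<lambda>\<omega>. d n (T y \<omega>) - g (T y \<omega>)) = nrm2 P (\<lambda>\<omega>. d n \<omega> - g \<omega>)"
        using T_nrm2(2)[OF L2_diff[OF dL[of n] g], of y] .
      show ?thesis
        using nrm2_triangle3[OF g dL[of n] gT] nrm2_triangle3[OF dL[of n] dT(1)[of n] gT] s
          nrm2_commute[of P g "d n"] by linarith
    qed

    have "(\<lambda>n. nrm2 P (\<lambda>\<omega>. d n \<omega> - g \<omega>) + nrm2 P (\<lambda>\<omega>. d n \<omega> - d n (T y \<omega>)) + nrm2 P (\<lambda>\<omega>. d n \<omega> - g \<omega>)) \<longlonglongrightarrow> 0 + 0 + 0"
      by (intro tendsto_add lim lim0)
    then have "(\<lambda>n. nrm2 P (\<lambda>\<omega>. d n \<omega> - g \<omega>) + nrm2 P (\<lambda>\<omega>. d n \<omega> - d n (T y \<omega>)) + nrm2 P (\<lambda>\<omega>. d n \<omega> - g \<omega>)) \<longlonglongrightarrow> 0"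
      by simp
    then have "nrm2 P (\<lambda>\<omega>. g \<omega> - g (T y \<omega>)) \<le> 0"
      by (rule LIMSEQ_le_const) (rule exI[of _ 0], intro allI impI, rule bnd)
    then have "(\<integral>\<omega>. (norm (g \<omega> - g (T y \<omega>)))\<^sup>2 \<partial>P) = 0"
      using nrm2_nonneg[of P "\<lambda>\<omega>. g \<omega> - g (T y \<omega>)"] nrm2_sq[of P "\<lambda>\<omega>. g \<omega> - g (T y \<omega>)"] by simp
    then have "AE \<omega> in P. (norm (g \<omega> - g (T y \<omega>)))\<^sup>2 = 0"
      by (subst (asm) integral_nonneg_eq_0_iff_AE[OF L2_integrable[OF L2_diff[OF g gT]]]) auto
    then show ?thesis by eventually_elim simp
  qed
  have one: "(\<lambda>\<omega>. 1::real) \<in> L2 P" by (rule continuous_L2) simp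
  have int: "integrable P (\<lambda>\<omega>. f \<omega> $ i)" if "f \<in> L2 P" for f :: "'w \<Rightarrow> real^3" and i
    using L2_mult_integrable[OF L2_component[OF that, of i] one] by simp
  have "(\<integral>\<omega>. g \<omega> $ i \<partial>P) = 0" for i
  proof -
    have "(\<lambda>\<omega>. axis i 1 :: real^3) \<in> L2 P" by (rule L2I) auto
    from L2_inner_tendsto[OF dL g this lim]
    have l: "(\<lambda>n. \<integral>\<omega>. d n \<omega> $ i \<partial>P) \<longlonglongrightarrow> (\<integral>\<omega>. g \<omega> $ i \<partial>P)" by (simp add: inner_axis)
    have "(\<integral>\<omega>. d n \<omega> $ i \<partial>P) = 0" for n
      using d[of n] avg_ops_mean[OF _ W, of _ i] mean[of i] by (auto simp: D_def)
    then show ?thesis using LIMSEQ_unique[OF l] by simp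
  qed
  moreover have "AE \<omega> in P. g \<omega> $ i = (\<integral>\<omega>. g \<omega> $ i \<partial>P)" for i
  proof (rule ergodic_constant[OF int[OF g]])
    fix y
    from inv[of y] show "AE \<omega> in P. g (T y \<omega>) $ i = g \<omega> $ i" by eventually_elim simp
  qed
  ultimately have "AE \<omega> in P. \<forall>i. g \<omega> $ i = 0" by (simp add: AE_all_countable)
  then have g0: "AE \<omega> in P. d n \<omega> - g \<omega> = d n \<omega>" for n by eventually_elim (simp add: vec_eq_iff)
  have "nrm2 P (\<lambda>\<omega>. d n \<omega> - g \<omega>) = nrm2 P (d n)" for n
    by (rule nrm2_cong_AE[OF L2_meas[OF L2_diff[OF dL g]] L2_meas[OF dL] g0])
  then have "(\<lambda>n. nrm2 P (d n)) \<longlonglongrightarrow> 0" using lim by simp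
  then have "\<forall>\<^sub>F n in sequentially. nrm2 P (d n) < e" using e by (rule order_tendstoD)
  then obtain n where "nrm2 P (d n) < e" by (auto simp: eventually_sequentially)
  then show ?thesis using d[of n] by (auto simp: D_def)
qed

text \<open>Let G be a smooth approximation of W and S an averaging operator with S W small. Up to the curl error,
S G - G is the gradient of a function f, so that -f has gradient G - S G, which is close to W - S W and thus to W.\<close>

lemma curl_free_in_L2_pot:
  assumes W: "W \<in> L2 P" and mean: "\<And>i. (\<integral>\<omega>. W \<omega> $ i \<partial>P) = 0" and curl: "curl_free W"
  shows "W \<in> L2_pot P T"
  unfolding L2_pot_def
proof (intro CollectI conjI allI impI W)
  fix \<epsilon> :: real assume \<epsilon>: "0 < \<epsilon>"
  \<comment> \<open>The errors collected at the end are at most e + 8 e + e + 8 e.\<close>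
  define e where "e = \<epsilon> / 20"
  have e: "0 < e" using \<epsilon> by (simp add: e_def)
  have Wi: "(\<lambda>\<omega>. W \<omega> $ j) \<in> L2 P" for j by (rule L2_component[OF W])
  have approx: "\<exists>g. continuous_on UNIV g \<and> nrm2 P (\<lambda>\<omega>. W \<omega> $ j - g \<omega>) < r" if "0 < r" for j r
    using continuous_dense[OF Wi that, of j] by (simp add: nrm2_def)
  obtain S where S: "S \<in> avg_ops" "nrm2 P (S W) < e" using mean_ergodic[OF W mean e] by blast
  obtain Y where Y: "0 \<le> Y" "\<And>m g H. (\<forall>j. continuous_on UNIV (g j)) \<Longrightarrow> (\<forall>i j. nrm2 P (curl_entry m g i j) \<le> H) \<Longrightarrow>
     (\<exists>f\<in>C1_omega T. nrm2 P (\<lambda>\<omega>. grad_omega T f \<omega> -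
        (S (\<lambda>\<omega>. \<chi> j. mollify (moll m) (g j) \<omega>) \<omega> - (\<chi> j. mollify (moll m) (g j) \<omega>))) \<le> Y * H)"
    using avg_ops_potential[OF S(1)] by auto
  have "\<forall>j. \<exists>g. continuous_on UNIV g \<and> nrm2 P (\<lambda>\<omega>. W \<omega> $ j - g \<omega>) < e" using approx[OF e] by blast
  then obtain g0 where g0: "\<And>j. continuous_on UNIV (g0 j)" "\<And>j. nrm2 P (\<lambda>\<omega>. W \<omega> $ j - g0 j \<omega>) < e"
    by (auto dest!: choice)
  have "\<forall>j. \<exists>m0. \<forall>m\<ge>m0. \<forall>\<omega>. \<bar>mollify (moll m) (g0 j) \<omega> - g0 j \<omega>\<bar> \<le> e" using mollify_approx[OF g0(1) e] by blast
  then obtain m0 where m0: "\<And>j m \<omega>. m \<ge> m0 j \<Longrightarrow> \<bar>mollify (moll m) (g0 j) \<omega> - g0 j \<omega>\<bar> \<le> e" by (auto dest!: choice)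
  define m where "m = Max (range m0)"
  have mm: "\<bar>mollify (moll m) (g0 j) \<omega> - g0 j \<omega>\<bar> \<le> e" for j \<omega> by (rule m0) (simp add: m_def)
  \<comment> \<open>S determines Y and the first approximation g0 determines m, and smoothing at this m is close to the
     identity on W. Only now W is approximated so well by g that the curl of the smoothing of g is small.\<close>
  define e' where "e' = e / (1 + 2 * moll_grad_mass m * Y)"
  have den: "1 \<le> 1 + 2 * moll_grad_mass m * Y" using moll_grad_mass_nonneg[of m] Y(1) by simp
  have Ym: "0 \<le> Y * (e * moll_grad_mass m)" using e moll_grad_mass_nonneg[of m] Y(1) by simp
  have e': "0 < e'" "e' \<le> e" "2 * moll_grad_mass m * Y * e' \<le> e"
    using e den Ym unfolding e'_def by (auto simp: field_simps)
  have "\<forall>j. \<exists>g. continuous_on UNIV g \<and> nrm2 P (\<lambda>\<omega>. W \<omega> $ j - g \<omega>) < e'" using approx[OF e'(1)] by blast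
  then obtain g where g: "\<And>j. continuous_on UNIV (g j)" "\<And>j. nrm2 P (\<lambda>\<omega>. W \<omega> $ j - g j \<omega>) < e'"
    by (auto dest!: choice)
  let ?G = "\<lambda>\<omega>. \<chi> j. mollify (moll m) (g j) \<omega>"
  have Mc: "continuous_on UNIV (mollify (moll m) h)" if "continuous_on UNIV h" for h by (rule mollify_continuous[OF moll_Cc that])
  have GL: "?G \<in> L2 P" by (rule L2_vec) (simp add: continuous_L2 Mc g)
  have GW: "nrm2 P (\<lambda>\<omega>. W \<omega> - ?G \<omega>) \<le> 8 * e"
  proof -
    have "nrm2 P (\<lambda>\<omega>. W \<omega> - ?G \<omega>) \<le> 2 * (4 * e)"
    proof (rule nrm2_vec_le)
      fix i
      show "(\<lambda>\<omega>. (W \<omega> - ?G \<omega>) $ i) \<in> L2 P" by (intro L2_component L2_diff W GL)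
      have l: "g i \<in> L2 P" "g0 i \<in> L2 P" "mollify (moll m) (g i) \<in> L2 P" "mollify (moll m) (g0 i) \<in> L2 P"
        by (intro continuous_L2 Mc g g0)+
      have a1: "nrm2 P (\<lambda>\<omega>. W \<omega> $ i - mollify (moll m) (g i) \<omega>) \<le> nrm2 P (\<lambda>\<omega>. W \<omega> $ i - g0 i \<omega>)
          + nrm2 P (\<lambda>\<omega>. g0 i \<omega> - mollify (moll m) (g i) \<omega>)"
        by (rule nrm2_triangle3[OF Wi l(2) l(3)])
      have a2: "nrm2 P (\<lambda>\<omega>. g0 i \<omega> - mollify (moll m) (g i) \<omega>) \<le> nrm2 P (\<lambda>\<omega>. g0 i \<omega> - mollify (moll m) (g0 i) \<omega>)
          + nrm2 P (\<lambda>\<omega>. mollify (moll m) (g0 i) \<omega> - mollify (moll m) (g i) \<omega>)"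
        by (rule nrm2_triangle3[OF l(2) l(4) l(3)])
      have a3: "nrm2 P (\<lambda>\<omega>. g0 i \<omega> - mollify (moll m) (g0 i) \<omega>) \<le> e"
      proof -
        have "nrm2 P (\<lambda>\<omega>. g0 i \<omega> - mollify (moll m) (g0 i) \<omega>) \<le> nrm2 P (\<lambda>\<omega>. e)"
          by (rule nrm2_mono[OF L2_meas[OF L2_diff[OF l(2) l(4)]] continuous_L2])
             (use mm[of i] e in \<open>auto simp: abs_minus_commute\<close>)
        then show ?thesis using e by (simp add: nrm2_def prob_space)
      qed
      have a4: "nrm2 P (\<lambda>\<omega>. mollify (moll m) (g0 i) \<omega> - mollify (moll m) (g i) \<omega>) \<le> 2 * e"
      proof -
        have "nrm2 P (mollify (moll m) (\<lambda>\<omega>. g0 i \<omega> - g i \<omega>)) \<le> (\<integral>z. \<bar>moll m z\<bar> \<partial>lebesgue) * nrm2 P (\<lambda>\<omega>. g0 i \<omega> - g i \<omega>)"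
          by (intro mollify_contraction moll_Cc continuous_on_diff g g0)
        also have "(\<integral>z. \<bar>moll m z\<bar> \<partial>lebesgue) = 1" using moll_integral[of m] moll_nonneg[of m] by simp
        also have "nrm2 P (\<lambda>\<omega>. g0 i \<omega> - g i \<omega>) \<le> nrm2 P (\<lambda>\<omega>. g0 i \<omega> - W \<omega> $ i) + nrm2 P (\<lambda>\<omega>. W \<omega> $ i - g i \<omega>)"
          by (rule nrm2_triangle3[OF l(2) Wi l(1)])
        also have "\<dots> \<le> e + e" using g0(2)[of i] g(2)[of i] e'(2) nrm2_commute[of P "g0 i" "\<lambda>\<omega>. W \<omega> $ i"] by linarith
        finally show ?thesis unfolding mollify_diff[OF moll_Cc g0(1) g(1)] by simp
      qed
      have "nrm2 P (\<lambda>\<omega>. W \<omega> $ i - mollify (moll m) (g i) \<omega>) \<le> 4 * e"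
        using a1 a2 a3 a4 g0(2)[of i] by linarith
      then show "nrm2 P (\<lambda>\<omega>. (W \<omega> - ?G \<omega>) $ i) \<le> 4 * e" by simp
    qed
    then show ?thesis by simp
  qed
  have "nrm2 P (curl_entry m g i j) \<le> 2 * moll_grad_mass m * e'" for i j
    by (rule curl_entry_bound[OF W curl g(1)]) (rule less_imp_le[OF g(2)])
  then obtain f where f: "f \<in> C1_omega T" "nrm2 P (\<lambda>\<omega>. grad_omega T f \<omega> - (S ?G \<omega> - ?G \<omega>)) \<le> Y * (2 * moll_grad_mass m * e')"
    using Y(2)[of g m "2 * moll_grad_mass m * e'"] g(1) by blast
  have fe: "nrm2 P (\<lambda>\<omega>. grad_omega T f \<omega> - (S ?G \<omega> - ?G \<omega>)) \<le> e" using f(2) e'(3) by (simp add: mult_ac)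
  let ?u = "\<lambda>\<omega>. (-1) * f \<omega> + 0 * f \<omega>"
  note lc = C1_omega_lincomb[OF f(1) f(1), of "-1" 0]
  have fL: "grad_omega T f \<in> L2 P" by (rule grad_omega_measurable[OF f(1)])
  have SL: "S W \<in> L2 P" "S ?G \<in> L2 P" using avg_ops_L2[OF S(1) W] avg_ops_L2[OF S(1) GL] by auto
  have SD: "nrm2 P (\<lambda>\<omega>. S ?G \<omega> - S W \<omega>) \<le> 8 * e"
  proof -
    have "S (\<lambda>\<omega>. W \<omega> - ?G \<omega>) = (\<lambda>\<omega>. S W \<omega> - S ?G \<omega>)" using avg_ops_diff[OF S(1), of W ?G] by (simp add: fun_eq_iff)
    then have "nrm2 P (\<lambda>\<omega>. S W \<omega> - S ?G \<omega>) \<le> nrm2 P (\<lambda>\<omega>. W \<omega> - ?G \<omega>)"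
      using avg_ops_L2[OF S(1) L2_diff[OF W GL]] by simp
    then show ?thesis using GW nrm2_commute[of P "S ?G" "S W"] by linarith
  qed
  let ?A = "\<lambda>\<omega>. grad_omega T f \<omega> - (S ?G \<omega> - ?G \<omega>)" and ?B = "\<lambda>\<omega>. S ?G \<omega> - S W \<omega>" and ?C = "\<lambda>\<omega>. W \<omega> - ?G \<omega>"
  have AL: "?A \<in> L2 P" "?B \<in> L2 P" "?C \<in> L2 P" by (intro L2_diff fL SL GL W)+
  have eq: "W \<omega> - grad_omega T ?u \<omega> = ((?A \<omega> + ?B \<omega>) + S W \<omega>) + ?C \<omega>" for \<omega>
    unfolding lc(2) by simp
  have "nrm2 P (\<lambda>\<omega>. W \<omega> - grad_omega T ?u \<omega>) \<le> ((nrm2 P ?A + nrm2 P ?B) + nrm2 P (S W)) + nrm2 P ?C"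
    unfolding eq
    using nrm2_triangle[OF L2_add[OF L2_add[OF AL(1,2)] SL(1)] AL(3)] nrm2_triangle[OF L2_add[OF AL(1,2)] SL(1)] nrm2_triangle[OF AL(1,2)]
    by linarith
  also have "\<dots> < 20 * e" using fe SD S(2) GW e by linarith
  finally have "nrm2 P (\<lambda>\<omega>. W \<omega> - grad_omega T ?u \<omega>) < \<epsilon>" by (simp add: e_def)
  then show "\<exists>u\<in>C1_omega T. sqrt (\<integral>\<omega>. (norm (W \<omega> - grad_omega T u \<omega>))\<^sup>2 \<partial>P) < \<epsilon>"
    using lc(1) unfolding nrm2_def by blast
qed

text \<open>Tent functions around the points of finite nets give partitions of unity after normalisation;
rational combinations of them are dense by uniform continuity.\<close>

lemma continuous_separable:
  "\<exists>C0 :: ('w \<Rightarrow> real) set. countable C0 \<and> (\<forall>q\<in>C0. continuous_on UNIV q) \<and>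
     (\<forall>f e. continuous_on UNIV f \<longrightarrow> 0 < e \<longrightarrow> (\<exists>q\<in>C0. \<forall>\<omega>. \<bar>f \<omega> - q \<omega>\<bar> \<le> e))"
proof -
  have "\<forall>n. \<exists>X. finite X \<and> (UNIV :: 'w set) \<subseteq> (\<Union>x\<in>X. ball x (inverse (real (Suc n))))"
  proof
    fix n
    obtain X where "X \<subseteq> UNIV" "finite X" "(UNIV :: 'w set) \<subseteq> (\<Union>x\<in>X. ball x (inverse (real (Suc n))))"
    proof (rule compactE_image[OF compact_UNIV, of UNIV "\<lambda>x. ball x (inverse (real (Suc n)))"])
      show "(UNIV :: 'w set) \<subseteq> (\<Union>x\<in>UNIV. ball x (inverse (real (Suc n))))"
      proof
        fix x :: 'w
        have "x \<in> ball x (inverse (real (Suc n)))" by (simp del: of_nat_Suc)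
        then show "x \<in> (\<Union>x\<in>UNIV. ball x (inverse (real (Suc n))))" by blast
      qed
    qed auto
    then show "\<exists>X. finite X \<and> (UNIV :: 'w set) \<subseteq> (\<Union>x\<in>X. ball x (inverse (real (Suc n))))" by blast
  qed
  then obtain X where X: "\<And>n. finite (X n)" "\<And>n. (UNIV :: 'w set) \<subseteq> (\<Union>x\<in>X n. ball x (inverse (real (Suc n))))"
    by (auto dest!: choice)
  define p where "p n x \<omega> = max 0 (inverse (real (Suc n)) - dist x \<omega>)" for n and x \<omega> :: 'w
  define Z where "Z n \<omega> = (\<Sum>x\<in>X n. p n x \<omega>)" for n \<omega>
  define F where "F n c \<omega> = (\<Sum>x\<in>X n. c x * p n x \<omega>) / Z n \<omega>" for n c \<omega>
  define C0 where "C0 = (\<Union>n. F n ` (X n \<rightarrow>\<^sub>E \<rat>))"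
  have p0: "0 \<le> p n x \<omega>" for n x \<omega> by (simp add: p_def)
  have Zpos: "0 < Z n \<omega>" for n \<omega>
  proof -
    obtain x where x: "x \<in> X n" "dist x \<omega> < inverse (real (Suc n))" using subsetD[OF X(2)[of n] UNIV_I[of \<omega>]] by (auto simp del: of_nat_Suc)
    have "0 < p n x \<omega>" using x(2) by (simp add: p_def)
    then show ?thesis unfolding Z_def using x(1) X(1) p0 by (intro sum_pos2[of _ x]) auto
  qed
  have "countable C0" unfolding C0_def by (intro countable_UN countable_image countable_PiE X countable_rat) auto
  moreover have "continuous_on UNIV q" if "q \<in> C0" for q
  proof -
    obtain n c where q: "q = F n c" using \<open>q \<in> C0\<close> by (auto simp: C0_def)
    have pc: "continuous_on UNIV (p n x)" for x unfolding p_def by (intro continuous_intros)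
    have "continuous_on UNIV (Z n)" unfolding Z_def by (intro continuous_on_sum pc)
    then show ?thesis unfolding q F_def
      using Zpos by (intro continuous_on_divide continuous_on_sum continuous_on_mult continuous_on_const pc) (auto simp: less_imp_neq[symmetric])
  qed
  moreover have "\<exists>q\<in>C0. \<forall>\<omega>. \<bar>f \<omega> - q \<omega>\<bar> \<le> e" if f: "continuous_on UNIV f" and e: "0 < e" for f e
  proof -
    have "uniformly_continuous_on UNIV f" by (rule compact_uniformly_continuous[OF f compact_UNIV])
    moreover have "0 < e / 2" using e by simp
    ultimately obtain d where d: "d > 0" "\<And>x y. dist y x < d \<Longrightarrow> dist (f y) (f x) < e / 2"
      unfolding uniformly_continuous_on_def by blast
    obtain n where n: "inverse (real (Suc n)) < d" using reals_Archimedean[OF d(1)] by blast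
    have "\<forall>x. \<exists>r\<in>\<rat>. \<bar>f x - r\<bar> < e / 2"
    proof
      fix x
      obtain r where "r \<in> \<rat>" "f x < r" "r < f x + e / 2" using Rats_dense_in_real[of "f x" "f x + e / 2"] e by auto
      then show "\<exists>r\<in>\<rat>. \<bar>f x - r\<bar> < e / 2" by (intro bexI[of _ r]) auto
    qed
    then obtain c where c: "\<And>x. c x \<in> \<rat>" "\<And>x. \<bar>f x - c x\<bar> < e / 2" by metis
    define c' where "c' = restrict c (X n)"
    have "\<bar>f \<omega> - F n c' \<omega>\<bar> \<le> e" for \<omega>
    proof -
      have "f \<omega> * Z n \<omega> - (\<Sum>x\<in>X n. c' x * p n x \<omega>) = (\<Sum>x\<in>X n. (f \<omega> - c x) * p n x \<omega>)"
        unfolding Z_def c'_def by (simp add: sum_distrib_left left_diff_distrib sum_subtractf)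
      also have "\<bar>\<dots>\<bar> \<le> (\<Sum>x\<in>X n. \<bar>(f \<omega> - c x) * p n x \<omega>\<bar>)" by (rule sum_abs)
      also have "\<dots> \<le> (\<Sum>x\<in>X n. e * p n x \<omega>)"
      proof (rule sum_mono)
        fix x
        show "\<bar>(f \<omega> - c x) * p n x \<omega>\<bar> \<le> e * p n x \<omega>"
        proof (cases "p n x \<omega> = 0")
          case False
          then have "dist x \<omega> < inverse (real (Suc n))" by (auto simp: p_def max_def split: if_splits)
          then have "dist (f \<omega>) (f x) < e / 2" using n by (intro d(2)) (simp add: dist_commute)
          then have "\<bar>f \<omega> - c x\<bar> \<le> e" using c(2)[of x] unfolding dist_real_def by argo
          then show ?thesis using p0[of n x \<omega>] by (simp add: abs_mult mult_right_mono)
        qed simp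
      qed
      also have "\<dots> = e * Z n \<omega>" by (simp add: Z_def sum_distrib_left)
      finally have "\<bar>f \<omega> * Z n \<omega> - (\<Sum>x\<in>X n. c' x * p n x \<omega>)\<bar> \<le> e * Z n \<omega>" .
      moreover have "f \<omega> - F n c' \<omega> = (f \<omega> * Z n \<omega> - (\<Sum>x\<in>X n. c' x * p n x \<omega>)) / Z n \<omega>"
        unfolding F_def using Zpos[of n \<omega>] by (simp add: diff_divide_distrib)
      ultimately show ?thesis using Zpos[of n \<omega>] by (simp add: abs_divide divide_le_eq)
    qed
    moreover have "F n c' \<in> C0" unfolding C0_def c'_def using c(1) by (intro UN_I[of n] imageI) auto
    ultimately show ?thesis by blast
  qed
  ultimately show ?thesis by blast
qed

end

section \<open>Two-scale compactness\<close>

text \<open>Boundedness is added to make the class closed under products.\<close>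

definition bdd_int :: "(real^3 \<Rightarrow> real) \<Rightarrow> bool" where
  "bdd_int \<phi> \<longleftrightarrow> integrable lebesgue \<phi> \<and> (\<exists>B. \<forall>x. \<bar>\<phi> x\<bar> \<le> B)"

lemma bdd_int_mult:
  assumes f: "bdd_int f" and g: "bdd_int g" shows "bdd_int (\<lambda>x. f x * g x)"
proof -
  obtain A B where A: "\<And>x. \<bar>f x\<bar> \<le> A" and B: "\<And>x. \<bar>g x\<bar> \<le> B" using f g by (auto simp: bdd_int_def)
  have fi: "integrable lebesgue f" and gi: "integrable lebesgue g" using f g by (auto simp: bdd_int_def)
  note [measurable] = borel_measurable_integrable[OF fi] borel_measurable_integrable[OF gi]
  have A0: "0 \<le> A" using A[of 0] by linarith
  have le: "\<bar>f x * g x\<bar> \<le> A * \<bar>g x\<bar>" for x using A[of x] by (simp add: abs_mult mult_right_mono)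
  have "integrable lebesgue (\<lambda>x. f x * g x)"
  proof (rule Bochner_Integration.integrable_bound)
    show "integrable lebesgue (\<lambda>x. A * g x)" using gi by simp
    show "AE x in lebesgue. norm (f x * g x) \<le> norm (A * g x)" using le A0 by (simp add: abs_mult)
  qed measurable
  moreover have "\<bar>f x * g x\<bar> \<le> A * B" for x using le[of x] mult_left_mono[OF B[of x] A0] by linarith
  ultimately show ?thesis by (auto simp: bdd_int_def)
qed

lemma bdd_int_cmult: "bdd_int f \<Longrightarrow> bdd_int (\<lambda>x. c * f x)"
proof -
  assume f: "bdd_int f"
  then obtain A where "\<And>x. \<bar>f x\<bar> \<le> A" by (auto simp: bdd_int_def)
  then have "\<bar>c * f x\<bar> \<le> \<bar>c\<bar> * A" for x by (simp add: abs_mult mult_left_mono)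
  with f show ?thesis by (auto simp: bdd_int_def)
qed

lemma bdd_int_support:
  assumes "f \<in> borel_measurable lebesgue" "\<And>x. \<bar>f x\<bar> \<le> B" "\<And>x. R < norm x \<Longrightarrow> f x = 0"
  shows "bdd_int f"
  using integrable_bounded_supp[OF assms] assms(2) by (auto simp: bdd_int_def)

lemma Cc_infinity_bdd_int: "\<phi> \<in> Cc_infinity \<Longrightarrow> bdd_int \<phi>"
  using Cc_infinity_integrable[of \<phi>] Cc_infinity_bounded[of \<phi>] by (auto simp: bdd_int_def)

lemma corner_cell_dist: "norm (x - corner m (cell m x)) \<le> 3"
proof -
  have "\<bar>(x - corner m (cell m x)) $ l\<bar> \<le> 1" for l
  proof -
    define s where "s = real (Suc m)"
    have s: "s \<ge> 1" by (simp add: s_def)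
    have "x $ l - of_int \<lfloor>s * x $ l\<rfloor> / s = (s * x $ l - of_int \<lfloor>s * x $ l\<rfloor>) / s"
      using s by (simp add: diff_divide_distrib)
    then have "\<bar>x $ l - of_int \<lfloor>s * x $ l\<rfloor> / s\<bar> = \<bar>s * x $ l - of_int \<lfloor>s * x $ l\<rfloor>\<bar> / s"
      using s by (simp only: abs_divide abs_of_nonneg)
    also have "\<dots> \<le> 1 / 1" using s by (intro frac_le) (auto simp: abs_if, linarith+)
    finally show ?thesis by (simp add: corner_cell_nth s_def)
  qed
  then have "(\<Sum>l\<in>UNIV. \<bar>(x - corner m (cell m x)) $ l\<bar>) \<le> (\<Sum>l\<in>(UNIV::3 set). 1)" by (intro sum_mono)
  then show ?thesis using norm_le_l1_cart[of "x - corner m (cell m x)"] by simp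
qed

text \<open>Only finitely many cubes meet the support of a test function.\<close>

lemma finite_corners: "finite {t. norm (corner m t) \<le> R}"
proof -
  define s where "s = real (Suc m)"
  have s: "s > 0" by (simp add: s_def)
  define N where "N = \<lceil>R * s\<rceil>"
  have le: "i \<in> {-N..N}" if "\<bar>of_int i / s\<bar> \<le> R" for i :: int
  proof -
    have "\<bar>of_int i :: real\<bar> \<le> R * s" using that s by (simp add: abs_divide field_simps)
    then have "of_int i \<le> R * s" "of_int (-i) \<le> R * s" by auto
    then have "\<lceil>of_int i :: real\<rceil> \<le> N" "\<lceil>of_int (-i) :: real\<rceil> \<le> N" unfolding N_def by (intro ceiling_mono, simp)+
    then have "i \<le> N" "- i \<le> N" unfolding ceiling_of_int by -
    then show ?thesis by simp
  qed
  have "{t. norm (corner m t) \<le> R} \<subseteq> {-N..N} \<times> {-N..N} \<times> {-N..N}"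
  proof
    fix t assume t: "t \<in> {t. norm (corner m t) \<le> R}"
    obtain i j k where tt: "t = (i, j, k)" by (cases t)
    have "\<bar>corner m t $ l\<bar> \<le> R" for l using t component_le_norm_cart[of "corner m t" l] by simp
    from this[of 1] this[of 2] this[of 3]
    have "\<bar>of_int i / s\<bar> \<le> R" "\<bar>of_int j / s\<bar> \<le> R" "\<bar>of_int k / s\<bar> \<le> R" by (simp_all add: corner_def tt s_def)
    then show "t \<in> {-N..N} \<times> {-N..N} \<times> {-N..N}" unfolding tt by (intro SigmaI le)
  qed
  then show ?thesis by (rule finite_subset) simp
qed

definition cell_ind :: "nat \<Rightarrow> int \<times> int \<times> int \<Rightarrow> real^3 \<Rightarrow> real" where
  "cell_ind m t x = (if cell m x = t then 1 else 0)"

lemma step_measurable: "(\<lambda>x. h (cell m x) :: real) \<in> borel_measurable lebesgue"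
  by (intro borel_lebesgue_measurable measurable_compose[OF cell_measurable]) simp

lemma cell_ind_bdd_int: "bdd_int (cell_ind m t)"
proof (rule bdd_int_support[of _ 1 "norm (corner m t) + 3"])
  show "cell_ind m t \<in> borel_measurable lebesgue"
    unfolding cell_ind_def[abs_def] by (rule step_measurable[of "\<lambda>s. if s = t then 1 else 0"])
  show "cell_ind m t x = 0" if "norm (corner m t) + 3 < norm x" for x
    using corner_cell_dist[of x m] norm_triangle_ineq2[of x "corner m t"] that by (auto simp: cell_ind_def)
qed (simp add: cell_ind_def)

text \<open>Test functions are approximated by step functions on the grids. These use countably many
indicators altogether, which is what the diagonal extraction needs.\<close>

lemma step_approximation:
  assumes \<phi>: "\<phi> \<in> Cc_infinity"
  shows "bdd_int (\<lambda>x. \<phi> x - \<phi> (corner m (cell m x)))"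
    and "(\<lambda>m. nrm2 lebesgue (\<lambda>x. \<phi> x - \<phi> (corner m (cell m x)))) \<longlonglongrightarrow> 0"
proof -
  obtain R where R: "R > 0" "\<And>x. R < norm x \<Longrightarrow> \<phi> x = 0" using Cc_infinityD(2)[OF \<phi>] by blast
  obtain B where B: "B > 0" "\<And>x. \<bar>\<phi> x\<bar> \<le> B" using Cc_infinity_bounded[OF \<phi>] by blast
  define d where "d m x = \<phi> x - \<phi> (corner m (cell m x))" for m x
  have dm: "d m \<in> borel_measurable lebesgue" for m
    unfolding d_def[abs_def] by (intro borel_measurable_diff Cc_infinity_measurable_leb \<phi> step_measurable[of "\<lambda>t. \<phi> (corner m t)"])
  have dB: "\<bar>d m x\<bar> \<le> 2 * B" for m x using B(2)[of x] B(2)[of "corner m (cell m x)"] unfolding d_def by linarith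
  have d0: "d m x = 0" if "R + 3 < norm x" for m x
    using corner_cell_dist[of x m] norm_triangle_ineq2[of x "corner m (cell m x)"] that unfolding d_def by (simp add: R)
  show "bdd_int (\<lambda>x. \<phi> x - \<phi> (corner m (cell m x)))" using bdd_int_support[OF dm dB d0] by (simp add: d_def[abs_def])
  have "(\<lambda>m. \<integral>x. (d m x)\<^sup>2 \<partial>lebesgue) \<longlonglongrightarrow> (\<integral>x. 0 \<partial>(lebesgue :: (real^3) measure))"
  proof (rule integral_dominated_convergence[where w="\<lambda>x. (2 * B)\<^sup>2 * indicator (cball 0 (R + 3)) x"])
    show "(\<lambda>x. (d m x)\<^sup>2) \<in> borel_measurable lebesgue" for m using dm[of m] by (rule borel_measurable_power)
    show "integrable lebesgue (\<lambda>x. (2 * B)\<^sup>2 * indicator (cball (0::real^3) (R + 3)) x)"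
      using finite_cball_lebesgue by (intro integrable_mult_right integrable_real_indicator) auto
    show "AE x in lebesgue. (\<lambda>m. (d m x)\<^sup>2) \<longlonglongrightarrow> 0"
    proof (rule AE_I2)
      fix x
      have "isCont \<phi> x" using smooth_has_derivative[OF Cc_infinityD(1)[OF \<phi>]] by (rule has_derivative_continuous)
      then have "(\<lambda>m. \<phi> (corner m (cell m x))) \<longlonglongrightarrow> \<phi> x" by (rule isCont_tendsto_compose) (rule corner_cell_limit)
      then have "(\<lambda>m. (d m x)\<^sup>2) \<longlonglongrightarrow> (\<phi> x - \<phi> x)\<^sup>2" unfolding d_def by (intro tendsto_power tendsto_diff tendsto_const)
      then show "(\<lambda>m. (d m x)\<^sup>2) \<longlonglongrightarrow> 0" by simp
    qed
    show "AE x in lebesgue. norm ((d m x)\<^sup>2) \<le> (2 * B)\<^sup>2 * indicator (cball 0 (R + 3)) x" for m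
    proof (rule AE_I2)
      fix x
      show "norm ((d m x)\<^sup>2) \<le> (2 * B)\<^sup>2 * indicator (cball 0 (R + 3)) x"
        using power_mono[OF dB[of m x], of 2] d0[of x m] by (auto simp: indicator_def not_le)
    qed
  qed simp
  then have "(\<lambda>m. \<integral>x. (d m x)\<^sup>2 \<partial>lebesgue) \<longlonglongrightarrow> 0" by simp
  then have "(\<lambda>m. sqrt (\<integral>x. (d m x)\<^sup>2 \<partial>lebesgue)) \<longlonglongrightarrow> sqrt 0" by (rule tendsto_real_sqrt)
  then show "(\<lambda>m. nrm2 lebesgue (\<lambda>x. \<phi> x - \<phi> (corner m (cell m x)))) \<longlonglongrightarrow> 0" by (simp add: nrm2_def d_def)
qed

context typical_trajectory
begin

abbreviation "LP \<equiv> (lebesgue :: (real^3) measure) \<Otimes>\<^sub>M P"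

lemma pair_sigma_finite_lebesgue: "pair_sigma_finite (lebesgue :: (real^3) measure) P"
  by (intro pair_sigma_finite.intro sigma_finite_lebesgue sigma_finite_measure_axioms)

lemma tensor_integral:
  fixes b :: "'a \<Rightarrow> real"
  assumes \<phi>: "integrable lebesgue \<phi>" and b: "continuous_on UNIV b"
  shows "integrable LP (\<lambda>z. \<phi> (fst z) * b (snd z))"
    and "(\<integral>z. \<phi> (fst z) * b (snd z) \<partial>LP) = (\<integral>x. \<phi> x \<partial>lebesgue) * (\<integral>\<omega>. b \<omega> \<partial>P)"
proof -
  interpret Q: pair_sigma_finite "lebesgue :: (real^3) measure" P by (rule pair_sigma_finite_lebesgue)
  note [measurable] = borel_measurable_integrable[OF \<phi>] continuous_measurable[OF b]

  show I: "integrable LP (\<lambda>z. \<phi> (fst z) * b (snd z))"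
  proof (rule Q.Fubini_integrable)
    show "(\<lambda>z. \<phi> (fst z) * b (snd z)) \<in> borel_measurable LP" by measurable
    show "integrable lebesgue (\<lambda>x. \<integral>y. norm (\<phi> (fst (x, y)) * b (snd (x, y))) \<partial>P)" using \<phi> by (simp add: abs_mult)
    show "AE x in lebesgue. integrable P (\<lambda>y. \<phi> (fst (x, y)) * b (snd (x, y)))" using continuous_integrable[OF b] by simp
  qed
  from Q.integral_fst'[OF I] show "(\<integral>z. \<phi> (fst z) * b (snd z) \<partial>LP) = (\<integral>x. \<phi> x \<partial>lebesgue) * (\<integral>\<omega>. b \<omega> \<partial>P)" by simp
qed

lemma tensor_nrm2:
  assumes \<phi>: "bdd_int \<phi>" and b: "continuous_on UNIV b"
  shows "nrm2 LP (\<lambda>z. \<phi> (fst z) * b (snd z)) = nrm2 lebesgue \<phi> * nrm2 P b"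
proof -
  have "integrable lebesgue (\<lambda>x. (\<phi> x)\<^sup>2)" using bdd_int_mult[OF \<phi> \<phi>] by (simp add: bdd_int_def power2_eq_square)
  moreover have "continuous_on UNIV (\<lambda>\<omega>. (b \<omega>)\<^sup>2)" by (intro continuous_intros b)
  ultimately show ?thesis
    using tensor_integral(2)[of "\<lambda>x. (\<phi> x)\<^sup>2" "\<lambda>\<omega>. (b \<omega>)\<^sup>2"] by (simp add: nrm2_def power_mult_distrib real_sqrt_mult)
qed

text \<open>Finite sums of products \<phi>(x) b(\<omega>). For these functions the restriction to the trajectory makes
sense pointwise.\<close>

inductive_set tests :: "((real^3) \<times> 'a \<Rightarrow> real) set" where
  tests_zero: "(\<lambda>z. 0) \<in> tests"
| tests_step: "bdd_int \<phi> \<Longrightarrow> continuous_on UNIV b \<Longrightarrow> \<psi> \<in> tests \<Longrightarrow> (\<lambda>z. \<phi> (fst z) * b (snd z) + \<psi> z) \<in> tests"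

lemma tests_tensor: "bdd_int \<phi> \<Longrightarrow> continuous_on UNIV b \<Longrightarrow> (\<lambda>z. \<phi> (fst z) * b (snd z)) \<in> tests"
  using tests_step[OF _ _ tests_zero] by simp

lemma tests_add: "\<psi> \<in> tests \<Longrightarrow> \<psi>' \<in> tests \<Longrightarrow> (\<lambda>z. \<psi> z + \<psi>' z) \<in> tests"
proof (induction rule: tests.induct)
  case (tests_step \<phi> b \<psi>)
  then show ?case using tests.tests_step[of \<phi> b "\<lambda>z. \<psi> z + \<psi>' z"] by (simp add: add.assoc)
qed simp

lemma tests_tensor_mult:
  assumes \<phi>: "bdd_int \<phi>" and b: "continuous_on UNIV b"
  shows "\<psi> \<in> tests \<Longrightarrow> (\<lambda>z. (\<phi> (fst z) * b (snd z)) * \<psi> z) \<in> tests"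
proof (induction rule: tests.induct)
  case tests_zero
  show ?case using tests.tests_zero by simp
next
  case (tests_step \<phi>' b' \<psi>)
  have "continuous_on UNIV (\<lambda>\<omega>. b \<omega> * b' \<omega>)" by (intro continuous_on_mult b tests_step)
  from tests.tests_step[OF bdd_int_mult[OF \<phi> tests_step(1)] this tests_step(4)]
  show ?case by (simp add: algebra_simps)
qed

lemma tests_cmult: "\<psi> \<in> tests \<Longrightarrow> (\<lambda>z. c * \<psi> z) \<in> tests"
proof (induction rule: tests.induct)
  case tests_zero
  show ?case using tests.tests_zero by simp
next
  case (tests_step \<phi> b \<psi>)
  from tests.tests_step[OF bdd_int_cmult[OF tests_step(1), of c] tests_step(2,4)] show ?case by (simp add: algebra_simps)
qed

lemma tests_lincomb: "\<psi> \<in> tests \<Longrightarrow> \<psi>' \<in> tests \<Longrightarrow> (\<lambda>z. s * \<psi> z + t * \<psi>' z) \<in> tests"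
  by (intro tests_add tests_cmult)

lemma tests_diff: "\<psi> \<in> tests \<Longrightarrow> \<psi>' \<in> tests \<Longrightarrow> (\<lambda>z. \<psi> z - \<psi>' z) \<in> tests"
  using tests_lincomb[of \<psi> \<psi>' 1 "-1"] by simp

text \<open>Closedness under products turns the convergence of integrals into the convergence of norms.\<close>

lemma tests_mult: "\<psi> \<in> tests \<Longrightarrow> \<psi>' \<in> tests \<Longrightarrow> (\<lambda>z. \<psi> z * \<psi>' z) \<in> tests"
proof (induction rule: tests.induct)
  case tests_zero
  show ?case using tests.tests_zero by simp
next
  case (tests_step \<phi> b \<psi>)
  have "(\<lambda>z. (\<phi> (fst z) * b (snd z)) * \<psi>' z + \<psi> z * \<psi>' z) \<in> tests"
    by (intro tests_add tests_tensor_mult tests_step.hyps(1,2) tests_step.IH tests_step.prems)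
  then show ?case by (simp add: distrib_right)
qed

text \<open>The values of \<psi> at the microscopic position of x on the trajectory through \<omega>0.\<close>

definition trace :: "real \<Rightarrow> ((real^3) \<times> 'a \<Rightarrow> real) \<Rightarrow> real^3 \<Rightarrow> real" where
  "trace \<epsilon> \<psi> x = \<psi> (x, T (x /\<^sub>R \<epsilon>) \<omega>0)"

lemma tests_limit:
  "\<psi> \<in> tests \<Longrightarrow> integrable LP \<psi> \<and> (\<forall>\<epsilon>. integrable lebesgue (trace \<epsilon> \<psi>)) \<and>
     ((\<lambda>\<epsilon>. \<integral>x. trace \<epsilon> \<psi> x \<partial>lebesgue) \<longlongrightarrow> (\<integral>z. \<psi> z \<partial>LP)) (at_right 0)"
proof (induction rule: tests.induct)
  case tests_zero
  show ?case by (simp add: trace_def[abs_def])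
next
  case (tests_step \<phi> b \<psi>)
  have \<phi>: "integrable lebesgue \<phi>" using tests_step(1) by (simp add: bdd_int_def)
  note ol = oscillation_limit[OF \<phi> tests_step(2)] and ti = tensor_integral[OF \<phi> tests_step(2)]
  have IH: "integrable LP \<psi>" "\<And>\<epsilon>. integrable lebesgue (trace \<epsilon> \<psi>)"
    "((\<lambda>\<epsilon>. \<integral>x. trace \<epsilon> \<psi> x \<partial>lebesgue) \<longlongrightarrow> (\<integral>z. \<psi> z \<partial>LP)) (at_right 0)"
    using tests_step.IH by blast+
  have tr: "trace \<epsilon> (\<lambda>z. \<phi> (fst z) * b (snd z) + \<psi> z) = (\<lambda>x. \<phi> x * b (T (x /\<^sub>R \<epsilon>) \<omega>0) + trace \<epsilon> \<psi> x)" for \<epsilon>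
    by (simp add: trace_def[abs_def])
  show ?case
    unfolding tr Bochner_Integration.integral_add[OF ol(2) IH(2)] Bochner_Integration.integral_add[OF ti(1) IH(1)] ti(2)
    by (intro conjI allI Bochner_Integration.integrable_add tendsto_add ol ti IH)
qed

text \<open>The ergodic limit applied to the square of \<psi>. It says that test functions oscillating along the
trajectory have asymptotically the norm of \<psi> on the product space.\<close>

lemma tests_nrm2:
  assumes \<psi>: "\<psi> \<in> tests"
  shows "\<psi> \<in> L2 LP" "trace \<epsilon> \<psi> \<in> L2 lebesgue"
    "((\<lambda>\<epsilon>. nrm2 lebesgue (trace \<epsilon> \<psi>)) \<longlongrightarrow> nrm2 LP \<psi>) (at_right 0)"
proof -
  note a = tests_limit[OF \<psi>] and s = tests_limit[OF tests_mult[OF \<psi> \<psi>]]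
  have tr: "trace \<epsilon> (\<lambda>z. \<psi> z * \<psi> z) = (\<lambda>x. (trace \<epsilon> \<psi> x)\<^sup>2)" for \<epsilon> by (simp add: trace_def[abs_def] power2_eq_square)
  show "\<psi> \<in> L2 LP" using a s by (intro L2I borel_measurable_integrable) (simp_all add: power2_eq_square)
  show "trace \<epsilon> \<psi> \<in> L2 lebesgue" using a s unfolding tr by (intro L2I borel_measurable_integrable) simp_all
  have "((\<lambda>\<epsilon>. \<integral>x. (trace \<epsilon> \<psi> x)\<^sup>2 \<partial>lebesgue) \<longlongrightarrow> (\<integral>z. (\<psi> z)\<^sup>2 \<partial>LP)) (at_right 0)"
    using s unfolding tr by (simp add: power2_eq_square)
  from tendsto_real_sqrt[OF this] show "((\<lambda>\<epsilon>. nrm2 lebesgue (trace \<epsilon> \<psi>)) \<longlongrightarrow> nrm2 LP \<psi>) (at_right 0)"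
    by (simp add: nrm2_def)
qed

text \<open>The functionals \<psi> \<mapsto> \<integral> g \<psi>(x, T(x/e) \<omega>0) dx are bounded by C times the norm of the trace of \<psi>. A
diagonal extraction makes them converge on a countable family of products of cell indicators and
continuous functions. The bound persists in the limit in the norm of the product space, so the set of
\<psi> with convergent functionals is closed under approximation in that norm and contains all \<phi>(x) b(\<omega>);
the limit functional has a Riesz representative.\<close>

lemma two_scale_compactness:
  fixes g :: "nat \<Rightarrow> 3 \<Rightarrow> real^3 \<Rightarrow> real"
  assumes g: "\<And>n i. g n i \<in> L2 lebesgue" and bound: "\<And>n i. nrm2 lebesgue (g n i) \<le> C"
    and e: "filterlim e (at_right 0) sequentially"
  shows "\<exists>k V. strict_mono (k :: nat \<Rightarrow> nat) \<and> (\<forall>i. V i \<in> L2 LP \<and>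
     (\<forall>\<phi>\<in>Cc_infinity. \<forall>b. continuous_on UNIV b \<longrightarrow>
        (\<lambda>n. \<integral>x. g (k n) i x * \<phi> x * b (T (x /\<^sub>R e (k n)) \<omega>0) \<partial>lebesgue) \<longlonglongrightarrow> (\<integral>z. V i z * (\<phi> (fst z) * b (snd z)) \<partial>LP)))"
proof -
  have C: "0 \<le> C" using order_trans[OF nrm2_nonneg bound] .
  define L where "L n i \<psi> = (\<integral>x. g n i x * trace (e n) \<psi> x \<partial>lebesgue)" for n i \<psi>
  have Lbd: "\<bar>L n i \<psi>\<bar> \<le> C * nrm2 lebesgue (trace (e n) \<psi>)" if \<psi>: "\<psi> \<in> tests" for n i \<psi>
    using L2_Cauchy_Schwarz_real[OF g tests_nrm2(2)[OF \<psi>], of n i "e n"] mult_right_mono[OF bound[of n i] nrm2_nonneg[of lebesgue "trace (e n) \<psi>"]]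
    unfolding L_def by linarith
  have Llin: "L n i (\<lambda>z. s * \<psi> z + t * \<psi>' z) = s * L n i \<psi> + t * L n i \<psi>'" if \<psi>: "\<psi> \<in> tests" "\<psi>' \<in> tests" for n i s t \<psi> \<psi>'
  proof -
    note I = L2_mult_integrable[OF g tests_nrm2(2)[OF \<psi>(1)], of n i "e n"] L2_mult_integrable[OF g tests_nrm2(2)[OF \<psi>(2)], of n i "e n"]
    have "L n i (\<lambda>z. s * \<psi> z + t * \<psi>' z) = (\<integral>x. s * (g n i x * trace (e n) \<psi> x) + t * (g n i x * trace (e n) \<psi>' x) \<partial>lebesgue)"
      unfolding L_def trace_def by (simp add: algebra_simps)
    also have "\<dots> = s * L n i \<psi> + t * L n i \<psi>'" unfolding L_def using I by simp
    finally show ?thesis .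
  qed
  have Nlim: "(\<lambda>n. nrm2 lebesgue (trace (e n) \<psi>)) \<longlonglongrightarrow> nrm2 LP \<psi>" if "\<psi> \<in> tests" for \<psi>
    by (rule filterlim_compose[OF tests_nrm2(3)[OF that] e])
  obtain C0 :: "('a \<Rightarrow> real) set" where C0: "countable C0" "\<And>q. q \<in> C0 \<Longrightarrow> continuous_on UNIV q"
    "\<And>f r. continuous_on UNIV f \<Longrightarrow> 0 < r \<Longrightarrow> \<exists>q\<in>C0. \<forall>\<omega>. \<bar>f \<omega> - q \<omega>\<bar> \<le> r"
    using continuous_separable by blast
  define \<Psi> where "\<Psi> = (\<lambda>(m, t, q :: 'a \<Rightarrow> real) z. cell_ind m t (fst z) * q (snd z))"
  define S where "S = (UNIV :: 3 set) \<times> (\<Psi> ` (UNIV \<times> UNIV \<times> C0))"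
  have cS: "countable S" unfolding S_def using C0(1) by (intro countable_SIGMA countable_image) auto
  have S_tests: "\<psi> \<in> tests" if "(i, \<psi>) \<in> S" for i \<psi>
    using that tests_tensor[OF cell_ind_bdd_int C0(2)] by (auto simp: S_def \<Psi>_def)
  have "\<exists>B. \<forall>n. \<bar>L n i \<psi>\<bar> \<le> B" if \<psi>: "\<psi> \<in> tests" for i \<psi>
  proof -
    have "Bseq (\<lambda>n. nrm2 lebesgue (trace (e n) \<psi>))" by (rule convergent_imp_Bseq[OF convergentI[OF Nlim[OF \<psi>]]])
    then obtain K where "\<And>n. nrm2 lebesgue (trace (e n) \<psi>) \<le> K" by (auto simp: Bseq_def)
    then have "\<bar>L n i \<psi>\<bar> \<le> C * K" for n using Lbd[OF \<psi>, of n i] mult_left_mono[OF _ C] order_trans by meson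
    then show ?thesis by blast
  qed
  then have "\<forall>p\<in>S. \<exists>B. \<forall>n. \<bar>L n (fst p) (snd p)\<bar> \<le> B" using S_tests by (metis prod.collapse)
  then obtain B where B: "\<And>p n. p \<in> S \<Longrightarrow> \<bar>L n (fst p) (snd p)\<bar> \<le> B p" by (auto dest!: bchoice)
  have Bpos: "0 < 1 + B p" if "p \<in> S" for p using B[OF that, of 0] by linarith
  \<comment> \<open>Division by 1 + B p replaces the bound B p, which depends on p, by the common bound 1.\<close>
  obtain k where k: "strict_mono (k :: nat \<Rightarrow> nat)" "\<And>p. p \<in> S \<Longrightarrow> \<exists>l. (\<lambda>n. L (k n) (fst p) (snd p) / (1 + B p)) \<longlonglongrightarrow> l"
  proof (rule function_convergent_subsequence[OF cS, of "\<lambda>n p. L n (fst p) (snd p) / (1 + B p)" 1])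
    show "norm (L n (fst p) (snd p) / (1 + B p)) \<le> 1" if "p \<in> S" for n p
      using B[OF that, of n] Bpos[OF that] by (simp add: abs_divide)
  qed (rule that)
  define Conv where "Conv = {\<psi> \<in> tests. \<forall>i. convergent (\<lambda>n. L (k n) i \<psi>)}"
  have Nlim': "(\<lambda>n. nrm2 lebesgue (trace (e (k n)) \<psi>)) \<longlonglongrightarrow> nrm2 LP \<psi>" if "\<psi> \<in> tests" for \<psi>
    using LIMSEQ_subseq_LIMSEQ[OF Nlim[OF that] k(1)] by (simp add: o_def)
  have Conv_lin: "(\<lambda>z. s * \<psi> z + t * \<psi>' z) \<in> Conv" if "\<psi> \<in> Conv" "\<psi>' \<in> Conv" for s t \<psi> \<psi>'
  proof -
    have t: "\<psi> \<in> tests" "\<psi>' \<in> tests" and c: "\<And>i. convergent (\<lambda>n. L (k n) i \<psi>)" "\<And>i. convergent (\<lambda>n. L (k n) i \<psi>')"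
      using that by (auto simp: Conv_def)
    have "convergent (\<lambda>n. s * L (k n) i \<psi> + t * L (k n) i \<psi>')" for i
      by (intro convergent_add convergent_mult convergent_const c)
    then show ?thesis unfolding Conv_def using tests_lincomb[OF t] by (simp add: Llin[OF t])
  qed
  have Conv_zero: "(\<lambda>z. 0) \<in> Conv"
    using tests_zero by (simp add: Conv_def L_def trace_def convergent_const)
  have Conv_approx: "\<psi> \<in> Conv" if \<psi>: "\<psi> \<in> tests" and ap: "\<And>r. 0 < r \<Longrightarrow> \<exists>\<psi>'\<in>Conv. nrm2 LP (\<lambda>z. \<psi> z - \<psi>' z) < r" for \<psi>
  proof -
    have "Cauchy (\<lambda>n. L (k n) i \<psi>)" for i
    proof (rule metric_CauchyI)
      fix \<epsilon> :: real assume \<epsilon>: "0 < \<epsilon>"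
      define r where "r = \<epsilon> / (3 * (C + 1))"
      have r: "0 < r" "C * r < \<epsilon> / 3" using \<epsilon> C by (auto simp: r_def field_simps add_pos_nonneg)
      obtain \<psi>' where \<psi>': "\<psi>' \<in> Conv" "nrm2 LP (\<lambda>z. \<psi> z - \<psi>' z) < r" using ap[OF r(1)] by blast
      have t: "\<psi>' \<in> tests" and c: "convergent (\<lambda>n. L (k n) i \<psi>')" using \<psi>'(1) by (auto simp: Conv_def)
      note d = tests_diff[OF \<psi> t]
      have dL: "L n i (\<lambda>z. \<psi> z - \<psi>' z) = L n i \<psi> - L n i \<psi>'" for n using Llin[OF \<psi> t, of n i 1 "-1"] by simp
      have "\<forall>\<^sub>F n in sequentially. nrm2 lebesgue (trace (e (k n)) (\<lambda>z. \<psi> z - \<psi>' z)) < r"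
        using Nlim'[OF d] \<psi>'(2) by (rule order_tendstoD)
      then obtain N1 where N1: "\<And>n. n \<ge> N1 \<Longrightarrow> nrm2 lebesgue (trace (e (k n)) (\<lambda>z. \<psi> z - \<psi>' z)) < r"
        by (auto simp: eventually_sequentially)
      have close: "\<bar>L (k n) i \<psi> - L (k n) i \<psi>'\<bar> < \<epsilon> / 3" if "n \<ge> N1" for n
        using Lbd[OF d, of "k n" i] mult_left_mono[OF less_imp_le[OF N1[OF that]] C] r(2) unfolding dL by linarith
      have "Cauchy (\<lambda>n. L (k n) i \<psi>')" using c by (rule convergent_Cauchy)
      then obtain N2 where N2: "\<And>m n. m \<ge> N2 \<Longrightarrow> n \<ge> N2 \<Longrightarrow> dist (L (k m) i \<psi>') (L (k n) i \<psi>') < \<epsilon> / 3"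
        using metric_CauchyD[of "\<lambda>n. L (k n) i \<psi>'" "\<epsilon> / 3"] \<epsilon> by auto
      have "dist (L (k m) i \<psi>) (L (k n) i \<psi>) < \<epsilon>" if "m \<ge> max N1 N2" "n \<ge> max N1 N2" for m n
      proof -
        have arith: "\<bar>a - b\<bar> < \<epsilon>" if "\<bar>a - a'\<bar> < \<epsilon> / 3" "\<bar>b - b'\<bar> < \<epsilon> / 3" "\<bar>a' - b'\<bar> < \<epsilon> / 3" for a b a' b' :: real
          using that by linarith
        show ?thesis unfolding dist_real_def
          by (rule arith[OF close close N2[unfolded dist_real_def]]) (use that in auto)
      qed
      then show "\<exists>M. \<forall>m\<ge>M. \<forall>n\<ge>M. dist (L (k m) i \<psi>) (L (k n) i \<psi>) < \<epsilon>" by blast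
    qed
    then show ?thesis unfolding Conv_def using \<psi> by (simp add: Cauchy_convergent)
  qed
  have Conv_cell: "(\<lambda>z. cell_ind m t (fst z) * q (snd z)) \<in> Conv" if q: "q \<in> C0" for m t q
  proof -
    let ?\<psi> = "\<lambda>z. cell_ind m t (fst z) * q (snd z)"
    have S: "(i, ?\<psi>) \<in> S" for i unfolding S_def \<Psi>_def using q by (auto intro!: image_eqI[of _ _ "(m, t, q)"])
    have "convergent (\<lambda>n. L (k n) i ?\<psi>)" for i
    proof -
      obtain l where "(\<lambda>n. L (k n) i ?\<psi> / (1 + B (i, ?\<psi>))) \<longlonglongrightarrow> l" using k(2)[OF S[of i]] by auto
      then have "(\<lambda>n. (L (k n) i ?\<psi> / (1 + B (i, ?\<psi>))) * (1 + B (i, ?\<psi>))) \<longlonglongrightarrow> l * (1 + B (i, ?\<psi>))"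
        by (rule tendsto_mult[OF _ tendsto_const])
      then show ?thesis using Bpos[OF S[of i]] by (auto simp: convergent_def)
    qed
    then show ?thesis unfolding Conv_def using S_tests[OF S] by simp
  qed
  have Conv_step: "(\<lambda>z. (\<Sum>t\<in>J. h t * cell_ind m t (fst z)) * q (snd z)) \<in> Conv" if q: "q \<in> C0" and J: "finite J" for m J q and h :: "int \<times> int \<times> int \<Rightarrow> real"
    using J
  proof induction
    case empty
    show ?case using Conv_zero by simp
  next
    case (insert t J)
    from Conv_lin[OF Conv_cell[OF q, of m t] insert.IH, of "h t" 1] insert.hyps show ?case by (simp add: algebra_simps)
  qed
  have Conv_C0: "(\<lambda>z. \<phi> (fst z) * q (snd z)) \<in> Conv" if \<phi>: "\<phi> \<in> Cc_infinity" and q: "q \<in> C0" for \<phi> q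
  proof (rule Conv_approx)
    note qc = C0(2)[OF q]
    show "(\<lambda>z. \<phi> (fst z) * q (snd z)) \<in> tests" by (rule tests_tensor[OF Cc_infinity_bdd_int[OF \<phi>] qc])
    fix r :: real assume r: "0 < r"
    obtain R where R: "\<And>x. R < norm x \<Longrightarrow> \<phi> x = 0" using Cc_infinityD(2)[OF \<phi>] by blast
    have "(\<lambda>m. nrm2 lebesgue (\<lambda>x. \<phi> x - \<phi> (corner m (cell m x))) * nrm2 P q) \<longlonglongrightarrow> 0 * nrm2 P q"
      by (intro tendsto_mult step_approximation(2)[OF \<phi>] tendsto_const)
    then have "\<forall>\<^sub>F m in sequentially. nrm2 lebesgue (\<lambda>x. \<phi> x - \<phi> (corner m (cell m x))) * nrm2 P q < r"
      using r by (intro order_tendstoD(2)[of _ 0]) simp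
    then obtain m where m: "nrm2 lebesgue (\<lambda>x. \<phi> x - \<phi> (corner m (cell m x))) * nrm2 P q < r"
      by (auto simp: eventually_sequentially)
    let ?J = "{t. norm (corner m t) \<le> R}"
    have sum: "(\<Sum>t\<in>?J. \<phi> (corner m t) * cell_ind m t x) = \<phi> (corner m (cell m x))" for x
    proof -
      have "(\<Sum>t\<in>?J. \<phi> (corner m t) * cell_ind m t x) = (\<Sum>t\<in>?J. if cell m x = t then \<phi> (corner m t) else 0)"
        by (intro sum.cong) (auto simp: cell_ind_def)
      also have "\<dots> = (if cell m x \<in> ?J then \<phi> (corner m (cell m x)) else 0)" by (rule sum.delta'[OF finite_corners])
      also have "\<dots> = \<phi> (corner m (cell m x))" using R by auto
      finally show ?thesis .
    qed
    have "(\<lambda>z. \<phi> (corner m (cell m (fst z))) * q (snd z)) \<in> Conv"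
      using Conv_step[OF q finite_corners, of "\<lambda>t. \<phi> (corner m t)" m m R] unfolding sum .
    moreover have "nrm2 LP (\<lambda>z. \<phi> (fst z) * q (snd z) - \<phi> (corner m (cell m (fst z))) * q (snd z)) < r"
      using m tensor_nrm2[OF step_approximation(1)[OF \<phi>, of m] qc] by (simp add: left_diff_distrib)
    ultimately show "\<exists>\<psi>'\<in>Conv. nrm2 LP (\<lambda>z. \<phi> (fst z) * q (snd z) - \<psi>' z) < r"
      by (intro bexI[of _ "\<lambda>z. \<phi> (corner m (cell m (fst z))) * q (snd z)"])
  qed
  have Conv_tensor: "(\<lambda>z. \<phi> (fst z) * b (snd z)) \<in> Conv" if \<phi>: "\<phi> \<in> Cc_infinity" and b: "continuous_on UNIV b" for \<phi> b
  proof (rule Conv_approx)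
    note \<phi>i = Cc_infinity_bdd_int[OF \<phi>]
    show "(\<lambda>z. \<phi> (fst z) * b (snd z)) \<in> tests" by (rule tests_tensor[OF \<phi>i b])
    fix r :: real assume r: "0 < r"
    define s where "s = r / (1 + nrm2 lebesgue \<phi>)"
    have pos: "0 < 1 + nrm2 lebesgue \<phi>" by (simp add: add_pos_nonneg)
    have s: "0 < s" "nrm2 lebesgue \<phi> * s < r" using r pos by (auto simp: s_def field_simps)
    obtain q where q: "q \<in> C0" "\<And>\<omega>. \<bar>b \<omega> - q \<omega>\<bar> \<le> s" using C0(3)[OF b s(1)] by blast
    note qc = C0(2)[OF q(1)]
    have bq: "continuous_on UNIV (\<lambda>\<omega>. b \<omega> - q \<omega>)" by (intro continuous_on_diff b qc)
    have "nrm2 P (\<lambda>\<omega>. b \<omega> - q \<omega>) \<le> nrm2 P (\<lambda>\<omega>. s)"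
      by (rule nrm2_mono[OF continuous_measurable[OF bq] continuous_L2]) (use q(2) s(1) in auto)
    also have "\<dots> = s" using s(1) by (simp add: nrm2_def prob_space)
    finally have "nrm2 lebesgue \<phi> * nrm2 P (\<lambda>\<omega>. b \<omega> - q \<omega>) < r"
      using mult_left_mono[of "nrm2 P (\<lambda>\<omega>. b \<omega> - q \<omega>)" s "nrm2 lebesgue \<phi>"] s(2) by simp
    then have "nrm2 LP (\<lambda>z. \<phi> (fst z) * b (snd z) - \<phi> (fst z) * q (snd z)) < r"
      using tensor_nrm2[OF \<phi>i bq] by (simp add: right_diff_distrib)
    then show "\<exists>\<psi>'\<in>Conv. nrm2 LP (\<lambda>z. \<phi> (fst z) * b (snd z) - \<psi>' z) < r" using Conv_C0[OF \<phi> q(1)] by (rule bexI)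
  qed
  have Riesz: "\<exists>V\<in>L2 LP. \<forall>\<psi>\<in>Conv. lim (\<lambda>n. L (k n) i \<psi>) = (\<integral>z. V z * \<psi> z \<partial>LP)" for i
  proof (rule L2_Riesz[where C=C])
    have CL: "(\<lambda>n. L (k n) i \<psi>) \<longlonglongrightarrow> lim (\<lambda>n. L (k n) i \<psi>)" if "\<psi> \<in> Conv" for \<psi>
      using that by (simp add: Conv_def convergent_LIMSEQ_iff)
    show "Conv \<subseteq> L2 LP" using tests_nrm2(1) by (auto simp: Conv_def)
    show "(\<lambda>z. 0) \<in> Conv" by (rule Conv_zero)
    fix \<psi> assume \<psi>: "\<psi> \<in> Conv"
    then have t: "\<psi> \<in> tests" by (simp add: Conv_def)
    show "\<bar>lim (\<lambda>n. L (k n) i \<psi>)\<bar> \<le> C * nrm2 LP \<psi>"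
      by (rule LIMSEQ_le[OF tendsto_rabs[OF CL[OF \<psi>]] tendsto_mult[OF tendsto_const Nlim'[OF t]]]) (use Lbd[OF t] in blast)
    fix \<psi>' s t assume \<psi>': "\<psi>' \<in> Conv"
    then have t': "\<psi>' \<in> tests" by (simp add: Conv_def)
    have "(\<lambda>n. s * L (k n) i \<psi> + t * L (k n) i \<psi>') \<longlonglongrightarrow> s * lim (\<lambda>n. L (k n) i \<psi>) + t * lim (\<lambda>n. L (k n) i \<psi>')"
      by (intro tendsto_add tendsto_mult tendsto_const CL \<psi> \<psi>')
    then show "(\<lambda>z. s * \<psi> z + t * \<psi>' z) \<in> Conv \<and>
        lim (\<lambda>n. L (k n) i (\<lambda>z. s * \<psi> z + t * \<psi>' z)) = s * lim (\<lambda>n. L (k n) i \<psi>) + t * lim (\<lambda>n. L (k n) i \<psi>')"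
      unfolding Llin[OF \<open>\<psi> \<in> tests\<close> t'] using Conv_lin[OF \<psi> \<psi>'] by (intro conjI limI)
  qed
  define V where "V i = (SOME V. V \<in> L2 LP \<and> (\<forall>\<psi>\<in>Conv. lim (\<lambda>n. L (k n) i \<psi>) = (\<integral>z. V z * \<psi> z \<partial>LP)))" for i
  have Vs: "V i \<in> L2 LP \<and> (\<forall>\<psi>\<in>Conv. lim (\<lambda>n. L (k n) i \<psi>) = (\<integral>z. V i z * \<psi> z \<partial>LP))" for i
    unfolding V_def by (rule someI_ex[OF Riesz[unfolded Bex_def]])
  have V: "V i \<in> L2 LP" "\<psi> \<in> Conv \<Longrightarrow> lim (\<lambda>n. L (k n) i \<psi>) = (\<integral>z. V i z * \<psi> z \<partial>LP)" for i \<psi>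
    using Vs[of i] by simp_all
  have "(\<lambda>n. \<integral>x. g (k n) i x * \<phi> x * b (T (x /\<^sub>R e (k n)) \<omega>0) \<partial>lebesgue) \<longlonglongrightarrow> (\<integral>z. V i z * (\<phi> (fst z) * b (snd z)) \<partial>LP)"
    if "\<phi> \<in> Cc_infinity" "continuous_on UNIV b" for i \<phi> b
  proof -
    note \<psi> = Conv_tensor[OF that]
    then have "(\<lambda>n. L (k n) i (\<lambda>z. \<phi> (fst z) * b (snd z))) \<longlonglongrightarrow> lim (\<lambda>n. L (k n) i (\<lambda>z. \<phi> (fst z) * b (snd z)))"
      by (simp add: Conv_def convergent_LIMSEQ_iff)
    then show ?thesis unfolding V(2)[OF \<psi>] by (simp add: L_def trace_def mult.assoc)
  qed
  then show ?thesis using k(1) V(1) by (intro exI[of _ k] exI[of _ V]) simp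
qed

end

section \<open>The two-scale limit of the gradients\<close>

context stochastic_setting
begin

text \<open>In particular smoothing with a derivative of a test function produces mean zero.\<close>

lemma mollify_mean:
  assumes \<kappa>: "\<kappa> \<in> Cc_infinity" and q: "continuous_on UNIV q"
  shows "(\<integral>\<omega>. mollify \<kappa> q \<omega> \<partial>P) = (\<integral>z. \<kappa> z \<partial>lebesgue) * (\<integral>\<omega>. q \<omega> \<partial>P)"
proof -
  have id: "(\<lambda>s. s) \<in> borel_measurable (lebesgue :: (real^3) measure)" by (rule borel_lebesgue_measurable_vec) simp
  have "(\<integral>\<omega>. (\<integral>s. \<kappa> s * q (T s \<omega>) \<partial>lebesgue) * 1 \<partial>P) = (\<integral>s. \<kappa> s * (\<integral>\<omega>. q (T s \<omega>) * 1 \<partial>P) \<partial>lebesgue)"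
    by (rule averaging_Fubini[OF sigma_finite_lebesgue id Cc_infinity_integrable[OF \<kappa>] q continuous_on_const])
  then show ?thesis using T_integral(1)[OF continuous_measurable[OF q]] by (simp add: mollify_def)
qed

lemma L2_Omega_integrable:
  fixes f :: "'w \<Rightarrow> real"
  assumes "f \<in> L2 P" "continuous_on UNIV b"
  shows "integrable P (\<lambda>\<omega>. f \<omega> * b \<omega>)"
  by (rule L2_mult_integrable[OF assms(1) continuous_L2[OF assms(2)]])

text \<open>Both sides of the curl identity are continuous in q with respect to uniform convergence, so a dense
set of q suffices. Constants have no curl because the test functions have mean zero.\<close>

lemma curl_free_subtract_constant:
  assumes W: "W \<in> L2 P"
    and dense: "\<And>f e. continuous_on UNIV f \<Longrightarrow> 0 < e \<Longrightarrow> \<exists>q\<in>C0. \<forall>\<omega>. \<bar>f \<omega> - q \<omega>\<bar> \<le> e"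
    and cont: "\<And>q. q \<in> C0 \<Longrightarrow> continuous_on UNIV q"
    and curl: "\<And>m q i j. q \<in> C0 \<Longrightarrow> (\<integral>\<omega>. W \<omega> $ j * mollify (partial_deriv i (moll m)) q \<omega> \<partial>P)
       = (\<integral>\<omega>. W \<omega> $ i * mollify (partial_deriv j (moll m)) q \<omega> \<partial>P)"
  shows "curl_free (\<lambda>\<omega>. W \<omega> - c)"
  unfolding curl_free_def
proof (intro allI impI)
  fix m i j and q :: "'w \<Rightarrow> real"
  assume q: "continuous_on UNIV q"
  define M where "M i q = mollify (partial_deriv i (moll m)) q" for i q
  have \<kappa>: "partial_deriv i (moll m) \<in> Cc_infinity" for i by (rule Cc_infinity_partial[OF moll_Cc])
  have Mc: "continuous_on UNIV (M i q)" if "continuous_on UNIV q" for i q unfolding M_def by (rule mollify_continuous[OF \<kappa> that])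
  have Wi: "(\<lambda>\<omega>. W \<omega> $ i) \<in> L2 P" for i by (rule L2_component[OF W])
  note I = L2_Omega_integrable[OF Wi Mc]
  have M0: "(\<integral>\<omega>. M i q \<omega> \<partial>P) = 0" for i
    unfolding M_def mollify_mean[OF \<kappa> q] integral_partial_deriv_zero[OF moll_Cc] by simp
  define F where "F q = (\<integral>\<omega>. W \<omega> $ j * M i q \<omega> \<partial>P) - (\<integral>\<omega>. W \<omega> $ i * M j q \<omega> \<partial>P)" for q
  define K where "K = (nrm2 P (\<lambda>\<omega>. W \<omega> $ j) + nrm2 P (\<lambda>\<omega>. W \<omega> $ i)) * moll_grad_mass m"
  have K0: "0 \<le> K" unfolding K_def by (intro mult_nonneg_nonneg add_nonneg_nonneg nrm2_nonneg moll_grad_mass_nonneg)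
  have step: "\<bar>(\<integral>\<omega>. W \<omega> $ j * M i q \<omega> \<partial>P) - (\<integral>\<omega>. W \<omega> $ j * M i q' \<omega> \<partial>P)\<bar> \<le> nrm2 P (\<lambda>\<omega>. W \<omega> $ j) * (moll_grad_mass m * r)"
    if q': "continuous_on UNIV q'" and r: "\<And>\<omega>. \<bar>q \<omega> - q' \<omega>\<bar> \<le> r" for q' r i j
  proof -
    have qq: "continuous_on UNIV (\<lambda>\<omega>. q \<omega> - q' \<omega>)" by (intro continuous_on_diff q q')
    have r0: "0 \<le> r" using r[of undefined] by linarith
    have "nrm2 P (\<lambda>\<omega>. q \<omega> - q' \<omega>) \<le> nrm2 P (\<lambda>\<omega>. r)"
      by (rule nrm2_mono[OF continuous_measurable[OF qq] continuous_L2]) (use r r0 in auto)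
    also have "\<dots> = r" using r0 by (simp add: nrm2_def prob_space)
    finally have a: "nrm2 P (M i (\<lambda>\<omega>. q \<omega> - q' \<omega>)) \<le> moll_grad_mass m * r"
      using mollify_partial_bound[OF qq, of i m] mult_left_mono[of _ r "moll_grad_mass m"] moll_grad_mass_nonneg[of m]
      unfolding M_def by (meson order_trans)
    have "(\<integral>\<omega>. W \<omega> $ j * M i q \<omega> \<partial>P) - (\<integral>\<omega>. W \<omega> $ j * M i q' \<omega> \<partial>P) = (\<integral>\<omega>. W \<omega> $ j * M i (\<lambda>\<omega>. q \<omega> - q' \<omega>) \<omega> \<partial>P)"
      unfolding Bochner_Integration.integral_diff[OF I[OF q] I[OF q'], symmetric]
      by (simp add: M_def mollify_diff[OF \<kappa> q q'] right_diff_distrib)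
    also have "\<bar>\<dots>\<bar> \<le> nrm2 P (\<lambda>\<omega>. W \<omega> $ j) * nrm2 P (M i (\<lambda>\<omega>. q \<omega> - q' \<omega>))"
      by (rule L2_Cauchy_Schwarz_real[OF Wi continuous_L2[OF Mc[OF qq]]])
    also have "\<dots> \<le> nrm2 P (\<lambda>\<omega>. W \<omega> $ j) * (moll_grad_mass m * r)" by (rule mult_left_mono[OF a nrm2_nonneg])
    finally show ?thesis .
  qed
  have "\<bar>F q\<bar> \<le> e" if e: "0 < e" for e
  proof -
    define r where "r = e / (1 + K)"
    have r: "0 < r" "K * r \<le> e" using e K0 by (auto simp: r_def field_simps)
    obtain q' where q': "q' \<in> C0" "\<And>\<omega>. \<bar>q \<omega> - q' \<omega>\<bar> \<le> r" using dense[OF q r(1)] by blast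
    have "F q' = 0" using curl[OF q'(1)] by (simp add: F_def M_def)
    then have "\<bar>F q\<bar> \<le> K * r"
      using step[OF cont[OF q'(1)] q'(2), of j i] step[OF cont[OF q'(1)] q'(2), of i j]
      unfolding F_def K_def by (simp add: distrib_right mult.assoc)
    then show ?thesis using r(2) by linarith
  qed
  then have "F q = 0" using dense_eq0_I[of "F q"] by blast
  moreover have "(\<integral>\<omega>. (W \<omega> - c) $ j * M i q \<omega> \<partial>P) = (\<integral>\<omega>. W \<omega> $ j * M i q \<omega> \<partial>P)" for i j
  proof -
    have "(\<integral>\<omega>. (W \<omega> - c) $ j * M i q \<omega> \<partial>P) = (\<integral>\<omega>. W \<omega> $ j * M i q \<omega> - c $ j * M i q \<omega> \<partial>P)"
      by (simp add: left_diff_distrib)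
    also have "\<dots> = (\<integral>\<omega>. W \<omega> $ j * M i q \<omega> \<partial>P) - c $ j * (\<integral>\<omega>. M i q \<omega> \<partial>P)"
      using I[OF q, of j i] continuous_integrable[OF Mc[OF q, of i]] by simp
    finally show ?thesis by (simp add: M0)
  qed
  ultimately show "(\<integral>\<omega>. (W \<omega> - c) $ j * mollify (partial_deriv i (moll m)) q \<omega> \<partial>P)
      = (\<integral>\<omega>. (W \<omega> - c) $ i * mollify (partial_deriv j (moll m)) q \<omega> \<partial>P)"
    by (simp add: F_def M_def)
qed

text \<open>Along the trajectory at scale \<epsilon> each derivative produces a factor 1/\<epsilon>.\<close>

lemma mollify_rescaled:
  assumes \<kappa>: "\<kappa> \<in> Cc_infinity" and q: "continuous_on UNIV q"
  shows "smooth (\<lambda>x. mollify \<kappa> q (T (x /\<^sub>R \<epsilon>) \<omega>))"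
    and "partial_deriv i (\<lambda>x. mollify \<kappa> q (T (x /\<^sub>R \<epsilon>) \<omega>)) x = - inverse \<epsilon> * mollify (partial_deriv i \<kappa>) q (T (x /\<^sub>R \<epsilon>) \<omega>)"
proof -
  note s = mollify_smooth_orbit(2)[OF \<kappa> q, of \<omega>]
  show "smooth (\<lambda>x. mollify \<kappa> q (T (x /\<^sub>R \<epsilon>) \<omega>))" using smooth_affine[OF s, of "inverse \<epsilon>" 0] by simp
  show "partial_deriv i (\<lambda>x. mollify \<kappa> q (T (x /\<^sub>R \<epsilon>) \<omega>)) x = - inverse \<epsilon> * mollify (partial_deriv i \<kappa>) q (T (x /\<^sub>R \<epsilon>) \<omega>)"
    using partial_deriv_affine[OF s, of i "inverse \<epsilon>" 0 x] mollify_smooth_orbit(3)[OF \<kappa> q] by simp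
qed

end

context typical_trajectory
begin

lemma slice_L2:
  fixes f :: "(real^3) \<times> 'a \<Rightarrow> 'c::euclidean_space"
  assumes f: "f \<in> L2 LP"
  shows "AE x in lebesgue. (\<lambda>\<omega>. f (x, \<omega>)) \<in> L2 P"
proof -
  interpret Q: pair_sigma_finite "lebesgue :: (real^3) measure" P by (rule pair_sigma_finite_lebesgue)
  have [measurable]: "f \<in> borel_measurable LP" by (rule L2_meas[OF f])
  have "AE x in lebesgue. integrable P (\<lambda>\<omega>. (norm (f (x, \<omega>)))\<^sup>2)" by (rule Q.AE_integrable_fst'[OF L2_integrable[OF f]])
  moreover have m: "(\<lambda>\<omega>. f (x, \<omega>)) \<in> borel_measurable P" for x by (rule measurable_Pair2[OF L2_meas[OF f]]) simp
  ultimately show ?thesis by (elim eventually_mono) (rule L2I[OF m])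
qed

lemma slice_pairing:
  assumes V: "V \<in> L2 LP" and b: "continuous_on UNIV b"
  shows "loc_int (\<lambda>x. \<integral>\<omega>. V (x, \<omega>) * b \<omega> \<partial>P)"
    and "bdd_int \<phi> \<Longrightarrow> (\<integral>z. V z * (\<phi> (fst z) * b (snd z)) \<partial>LP) = (\<integral>x. (\<integral>\<omega>. V (x, \<omega>) * \<phi> x * b \<omega> \<partial>P) \<partial>lebesgue)"
    and "bdd_int \<phi> \<Longrightarrow> (\<integral>z. V z * (\<phi> (fst z) * b (snd z)) \<partial>LP) = (\<integral>x. (\<integral>\<omega>. V (x, \<omega>) * b \<omega> \<partial>P) * \<phi> x \<partial>lebesgue)"
proof -
  interpret Q: pair_sigma_finite "lebesgue :: (real^3) measure" P by (rule pair_sigma_finite_lebesgue)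
  have inner: "(\<integral>\<omega>. V (x, \<omega>) * (\<phi> x * b \<omega>) \<partial>P) = (\<integral>\<omega>. V (x, \<omega>) * b \<omega> \<partial>P) * \<phi> x" for x \<phi>
  proof -
    have "(\<integral>\<omega>. V (x, \<omega>) * (\<phi> x * b \<omega>) \<partial>P) = (\<integral>\<omega>. (V (x, \<omega>) * b \<omega>) * \<phi> x \<partial>P)" by (simp add: mult_ac)
    then show ?thesis by simp
  qed
  have I: "integrable LP (\<lambda>z. V z * (\<phi> (fst z) * b (snd z)))" if "bdd_int \<phi>" for \<phi>
    by (rule L2_mult_integrable[OF V tests_nrm2(1)[OF tests_tensor[OF that b]]])
  note F = Q.integral_fst'[OF I] and F' = Q.integrable_fst'[OF I]
  show "(\<integral>z. V z * (\<phi> (fst z) * b (snd z)) \<partial>LP) = (\<integral>x. (\<integral>\<omega>. V (x, \<omega>) * \<phi> x * b \<omega> \<partial>P) \<partial>lebesgue)" if "bdd_int \<phi>"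
    using F[OF that] by (simp add: mult.assoc)
  show "(\<integral>z. V z * (\<phi> (fst z) * b (snd z)) \<partial>LP) = (\<integral>x. (\<integral>\<omega>. V (x, \<omega>) * b \<omega> \<partial>P) * \<phi> x \<partial>lebesgue)" if "bdd_int \<phi>"
    using F[OF that] unfolding fst_conv snd_conv inner by simp
  show "loc_int (\<lambda>x. \<integral>\<omega>. V (x, \<omega>) * b \<omega> \<partial>P)"
    unfolding loc_int_def
  proof (intro conjI allI)
    note [measurable] = L2_meas[OF V] continuous_measurable[OF b]
    show "(\<lambda>x. \<integral>\<omega>. V (x, \<omega>) * b \<omega> \<partial>P) \<in> borel_measurable lebesgue" by measurable
    fix R
    have "indicator (cball (0::real^3) R) \<in> borel_measurable lebesgue" by (rule borel_measurable_indicator) simp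
    then have "bdd_int (\<lambda>x. indicator (cball 0 R) x)"
      by (rule bdd_int_support[of _ 1 R]) (auto simp: indicator_def)
    from F'[OF this] show "integrable lebesgue (\<lambda>x. indicator (cball 0 R) x * (\<integral>\<omega>. V (x, \<omega>) * b \<omega> \<partial>P))"
      unfolding fst_conv snd_conv inner by (simp add: mult.commute)
  qed
qed

text \<open>Testing with arbitrary \<phi> localises an identity in x.\<close>

lemma slices_agree:
  assumes V: "V \<in> L2 LP" "V' \<in> L2 LP" and b: "continuous_on UNIV b" "continuous_on UNIV b'"
    and eq: "\<And>\<phi>. \<phi> \<in> Cc_infinity \<Longrightarrow> (\<integral>z. V z * (\<phi> (fst z) * b (snd z)) \<partial>LP) = (\<integral>z. V' z * (\<phi> (fst z) * b' (snd z)) \<partial>LP)"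
  shows "AE x in lebesgue. (\<integral>\<omega>. V (x, \<omega>) * b \<omega> \<partial>P) = (\<integral>\<omega>. V' (x, \<omega>) * b' \<omega> \<partial>P)"
proof -
  define c c' where "c x = (\<integral>\<omega>. V (x, \<omega>) * b \<omega> \<partial>P)" and "c' x = (\<integral>\<omega>. V' (x, \<omega>) * b' \<omega> \<partial>P)" for x
  have l: "loc_int c" "loc_int c'"
    unfolding c_def[abs_def] c'_def[abs_def] by (rule slice_pairing(1)[OF V(1) b(1)], rule slice_pairing(1)[OF V(2) b(2)])
  have "AE x in lebesgue. c x - c' x = 0"
  proof (rule fundamental_lemma)
    show "loc_int (\<lambda>x. c x - c' x)" using l unfolding loc_int_def by (auto simp: right_diff_distrib)
    fix \<phi> assume \<phi>: "\<phi> \<in> Cc_infinity"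
    have "(\<integral>x. c x * \<phi> x \<partial>lebesgue) = (\<integral>x. c' x * \<phi> x \<partial>lebesgue)"
      using eq[OF \<phi>] slice_pairing(3)[OF V(1) b(1) Cc_infinity_bdd_int[OF \<phi>]] slice_pairing(3)[OF V(2) b(2) Cc_infinity_bdd_int[OF \<phi>]]
      by (simp add: c_def c'_def)
    then show "(\<integral>x. (c x - c' x) * \<phi> x \<partial>lebesgue) = 0"
      using loc_int_Cc_integrable[OF l(1) \<phi>] loc_int_Cc_integrable[OF l(2) \<phi>] by (simp add: left_diff_distrib)
  qed
  then show ?thesis by eventually_elim (simp add: c_def c'_def)
qed

text \<open>The weak symmetry of second derivatives is tested with \<phi>(x) B(T(x/e) \<omega>0), where B = mollify \<kappa> q. Its
derivative is 1/e times a derivative of B plus a bounded term. After multiplication by e the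
bounded term disappears in the limit.\<close>

lemma gradient_limit_curl_free:
  assumes u: "\<And>n. u n \<in> BL1" and e: "\<And>n::nat. 0 < e n" "e \<longlonglongrightarrow> 0"
    and lim: "\<And>i \<phi> b. \<phi> \<in> Cc_infinity \<Longrightarrow> continuous_on UNIV b \<Longrightarrow>
       (\<lambda>n. \<integral>x. weak_gradient (u n) x $ i * \<phi> x * b (T (x /\<^sub>R e n) \<omega>0) \<partial>lebesgue) \<longlonglongrightarrow> (\<integral>z. V i z * (\<phi> (fst z) * b (snd z)) \<partial>LP)"
    and \<phi>: "\<phi> \<in> Cc_infinity" and \<kappa>: "\<kappa> \<in> Cc_infinity" and q: "continuous_on UNIV q"
  shows "(\<integral>z. V j z * (\<phi> (fst z) * mollify (partial_deriv i \<kappa>) q (snd z)) \<partial>LP)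
       = (\<integral>z. V i z * (\<phi> (fst z) * mollify (partial_deriv j \<kappa>) q (snd z)) \<partial>LP)"
proof -
  define I where "I n i \<phi> b = (\<integral>x. weak_gradient (u n) x $ i * \<phi> x * b (T (x /\<^sub>R e n) \<omega>0) \<partial>lebesgue)" for n i \<phi> and b :: "'a \<Rightarrow> real"
  define J where "J i \<phi> b = (\<integral>z. V i z * (\<phi> (fst z) * b (snd z)) \<partial>LP)" for i \<phi> and b :: "'a \<Rightarrow> real"
  have lim': "(\<lambda>n. I n i \<phi> b) \<longlonglongrightarrow> J i \<phi> b" if "\<phi> \<in> Cc_infinity" "continuous_on UNIV b" for i \<phi> b
    unfolding I_def J_def by (rule lim[OF that])
  let ?M = "\<lambda>i. mollify (partial_deriv i \<kappa>) q"
  have Mc: "continuous_on UNIV (?M i)" for i by (intro mollify_continuous Cc_infinity_partial \<kappa> q)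
  have Bc: "continuous_on UNIV (mollify \<kappa> q)" by (intro mollify_continuous \<kappa> q)
  have key: "I n j \<phi> (?M i) - I n i \<phi> (?M j) = e n * (I n j (partial_deriv i \<phi>) (mollify \<kappa> q) - I n i (partial_deriv j \<phi>) (mollify \<kappa> q))" for n
  proof -
    note w = weak_gradient_props[OF u[of n]]
    define g where "g = weak_gradient (u n)"
    have gl: "loc_int (\<lambda>x. g x $ i)" and gL: "(\<lambda>x. g x $ i) \<in> L2 lebesgue" for i
      unfolding g_def by (rule L2_loc_int, rule L2_component[OF w(1)], rule L2_component[OF w(1)])
    define B where "B x = mollify \<kappa> q (T (x /\<^sub>R e n) \<omega>0)" for x
    have Bs: "smooth B" and Bd: "partial_deriv i B x = - inverse (e n) * ?M i (T (x /\<^sub>R e n) \<omega>0)" for i x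
      unfolding B_def[abs_def] by (rule mollify_rescaled[OF \<kappa> q])+
    define \<psi> where "\<psi> x = \<phi> x * B x" for x
    have \<psi>: "\<psi> \<in> Cc_infinity" unfolding \<psi>_def[abs_def] by (rule Cc_infinity_mult[OF \<phi> Bs])
    have Int: "integrable lebesgue (\<lambda>x. g x $ i * \<phi> x * b (T (x /\<^sub>R e n) \<omega>0))" if "\<phi> \<in> Cc_infinity" "continuous_on UNIV b" for i \<phi> b
      using L2_mult_integrable[OF gL tests_nrm2(2)[OF tests_tensor[OF Cc_infinity_bdd_int[OF that(1)] that(2)]], of i "e n"]
      by (simp add: trace_def mult.assoc)
    have d: "(\<integral>x. g x $ i * partial_deriv j \<psi> x \<partial>lebesgue) = I n i (partial_deriv j \<phi>) (mollify \<kappa> q) - inverse (e n) * I n i \<phi> (?M j)" for i j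
    proof -
      have pd: "partial_deriv j \<psi> x = \<phi> x * partial_deriv j B x + partial_deriv j \<phi> x * B x" for x
        unfolding \<psi>_def[abs_def] by (rule partial_deriv_mult[OF Cc_infinityD(1)[OF \<phi>] Bs])
      have "(\<integral>x. g x $ i * partial_deriv j \<psi> x \<partial>lebesgue) = (\<integral>x. g x $ i * partial_deriv j \<phi> x * mollify \<kappa> q (T (x /\<^sub>R e n) \<omega>0)
          - inverse (e n) * (g x $ i * \<phi> x * ?M j (T (x /\<^sub>R e n) \<omega>0)) \<partial>lebesgue)"
        unfolding pd Bd B_def by (simp add: algebra_simps)
      also have "\<dots> = I n i (partial_deriv j \<phi>) (mollify \<kappa> q) - inverse (e n) * I n i \<phi> (?M j)"
        using Int[OF Cc_infinity_partial[OF \<phi>, of j] Bc, of i] Int[OF \<phi> Mc, of i j] by (simp add: I_def g_def)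
      finally show ?thesis .
    qed
    have "I n i (partial_deriv j \<phi>) (mollify \<kappa> q) - inverse (e n) * I n i \<phi> (?M j)
        = I n j (partial_deriv i \<phi>) (mollify \<kappa> q) - inverse (e n) * I n j \<phi> (?M i)"
      using weak_gradient_curl_free[OF L2_theta_loc_int[OF w(3)] gl w(2)[folded g_def] \<psi>, of i j] unfolding d .
    then show ?thesis using e(1)[of n] by (simp add: field_simps)
  qed
  have "(\<lambda>n. I n j \<phi> (?M i) - I n i \<phi> (?M j)) \<longlonglongrightarrow> J j \<phi> (?M i) - J i \<phi> (?M j)"
    by (intro tendsto_diff lim' \<phi> Mc)
  moreover have "(\<lambda>n. I n j \<phi> (?M i) - I n i \<phi> (?M j)) \<longlonglongrightarrow> 0 * (J j (partial_deriv i \<phi>) (mollify \<kappa> q) - J i (partial_deriv j \<phi>) (mollify \<kappa> q))"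
    unfolding key by (intro tendsto_mult tendsto_diff lim' e Cc_infinity_partial \<phi> Bc)
  ultimately have "J j \<phi> (?M i) - J i \<phi> (?M j) = 0" using LIMSEQ_unique by fastforce
  then show ?thesis by (simp add: J_def)
qed

text \<open>The weak gradient moves the derivative to \<phi>, and b = 1 in the two-scale limit of the functions.\<close>

lemma gradient_limit_mean:
  fixes u :: "real \<Rightarrow> real^3 \<Rightarrow> real"
  assumes u: "\<And>\<epsilon>. 0 < \<epsilon> \<Longrightarrow> u \<epsilon> \<in> BL1" "\<And>\<epsilon>. 0 < \<epsilon> \<Longrightarrow> BL1_norm (u \<epsilon>) \<le> C"
    and ui: "u_inf \<in> BL1" and wc: "BL1_weak_conv u u_inf (at_right 0)"
    and e: "\<And>n::nat. 0 < e n" "e \<longlonglongrightarrow> 0" and \<phi>: "\<phi> \<in> Cc_infinity"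
  shows "(\<lambda>n. \<integral>x. weak_gradient (u (e n)) x $ i * \<phi> x \<partial>lebesgue) \<longlonglongrightarrow> (\<integral>x. weak_gradient u_inf x $ i * \<phi> x \<partial>lebesgue)"
proof -
  have "(\<lambda>n. \<integral>x. u (e n) x * partial_deriv i \<phi> x * 1 \<partial>lebesgue) \<longlonglongrightarrow> (\<integral>x. u_inf x * partial_deriv i \<phi> x \<partial>lebesgue) * (\<integral>\<omega>. 1 \<partial>P)"
  proof (rule filterlim_compose[OF _ filterlim_at_right_0[OF e]])
    show "((\<lambda>\<epsilon>. \<integral>x. u \<epsilon> x * partial_deriv i \<phi> x * 1 \<partial>lebesgue) \<longlongrightarrow> (\<integral>x. u_inf x * partial_deriv i \<phi> x \<partial>lebesgue) * (\<integral>\<omega>. 1 \<partial>P)) (at_right 0)"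
      by (rule oscillating_pairing_limit[where C=C and b="\<lambda>_. 1"])
         (erule u | rule ui wc Cc_infinity_partial[OF \<phi>] continuous_on_const)+
  qed
  from tendsto_minus[OF this]
  have l: "(\<lambda>n. - (\<integral>x. u (e n) x * partial_deriv i \<phi> x \<partial>lebesgue)) \<longlonglongrightarrow> - (\<integral>x. u_inf x * partial_deriv i \<phi> x \<partial>lebesgue)"
    by (simp add: prob_space)
  have w: "(\<integral>x. v x * partial_deriv i \<phi> x \<partial>lebesgue) = - (\<integral>x. weak_gradient v x $ i * \<phi> x \<partial>lebesgue)" if "v \<in> BL1" for v
    using weak_gradient_props(2)[OF that] \<phi> by (simp add: is_weak_gradient_def)
  show ?thesis using l unfolding w[OF u(1)[OF e(1)]] w[OF ui] by simp
qed

text \<open>The limit V of the gradients has mean equal to the gradient of u_inf and is curl-free in \<omega>, for almost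
every x; the exceptional sets are collected over countably many test functions q. Hence V minus its
mean is potential.\<close>

lemma gradient_two_scale_limit:
  assumes u: "\<And>\<epsilon>. 0 < \<epsilon> \<Longrightarrow> u \<epsilon> \<in> BL1" "\<And>\<epsilon>. 0 < \<epsilon> \<Longrightarrow> BL1_norm (u \<epsilon>) \<le> C"
    and ui: "u_inf \<in> BL1" and wc: "BL1_weak_conv u u_inf (at_right 0)"
  shows "\<exists>\<xi> \<in> L2_L2_pot P T. \<exists>e :: nat \<Rightarrow> real. (\<forall>n. 0 < e n) \<and> e \<longlonglongrightarrow> 0 \<and>
     two_scale_weak_L2 P T \<omega>0 (filtermap e sequentially)
       (\<lambda>\<epsilon>. weak_gradient (u \<epsilon>)) (\<lambda>(x, \<omega>). weak_gradient u_inf x + \<xi> (x, \<omega>))"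
proof -
  \<comment> \<open>Any sequence of scales tending to 0 serves; a subsequence of this one is selected below.\<close>
  define e0 where "e0 n = inverse (real (Suc n))" for n
  have e0: "0 < e0 n" "e0 \<longlonglongrightarrow> 0" for n
    unfolding e0_def[abs_def] by (simp, rule LIMSEQ_inverse_real_of_nat)
  define g where "g n i x = weak_gradient (u (e0 n)) x $ i" for n i x
  note w = weak_gradient_props[OF u(1)] and wi = weak_gradient_props[OF ui]
  have gL: "g n i \<in> L2 lebesgue" for n i unfolding g_def[abs_def] by (rule L2_component[OF w(1)[OF e0(1)]])
  have gC: "nrm2 lebesgue (g n i) \<le> C" for n i
    using nrm2_component_le[OF w(1)[OF e0(1)], of n i] u(2)[OF e0(1), of n] unfolding g_def[abs_def] BL1_norm_eq by linarith
  from two_scale_compactness[of g C e0, OF gL gC filterlim_at_right_0[OF e0]]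
  obtain k V where k: "strict_mono (k :: nat \<Rightarrow> nat)" and VA: "\<forall>i. V i \<in> L2 LP \<and>
     (\<forall>\<phi>\<in>Cc_infinity. \<forall>b. continuous_on UNIV b \<longrightarrow>
        (\<lambda>n. \<integral>x. g (k n) i x * \<phi> x * b (T (x /\<^sub>R e0 (k n)) \<omega>0) \<partial>lebesgue) \<longlonglongrightarrow> (\<integral>z. V i z * (\<phi> (fst z) * b (snd z)) \<partial>LP))"
    by (elim exE conjE)
  have V: "V i \<in> L2 LP" for i using spec[OF VA, of i] by (rule conjunct1)
  have VL: "(\<lambda>n. \<integral>x. g (k n) i x * \<phi> x * b (T (x /\<^sub>R e0 (k n)) \<omega>0) \<partial>lebesgue) \<longlonglongrightarrow> (\<integral>z. V i z * (\<phi> (fst z) * b (snd z)) \<partial>LP)"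
    if "\<phi> \<in> Cc_infinity" "continuous_on UNIV b" for i \<phi> b
    using spec[OF bspec[OF conjunct2[OF spec[OF VA, of i]] that(1)], of b] that(2) by (rule mp)
  define e where "e n = e0 (k n)" for n
  have e: "0 < e n" "e \<longlonglongrightarrow> 0" for n
    using e0(1) LIMSEQ_subseq_LIMSEQ[OF e0(2) k] by (simp_all add: e_def[abs_def] o_def)
  note lim = VL[unfolded g_def, folded e_def]
  obtain C0 :: "('a \<Rightarrow> real) set" where C0: "countable C0" "\<And>q. q \<in> C0 \<Longrightarrow> continuous_on UNIV q"
    "\<And>f r. continuous_on UNIV f \<Longrightarrow> 0 < r \<Longrightarrow> \<exists>q\<in>C0. \<forall>\<omega>. \<bar>f \<omega> - q \<omega>\<bar> \<le> r"
    using continuous_separable by blast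
  let ?M = "\<lambda>m i. mollify (partial_deriv i (moll m))"
  define G where "G = weak_gradient u_inf"
  have GL: "(\<lambda>z. G (fst z)) \<in> L2 LP" unfolding G_def by (rule L2_prod_const[OF wi(1)])
  have mean: "AE x in lebesgue. \<forall>i. (\<integral>\<omega>. V i (x, \<omega>) \<partial>P) = G x $ i"
  proof (subst AE_all_countable, rule allI)
    fix i
    have one: "continuous_on UNIV (\<lambda>\<omega>::'a. 1::real)" by simp
    have "AE x in lebesgue. (\<integral>\<omega>. V i (x, \<omega>) * 1 \<partial>P) = (\<integral>\<omega>. G (fst (x, \<omega>)) $ i * 1 \<partial>P)"
    proof (rule slices_agree[OF V L2_component[OF GL] one one])
      fix \<phi> assume \<phi>: "\<phi> \<in> Cc_infinity"
      have "(\<lambda>n. \<integral>x. weak_gradient (u (e n)) x $ i * \<phi> x \<partial>lebesgue) \<longlonglongrightarrow> (\<integral>z. V i z * (\<phi> (fst z) * 1) \<partial>LP)"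
        using lim[OF \<phi> one, of i] by simp
      from LIMSEQ_unique[OF this gradient_limit_mean[OF u ui wc e \<phi>]]
      have "(\<integral>z. V i z * (\<phi> (fst z) * 1) \<partial>LP) = (\<integral>x. G x $ i * \<phi> x \<partial>lebesgue)" by (simp add: G_def)
      also have "\<dots> = (\<integral>z. G (fst z) $ i * (\<phi> (fst z) * 1) \<partial>LP)"
        unfolding slice_pairing(3)[OF L2_component[OF GL] one Cc_infinity_bdd_int[OF \<phi>]] by (simp add: prob_space)
      finally show "(\<integral>z. V i z * (\<phi> (fst z) * 1) \<partial>LP) = (\<integral>z. G (fst z) $ i * (\<phi> (fst z) * 1) \<partial>LP)" .
    qed
    then show "AE x in lebesgue. (\<integral>\<omega>. V i (x, \<omega>) \<partial>P) = G x $ i" by (simp add: prob_space)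
  qed
  have "AE x in lebesgue. (\<integral>\<omega>. V j (x, \<omega>) * ?M m i q \<omega> \<partial>P) = (\<integral>\<omega>. V i (x, \<omega>) * ?M m j q \<omega> \<partial>P)"
    if q: "q \<in> C0" for m q i j
    by (rule slices_agree[OF V V])
       (intro mollify_continuous Cc_infinity_partial moll_Cc C0(2)[OF q], intro mollify_continuous Cc_infinity_partial moll_Cc C0(2)[OF q],
        rule gradient_limit_curl_free[OF u(1)[OF e(1)] e lim _ moll_Cc C0(2)[OF q]])
  then have "AE x in lebesgue. \<forall>m i j. \<forall>q\<in>C0. (\<integral>\<omega>. V j (x, \<omega>) * ?M m i q \<omega> \<partial>P) = (\<integral>\<omega>. V i (x, \<omega>) * ?M m j q \<omega> \<partial>P)"
    by (simp add: AE_all_countable AE_ball_countable[OF C0(1)])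
  moreover have "AE x in lebesgue. \<forall>i. (\<lambda>\<omega>. V i (x, \<omega>)) \<in> L2 P"
    using slice_L2[OF V] by (simp add: AE_all_countable)
  ultimately have pot: "AE x in lebesgue. (\<lambda>\<omega>. (\<chi> i. V i (x, \<omega>)) - G x) \<in> L2_pot P T"
    using mean
  proof eventually_elim
    case (elim x)
    let ?W = "\<lambda>\<omega>. (\<chi> i. V i (x, \<omega>)) :: real^3"
    have W: "?W \<in> L2 P" by (rule L2_vec) (simp add: elim(2))
    have c: "(\<lambda>\<omega>. G x) \<in> L2 P" by (rule L2I) auto
    show ?case
    proof (rule curl_free_in_L2_pot)
      show "(\<lambda>\<omega>. ?W \<omega> - G x) \<in> L2 P" by (rule L2_diff[OF W c])
      show "curl_free (\<lambda>\<omega>. ?W \<omega> - G x)"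
        by (rule curl_free_subtract_constant[OF W C0(3) C0(2)]) (use elim(1) in auto)
      fix i
      have "integrable P (\<lambda>\<omega>. V i (x, \<omega>))" using L2_Omega_integrable[of "\<lambda>\<omega>. V i (x, \<omega>)" "\<lambda>_. 1"] elim(2) by simp
      then show "(\<integral>\<omega>. (?W \<omega> - G x) $ i \<partial>P) = 0" using elim(3) by (simp add: prob_space)
    qed
  qed
  define \<xi> where "\<xi> z = (\<chi> i. V i z) - G (fst z)" for z
  have \<xi>L: "\<xi> \<in> L2 LP" unfolding \<xi>_def[abs_def] by (intro L2_diff GL L2_vec) (simp add: V)
  have \<xi>: "\<xi> \<in> L2_L2_pot P T" unfolding L2_L2_pot_def using \<xi>L pot by (simp add: \<xi>_def)
  have sum: "(\<lambda>(x, \<omega>). weak_gradient u_inf x + \<xi> (x, \<omega>)) = (\<lambda>z. \<chi> i. V i z)"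
    by (simp add: fun_eq_iff \<xi>_def G_def)
  have "two_scale_weak_L2 P T \<omega>0 (filtermap e sequentially) (\<lambda>\<epsilon>. weak_gradient (u \<epsilon>)) (\<lambda>z. \<chi> i. V i z)"
    unfolding two_scale_weak_L2_def two_scale_identity_def filterlim_filtermap
  proof (intro conjI allI impI ballI)
    show "weak_gradient (u \<epsilon>) \<in> L2 lebesgue" if "0 < \<epsilon>" for \<epsilon> by (rule w(1)[OF that])
    show "(\<lambda>z. \<chi> i. V i z) \<in> L2 LP" by (rule L2_vec) (simp add: V)
    fix i \<phi> and b :: "'a \<Rightarrow> real"
    assume \<phi>: "\<phi> \<in> Cc_infinity" and b: "continuous_on UNIV b"
    show "(\<lambda>n. \<integral>x. weak_gradient (u (e n)) x $ i * \<phi> x * b (T (x /\<^sub>R e n) \<omega>0) \<partial>lebesgue)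
      \<longlonglongrightarrow> (\<integral>x. (\<integral>\<omega>. (\<chi> i. V i (x, \<omega>)) $ i * \<phi> x * b \<omega> \<partial>P) \<partial>lebesgue)"
      using lim[OF \<phi> b, of i] unfolding slice_pairing(2)[OF V b Cc_infinity_bdd_int[OF \<phi>]] by simp
  qed
  then show ?thesis unfolding sum[symmetric] using \<xi> e by (intro bexI[of _ \<xi>] exI[of _ e]) auto
qed

end

theorem proposition5p2:
  fixes P :: "'w::metric_space measure"
    and T :: "real^3 \<Rightarrow> 'w \<Rightarrow> 'w"
    and a \<kappa> Msat :: "'w \<Rightarrow> real"
    and c_ex C_ex C_DMI C_sat :: real
    and \<omega>0 :: 'w
    and u :: "real \<Rightarrow> real^3 \<Rightarrow> real"
    and u_inf :: "real^3 \<Rightarrow> real"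
  assumes "stochastic_setting P T"
    and "a \<in> borel_measurable P" and "\<kappa> \<in> borel_measurable P" and "Msat \<in> borel_measurable P"
    and "0 < c_ex" and "AE \<omega> in P. c_ex \<le> a \<omega> \<and> a \<omega> \<le> C_ex"
    and "AE \<omega> in P. \<bar>\<kappa> \<omega>\<bar> \<le> C_DMI"
    and "AE \<omega> in P. 0 \<le> Msat \<omega> \<and> Msat \<omega> \<le> C_sat"
    and "\<omega>0 \<in> typical_set P T a \<kappa> Msat"
    and "\<And>\<epsilon>. 0 < \<epsilon> \<Longrightarrow> u \<epsilon> \<in> BL1"
    and "\<exists>C. \<forall>\<epsilon>>0. BL1_norm (u \<epsilon>) \<le> C"
    and "u_inf \<in> BL1"
    and "BL1_weak_conv u u_inf (at_right 0)"
  shows "two_scale_L2_theta P T \<omega>0 (at_right 0) u (\<lambda>(x, \<omega>). u_inf x) \<and>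
    (\<exists>\<xi> \<in> L2_L2_pot P T. \<exists>e :: nat \<Rightarrow> real. (\<forall>n. 0 < e n) \<and> e \<longlonglongrightarrow> 0 \<and>
       two_scale_weak_L2 P T \<omega>0 (filtermap e sequentially)
         (\<lambda>\<epsilon>. weak_gradient (u \<epsilon>)) (\<lambda>(x, \<omega>). weak_gradient u_inf x + \<xi> (x, \<omega>)))"
proof -
  have "\<omega>0 \<in> typical P T (\<lambda>_. 1)" using assms(9) by (simp add: typical_set_def)
  then have "typical_trajectory P T \<omega>0"
    by (intro typical_trajectory.intro assms(1) typical_trajectory_axioms.intro)
  then interpret typical_trajectory P T \<omega>0 .
  obtain C where C: "\<And>\<epsilon>. 0 < \<epsilon> \<Longrightarrow> BL1_norm (u \<epsilon>) \<le> C" using assms(11) by blast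
  show ?thesis
    by (intro conjI two_scale_L2_theta_limit[OF assms(10) C assms(12,13)] gradient_two_scale_limit[OF assms(10) C assms(12,13)])
qed

end
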